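(* Let $\alpha\ge 0$, $\beta>0$, $\nu>0$, $T>0$ and $2\le q\le\infty$. For any $v_0\in V^0$ and any $\theta_0\in L_q$ (with zero spatial mean), there exists a weak solution $(v,\theta)$ of the system \[ \partial_t v+B(u,v)+\nu\Lambda^{2\beta}v=\Pi(\theta e_3),\qquad \partial_t\theta+u\cdot\nabla\theta=0,\qquad v=\Lambda^{2\alpha}u \] on $[0,T]$ with initial data $(v_0,\theta_0)$. Moreover $\theta\in C_w([0,T];L_q)$.
   Context: Let $\mathbb T=[0,2\pi]^3$ with periodic boundary conditions and $L_p=L^p(\mathbb T)$. For $s\in\mathbb R$, $H^s$ is the space of real periodic functions/distributions $f=\sum_{k\in\mathbb Z^3\setminus\{0\}}f_ke^{ik\cdot x}$ (zero spatial mean) with $f_{-k}=\overline{f_k}$ and $\|f\|_{H^s}^2=\sum_k|f_k|^2|k|^{2s}<\infty$. $V^s$ is the analogous space of vector fields $w=\sum_{k\neq0}w_ke^{ik\cdot x}$, $w_k\in\mathbb C^3$, $w_{-k}=\overline{w_k}$, $w_k\cdot k=0$ (divergence free, zero mean), with $\|w\|_{V^s}^2=\sum_k|w_k|^2|k|^{2s}$. $\Lambda^s$ denotes the Fourier multiplier by $|k|^s$ (so $\Lambda^2=-\Delta$), acting on scalars and vectors. $\langle\cdot,\cdot\rangle$ denotes the $L^2$ scalar product (and the $H^s$–$H^{-s}$ duality). $\Pi$ is the Leray–Helmholtz projection of $L^2$ onto $V^0$; $B(u,v)=\Pi((u\cdot\nabla)v)$, i.e. $\langle B(u,v),w\rangle=\int_{\mathbb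 T}((u\cdot\nabla)v)\cdot w\,dx$. $e_3=(0,0,1)$. Given $v_0\in V^0$, $\theta_0\in H^0$, a weak solution on $[0,T]$ is a pair $(v,\theta)$ with $v\in L^\infty(0,T;V^0)\cap L^2(0,T;V^\beta)\cap C_w([0,T];V^0)$, $\theta\in L^\infty(0,T;H^0)\cap C_w([0,T];H^0)$, such that, with $u=\Lambda^{-2\alpha}v$, for every $\psi\in V^{5/2}$, $\phi\in H^{5/2}$ and every $t\in[0,T]$: $\langle v(t),\psi\rangle-\int_0^t\langle B(u(s),\psi),v(s)\rangle ds+\nu\int_0^t\langle\Lambda^\beta v(s),\Lambda^\beta\psi\rangle ds=\langle v_0,\psi\rangle+\int_0^t\langle\theta(s)e_3,\psi\rangle ds$ and $\langle\theta(t),\phi\rangle-\int_0^t\langle u(s)\cdot\nabla\phi,\theta(s)\rangle ds=\langle\theta_0,\phi\rangle$. $C_w$ denotes weakly continuous functions. *)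

theory Defs
  imports "HOL-Analysis.Analysis"
begin

text \<open>Periodic fields on the torus [0,2pi]^3 are represented by their Fourier
coefficients indexed by wave vectors k in Z^3.  A scalar field is a map
int^3 => complex, a vector field is a map int^3 => complex^3.\<close>

type_synonym wvec = "int ^ 3"
type_synonym sfield = "wvec \<Rightarrow> complex"
type_synonym vfield = "wvec \<Rightarrow> complex ^ 3"

definition knorm :: "wvec \<Rightarrow> real" where
  "knorm k = sqrt (\<Sum>i\<in>UNIV. (real_of_int (k $ i))\<^sup>2)"

definition cdot :: "complex ^ 3 \<Rightarrow> complex ^ 3 \<Rightarrow> complex" where
  "cdot a b = (\<Sum>i\<in>UNIV. a $ i * b $ i)"

definition kdot :: "wvec \<Rightarrow> complex ^ 3 \<Rightarrow> complex" where
  "kdot k w = (\<Sum>i\<in>UNIV. of_int (k $ i) * w $ i)"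

definition vcnj :: "complex ^ 3 \<Rightarrow> complex ^ 3" where
  "vcnj w = (\<chi> i. cnj (w $ i))"

definition e3 :: "3" where "e3 = 3"

text \<open>real, zero mean scalar distributions; real, zero mean, divergence free vector distributions\<close>
definition real_s :: "sfield \<Rightarrow> bool" where
  "real_s f \<longleftrightarrow> f 0 = 0 \<and> (\<forall>k. f (- k) = cnj (f k))"

definition real_v :: "vfield \<Rightarrow> bool" where
  "real_v w \<longleftrightarrow> w 0 = 0 \<and> (\<forall>k. w (- k) = vcnj (w k)) \<and> (\<forall>k. kdot k (w k) = 0)"

definition ssq :: "real \<Rightarrow> sfield \<Rightarrow> ennreal" where
  "ssq s f = (\<Sum>\<^sub>\<infinity>k\<in>UNIV. ennreal ((norm (f k))\<^sup>2 * knorm k powr (2 * s)))"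

definition vsq :: "real \<Rightarrow> vfield \<Rightarrow> ennreal" where
  "vsq s w = (\<Sum>\<^sub>\<infinity>k\<in>UNIV. ennreal ((norm (w k))\<^sup>2 * knorm k powr (2 * s)))"

definition in_H :: "real \<Rightarrow> sfield \<Rightarrow> bool" where
  "in_H s f \<longleftrightarrow> real_s f \<and> ssq s f < \<infinity>"

definition in_V :: "real \<Rightarrow> vfield \<Rightarrow> bool" where
  "in_V s w \<longleftrightarrow> real_v w \<and> vsq s w < \<infinity>"

definition lam_s :: "real \<Rightarrow> sfield \<Rightarrow> sfield" where
  "lam_s s f = (\<lambda>k. of_real (knorm k powr s) * f k)"

definition lam_v :: "real \<Rightarrow> vfield \<Rightarrow> vfield" where
  "lam_v s w = (\<lambda>k. (knorm k powr s) *\<^sub>R w k)"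

text \<open>L^2 scalar products (H^s - H^{-s} duality): integral over the torus of f g\<close>
definition pair_s :: "sfield \<Rightarrow> sfield \<Rightarrow> real" where
  "pair_s f g = (2 * pi) ^ 3 * Re (\<Sum>\<^sub>\<infinity>k\<in>UNIV. f k * cnj (g k))"

definition pair_v :: "vfield \<Rightarrow> vfield \<Rightarrow> real" where
  "pair_v f g = (2 * pi) ^ 3 * Re (\<Sum>\<^sub>\<infinity>k\<in>UNIV. cdot (f k) (vcnj (g k)))"

text \<open>\<open><B(u,psi), w> = \<integral> ((u\<cdot>\<nabla>)psi)\<cdot>w dx\<close> in Fourier variables\<close>
definition bform :: "vfield \<Rightarrow> vfield \<Rightarrow> vfield \<Rightarrow> real" where
  "bform u psi w = (2 * pi) ^ 3 *
     Re (\<Sum>\<^sub>\<infinity>(j, m)\<in>UNIV. \<i> * kdot m (u j) * cdot (psi m) (w (- j - m)))"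

text \<open>\<open><u\<cdot>\<nabla>phi, th> = \<integral> (u\<cdot>\<nabla>phi) th dx\<close> in Fourier variables\<close>
definition tform :: "vfield \<Rightarrow> sfield \<Rightarrow> sfield \<Rightarrow> real" where
  "tform u phi th = (2 * pi) ^ 3 *
     Re (\<Sum>\<^sub>\<infinity>(j, m)\<in>UNIV. \<i> * kdot m (u j) * phi m * th (- j - m))"

definition force :: "sfield \<Rightarrow> vfield \<Rightarrow> real" where
  "force th psi = (2 * pi) ^ 3 * Re (\<Sum>\<^sub>\<infinity>k\<in>UNIV. th k * cnj (psi k $ e3))"

definition weak_solution ::
  "real \<Rightarrow> real \<Rightarrow> real \<Rightarrow> real \<Rightarrow> vfield \<Rightarrow> sfield \<Rightarrow> (real \<Rightarrow> vfield) \<Rightarrow> (real \<Rightarrow> sfield) \<Rightarrow> bool"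
where
  "weak_solution \<alpha> \<beta> \<nu> T v0 th0 v th \<longleftrightarrow>
     \<comment> \<open>v in L^infty(0,T;V^0) \<inter> C_w([0,T];V^0)\<close>
     (\<forall>t\<in>{0..T}. in_V 0 (v t)) \<and>
     (\<exists>M::real. \<forall>t\<in>{0..T}. vsq 0 (v t) \<le> ennreal M) \<and>
     (\<forall>w. in_V 0 w \<longrightarrow> continuous_on {0..T} (\<lambda>t. pair_v (v t) w)) \<and>
     \<comment> \<open>v in L^2(0,T;V^beta)\<close>
     (set_nn_integral lborel {0..T} (\<lambda>t. vsq \<beta> (v t)) < \<infinity>) \<and>
     \<comment> \<open>th in L^infty(0,T;H^0) \<inter> C_w([0,T];H^0)\<close>
     (\<forall>t\<in>{0..T}. in_H 0 (th t)) \<and>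
     (\<exists>M::real. \<forall>t\<in>{0..T}. ssq 0 (th t) \<le> ennreal M) \<and>
     (\<forall>g. in_H 0 g \<longrightarrow> continuous_on {0..T} (\<lambda>t. pair_s (th t) g)) \<and>
     \<comment> \<open>momentum equation, u = Lambda^(-2 alpha) v\<close>
     (\<forall>psi t. in_V (5/2) psi \<and> t \<in> {0..T} \<longrightarrow>
        set_integrable lborel {0..t} (\<lambda>s. bform (lam_v (-2*\<alpha>) (v s)) psi (v s)) \<and>
        set_integrable lborel {0..t} (\<lambda>s. pair_v (lam_v \<beta> (v s)) (lam_v \<beta> psi)) \<and>
        set_integrable lborel {0..t} (\<lambda>s. force (th s) psi) \<and>
        pair_v (v t) psi
          - (LINT s:{0..t}|lborel. bform (lam_v (-2*\<alpha>) (v s)) psi (v s))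
          + \<nu> * (LINT s:{0..t}|lborel. pair_v (lam_v \<beta> (v s)) (lam_v \<beta> psi))
        = pair_v v0 psi + (LINT s:{0..t}|lborel. force (th s) psi)) \<and>
     \<comment> \<open>transport equation\<close>
     (\<forall>phi t. in_H (5/2) phi \<and> t \<in> {0..T} \<longrightarrow>
        set_integrable lborel {0..t} (\<lambda>s. tform (lam_v (-2*\<alpha>) (v s)) phi (th s)) \<and>
        pair_s (th t) phi
          - (LINT s:{0..t}|lborel. tform (lam_v (-2*\<alpha>) (v s)) phi (th s))
        = pair_s th0 phi)"

definition Tbox :: "(real ^ 3) set" where
  "Tbox = {x. \<forall>i. 0 \<le> x $ i \<and> x $ i \<le> 2 * pi}"

definition in_Lq :: "ereal \<Rightarrow> (real ^ 3 \<Rightarrow> real) \<Rightarrow> bool" where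
  "in_Lq q f \<longleftrightarrow> f \<in> borel_measurable (lebesgue_on Tbox) \<and>
     (if q = \<infinity> then (\<exists>C. AE x in lebesgue_on Tbox. \<bar>f x\<bar> \<le> C)
      else integrable (lebesgue_on Tbox) (\<lambda>x. \<bar>f x\<bar> powr real_of_ereal q))"

text \<open>conjugate exponent q' (for 1 < q): q' = 1 if q = infinity\<close>
definition conj_exp :: "ereal \<Rightarrow> ereal" where
  "conj_exp q = (if q = \<infinity> then 1 else ereal (real_of_ereal q / (real_of_ereal q - 1)))"

definition fcoef :: "(real ^ 3 \<Rightarrow> real) \<Rightarrow> sfield" where
  "fcoef f = (\<lambda>k. complex_of_real (1 / (2 * pi) ^ 3) *
     integral\<^sup>L (lebesgue_on Tbox)
       (\<lambda>x. complex_of_real (f x) * cis (- (\<Sum>i\<in>UNIV. real_of_int (k $ i) * x $ i))))"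

text \<open>th in C_w([0,T]; L_q): each th(t) is (the coefficient sequence of) an L_q function,
  weakly continuous in t (weak-* for q = infinity), i.e. against every g in L_q'.\<close>
definition Cw_Lq :: "ereal \<Rightarrow> real \<Rightarrow> (real \<Rightarrow> sfield) \<Rightarrow> bool" where
  "Cw_Lq q T th \<longleftrightarrow> (\<exists>Th :: real \<Rightarrow> real ^ 3 \<Rightarrow> real.
     (\<forall>t\<in>{0..T}. in_Lq q (Th t) \<and> fcoef (Th t) = th t) \<and>
     (\<forall>g. in_Lq (conj_exp q) g \<longrightarrow>
        continuous_on {0..T} (\<lambda>t. integral\<^sup>L (lebesgue_on Tbox) (\<lambda>x. Th t x * g x))))"

end

theory Submission
  imports Defs "HOL-Real_Asymp.Real_Asymp" "HOL-Complex_Analysis.Great_Picard"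
begin

text \<open>
  The velocity is discretised by a Galerkin Euler step on a finite set of Fourier modes. The
  temperature is kept as a full function: the truncated velocity field is a finite sum of plane
  shear waves, and one time step averages \<open>\<theta>\<close> over translations along these shears. Since each shear
  profile is constant in its own direction, this average is doubly stochastic. Hence
  \<open>\<integral>\<phi>(\<theta>)\<close> does not increase for any convex \<open>\<phi>\<close>, which gives all \<open>L\<^sub>q\<close> bounds at once, while the
  Fourier coefficients follow the transport equation up to \<open>O(\<tau>\<^sup>2)\<close> per step.

  Each Fourier mode is equi-Lipschitz in time, so a diagonal subsequence converges mode by mode.
  The energy bound in \<open>L\<^sup>2(0,T;V\<^sup>\<beta>)\<close> with \<open>\<beta> > 0\<close> makes the tails of the convolutions uniformly small
  and lets the nonlinear terms pass to the limit. Convex functionals are lower semicontinuous under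
  convergence of Fourier coefficients, so \<open>\<theta>(t)\<close> stays bounded in \<open>L\<^sub>q\<close>, and weak continuity in
  \<open>L\<^sub>2\<close> upgrades to \<open>L\<^sub>q\<close> by truncating the test function.
\<close>

section \<open>Sums over the lattice as integrals\<close>

text \<open>A sharp Fourier truncation of \<theta> preserves only the L_2 bound, since such
  projections are not positive; hence \<theta> stays a function on the torus while v is cut to
  finitely many modes. Euler steps replace an existence theory for the coupled system: each
  approximation is an explicit recursion, and the step \<tau> is chosen after the mode set, so that
  constants growing with the number of modes are absorbed by \<tau>.

  The critical quantity is the sum over m, j of |m| |psi_m| |v_j| |c_(-j-m)|. Once the gradient is
  paid for, a test field in V^(5/2) leaves the weight |m|^(-3/2), whose squares |m|^(-3) just fail
  to be summable over Z^3. Any \<beta> > 0 supplies a surplus |j|^(-\<beta>) from v, and the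
  estimate closes with the summable weight |k|^(-3-2\<beta>).

  Besides reality and incompressibility, u enters only through |u_k| \<le> |v_k|, so \<alpha> = 0 is
  the hardest case and every \<alpha> is treated alike.

  Divergent sums and integrals have the default value 0, so each identity of the weak formulation
  has to be accompanied by absolute convergence.\<close>

lemma infsum_complex_eq_integral:
  fixes f :: "'i \<Rightarrow> complex"
  shows "infsum f UNIV = (\<integral>i. f i \<partial>count_space UNIV)"
proof (cases "f summable_on UNIV")
  case True
  then have "Infinite_Set_Sum.abs_summable_on f UNIV"
    using abs_summable_equivalent summable_on_iff_abs_summable_on_complex by blast
  then show ?thesis
    using infsetsum_infsum[of f UNIV] by (simp add: infsetsum_def)
next
  case False
  \<comment> \<open>For complex terms summability is absolute summability, so both sides take their
    default value 0 in the same cases.\<close>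
  then have "\<not> integrable (count_space UNIV) f"
    using abs_summable_equivalent[of f UNIV] summable_on_iff_abs_summable_on_complex[of f UNIV]
    by (simp add: Infinite_Set_Sum.abs_summable_on_def)
  then show ?thesis
    using False by (simp add: infsum_not_exists not_integrable_integral_eq)
qed

lemma infsum_ennreal_eq_nn_integral:
  fixes f :: "'i::countable \<Rightarrow> ennreal"
  shows "infsum f UNIV = (\<integral>\<^sup>+i. f i \<partial>count_space UNIV)"
proof -
  have S: "infsum f UNIV = (SUP F\<in>{F. finite F \<and> F \<subseteq> UNIV}. sum f F)"
    by (rule nonneg_infsum_complete) auto
  define A where "A n = {i::'i. to_nat i < n}" for n
  have finA: "finite (A n)" for n
  proof -
    have "A n = to_nat -` {..<n}" by (auto simp: A_def)
    then show ?thesis by (simp add: finite_vimageI)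
  qed
  have fin: "(\<integral>\<^sup>+i. f i * indicator F i \<partial>count_space UNIV) = sum f F" if "finite F" for F
    using that by (subst nn_integral_count_space'[of F]) (auto simp: indicator_def)
  have "(\<integral>\<^sup>+i. f i \<partial>count_space UNIV) = (\<integral>\<^sup>+i. (SUP n. f i * indicator (A n) i) \<partial>count_space UNIV)"
  proof (rule nn_integral_cong)
    fix i :: 'i
    show "f i = (SUP n. f i * indicator (A n) i)"
    proof (rule antisym)
      show "f i \<le> (SUP n. f i * indicator (A n) i)"
        by (rule SUP_upper2[of "Suc (to_nat i)"]) (auto simp: A_def)
    qed (auto intro!: SUP_least simp: indicator_def)
  qed
  also have "\<dots> = (SUP n. \<integral>\<^sup>+i. f i * indicator (A n) i \<partial>count_space UNIV)"
    by (rule nn_integral_monotone_convergence_SUP)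
      (auto simp: incseq_def le_fun_def A_def indicator_def)
  also have "\<dots> = (SUP n. sum f (A n))"
    by (simp add: fin finA)
  also have "\<dots> \<le> infsum f UNIV"
    unfolding S by (rule SUP_mono) (use finA in auto)
  finally have 1: "(\<integral>\<^sup>+i. f i \<partial>count_space UNIV) \<le> infsum f UNIV" .
  have "sum f F \<le> (\<integral>\<^sup>+i. f i \<partial>count_space UNIV)" if "finite F" for F
    unfolding fin[OF that, symmetric] by (rule nn_integral_mono) (auto simp: indicator_def)
  then have "infsum f UNIV \<le> (\<integral>\<^sup>+i. f i \<partial>count_space UNIV)"
    unfolding S by (auto intro!: SUP_least)
  with 1 show ?thesis by simp
qed

text \<open>Countability of the index turns measurability of each section into joint measurability,
  the entry condition for the Fubini arguments below.\<close>

lemma borel_measurable_pair_count_space: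
  fixes f :: "'a \<Rightarrow> 'i::countable \<Rightarrow> 'b::topological_space"
  assumes "\<And>i. (\<lambda>x. f x i) \<in> borel_measurable M"
  shows "(\<lambda>(x, i). f x i) \<in> borel_measurable (M \<Otimes>\<^sub>M count_space UNIV)"
proof -
  have "(\<lambda>p. (\<lambda>i x. f x i) (snd p) (fst p)) \<in> borel_measurable (M \<Otimes>\<^sub>M count_space UNIV)"
    by (rule measurable_compose_countable'[where I = UNIV])
       (auto intro: measurable_compose[OF measurable_fst] assms)
  then show ?thesis by (simp add: case_prod_beta)
qed

lemma borel_measurable_integral_count_space:
  fixes f :: "'a \<Rightarrow> 'i::countable \<Rightarrow> 'b::{banach, second_countable_topology}"
  assumes "\<And>i. (\<lambda>x. f x i) \<in> borel_measurable M"
  shows "(\<lambda>x. \<integral>i. f x i \<partial>count_space UNIV) \<in> borel_measurable M"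
  by (rule sigma_finite_measure.borel_measurable_lebesgue_integral
        [OF sigma_finite_measure_count_space borel_measurable_pair_count_space[OF assms]])

lemma borel_measurable_infsum_complex:
  fixes f :: "'a \<Rightarrow> 'i::countable \<Rightarrow> complex"
  assumes "\<And>i. (\<lambda>x. f x i) \<in> borel_measurable M"
  shows "(\<lambda>x. \<Sum>\<^sub>\<infinity>i. f x i) \<in> borel_measurable M"
  unfolding infsum_complex_eq_integral
  by (rule borel_measurable_integral_count_space) (rule assms)

lemma borel_measurable_nn_integral_count_space:
  fixes f :: "'a \<Rightarrow> 'i::countable \<Rightarrow> ennreal"
  assumes "\<And>i. (\<lambda>x. f x i) \<in> borel_measurable M"
  shows "(\<lambda>x. \<integral>\<^sup>+i. f x i \<partial>count_space UNIV) \<in> borel_measurable M"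
  by (rule sigma_finite_measure.borel_measurable_nn_integral
        [OF sigma_finite_measure_count_space borel_measurable_pair_count_space[OF assms]])

text \<open>Fubini with counting measure as one factor. Integrability of f x i in x holds for every
  i and not only for almost every i, because the empty set is the only null set of counting
  measure.\<close>

lemma integral_count_space_swap:
  fixes f :: "'a \<Rightarrow> 'i::countable \<Rightarrow> 'b::{banach, second_countable_topology}"
  assumes M: "sigma_finite_measure M"
    and f: "\<And>i. (\<lambda>x. f x i) \<in> borel_measurable M"
    and fin: "(\<integral>\<^sup>+x. (\<integral>\<^sup>+i. norm (f x i) \<partial>count_space UNIV) \<partial>M) < \<infinity>"
  shows "integrable M (\<lambda>x. \<integral>i. f x i \<partial>count_space UNIV)"
    and "integrable (count_space UNIV) (\<lambda>i. \<integral>x. f x i \<partial>M)"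
    and "(\<integral>i. (\<integral>x. f x i \<partial>M) \<partial>count_space UNIV) = (\<integral>x. (\<integral>i. f x i \<partial>count_space UNIV) \<partial>M)"
    and "\<And>i. integrable M (\<lambda>x. f x i)"
    and "AE x in M. integrable (count_space UNIV) (f x)"
proof -
  interpret M: sigma_finite_measure M by fact
  interpret C: sigma_finite_measure "count_space (UNIV::'i set)"
    by (rule sigma_finite_measure_count_space)
  interpret pair_sigma_finite M "count_space (UNIV::'i set)" ..
  have m: "(\<lambda>(x, i). f x i) \<in> borel_measurable (M \<Otimes>\<^sub>M count_space UNIV)"
    by (rule borel_measurable_pair_count_space[OF f])
  have int: "integrable (M \<Otimes>\<^sub>M count_space UNIV) (\<lambda>(x, i). f x i)"
  proof (rule integrableI_bounded[OF m])
    have "(\<integral>\<^sup>+p. norm (case p of (x, i) \<Rightarrow> f x i) \<partial>(M \<Otimes>\<^sub>M count_space UNIV))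
        = (\<integral>\<^sup>+x. (\<integral>\<^sup>+i. norm (f x i) \<partial>count_space UNIV) \<partial>M)"
      by (subst C.nn_integral_fst[symmetric]) (use m in \<open>auto intro!: measurable_compose[OF m]\<close>)
    then show "(\<integral>\<^sup>+p. norm (case p of (x, i) \<Rightarrow> f x i) \<partial>(M \<Otimes>\<^sub>M count_space UNIV)) < \<infinity>"
      using fin by simp
  qed
  show "integrable M (\<lambda>x. \<integral>i. f x i \<partial>count_space UNIV)"
    using integrable_fst'[OF int] by simp
  show "integrable (count_space UNIV) (\<lambda>i. \<integral>x. f x i \<partial>M)"
    using integrable_snd[OF int] by simp
  show "(\<integral>i. (\<integral>x. f x i \<partial>M) \<partial>count_space UNIV) = (\<integral>x. (\<integral>i. f x i \<partial>count_space UNIV) \<partial>M)"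
    using Fubini_integral[OF int] by simp
  show "AE x in M. integrable (count_space UNIV) (f x)"
    using AE_integrable_fst'[OF int] by simp
  have "AE i in count_space UNIV. integrable M (\<lambda>x. f x i)"
    using AE_integrable_snd[OF int] by simp
  then show "integrable M (\<lambda>x. f x i)" for i
    by (simp add: AE_count_space)
qed

section \<open>Lengths of wave vectors and lattice sums\<close>

lemma vsq_eq: "vsq s w = (\<integral>\<^sup>+k. ennreal ((norm (w k))\<^sup>2 * knorm k powr (2 * s)) \<partial>count_space UNIV)"
  unfolding vsq_def by (rule infsum_ennreal_eq_nn_integral)

lemma ssq_eq: "ssq s w = (\<integral>\<^sup>+k. ennreal ((norm (w k))\<^sup>2 * knorm k powr (2 * s)) \<partial>count_space UNIV)"
  unfolding ssq_def by (rule infsum_ennreal_eq_nn_integral)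

lemma knorm_nonneg [simp]: "0 \<le> knorm k"
  by (simp add: knorm_def sum_nonneg)

lemma knorm_0 [simp]: "knorm 0 = 0"
  by (simp add: knorm_def)

lemma knorm_minus [simp]: "knorm (- k) = knorm k"
  by (simp add: knorm_def)

lemma abs_component_le_knorm: "\<bar>real_of_int (k $ i)\<bar> \<le> knorm k"
proof -
  have "sqrt ((real_of_int (k $ i))\<^sup>2) \<le> knorm k"
    unfolding knorm_def by (intro real_sqrt_le_mono member_le_sum) auto
  then show ?thesis by simp
qed

lemma knorm_ge_1: "1 \<le> knorm k" if k: "k \<noteq> 0"
proof -
  obtain i where "k $ i \<noteq> 0"
    using k unfolding vec_eq_iff by auto
  then have "1 \<le> \<bar>real_of_int (k $ i)\<bar>" by linarith
  then show ?thesis using abs_component_le_knorm[of k i] by linarith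
qed

lemma knorm_pos: "0 < knorm k" if "k \<noteq> 0"
  using knorm_ge_1[OF that] by simp

lemma finite_knorm_le: "finite {k. knorm k \<le> R}"
proof -
  define B where "B = {- \<lceil>R\<rceil>..\<lceil>R\<rceil>}"
  have "{k. knorm k \<le> R} \<subseteq> (\<lambda>(a, b, c). vector [a, b, c]) ` (B \<times> B \<times> B)"
  proof
    fix k :: wvec assume "k \<in> {k. knorm k \<le> R}"
    then have "\<bar>real_of_int (k $ i)\<bar> \<le> R" for i
      using abs_component_le_knorm[of k i] by auto
    then have "k $ i \<in> B" for i
      unfolding B_def by (auto simp: abs_le_iff) (smt (verit) ceiling_minus floor_le_iff le_ceiling_iff le_floor_iff le_of_int_ceiling of_int_le_iff of_int_minus)+
    moreover have "k = vector [k $ 1, k $ 2, k $ 3]"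
      by (simp add: vec_eq_iff forall_3)
    ultimately show "k \<in> (\<lambda>(a, b, c). vector [a, b, c]) ` (B \<times> B \<times> B)"
      by (intro image_eqI[of _ _ "(k $ 1, k $ 2, k $ 3)"]) auto
  qed
  then show ?thesis
    by (rule finite_subset) (auto simp: B_def)
qed

text \<open>Every component satisfies max(1,|k_i|) \<le> |k| when k is nonzero. Splitting the
  exponent into three equal parts therefore bounds the lattice sum by the cube of a one-dimensional
  series with exponent -1 - e/3.\<close>

lemma nn_integral_lattice_powr:
  assumes e: "0 < e"
  shows "(\<integral>\<^sup>+k. ennreal (knorm k powr (- 3 - e)) \<partial>count_space UNIV) < \<infinity>"
proof -
  define f where "f n = max 1 \<bar>real_of_int n\<bar> powr (- 1 - e / 3)" for n
  have sf: "summable (\<lambda>n::nat. f (int n))"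
  proof (rule summable_comparison_test')
    show "summable (\<lambda>n::nat. real n powr (- 1 - e/3))"
      using e by (simp add: summable_real_powr_iff)
    show "norm (f (int n)) \<le> real n powr (- 1 - e/3)" if "n \<ge> 1" for n
      using that by (simp add: f_def max_def)
  qed
  have fm: "f (- n) = f n" for n by (simp add: f_def)
  have f0: "0 \<le> f n" for n by (simp add: f_def)
  have nat: "(\<integral>\<^sup>+n. ennreal (f (int n)) \<partial>count_space UNIV) < \<infinity>"
    using sf f0 by (simp add: nn_integral_count_space_nat suminf_ennreal_eq[OF _ summable_sums])
  have "(\<integral>\<^sup>+n. ennreal (f n) \<partial>count_space UNIV)
      \<le> (\<integral>\<^sup>+n. ennreal (f n) * indicator (range int) n + ennreal (f n) * indicator (range (\<lambda>n. - int n)) n \<partial>count_space UNIV)"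
  proof (rule nn_integral_mono)
    fix n :: int
    show "ennreal (f n) \<le> ennreal (f n) * indicator (range int) n + ennreal (f n) * indicator (range (\<lambda>n. - int n)) n"
      by (cases n rule: int_cases2) (auto simp: indicator_def)
  qed
  also have "\<dots> = (\<integral>\<^sup>+n. ennreal (f n) \<partial>count_space (range int)) + (\<integral>\<^sup>+n. ennreal (f n) \<partial>count_space (range (\<lambda>n. - int n)))"
    by (simp add: nn_integral_add nn_integral_count_space_indicator[symmetric])
  also have "(\<integral>\<^sup>+n. ennreal (f n) \<partial>count_space (range int)) = (\<integral>\<^sup>+n. ennreal (f (int n)) \<partial>count_space UNIV)"
    by (rule nn_integral_bij_count_space[symmetric]) (auto simp: bij_betw_def inj_on_def)
  also have "(\<integral>\<^sup>+n. ennreal (f n) \<partial>count_space (range (\<lambda>n. - int n))) = (\<integral>\<^sup>+n. ennreal (f (- int n)) \<partial>count_space UNIV)"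
    by (rule nn_integral_bij_count_space[symmetric]) (auto simp: bij_betw_def inj_on_def)
  finally have S: "(\<integral>\<^sup>+n. ennreal (f n) \<partial>count_space UNIV) < \<infinity>" (is "?S < _")
    by (rule le_less_trans) (use nat in \<open>simp add: fm\<close>)
  let ?t = "\<lambda>k::wvec. (k $ 1, k $ 2, k $ 3)"
  have bij: "bij_betw ?t UNIV UNIV"
    by (rule bij_betw_byWitness[of _ "\<lambda>(a, b, c). vector [a, b, c]"])
       (auto simp: vec_eq_iff forall_3)
  have "(\<integral>\<^sup>+k. ennreal (knorm k powr (- 3 - e)) \<partial>count_space UNIV)
     \<le> (\<integral>\<^sup>+k. (\<lambda>(a, b, c). ennreal (f a) * (ennreal (f b) * ennreal (f c))) (?t k) \<partial>count_space UNIV)"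
  proof (rule nn_integral_mono)
    fix k :: wvec
    show "ennreal (knorm k powr (- 3 - e)) \<le> (\<lambda>(a, b, c). ennreal (f a) * (ennreal (f b) * ennreal (f c))) (?t k)"
    proof (cases "k = 0")
      case False
      have "knorm k powr (-1 - e/3) \<le> f (k $ i)" for i
        unfolding f_def using abs_component_le_knorm[of k i] knorm_ge_1[OF False] e
        by (intro powr_mono2') auto
      then have "(knorm k powr (-1 - e/3) * (knorm k powr (-1 - e/3) * knorm k powr (-1 - e/3))) \<le> f (k $ 1) * (f (k $ 2) * f (k $ 3))"
        by (intro mult_mono) (auto simp: f0)
      also have "(knorm k powr (-1 - e/3) * (knorm k powr (-1 - e/3) * knorm k powr (-1 - e/3))) = knorm k powr (- 3 - e)"
        using knorm_pos[OF False] by (simp add: powr_add[symmetric])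
      finally show ?thesis by (simp add: ennreal_mult[symmetric] f0 ennreal_leI)
    qed simp
  qed
  also have "\<dots> = (\<integral>\<^sup>+p. (\<lambda>(a, b, c). ennreal (f a) * (ennreal (f b) * ennreal (f c))) p \<partial>count_space UNIV)"
    by (rule nn_integral_bij_count_space[OF bij])
  also have "\<dots> = ?S * (?S * ?S)"
    by (simp add: nn_integral_fst_count_space[symmetric] nn_integral_cmult nn_integral_multc case_prod_beta)
  also have "\<dots> < \<infinity>" using S by (simp add: ennreal_mult_less_top)
  finally show ?thesis .
qed

section \<open>Fourier coefficients on the torus\<close>

abbreviation LT :: "(real ^ 3) measure" where
  "LT \<equiv> lebesgue_on Tbox"

lemma Tbox_eq_cbox: "Tbox = cbox 0 (\<chi> i. 2 * pi)"
  by (auto simp: Tbox_def mem_box_cart)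

lemma lmeasurable_Tbox [simp, intro]: "Tbox \<in> lmeasurable"
  by (simp add: Tbox_eq_cbox)

lemma sets_lebesgue_Tbox [simp, intro, measurable]: "Tbox \<in> sets lebesgue"
  using lmeasurable_Tbox by (rule fmeasurableD)

lemma finite_measure_LT: "finite_measure LT"
  by (rule finite_measure_lebesgue_on) simp

lemma measure_LT: "measure LT (space LT) = (2 * pi) ^ 3"
proof -
  have "measure lebesgue Tbox = (2 * pi) ^ 3"
    unfolding Tbox_eq_cbox
    by (auto simp: content_cbox_if_cart interval_eq_empty_cart not_less prod_constant)
  then show ?thesis by (simp add: measure_restrict_space space_restrict_space)
qed

definition phase :: "wvec \<Rightarrow> real ^ 3 \<Rightarrow> real" where
  "phase k x = (\<Sum>i\<in>UNIV. real_of_int (k $ i) * x $ i)"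

lemma phase_add_right: "phase k (x + y) = phase k x + phase k y"
  by (simp add: phase_def sum.distrib algebra_simps)

lemma phase_scaleR: "phase k (c *\<^sub>R x) = c * phase k x"
  by (simp add: phase_def sum_distrib_left mult_ac)

lemma phase_minus_right: "phase k (- x) = - phase k x"
  by (simp add: phase_def sum_negf)

lemma phase_0 [simp]: "phase 0 x = 0"
  by (simp add: phase_def)

lemma phase_add: "phase (j + k) x = phase j x + phase k x"
  by (simp add: phase_def sum.distrib algebra_simps)

lemma phase_minus: "phase (- k) x = - phase k x"
  by (simp add: phase_def sum_negf)

lemma phase_diff: "phase (j - k) x = phase j x - phase k x"
  by (simp add: phase_def sum_subtractf algebra_simps)

lemma phase_axis: "phase k (c *\<^sub>R axis i 1) = c * real_of_int (k $ i)"
proof -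
  have "phase k (axis i 1) = (\<Sum>l\<in>UNIV. if l = i then real_of_int (k $ i) else 0)"
    unfolding phase_def by (intro sum.cong) (auto simp: axis_def)
  then show ?thesis by (simp add: phase_scaleR)
qed

lemma continuous_on_phase [continuous_intros]: "continuous_on S (phase k)"
  unfolding phase_def by (intro continuous_intros)

lemma continuous_on_cis_phase [continuous_intros]: "continuous_on S (\<lambda>x. cis (phase k x))"
  by (intro continuous_on_cis continuous_intros)

text \<open>Continuity is part of the notion: it keeps compositions with convex functions integrable
  over the box and allows the box to be cut by \<open>integral_split\<close>.\<close>

definition cperiodic :: "(real ^ 3 \<Rightarrow> 'b::topological_space) \<Rightarrow> bool" where
  "cperiodic f \<longleftrightarrow> continuous_on UNIV f \<and> (\<forall>x i. f (x + (2 * pi) *\<^sub>R axis i 1) = f x)"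

lemma cperiodic_translate:
  assumes "cperiodic f" shows "cperiodic (\<lambda>x. f (x + d))"
proof -
  have "continuous_on UNIV (\<lambda>x. f (x + d))"
    by (rule continuous_on_compose2[of UNIV f]) (use assms in \<open>auto simp: cperiodic_def intro!: continuous_intros\<close>)
  moreover have "f (x + (2 * pi) *\<^sub>R axis i 1 + d) = f (x + d)" for x i
    using assms unfolding cperiodic_def by (metis add.commute add.left_commute)
  ultimately show ?thesis by (auto simp: cperiodic_def)
qed

lemma cperiodic_compose:
  assumes "cperiodic f" "continuous_on UNIV g" shows "cperiodic (\<lambda>x. g (f x))"
  using assms by (auto simp: cperiodic_def intro: continuous_on_compose2[of UNIV g])

lemma cperiodic_cis_phase: "cperiodic (\<lambda>x. cis (phase k x))"
proof -
  have "cis (2 * pi * real_of_int n) = 1" for n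
    by (simp add: cis.ctr complex_eq_iff)
  then have "cis (phase k (x + (2 * pi) *\<^sub>R axis i 1)) = cis (phase k x)" for x i
    by (simp add: phase_add_right phase_axis cis_mult[symmetric])
  then show ?thesis
    by (auto simp: cperiodic_def intro!: continuous_intros)
qed

lemma cperiodic_const: "cperiodic (\<lambda>x. c)"
  by (simp add: cperiodic_def)

lemma cperiodic_add:
  fixes f g :: "real ^ 3 \<Rightarrow> 'b::real_normed_vector"
  shows "cperiodic f \<Longrightarrow> cperiodic g \<Longrightarrow> cperiodic (\<lambda>x. f x + g x)"
  by (auto simp: cperiodic_def intro!: continuous_intros)

lemma cperiodic_mult:
  fixes f g :: "real ^ 3 \<Rightarrow> 'b::real_normed_algebra"
  shows "cperiodic f \<Longrightarrow> cperiodic g \<Longrightarrow> cperiodic (\<lambda>x. f x * g x)"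
  by (auto simp: cperiodic_def intro!: continuous_intros)

lemma cperiodic_sum:
  fixes f :: "'i \<Rightarrow> real ^ 3 \<Rightarrow> 'b::real_normed_vector"
  shows "(\<And>i. i \<in> I \<Longrightarrow> cperiodic (f i)) \<Longrightarrow> cperiodic (\<lambda>x. \<Sum>i\<in>I. f i x)"
  by (auto simp: cperiodic_def intro!: continuous_intros sum.cong)

lemma integrable_LT_continuous:
  fixes f :: "real ^ 3 \<Rightarrow> 'b::euclidean_space"
  assumes "continuous_on Tbox f" shows "integrable LT f"
  using assms unfolding Tbox_eq_cbox by (rule continuous_imp_integrable)

lemma integrable_LT_cperiodic:
  fixes f :: "real ^ 3 \<Rightarrow> 'b::euclidean_space"
  assumes "cperiodic f" shows "integrable LT f"
  using assms by (auto simp: cperiodic_def intro!: integrable_LT_continuous elim: continuous_on_subset)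

lemma integral_LT_eq_integral_cbox:
  fixes f :: "real ^ 3 \<Rightarrow> 'b::euclidean_space"
  assumes "cperiodic f" shows "integral\<^sup>L LT f = integral (cbox 0 (\<chi> i. 2 * pi)) f"
  unfolding Tbox_eq_cbox[symmetric]
  by (rule lebesgue_integral_eq_integral[OF integrable_LT_cperiodic[OF assms]]) simp

text \<open>The box lengthened by s in direction i is cut once at height s and once at height 2 pi.
  The two slabs of thickness s have equal integrals by periodicity, hence so do the remaining boxes,
  one of which is the translate of the other.\<close>

lemma integral_LT_translate_axis:
  fixes f :: "real ^ 3 \<Rightarrow> 'b::euclidean_space"
  assumes f: "cperiodic f" and s: "0 \<le> s" "s \<le> 2 * pi"
  shows "(\<integral>x. f (x + s *\<^sub>R axis i 1) \<partial>LT) = integral\<^sup>L LT f"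
proof -
  let ?e = "axis i 1 :: real ^ 3"
  let ?b = "(\<chi> i. 2 * pi) :: real ^ 3"
  have e: "?e \<in> Basis" by (simp add: axis_in_Basis_iff)
  have ic: "f integrable_on cbox a b" for a b
    by (rule integrable_continuous) (use f in \<open>auto simp: cperiodic_def elim: continuous_on_subset\<close>)
  have ei: "x \<bullet> ?e = x $ i" for x by (simp add: inner_axis)
  have ec: "?e $ l = (if l = i then 1 else 0)" for l by (simp add: axis_def)
  have sh: "integral (cbox a b) (\<lambda>x. f (x + d)) = integral (cbox (a + d) (b + d)) f" for a b d
    using integral_shift_cbox[of "a + d" d "b + d" f] by simp
  have per: "(\<lambda>x. f (x + (2 * pi) *\<^sub>R ?e)) = f"
    using f by (auto simp: cperiodic_def)
  have U1: "cbox 0 (?b + s *\<^sub>R ?e) \<inter> {x. x \<bullet> ?e \<le> s} = cbox 0 (?b + (s - 2 * pi) *\<^sub>R ?e)"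
    using s exhaust_3[of i] by (auto simp: set_eq_iff mem_box_cart ei ec forall_3)
  have U2: "cbox 0 (?b + s *\<^sub>R ?e) \<inter> {x. x \<bullet> ?e \<ge> s} = cbox (s *\<^sub>R ?e) (?b + s *\<^sub>R ?e)"
    using s exhaust_3[of i] by (auto simp: set_eq_iff mem_box_cart ei ec forall_3)
  have U3: "cbox 0 (?b + s *\<^sub>R ?e) \<inter> {x. x \<bullet> ?e \<le> 2 * pi} = cbox 0 ?b"
    using s exhaust_3[of i] by (auto simp: set_eq_iff mem_box_cart ei ec forall_3)
  have U4: "cbox 0 (?b + s *\<^sub>R ?e) \<inter> {x. x \<bullet> ?e \<ge> 2 * pi} = cbox ((2 * pi) *\<^sub>R ?e) (?b + s *\<^sub>R ?e)"
    using s exhaust_3[of i] by (auto simp: set_eq_iff mem_box_cart ei ec forall_3)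
  have "integral (cbox 0 (?b + (s - 2 * pi) *\<^sub>R ?e)) f
      = integral (cbox 0 (?b + (s - 2 * pi) *\<^sub>R ?e)) (\<lambda>x. f (x + (2 * pi) *\<^sub>R ?e))"
    unfolding per ..
  also have "\<dots> = integral (cbox ((2 * pi) *\<^sub>R ?e) (?b + s *\<^sub>R ?e)) f"
    unfolding sh by (simp add: algebra_simps)
  finally have A: "integral (cbox 0 (?b + (s - 2 * pi) *\<^sub>R ?e)) f = integral (cbox ((2 * pi) *\<^sub>R ?e) (?b + s *\<^sub>R ?e)) f" .
  have "integral (cbox (s *\<^sub>R ?e) (?b + s *\<^sub>R ?e)) f = integral (cbox 0 ?b) f"
    using integral_split[OF ic e, of 0 "?b + s *\<^sub>R ?e" s] integral_split[OF ic e, of 0 "?b + s *\<^sub>R ?e" "2 * pi"] A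
    unfolding U1 U2 U3 U4 by simp
  then show ?thesis
    using sh[of 0 ?b "s *\<^sub>R ?e"]
    by (simp add: integral_LT_eq_integral_cbox f cperiodic_translate)
qed

lemma cperiodic_int_shift:
  assumes "cperiodic f"
  shows "f (x + (2 * pi * real_of_int m) *\<^sub>R axis i 1) = f x"
proof (induction m rule: int_induct[of _ 0])
  case (step1 m)
  have "x + (2 * pi * real_of_int (m + 1)) *\<^sub>R axis i 1
      = x + (2 * pi * real_of_int m) *\<^sub>R axis i 1 + (2 * pi) *\<^sub>R axis i 1"
    by (simp add: algebra_simps)
  then show ?case using step1 assms unfolding cperiodic_def by metis
next
  case (step2 m)
  have "x + (2 * pi * real_of_int m) *\<^sub>R axis i 1
      = x + (2 * pi * real_of_int (m - 1)) *\<^sub>R axis i 1 + (2 * pi) *\<^sub>R axis i 1"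
    by (simp add: algebra_simps)
  then show ?case using step2 assms unfolding cperiodic_def by metis
qed simp

lemma integral_LT_translate:
  fixes f :: "real ^ 3 \<Rightarrow> 'b::euclidean_space"
  assumes f: "cperiodic f"
  shows "(\<integral>x. f (x + d) \<partial>LT) = integral\<^sup>L LT f"
proof -
  have ax: "(\<integral>x. g (x + s *\<^sub>R axis i 1) \<partial>LT) = integral\<^sup>L LT g"
    if g: "cperiodic g" for g :: "real ^ 3 \<Rightarrow> 'b" and s i
  proof -
    define m where "m = \<lfloor>s / (2 * pi)\<rfloor>"
    define r where "r = s - 2 * pi * real_of_int m"
    have "real_of_int m \<le> s / (2 * pi)" "s / (2 * pi) < real_of_int m + 1"
      unfolding m_def by linarith+
    then have r: "0 \<le> r" "r \<le> 2 * pi"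
      unfolding r_def by (simp_all add: field_simps)
    have "g (x + s *\<^sub>R axis i 1) = g (x + r *\<^sub>R axis i 1)" for x
      using cperiodic_int_shift[OF g, of "x + r *\<^sub>R axis i 1" m i] by (simp add: r_def algebra_simps)
    then show ?thesis
      using integral_LT_translate_axis[OF g r, of i] by simp
  qed
  have d: "x + d = x + (d $ 1) *\<^sub>R axis 1 1 + (d $ 2) *\<^sub>R axis 2 1 + (d $ 3) *\<^sub>R axis 3 1" for x
    by (simp add: vec_eq_iff forall_3 axis_def)
  show ?thesis
    unfolding d
    using ax[of "\<lambda>x. f (x + (d $ 2) *\<^sub>R axis 2 1 + (d $ 3) *\<^sub>R axis 3 1)" "d $ 1" 1]
      ax[of "\<lambda>x. f (x + (d $ 3) *\<^sub>R axis 3 1)" "d $ 2" 2] ax[OF f, of "d $ 3" 3]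
      cperiodic_translate[OF f, of "(d $ 3) *\<^sub>R axis 3 1"]
      cperiodic_translate[OF cperiodic_translate[OF f, of "(d $ 3) *\<^sub>R axis 3 1"], of "(d $ 2) *\<^sub>R axis 2 1"]
    by (simp add: add.assoc)
qed

lemma integral_LT_cis_phase:
  "(\<integral>x. cis (phase k x) \<partial>LT) = (if k = 0 then (2 * pi) ^ 3 else 0)"
proof (cases "k = 0")
  case True
  then show ?thesis using measure_LT by (simp add: scaleR_conv_of_real)
next
  case False
  then obtain i where i: "k $ i \<noteq> 0" unfolding vec_eq_iff by auto
  \<comment> \<open>Half a wavelength in a direction with nonzero k_i: the shift flips the sign of
    the wave but leaves its integral unchanged.\<close>
  define d :: "real ^ 3" where "d = (pi / real_of_int (k $ i)) *\<^sub>R axis i 1"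
  have "phase k d = pi" using i by (simp add: d_def phase_axis)
  then have "cis (phase k (x + d)) = - cis (phase k x)" for x
    by (simp add: phase_add_right cis_mult[symmetric])
  then have "(\<integral>x. - cis (phase k x) \<partial>LT) = (\<integral>x. cis (phase k x) \<partial>LT)"
    using integral_LT_translate[OF cperiodic_cis_phase, of k d] by simp
  then show ?thesis using False by simp
qed

lemma fcoef_eq: "fcoef f k = complex_of_real (1 / (2 * pi) ^ 3) * (\<integral>x. complex_of_real (f x) * cis (- phase k x) \<partial>LT)"
  by (simp add: fcoef_def phase_def)

lemma integrable_LT_mult_cis:
  fixes f :: "real ^ 3 \<Rightarrow> real"
  assumes "integrable LT f"
  shows "integrable LT (\<lambda>x. complex_of_real (f x) * cis (phase k x))"
proof (rule Bochner_Integration.integrable_bound)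
  show "integrable LT (\<lambda>x. complex_of_real (f x))" using assms by simp
  have "(\<lambda>x. cis (phase k x)) \<in> borel_measurable LT"
    by (intro continuous_imp_measurable_on_sets_lebesgue continuous_intros) simp
  then show "(\<lambda>x. complex_of_real (f x) * cis (phase k x)) \<in> borel_measurable LT"
    using assms by (auto intro!: borel_measurable_times)
qed (simp add: norm_mult)

lemma integrable_LT_mult_cis':
  fixes f :: "real ^ 3 \<Rightarrow> real"
  assumes "integrable LT f"
  shows "integrable LT (\<lambda>x. complex_of_real (f x) * cis (- phase k x))"
  using integrable_LT_mult_cis[OF assms, of "- k"] by (simp add: phase_minus)

lemma fcoef_add:
  assumes "integrable LT f" "integrable LT g"
  shows "fcoef (\<lambda>x. f x + g x) k = fcoef f k + fcoef g k"
  using integrable_LT_mult_cis'[OF assms(1), of k] integrable_LT_mult_cis'[OF assms(2), of k]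
  by (simp add: fcoef_eq distrib_right add_divide_distrib)

lemma fcoef_cmult: "fcoef (\<lambda>x. c * f x) k = of_real c * fcoef f k"
  by (simp add: fcoef_eq mult.assoc)

lemma fcoef_diff:
  assumes "integrable LT f" "integrable LT g"
  shows "fcoef (\<lambda>x. f x - g x) k = fcoef f k - fcoef g k"
  using integrable_LT_mult_cis'[OF assms(1), of k] integrable_LT_mult_cis'[OF assms(2), of k]
  by (simp add: fcoef_eq left_diff_distrib diff_divide_distrib)

lemma fcoef_sum:
  assumes "\<And>i. i \<in> I \<Longrightarrow> integrable LT (f i)"
  shows "fcoef (\<lambda>x. \<Sum>i\<in>I. f i x) k = (\<Sum>i\<in>I. fcoef (f i) k)"
  using integrable_LT_mult_cis'[OF assms, of _ k]
  by (simp add: fcoef_eq sum_distrib_right sum_divide_distrib Bochner_Integration.integral_sum)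

lemma fcoef_uminus: "fcoef f (- k) = cnj (fcoef f k)"
  using Bochner_Integration.integral_cnj[of LT "\<lambda>x. complex_of_real (f x) * cis (- phase k x)"]
  by (simp add: fcoef_eq phase_minus cis_cnj)

lemma fcoef_0_eq: "fcoef f 0 = of_real (integral\<^sup>L LT f / (2 * pi) ^ 3)"
  by (simp add: fcoef_eq)

lemma fcoef_const: "fcoef (\<lambda>x. c) k = (if k = 0 then of_real c else 0)"
proof -
  have "fcoef (\<lambda>x. c) k = complex_of_real (1 / (2 * pi) ^ 3) * (of_real c * (\<integral>x. cis (phase (- k) x) \<partial>LT))"
    by (simp add: fcoef_eq phase_minus)
  then show ?thesis unfolding integral_LT_cis_phase by simp
qed

lemma fcoef_translate:
  assumes "cperiodic f"
  shows "fcoef (\<lambda>x. f (x + d)) k = cis (phase k d) * fcoef f k"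
proof -
  define G where "G x = complex_of_real (f x) * cis (- phase k x)" for x
  have "cperiodic G"
    unfolding G_def phase_minus[symmetric]
    by (intro cperiodic_mult cperiodic_cis_phase cperiodic_compose[OF assms] continuous_intros)
  then have "(\<integral>x. G (x + d) \<partial>LT) = integral\<^sup>L LT G"
    by (rule integral_LT_translate)
  moreover have eq: "complex_of_real (f (x + d)) * cis (- phase k x) = cis (phase k d) * G (x + d)" for x
    by (simp add: G_def phase_add_right cis_mult mult_ac)
  ultimately have "(\<integral>x. complex_of_real (f (x + d)) * cis (- phase k x) \<partial>LT) = cis (phase k d) * integral\<^sup>L LT G"
    by (simp add: eq)
  then show ?thesis
    unfolding fcoef_eq G_def by simp
qed

lemma fcoef_mult_wave:
  assumes "integrable LT f"
  shows "fcoef (\<lambda>x. Re (c * cis (phase j x)) * f x) k = (c * fcoef f (k - j) + cnj c * fcoef f (k + j)) / 2"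
proof -
  have Re: "complex_of_real (Re z) = (z + cnj z) / 2" for z by (simp add: complex_eq_iff)
  have A: "cis (- phase (k - j) x) = cis (phase j x) * cis (- phase k x)"
    and B: "cis (- phase (k + j) x) = cis (- phase j x) * cis (- phase k x)" for x
    by (simp_all add: cis_mult phase_diff phase_add algebra_simps)
  have "complex_of_real (Re (c * cis (phase j x)) * f x) * cis (- phase k x)
      = c / 2 * (complex_of_real (f x) * cis (- phase (k - j) x))
       + cnj c / 2 * (complex_of_real (f x) * cis (- phase (k + j) x))" for x
    unfolding of_real_mult Re A B by (simp add: cis_cnj field_simps)
  then show ?thesis
    using integrable_LT_mult_cis'[OF assms, of "k - j"] integrable_LT_mult_cis'[OF assms, of "k + j"]
    by (simp add: fcoef_eq algebra_simps add_divide_distrib)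
qed

lemma cis_phase_diff: "cis (phase (k - l) x) = cis (phase k x) * cnj (cis (phase l x))"
  by (simp add: phase_diff cis_cnj cis_mult)

lemma integral_LT_trig_mult_cnj:
  assumes "finite F" "finite G"
  shows "(\<integral>x. (\<Sum>k\<in>F. c k * cis (phase k x)) * cnj (\<Sum>k\<in>G. d k * cis (phase k x)) \<partial>LT)
       = (2 * pi) ^ 3 * (\<Sum>k\<in>F \<inter> G. c k * cnj (d k))"
proof -
  have ii: "integrable LT (\<lambda>x. a * cis (phase k x))" for a :: complex and k
    by (intro integrable_mult_right integrable_LT_cperiodic cperiodic_cis_phase)
  have "(\<Sum>k\<in>F. c k * cis (phase k x)) * cnj (\<Sum>k\<in>G. d k * cis (phase k x))
      = (\<Sum>k\<in>F. \<Sum>l\<in>G. c k * cnj (d l) * cis (phase (k - l) x))" for x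
    unfolding cnj_sum sum_product by (intro sum.cong refl) (simp add: cis_phase_diff mult_ac)
  moreover have "(\<integral>x. (\<Sum>k\<in>F. \<Sum>l\<in>G. c k * cnj (d l) * cis (phase (k - l) x)) \<partial>LT)
      = (\<Sum>k\<in>F. \<Sum>l\<in>G. c k * cnj (d l) * (\<integral>x. cis (phase (k - l) x) \<partial>LT))"
    by (simp add: Bochner_Integration.integral_sum Bochner_Integration.integrable_sum ii)
  moreover have "\<dots> = (\<Sum>k\<in>F. \<Sum>l\<in>G. if l = k then (2 * pi) ^ 3 * (c k * cnj (d k)) else 0)"
    unfolding integral_LT_cis_phase by (intro sum.cong) auto
  moreover have "\<dots> = (2 * pi) ^ 3 * (\<Sum>k\<in>F \<inter> G. c k * cnj (d k))"
    using assms by (simp add: sum.delta sum.inter_restrict sum_distrib_left if_distrib[of "(*) _"] cong: if_cong)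
  ultimately show ?thesis by simp
qed

lemma continuous_on_trig: "continuous_on S (\<lambda>x. \<Sum>k\<in>F. c k * cis (phase k x))"
  by (intro continuous_intros)

lemma integral_LT_trig_norm2:
  assumes "finite F"
  shows "(\<integral>x. (cmod (\<Sum>k\<in>F. c k * cis (phase k x)))\<^sup>2 \<partial>LT) = (2 * pi) ^ 3 * (\<Sum>k\<in>F. (cmod (c k))\<^sup>2)"
proof -
  have "complex_of_real (\<integral>x. (cmod (\<Sum>k\<in>F. c k * cis (phase k x)))\<^sup>2 \<partial>LT)
      = (\<integral>x. (\<Sum>k\<in>F. c k * cis (phase k x)) * cnj (\<Sum>k\<in>F. c k * cis (phase k x)) \<partial>LT)"
    by (simp only: complex_norm_square flip: integral_complex_of_real)
  also have "\<dots> = complex_of_real ((2 * pi) ^ 3 * (\<Sum>k\<in>F. (cmod (c k))\<^sup>2))"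
    unfolding integral_LT_trig_mult_cnj[OF assms assms] by (simp add: complex_norm_square[symmetric])
  finally show ?thesis by (simp only: of_real_eq_iff)
qed

lemma integrable_LT_sq_imp:
  fixes f :: "real ^ 3 \<Rightarrow> real"
  assumes "f \<in> borel_measurable LT" "integrable LT (\<lambda>x. (f x)\<^sup>2)"
  shows "integrable LT f"
proof (rule Bochner_Integration.integrable_bound)
  interpret finite_measure LT by (rule finite_measure_LT)
  show "integrable LT (\<lambda>x. 1 + (f x)\<^sup>2)" using assms by simp
  have "\<bar>a\<bar> \<le> 1 + a\<^sup>2" for a :: real
    using zero_le_power2[of "\<bar>a\<bar> - 1"] zero_le_power2[of a] by (simp add: power2_diff)
  then show "AE x in LT. norm (f x) \<le> norm (1 + (f x)\<^sup>2)" by simp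
qed fact

lemma Bessel:
  fixes f :: "real ^ 3 \<Rightarrow> real"
  assumes f: "f \<in> borel_measurable LT" "integrable LT (\<lambda>x. (f x)\<^sup>2)" and F: "finite F"
  shows "(2 * pi) ^ 3 * (\<Sum>k\<in>F. (cmod (fcoef f k))\<^sup>2) \<le> (\<integral>x. (f x)\<^sup>2 \<partial>LT)"
proof -
  have lin: "(\<integral>x. A x - 2 * Re (B x) + C x \<partial>LT) = integral\<^sup>L LT A - 2 * Re (integral\<^sup>L LT B) + integral\<^sup>L LT C"
    if "integrable LT A" "integrable LT B" "integrable LT C" for A C :: "real ^ 3 \<Rightarrow> real" and B
    using that integrable_Re[OF that(2)] by (simp add: integral_Re)
  let ?c = "fcoef f" and ?P = "\<lambda>x. \<Sum>k\<in>F. fcoef f k * cis (phase k x)"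
  have fi: "integrable LT f" by (rule integrable_LT_sq_imp[OF f])
  have e: "complex_of_real (f x) * cnj (?P x) = (\<Sum>k\<in>F. cnj (?c k) * (complex_of_real (f x) * cis (- phase k x)))" for x
    by (simp add: sum_distrib_left cis_cnj mult_ac)
  have i1: "integrable LT (\<lambda>x. complex_of_real (f x) * cnj (?P x))"
    unfolding e by (intro Bochner_Integration.integrable_sum integrable_mult_right integrable_LT_mult_cis' fi)
  have "(\<integral>x. complex_of_real (f x) * cnj (?P x) \<partial>LT) = (\<Sum>k\<in>F. cnj (?c k) * ((2 * pi) ^ 3 * ?c k))"
    unfolding e by (subst Bochner_Integration.integral_sum)
      (auto intro!: sum.cong integrable_mult_right integrable_LT_mult_cis' fi simp: fcoef_eq)
  also have "\<dots> = complex_of_real ((2 * pi) ^ 3 * (\<Sum>k\<in>F. (cmod (?c k))\<^sup>2))"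
    by (simp add: sum_distrib_left complex_norm_square mult_ac del: of_real_power)
  finally have e1: "(\<integral>x. complex_of_real (f x) * cnj (?P x) \<partial>LT) = complex_of_real ((2 * pi) ^ 3 * (\<Sum>k\<in>F. (cmod (?c k))\<^sup>2))" .
  have i2: "integrable LT (\<lambda>x. (cmod (?P x))\<^sup>2)"
    by (rule integrable_LT_continuous) (intro continuous_intros continuous_on_trig)
  have "0 \<le> (\<integral>x. (cmod (complex_of_real (f x) - ?P x))\<^sup>2 \<partial>LT)" by simp
  also have "\<dots> = (\<integral>x. (f x)\<^sup>2 - 2 * Re (complex_of_real (f x) * cnj (?P x)) + (cmod (?P x))\<^sup>2 \<partial>LT)"
  proof (rule Bochner_Integration.integral_cong[OF refl])
    fix x
    show "(cmod (complex_of_real (f x) - ?P x))\<^sup>2 = (f x)\<^sup>2 - 2 * Re (complex_of_real (f x) * cnj (?P x)) + (cmod (?P x))\<^sup>2"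
      unfolding cmod_power2 by (simp add: power2_eq_square algebra_simps)
  qed
  also have "\<dots> = (\<integral>x. (f x)\<^sup>2 \<partial>LT) - 2 * Re (\<integral>x. complex_of_real (f x) * cnj (?P x) \<partial>LT) + (\<integral>x. (cmod (?P x))\<^sup>2 \<partial>LT)"
    by (rule lin[OF f(2) i1 i2])
  finally show ?thesis
    unfolding e1 integral_LT_trig_norm2[OF F] by simp
qed

section \<open>Fejer means\<close>

definition fbox :: "nat \<Rightarrow> wvec set" where
  "fbox n = {k. \<forall>i. \<bar>k $ i\<bar> \<le> int n}"

lemma card_fbox: "card (fbox n) = (2 * n + 1) ^ 3" and finite_fbox [simp]: "finite (fbox n)"
proof -
  let ?B = "{- int n..int n}"
  have "bij_betw (\<lambda>(a, b, c). vector [a, b, c] :: wvec) (?B \<times> ?B \<times> ?B) (fbox n)"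
    by (rule bij_betw_byWitness[of _ "\<lambda>k. (k $ 1, k $ 2, k $ 3)"])
      (auto simp: fbox_def vec_eq_iff forall_3 abs_le_iff)
  note b = bij_betw_same_card[OF this] bij_betw_finite[OF this]
  have "card ?B = 2 * n + 1" by simp
  then show "card (fbox n) = (2 * n + 1) ^ 3"
    unfolding b(1)[symmetric] card_cartesian_product power3_eq_cube by simp
  show "finite (fbox n)" using b(2) by simp
qed

lemma uminus_in_fbox_iff [simp]: "- k \<in> fbox n \<longleftrightarrow> k \<in> fbox n"
  by (simp add: fbox_def)

lemma ex_fbox: "\<exists>m. k \<in> fbox m"
proof
  show "k \<in> fbox (nat (\<Sum>i\<in>UNIV. \<bar>k $ i\<bar>))"
    by (auto simp: fbox_def intro: order_trans[OF member_le_sum[of _ UNIV "\<lambda>i. \<bar>k $ i\<bar>"]])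
qed

lemma fbox_mono: "m \<le> n \<Longrightarrow> fbox m \<subseteq> fbox n"
  by (auto simp: fbox_def intro: order_trans)

text \<open>Summing over pairs of box points instead of weighted single modes makes this, by
  \<open>fejer_eq_integral\<close>, the convolution with a multiple of |sum over a in the box of
  e^(i a x)|^2. Positivity of the operator is then immediate.\<close>

definition fejer :: "nat \<Rightarrow> (real ^ 3 \<Rightarrow> real) \<Rightarrow> real ^ 3 \<Rightarrow> real" where
  "fejer n f x = (\<Sum>(a, b)\<in>fbox n \<times> fbox n. Re (fcoef f (a - b) * cis (phase (a - b) x))) / real (card (fbox n))"

definition fejer_weight :: "nat \<Rightarrow> wvec \<Rightarrow> real" where
  "fejer_weight n k = real (card {p \<in> fbox n \<times> fbox n. fst p - snd p = k}) / real (card (fbox n))"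

lemma cperiodic_fejer: "cperiodic (fejer n f)"
proof -
  have "cperiodic (\<lambda>x. Re (c * cis (phase k x)))" for c k
    by (rule cperiodic_compose[OF cperiodic_mult[OF cperiodic_const cperiodic_cis_phase]])
      (intro continuous_intros)
  then have "cperiodic (\<lambda>x. (\<Sum>p\<in>fbox n \<times> fbox n. Re (fcoef f (fst p - snd p) * cis (phase (fst p - snd p) x))) * (1 / real (card (fbox n))))"
    by (intro cperiodic_mult cperiodic_const cperiodic_sum)
  then show ?thesis by (simp add: fejer_def[abs_def] case_prod_beta)
qed

lemma fejer_eq_integral:
  assumes f: "integrable LT f"
  shows "fejer n f x = (\<integral>y. f y * (cmod (\<Sum>a\<in>fbox n. cis (phase a (x - y))))\<^sup>2 \<partial>LT) / ((2 * pi) ^ 3 * real (card (fbox n)))"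
proof -
  have ii: "integrable LT (\<lambda>y. a * (complex_of_real (f y) * cis (- phase k y)))" for a :: complex and k
    by (intro integrable_mult_right integrable_LT_mult_cis' f)
  have Re_mult: "Re (a * (complex_of_real c * z)) = c * Re (z * a)" for a z c
    by (simp add: algebra_simps)
  have Re_eq: "a = Re z" if "complex_of_real a = z" for a z
    using that by auto
  have m: "cis (phase k (x - y)) = cis (phase k x) * cnj (cis (phase k y))" for k y
    using phase_add_right[of k x "- y"] by (simp add: phase_minus_right cis_cnj cis_mult)
  have "complex_of_real (f y) * complex_of_real ((cmod (\<Sum>a\<in>fbox n. cis (phase a (x - y))))\<^sup>2)
     = (\<Sum>a\<in>fbox n. \<Sum>b\<in>fbox n. cis (phase (a - b) x) * (complex_of_real (f y) * cis (- phase (a - b) y)))" for y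
    unfolding complex_norm_square cnj_sum sum_product
    unfolding sum_distrib_left
    by (intro sum.cong refl) (simp add: m cis_phase_diff cis_cnj[symmetric] mult_ac)
  then have "complex_of_real (\<integral>y. f y * (cmod (\<Sum>a\<in>fbox n. cis (phase a (x - y))))\<^sup>2 \<partial>LT)
     = (\<integral>y. (\<Sum>a\<in>fbox n. \<Sum>b\<in>fbox n. cis (phase (a - b) x) * (complex_of_real (f y) * cis (- phase (a - b) y))) \<partial>LT)"
    by (simp flip: integral_complex_of_real)
  also have "\<dots> = (\<Sum>a\<in>fbox n. \<Sum>b\<in>fbox n. cis (phase (a - b) x) * (complex_of_real ((2 * pi) ^ 3) * fcoef f (a - b)))"
    unfolding fcoef_eq
    by (simp add: Bochner_Integration.integral_sum Bochner_Integration.integrable_sum ii)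
  finally have "(\<integral>y. f y * (cmod (\<Sum>a\<in>fbox n. cis (phase a (x - y))))\<^sup>2 \<partial>LT)
     = Re (\<Sum>a\<in>fbox n. \<Sum>b\<in>fbox n. cis (phase (a - b) x) * (complex_of_real ((2 * pi) ^ 3) * fcoef f (a - b)))"
    by (rule Re_eq)
  also have "\<dots> = (2 * pi) ^ 3 * (\<Sum>a\<in>fbox n. \<Sum>b\<in>fbox n. Re (fcoef f (a - b) * cis (phase (a - b) x)))"
    unfolding Re_sum sum_distrib_left
    by (intro sum.cong refl) (rule Re_mult)
  finally show ?thesis
    by (simp add: fejer_def sum.cartesian_product)
qed

lemma fejer_nonneg:
  assumes "integrable LT f" "AE x in LT. 0 \<le> f x"
  shows "0 \<le> fejer n f x"
  unfolding fejer_eq_integral[OF assms(1)]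
  by (intro divide_nonneg_nonneg integral_nonneg_AE) (use assms(2) in auto)

lemma fejer_diff:
  assumes "integrable LT f" "integrable LT g"
  shows "fejer n (\<lambda>x. f x - g x) x = fejer n f x - fejer n g x"
  by (simp add: fejer_def case_prod_beta fcoef_diff[OF assms] left_diff_distrib sum_subtractf diff_divide_distrib)

lemma fejer_cmult: "fejer n (\<lambda>x. c * f x) x = c * fejer n f x"
  by (simp add: fejer_def case_prod_beta fcoef_cmult sum_distrib_left algebra_simps)

lemma fejer_const: "fejer n (\<lambda>x. c) x = c"
proof -
  have "(\<Sum>(a, b)\<in>fbox n \<times> fbox n. Re (fcoef (\<lambda>x. c) (a - b) * cis (phase (a - b) x)))
      = (\<Sum>a\<in>fbox n. \<Sum>b\<in>fbox n. if b = a then c else 0)"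
    unfolding sum.cartesian_product by (intro sum.cong) (auto simp: fcoef_const)
  also have "\<dots> = card (fbox n) * c" by simp
  finally show ?thesis by (simp add: fejer_def card_fbox)
qed

lemma fcoef_wave:
  "fcoef (\<lambda>x. Re (c * cis (phase j x))) k = ((if k = j then c else 0) + (if k = - j then cnj c else 0)) / 2"
proof -
  interpret finite_measure LT by (rule finite_measure_LT)
  show ?thesis
    using fcoef_mult_wave[of "\<lambda>_. 1" c j k] by (simp add: fcoef_const eq_neg_iff_add_eq_0)
qed

lemma fcoef_fejer: "fcoef (fejer n f) k = fejer_weight n k * fcoef f k"
proof -
  let ?B = "fbox n \<times> fbox n"
  have ii: "integrable LT (\<lambda>x. Re (c * cis (phase j x)))" for c j
    by (intro integrable_LT_continuous continuous_intros)
  have fe: "fejer n f = (\<lambda>x. (1 / real (card (fbox n))) * (\<Sum>p\<in>?B. Re (fcoef f (fst p - snd p) * cis (phase (fst p - snd p) x))))"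
    by (simp add: fejer_def fun_eq_iff case_prod_beta)
  have sw: "(\<Sum>p\<in>?B. if k = - (fst p - snd p) then cnj (fcoef f (fst p - snd p)) else 0)
      = (\<Sum>p\<in>?B. if k = fst p - snd p then fcoef f (fst p - snd p) else 0)"
    by (rule sum.reindex_bij_witness[of _ prod.swap prod.swap]) (auto simp: fcoef_uminus[symmetric])
  have "(\<Sum>p\<in>?B. if k = fst p - snd p then fcoef f (fst p - snd p) else 0)
      = (\<Sum>p\<in>?B. if k = fst p - snd p then fcoef f k else 0)"
    by (intro sum.cong) auto
  also have "\<dots> = card {p \<in> ?B. fst p - snd p = k} * fcoef f k"
    by (subst sum.inter_filter[symmetric]) (auto simp: eq_commute[of k])
  finally have sk: "(\<Sum>p\<in>?B. if k = fst p - snd p then fcoef f (fst p - snd p) else 0)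
      = card {p \<in> ?B. fst p - snd p = k} * fcoef f k" .
  have "fcoef (\<lambda>x. \<Sum>p\<in>?B. Re (fcoef f (fst p - snd p) * cis (phase (fst p - snd p) x))) k
      = (\<Sum>p\<in>?B. fcoef (\<lambda>x. Re (fcoef f (fst p - snd p) * cis (phase (fst p - snd p) x))) k)"
    by (rule fcoef_sum) (rule ii)
  also have "\<dots> = card {p \<in> ?B. fst p - snd p = k} * fcoef f k"
    unfolding fcoef_wave sum_divide_distrib[symmetric] sum.distrib sw sk by simp
  finally show ?thesis
    unfolding fe fcoef_cmult by (simp add: fejer_weight_def)
qed

lemma fejer_weight_le_1: "fejer_weight n k \<le> 1"
proof -
  have "card {p \<in> fbox n \<times> fbox n. fst p - snd p = k} \<le> card (fbox n)"
    by (rule card_inj_on_le[of snd]) (auto simp: inj_on_def)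
  then show ?thesis by (simp add: fejer_weight_def card_fbox del: of_nat_power of_nat_add)
qed

lemma fejer_weight_0: "fejer_weight n 0 = 1"
proof -
  have "card (fbox n) \<le> card {p \<in> fbox n \<times> fbox n. fst p - snd p = 0}"
    by (rule card_inj_on_le[of "\<lambda>b. (b, b)"]) (auto simp: inj_on_def)
  then have "1 \<le> fejer_weight n 0" by (simp add: fejer_weight_def card_fbox del: of_nat_power of_nat_add)
  with fejer_weight_le_1[of n 0] show ?thesis by simp
qed

text \<open>If k lies in the box of size m, each b in the box of size n - m contributes the pair (k
  + b, b). The weight is thus squeezed between a ratio of box cardinalities tending to 1 and the
  bound 1.\<close>

lemma fejer_weight_tendsto: "(\<lambda>n. fejer_weight n k) \<longlonglongrightarrow> 1"
proof -
  obtain m where m: "k \<in> fbox m" using ex_fbox by auto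
  have le: "((2 * (real n - real m) + 1) / (2 * real n + 1)) ^ 3 \<le> fejer_weight n k" if n: "n \<ge> m" for n
  proof -
    have "card (fbox (n - m)) \<le> card {p \<in> fbox n \<times> fbox n. fst p - snd p = k}"
    proof (rule card_inj_on_le[of "\<lambda>b. (k + b, b)"])
      show "(\<lambda>b. (k + b, b)) ` fbox (n - m) \<subseteq> {p \<in> fbox n \<times> fbox n. fst p - snd p = k}"
      proof clarsimp
        fix b assume "b \<in> fbox (n - m)"
        then have "\<bar>k $ i\<bar> \<le> int m" "\<bar>b $ i\<bar> \<le> int n - int m" for i
          using m n by (simp_all add: fbox_def of_nat_diff)
        then have "\<bar>k $ i + b $ i\<bar> \<le> int n" "\<bar>b $ i\<bar> \<le> int n" for i
          using abs_triangle_ineq[of "k $ i" "b $ i"] n by (smt (verit))+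
        then show "k + b \<in> fbox n \<and> b \<in> fbox n" by (simp add: fbox_def)
      qed
    qed (auto simp: inj_on_def)
    then have "real ((2 * (n - m) + 1) ^ 3) \<le> real (card {p \<in> fbox n \<times> fbox n. fst p - snd p = k})"
      unfolding card_fbox by (rule of_nat_mono)
    then have "real ((2 * (n - m) + 1) ^ 3) / real (card (fbox n)) \<le> fejer_weight n k"
      unfolding fejer_weight_def by (rule divide_right_mono) simp
    then show ?thesis
      using n by (simp add: card_fbox power_divide of_nat_diff algebra_simps)
  qed
  have "(\<lambda>n. ((2 * (real n - real m) + 1) / (2 * real n + 1)) ^ 3) \<longlonglongrightarrow> 1"
    by real_asymp
  then show ?thesis
    using tendsto_const[of 1 sequentially]
    by (rule tendsto_sandwich[rotated 2])
       (simp_all only: eventually_sequentiallyI[OF le] fejer_weight_le_1 always_eventually simp_thms)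
qed

lemma convex_subgradient:
  fixes \<phi> :: "real \<Rightarrow> real"
  assumes "convex_on UNIV \<phi>"
  obtains c where "\<And>t. \<phi> t \<ge> \<phi> s + c * (t - s)"
proof -
  have "\<phi> t \<ge> \<phi> s + Inf ((\<lambda>t. (\<phi> s - \<phi> t) / (s - t)) ` ({s<..} \<inter> UNIV)) * (t - s)" for t
    by (rule convex_le_Inf_differential[OF assms]) auto
  then show thesis by (rule that)
qed

text \<open>Jensen's inequality for a positive linear operator fixing constants: it is applied to
  the nonnegative gap between \<phi> and its supporting line at the point s =
  \<open>fejer n f x\<close>.\<close>

lemma fejer_Jensen:
  assumes \<phi>: "convex_on UNIV \<phi>" and f: "integrable LT f" "integrable LT (\<lambda>x. \<phi> (f x))"
  shows "\<phi> (fejer n f x) \<le> fejer n (\<lambda>x. \<phi> (f x)) x"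
proof -
  interpret finite_measure LT by (rule finite_measure_LT)
  define s where "s = fejer n f x"
  obtain c where c: "\<And>t. \<phi> t \<ge> \<phi> s + c * (t - s)" using convex_subgradient[OF \<phi>, of s] by blast
  have "0 \<le> fejer n (\<lambda>x. (\<phi> (f x) - c * f x) - (\<phi> s - c * s)) x"
  proof (rule fejer_nonneg)
    show "AE x in LT. 0 \<le> (\<phi> (f x) - c * f x) - (\<phi> s - c * s)"
      by (rule AE_I2) (use c[of "f _"] in \<open>simp add: algebra_simps\<close>)
  qed (use f in auto)
  also have "\<dots> = fejer n (\<lambda>x. \<phi> (f x)) x - c * s - (\<phi> s - c * s)"
    using f by (simp add: fejer_diff fejer_cmult fejer_const) (simp add: s_def)
  finally show ?thesis by (simp add: s_def)
qed

lemma continuous_on_convex: "convex_on UNIV \<phi> \<Longrightarrow> continuous_on UNIV (\<phi> :: real \<Rightarrow> real)"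
  by (rule convex_on_continuous) auto

lemma integral_LT_fejer: "integral\<^sup>L LT (fejer n f) = integral\<^sup>L LT f"
proof -
  have "complex_of_real (integral\<^sup>L LT (fejer n f) / (2 * pi) ^ 3) = of_real (integral\<^sup>L LT f / (2 * pi) ^ 3)"
    using fcoef_fejer[of n f 0] unfolding fcoef_0_eq fejer_weight_0 by simp
  then show ?thesis unfolding of_real_eq_iff by simp
qed

text \<open>The mode 0 has weight 1, so integrating the pointwise Jensen inequality over the torus
  removes the Fejer mean on the right.\<close>

lemma integral_convex_fejer_le:
  assumes \<phi>: "convex_on UNIV \<phi>" and f: "integrable LT f" "integrable LT (\<lambda>x. \<phi> (f x))"
  shows "(\<integral>x. \<phi> (fejer n f x) \<partial>LT) \<le> (\<integral>x. \<phi> (f x) \<partial>LT)"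
proof -
  have "(\<integral>x. \<phi> (fejer n f x) \<partial>LT) \<le> integral\<^sup>L LT (fejer n (\<lambda>x. \<phi> (f x)))"
    by (intro integral_mono integrable_LT_cperiodic cperiodic_fejer fejer_Jensen \<phi> f
        cperiodic_compose[OF cperiodic_fejer] continuous_on_convex)
  then show ?thesis by (simp add: integral_LT_fejer)
qed

text \<open>Real parts are taken term by term so that the value is real for any coefficients; for
  conjugate-symmetric c and symmetric F it is the ordinary partial Fourier sum.\<close>

definition trig :: "wvec set \<Rightarrow> sfield \<Rightarrow> real ^ 3 \<Rightarrow> real" where
  "trig F c x = (\<Sum>k\<in>F. Re (c k * cis (phase k x)))"

lemma cperiodic_wave: "cperiodic (\<lambda>x. Re (c * cis (phase k x)))"
  by (rule cperiodic_compose[OF cperiodic_mult[OF cperiodic_const cperiodic_cis_phase]])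
    (intro continuous_intros)

lemma cperiodic_trig: "cperiodic (trig F c)"
  unfolding trig_def[abs_def] by (intro cperiodic_sum cperiodic_wave)

lemma continuous_on_trig_fun: "continuous_on S (trig F c)"
  using cperiodic_trig by (metis cperiodic_def continuous_on_subset subset_UNIV)

lemma borel_measurable_cperiodic:
  fixes f :: "real ^ 3 \<Rightarrow> 'b::euclidean_space"
  shows "cperiodic f \<Longrightarrow> f \<in> borel_measurable LT"
  using integrable_LT_cperiodic borel_measurable_integrable by blast

lemma fcoef_trig:
  assumes c: "\<And>k. c (- k) = cnj (c k)" and F: "finite F" "\<And>k. - k \<in> F \<longleftrightarrow> k \<in> F"
  shows "fcoef (trig F c) k = (if k \<in> F then c k else 0)"
proof -
  have "fcoef (trig F c) k = (\<Sum>j\<in>F. fcoef (\<lambda>x. Re (c j * cis (phase j x))) k)"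
    unfolding trig_def[abs_def] by (intro fcoef_sum integrable_LT_cperiodic cperiodic_wave)
  also have "\<dots> = ((\<Sum>j\<in>F. if k = j then c j else 0) + (\<Sum>j\<in>F. if k = - j then cnj (c j) else 0)) / 2"
    unfolding fcoef_wave sum.distrib[symmetric] sum_divide_distrib by simp
  also have "(\<Sum>j\<in>F. if k = - j then cnj (c j) else 0) = (\<Sum>j\<in>F. if k = j then c j else 0)"
    by (rule sum.reindex_bij_witness[of _ uminus uminus]) (auto simp: F c)
  finally show ?thesis using F by (simp add: sum.delta')
qed

lemma integral_trig_square:
  assumes c: "\<And>k. c (- k) = cnj (c k)" and F: "finite F" "\<And>k. - k \<in> F \<longleftrightarrow> k \<in> F"
  shows "(\<integral>x. (trig F c x)\<^sup>2 \<partial>LT) = (2 * pi) ^ 3 * (\<Sum>k\<in>F. (cmod (c k))\<^sup>2)"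
proof -
  have "(trig F c x)\<^sup>2 = (cmod (\<Sum>k\<in>F. c k * cis (phase k x)))\<^sup>2" for x
  proof -
    have "cnj (\<Sum>k\<in>F. c k * cis (phase k x)) = (\<Sum>k\<in>F. c k * cis (phase k x))"
      unfolding cnj_sum
      by (rule sum.reindex_bij_witness[of _ uminus uminus]) (auto simp: F c phase_minus cis_cnj)
    then have "Im (\<Sum>k\<in>F. c k * cis (phase k x)) = 0" by (metis Reals_cnj_iff complex_is_Real_iff)
    then show ?thesis
      unfolding cmod_power2 by (simp add: trig_def)
  qed
  then show ?thesis using integral_LT_trig_norm2[OF F(1), of c] by simp
qed

lemma trig_Diff: "G \<subseteq> F \<Longrightarrow> finite F \<Longrightarrow> trig F c x - trig G c x = trig (F - G) c x"
  unfolding trig_def by (subst sum_diff) auto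

lemma abs_le_sq_param:
  fixes a e :: real
  assumes "0 < e" shows "\<bar>a\<bar> \<le> (e + a\<^sup>2 / e) / 2"
proof -
  have "0 \<le> (\<bar>a\<bar> - e)\<^sup>2" by simp
  then have "2 * e * \<bar>a\<bar> \<le> e\<^sup>2 + a\<^sup>2" by (simp add: power2_diff mult_ac add_ac)
  then show ?thesis using assms by (simp add: field_simps power2_eq_square)
qed

text \<open>The weighted arithmetic-geometric mean inequality replaces Cauchy-Schwarz throughout:
  the free weight e lets one factor be made small at the expense of the other.\<close>

lemma abs_mult_le_param:
  fixes a b e :: real
  assumes "0 < e" shows "\<bar>a * b\<bar> \<le> (a\<^sup>2 / e + e * b\<^sup>2) / 2"
proof -
  have "0 \<le> (\<bar>a\<bar> - e * \<bar>b\<bar>)\<^sup>2" by simp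
  then have "2 * e * \<bar>a * b\<bar> \<le> a\<^sup>2 + e\<^sup>2 * b\<^sup>2" by (simp add: power2_diff power_mult_distrib abs_mult mult_ac)
  then show ?thesis using assms by (simp add: field_simps power2_eq_square)
qed

section \<open>Riesz-Fischer and weak limits in \<open>L\<^sub>q\<close>\<close>

text \<open>A fast subsequence of the box partial sums has summable L_1 increments and so converges
  almost everywhere. Fatou's lemma then identifies its limit as the L_2 limit of the whole sequence,
  and Bessel applied to the difference yields the coefficients.\<close>

lemma Riesz_Fischer:
  fixes c :: sfield
  assumes c: "\<And>k. c (- k) = cnj (c k)" and bd: "\<And>F. finite F \<Longrightarrow> (\<Sum>k\<in>F. (cmod (c k))\<^sup>2) \<le> A"
  obtains f where "f \<in> borel_measurable LT" "integrable LT (\<lambda>x. (f x)\<^sup>2)"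
    "\<And>k. fcoef f k = c k" "(\<lambda>n. \<integral>x. (f x - trig (fbox n) c x)\<^sup>2 \<partial>LT) \<longlonglongrightarrow> 0"
proof -
  interpret finite_measure LT by (rule finite_measure_LT)
  define S where "S n = trig (fbox n) c" for n
  define e where "e n = (2 * pi) ^ 3 * (\<Sum>k\<in>fbox n. (cmod (c k))\<^sup>2)" for n
  have Sm [measurable]: "S n \<in> borel_measurable LT" for n
    unfolding S_def by (intro borel_measurable_cperiodic cperiodic_trig)
  have Sdi: "integrable LT (\<lambda>x. (S n x - S m x)\<^sup>2)" for m n
    unfolding S_def
    by (intro integrable_LT_continuous continuous_intros continuous_on_trig_fun)
  have Sd: "(\<integral>x. (S n x - S m x)\<^sup>2 \<partial>LT) = e n - e m" if "m \<le> n" for m n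
  proof -
    have "(\<integral>x. (S n x - S m x)\<^sup>2 \<partial>LT) = (\<integral>x. (trig (fbox n - fbox m) c x)\<^sup>2 \<partial>LT)"
      unfolding S_def by (simp add: trig_Diff fbox_mono[OF that])
    also have "\<dots> = e n - e m"
      by (subst integral_trig_square[where c = c, OF c])
        (auto simp: e_def sum_diff fbox_mono[OF that] right_diff_distrib)
    finally show ?thesis .
  qed
  have e_inc: "incseq e"
    unfolding e_def incseq_def by (auto intro!: mult_left_mono sum_mono2 dest: subsetD[OF fbox_mono])
  have "\<exists>L. e \<longlonglongrightarrow> L \<and> (\<forall>n. e n \<le> L)"
    by (rule incseq_convergent[OF e_inc, of "(2 * pi) ^ 3 * A"])
      (auto simp: e_def intro!: mult_left_mono bd)
  then obtain L where L: "e \<longlonglongrightarrow> L" "\<And>n. e n \<le> L" by blast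
  \<comment> \<open>The rate 4^(-i) for squared distances is chosen so that
    \<open>abs_le_sq_param\<close> with weight 2^(-i) bounds the L_1 distances by a multiple of
    2^(-i).\<close>
  have "\<exists>n. L - e n \<le> (1/4) ^ i" for i
  proof -
    have "eventually (\<lambda>n. e n > L - (1/4) ^ i) sequentially"
      by (rule order_tendstoD[OF L(1)]) simp
    then show ?thesis by (auto simp: eventually_sequentially) (smt (verit) order_refl)
  qed
  then obtain N where N: "\<And>i. L - e (N i) \<le> (1/4) ^ i" by metis
  \<comment> \<open>Partial sums of N plus i: monotone, above N i (so the rate applies) and above i
    (so the subsequence is unbounded).\<close>
  define r where "r i = (\<Sum>j\<le>i. N j) + i" for i
  have rN: "N i \<le> r i" for i
    unfolding r_def using member_le_sum[of i "{..i}" N] by simp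
  have rs: "r i \<le> r (Suc i)" for i by (simp add: r_def)
  have ri: "i \<le> r i" for i by (simp add: r_def)
  define d where "d i x = \<bar>S (r (Suc i)) x - S (r i) x\<bar>" for i x
  have dm [measurable]: "d i \<in> borel_measurable LT" for i unfolding d_def by measurable
  have di: "integrable LT (d i)" and dI: "integral\<^sup>L LT (d i) \<le> ((2 * pi) ^ 3 + 1) * (1/2) ^ i" for i
  proof -
    have sq: "(\<integral>x. (d i x)\<^sup>2 \<partial>LT) \<le> (1/4) ^ i"
      using Sd[OF rs[of i]] L(2)[of "r (Suc i)"] N[of i] incseqD[OF e_inc rN[of i]] by (simp add: d_def)
    have i2: "integrable LT (\<lambda>x. (d i x)\<^sup>2)" using Sdi by (simp add: d_def)
    have le: "d i x \<le> ((1/2) ^ i + 2 ^ i * (d i x)\<^sup>2) / 2" for x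
      using abs_le_sq_param[of "(1/2) ^ i" "d i x"] by (simp add: power_divide d_def mult_ac)
    show di: "integrable LT (d i)"
      by (rule Bochner_Integration.integrable_bound[of _ "\<lambda>x. ((1/2) ^ i + 2 ^ i * (d i x)\<^sup>2) / 2"])
        (use i2 le in \<open>auto simp: d_def\<close>)
    have "integral\<^sup>L LT (d i) \<le> (\<integral>x. ((1/2) ^ i + 2 ^ i * (d i x)\<^sup>2) / 2 \<partial>LT)"
      by (rule integral_mono) (use i2 di le in auto)
    also have "\<dots> = ((1/2) ^ i * (2 * pi) ^ 3 + 2 ^ i * (\<integral>x. (d i x)\<^sup>2 \<partial>LT)) / 2"
      using i2 by (simp add: measure_LT[simplified])
    also have "\<dots> \<le> ((1/2) ^ i * (2 * pi) ^ 3 + 2 ^ i * (1/4) ^ i) / 2"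
      using sq by (intro divide_right_mono add_left_mono mult_left_mono) auto
    also have "2 ^ i * (1/4) ^ i = ((1/2)::real) ^ i"
      by (simp flip: power_mult_distrib)
    also have "((1/2) ^ i * (2 * pi) ^ 3 + (1/2) ^ i) / 2 \<le> ((2 * pi) ^ 3 + 1) * (1/2) ^ i"
      by (simp add: algebra_simps)
    finally show "integral\<^sup>L LT (d i) \<le> ((2 * pi) ^ 3 + 1) * (1/2) ^ i" .
  qed
  have "AE x in LT. summable (\<lambda>i. d i x)"
  proof -
    have "(\<integral>\<^sup>+x. (\<Sum>i. ennreal (d i x)) \<partial>LT) = (\<Sum>i. \<integral>\<^sup>+x. ennreal (d i x) \<partial>LT)"
      by (rule nn_integral_suminf) simp
    also have "\<dots> \<le> (\<Sum>i. ennreal (((2 * pi) ^ 3 + 1) * (1/2) ^ i))"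
    proof (intro suminf_le)
      fix i
      have "(\<integral>\<^sup>+x. ennreal (d i x) \<partial>LT) = ennreal (integral\<^sup>L LT (d i))"
        by (rule nn_integral_eq_integral[OF di]) (simp add: d_def)
      then show "(\<integral>\<^sup>+x. ennreal (d i x) \<partial>LT) \<le> ennreal (((2 * pi) ^ 3 + 1) * (1/2) ^ i)"
        using ennreal_leI[OF dI[of i]] by simp
    qed auto
    also have "\<dots> < \<infinity>"
      by (subst suminf_ennreal_eq[OF _ sums_mult[OF geometric_sums]]) auto
    finally have "AE x in LT. (\<Sum>i. ennreal (d i x)) \<noteq> \<infinity>"
      by (intro nn_integral_PInf_AE) auto
    then show ?thesis
      by (rule eventually_mono) (rule summable_suminf_not_top, auto simp: d_def)
  qed
  then have conv: "AE x in LT. convergent (\<lambda>i. S (r i) x)"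
  proof (rule eventually_mono)
    fix x assume "summable (\<lambda>i. d i x)"
    then have "summable (\<lambda>i. S (r (Suc i)) x - S (r i) x)"
      unfolding d_def by (rule summable_rabs_cancel)
    then have "convergent (\<lambda>i. S (r i) x - S (r 0) x)"
      by (simp add: summable_iff_convergent sum_lessThan_telescope[of "\<lambda>i. S (r i) x"])
    then show "convergent (\<lambda>i. S (r i) x)"
      by (simp add: convergent_diff_const_right_iff)
  qed
  define f where "f x = lim (\<lambda>i. S (r i) x)" for x
  have fm [measurable]: "f \<in> borel_measurable LT"
    unfolding f_def by measurable
  have lim: "AE x in LT. (\<lambda>i. S (r i) x) \<longlonglongrightarrow> f x"
    using conv by (auto simp: f_def convergent_LIMSEQ_iff)
  \<comment> \<open>Fatou along the subsequence: the distance of S m from the limit is at most the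
    remaining part L - e m of the energy.\<close>
  have F: "(\<integral>\<^sup>+x. ennreal ((f x - S m x)\<^sup>2) \<partial>LT) \<le> ennreal (L - e m)" for m
  proof -
    have "(\<integral>\<^sup>+x. ennreal ((f x - S m x)\<^sup>2) \<partial>LT) = (\<integral>\<^sup>+x. liminf (\<lambda>i. ennreal ((S (r i) x - S m x)\<^sup>2)) \<partial>LT)"
    proof (rule nn_integral_cong_AE, use lim in eventually_elim)
      fix x assume "(\<lambda>i. S (r i) x) \<longlonglongrightarrow> f x"
      then have "(\<lambda>i. ennreal ((S (r i) x - S m x)\<^sup>2)) \<longlonglongrightarrow> ennreal ((f x - S m x)\<^sup>2)"
        by (intro tendsto_intros)
      then show "ennreal ((f x - S m x)\<^sup>2) = liminf (\<lambda>i. ennreal ((S (r i) x - S m x)\<^sup>2))"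
        by (intro lim_imp_Liminf[symmetric]) auto
    qed
    also have "\<dots> \<le> liminf (\<lambda>i. \<integral>\<^sup>+x. ennreal ((S (r i) x - S m x)\<^sup>2) \<partial>LT)"
      by (rule nn_integral_liminf) measurable
    also have "\<dots> \<le> liminf (\<lambda>i. ennreal (L - e m))"
    proof (rule Liminf_mono, rule eventually_sequentiallyI[of m])
      fix i assume "m \<le> i"
      then have "m \<le> r i" using ri[of i] by simp
      then show "(\<integral>\<^sup>+x. ennreal ((S (r i) x - S m x)\<^sup>2) \<partial>LT) \<le> ennreal (L - e m)"
        using L(2)[of "r i"] by (subst nn_integral_eq_integral[OF Sdi]) (auto simp: Sd intro!: ennreal_leI)
    qed
    also have "\<dots> = ennreal (L - e m)" by (simp add: Liminf_const)
    finally show ?thesis .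
  qed
  have fSi: "integrable LT (\<lambda>x. (f x - S m x)\<^sup>2)" for m
  proof (rule integrableI_bounded)
    have "(\<integral>\<^sup>+x. ennreal (norm ((f x - S m x)\<^sup>2)) \<partial>LT) = (\<integral>\<^sup>+x. ennreal ((f x - S m x)\<^sup>2) \<partial>LT)" by simp
    also have "\<dots> \<le> ennreal (L - e m)" by (rule F)
    also have "\<dots> < \<infinity>" by simp
    finally show "(\<integral>\<^sup>+x. ennreal (norm ((f x - S m x)\<^sup>2)) \<partial>LT) < \<infinity>" .
  qed measurable
  have fSle: "(\<integral>x. (f x - S m x)\<^sup>2 \<partial>LT) \<le> L - e m" for m
    using F[of m] L(2)[of m] by (subst (asm) nn_integral_eq_integral[OF fSi]) auto
  have fS0: "(\<lambda>n. \<integral>x. (f x - S n x)\<^sup>2 \<partial>LT) \<longlonglongrightarrow> 0"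
  proof (rule tendsto_sandwich[of "\<lambda>_. 0" _ _ "\<lambda>n. L - e n"])
    show "(\<lambda>n. L - e n) \<longlonglongrightarrow> 0" using tendsto_diff[OF tendsto_const L(1), of L] by simp
  qed (use fSle in auto)
  have f2: "integrable LT (\<lambda>x. (f x)\<^sup>2)"
  proof (rule Bochner_Integration.integrable_bound)
    have "integrable LT (\<lambda>x. (S 0 x)\<^sup>2)"
      unfolding S_def by (intro integrable_LT_continuous continuous_intros continuous_on_trig_fun)
    then show "integrable LT (\<lambda>x. 2 * (f x - S 0 x)\<^sup>2 + 2 * (S 0 x)\<^sup>2)"
      using fSi by auto
    have "a\<^sup>2 \<le> 2 * (a - b)\<^sup>2 + 2 * b\<^sup>2" for a b :: real
      using zero_le_power2[of "a - 2 * b"] by (simp add: power2_eq_square algebra_simps)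
    then show "AE x in LT. norm ((f x)\<^sup>2) \<le> norm (2 * (f x - S 0 x)\<^sup>2 + 2 * (S 0 x)\<^sup>2)"
      by auto
  qed measurable
  have "fcoef f k = c k" for k
  proof -
    obtain m where m: "k \<in> fbox m" using ex_fbox by auto
    have fi: "integrable LT f" "integrable LT (S n)" for n
      using integrable_LT_sq_imp[OF fm f2] integrable_LT_cperiodic[OF cperiodic_trig] by (auto simp: S_def)
    have "(2 * pi) ^ 3 * (cmod (fcoef f k - c k))\<^sup>2 \<le> (\<integral>x. (f x - S n x)\<^sup>2 \<partial>LT)" if "n \<ge> m" for n
    proof -
      have "fcoef (\<lambda>x. f x - S n x) k = fcoef f k - c k"
        using fbox_mono[OF that] m unfolding fcoef_diff[OF fi] by (auto simp: S_def fcoef_trig c)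
      moreover have "(\<lambda>x. f x - S n x) \<in> borel_measurable LT" by measurable
      ultimately show ?thesis
        using Bessel[of "\<lambda>x. f x - S n x" "{k}"] fSi[of n] by simp
    qed
    then have "(2 * pi) ^ 3 * (cmod (fcoef f k - c k))\<^sup>2 \<le> 0"
      by (intro LIMSEQ_le_const[OF fS0]) auto
    then show ?thesis using pi_gt_zero by (auto simp: mult_le_0_iff)
  qed
  then show thesis
    by (rule that[OF fm f2 _ fS0[unfolded S_def]])
qed

lemma tendsto_sum_fbox:
  fixes h :: "wvec \<Rightarrow> complex"
  assumes "(\<lambda>k. norm (h k)) summable_on UNIV"
  shows "(\<lambda>n. \<Sum>k\<in>fbox n. h k) \<longlonglongrightarrow> (\<Sum>\<^sub>\<infinity>k. h k)"
proof -
  have "(h has_sum (\<Sum>\<^sub>\<infinity>k. h k)) UNIV"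
    using assms by (simp add: abs_summable_summable)
  then have "(sum h \<longlongrightarrow> (\<Sum>\<^sub>\<infinity>k. h k)) (finite_subsets_at_top UNIV)"
    by (simp add: has_sum_def)
  moreover have "filterlim fbox (finite_subsets_at_top UNIV) sequentially"
    unfolding filterlim_finite_subsets_at_top
  proof (intro allI impI)
    fix X :: "wvec set" assume X: "finite X \<and> X \<subseteq> UNIV"
    obtain m where m: "\<And>k. k \<in> fbox (m k)" using ex_fbox by metis
    have "X \<subseteq> fbox n" if "n \<ge> Max (insert 0 (m ` X))" for n
      using m X that fbox_mono[of "m _" n] by (fastforce simp: Max_ge_iff)
    then show "\<forall>\<^sub>F n in sequentially. finite (fbox n) \<and> X \<subseteq> fbox n \<and> fbox n \<subseteq> UNIV"
      by (auto simp: eventually_sequentially)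
  qed
  ultimately show ?thesis
    using filterlim_compose by blast
qed

lemma abs_summable_mult_l2:
  fixes a b :: "'i \<Rightarrow> complex"
  assumes "\<And>F. finite F \<Longrightarrow> (\<Sum>k\<in>F. (cmod (a k))\<^sup>2) \<le> A" "\<And>F. finite F \<Longrightarrow> (\<Sum>k\<in>F. (cmod (b k))\<^sup>2) \<le> B"
  shows "(\<lambda>k. norm (a k * cnj (b k))) summable_on UNIV"
proof (rule nonneg_bdd_above_summable_on)
  show "bdd_above (sum (\<lambda>k. norm (a k * cnj (b k))) ` {F. F \<subseteq> UNIV \<and> finite F})"
  proof (rule bdd_aboveI2)
    fix F :: "'i set" assume "F \<in> {F. F \<subseteq> UNIV \<and> finite F}"
    then have F: "finite F" by simp
    have "(\<Sum>k\<in>F. norm (a k * cnj (b k))) \<le> (\<Sum>k\<in>F. ((cmod (a k))\<^sup>2 + (cmod (b k))\<^sup>2) / 2)"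
      using abs_mult_le_param[of 1 "cmod (a k)" "cmod (b k)" for k] by (intro sum_mono) (simp add: norm_mult)
    also have "\<dots> \<le> (A + B) / 2"
      using assms(1)[OF F] assms(2)[OF F] by (simp add: sum.distrib sum_divide_distrib[symmetric])
    finally show "(\<Sum>k\<in>F. norm (a k * cnj (b k))) \<le> (A + B) / 2" .
  qed
qed simp

lemma integrable_mult_square:
  fixes f g :: "'a \<Rightarrow> real"
  assumes [measurable]: "f \<in> borel_measurable M" "g \<in> borel_measurable M"
    and "integrable M (\<lambda>x. (f x)\<^sup>2)" "integrable M (\<lambda>x. (g x)\<^sup>2)"
  shows "integrable M (\<lambda>x. f x * g x)"
proof (rule Bochner_Integration.integrable_bound)
  show "integrable M (\<lambda>x. ((f x)\<^sup>2 + (g x)\<^sup>2) / 2)" using assms by simp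
  show "AE x in M. norm (f x * g x) \<le> norm (((f x)\<^sup>2 + (g x)\<^sup>2) / 2)"
    using abs_mult_le_param[of 1] by (intro AE_I2) simp
qed measurable

lemma fcoef_square_bound:
  fixes g :: "real ^ 3 \<Rightarrow> real"
  assumes "g \<in> borel_measurable LT" "integrable LT (\<lambda>x. (g x)\<^sup>2)" "finite F"
  shows "(\<Sum>k\<in>F. (cmod (fcoef g k))\<^sup>2) \<le> (\<integral>x. (g x)\<^sup>2 \<partial>LT) / (2 * pi) ^ 3"
  using Bessel[OF assms] by (simp add: field_simps)

lemma tendsto_integral_mult_L2:
  fixes f g :: "real ^ 3 \<Rightarrow> real"
  assumes [measurable]: "f \<in> borel_measurable LT" "g \<in> borel_measurable LT" "\<And>n. S n \<in> borel_measurable LT"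
    and f: "integrable LT (\<lambda>x. (f x)\<^sup>2)" and g: "integrable LT (\<lambda>x. (g x)\<^sup>2)"
    and S: "\<And>n. integrable LT (\<lambda>x. (S n x)\<^sup>2)"
    and fS: "\<And>n. integrable LT (\<lambda>x. (f x - S n x)\<^sup>2)"
    and lim: "(\<lambda>n. \<integral>x. (f x - S n x)\<^sup>2 \<partial>LT) \<longlonglongrightarrow> 0"
  shows "(\<lambda>n. \<integral>x. S n x * g x \<partial>LT) \<longlonglongrightarrow> (\<integral>x. f x * g x \<partial>LT)"
proof (rule LIMSEQ_I)
  fix r :: real assume r: "0 < r"
  define G where "G = (\<integral>x. (g x)\<^sup>2 \<partial>LT)"
  have G: "0 \<le> G" by (simp add: G_def)
  define e where "e = r / (G + 1)"
  have e: "0 < e" using r G by (simp add: e_def)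
  have "eventually (\<lambda>n. (\<integral>x. (f x - S n x)\<^sup>2 \<partial>LT) < r * e) sequentially"
    by (rule order_tendstoD[OF lim]) (use r e in simp)
  then obtain N where N: "\<And>n. n \<ge> N \<Longrightarrow> (\<integral>x. (f x - S n x)\<^sup>2 \<partial>LT) < r * e"
    by (auto simp: eventually_sequentially)
  have "norm ((\<integral>x. S n x * g x \<partial>LT) - (\<integral>x. f x * g x \<partial>LT)) < r" if "n \<ge> N" for n
  proof -
    have i: "integrable LT (\<lambda>x. (f x - S n x) * g x)"
      by (rule integrable_mult_square) (use fS g in auto)
    have "(\<integral>x. f x * g x \<partial>LT) - (\<integral>x. S n x * g x \<partial>LT) = (\<integral>x. (f x - S n x) * g x \<partial>LT)"
      using integrable_mult_square[OF _ _ f g] integrable_mult_square[OF _ _ S[of n] g]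
      by (simp add: left_diff_distrib)
    also have "norm \<dots> \<le> (\<integral>x. \<bar>(f x - S n x) * g x\<bar> \<partial>LT)"
      using integral_norm_bound[of LT "\<lambda>x. (f x - S n x) * g x"] by simp
    also have "\<dots> \<le> (\<integral>x. ((f x - S n x)\<^sup>2 / e + e * (g x)\<^sup>2) / 2 \<partial>LT)"
      by (intro integral_mono abs_mult_le_param e) (use i fS[of n] g in auto)
    also have "\<dots> = ((\<integral>x. (f x - S n x)\<^sup>2 \<partial>LT) / e + e * G) / 2"
      using fS[of n] g by (simp add: G_def)
    also have "\<dots> < (r * e / e + e * (G + 1)) / 2"
      using N[OF that] e G by (intro divide_strict_right_mono add_less_le_mono divide_strict_right_mono mult_left_mono) auto
    also have "\<dots> = r" using e G by (simp add: e_def)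
    finally show ?thesis by (simp add: norm_minus_commute)
  qed
  then show "\<exists>N. \<forall>n\<ge>N. norm ((\<integral>x. S n x * g x \<partial>LT) - (\<integral>x. f x * g x \<partial>LT)) < r" by blast
qed

text \<open>Parseval's identity. It connects the pairing of coefficient sequences, for which weak
  continuity is proved, with integrals of functions, in which \<open>Cw_Lq\<close> is
  expressed.\<close>

lemma integral_mult_eq_pair_s:
  fixes f g :: "real ^ 3 \<Rightarrow> real"
  assumes c: "\<And>k. c (- k) = cnj (c k)" and cA: "\<And>F. finite F \<Longrightarrow> (\<Sum>k\<in>F. (cmod (c k))\<^sup>2) \<le> A"
    and [measurable]: "f \<in> borel_measurable LT" "g \<in> borel_measurable LT"
    and f: "integrable LT (\<lambda>x. (f x)\<^sup>2)" and g: "integrable LT (\<lambda>x. (g x)\<^sup>2)"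
    and lim: "(\<lambda>n. \<integral>x. (f x - trig (fbox n) c x)\<^sup>2 \<partial>LT) \<longlonglongrightarrow> 0"
  shows "(\<integral>x. f x * g x \<partial>LT) = pair_s c (fcoef g)"
proof -
  have tm [measurable]: "trig (fbox n) c \<in> borel_measurable LT" for n
    by (intro borel_measurable_cperiodic cperiodic_trig)
  have ti: "integrable LT (\<lambda>x. (trig (fbox n) c x)\<^sup>2)" for n
    by (intro integrable_LT_continuous continuous_intros continuous_on_trig_fun)
  have fti: "integrable LT (\<lambda>x. (f x - trig (fbox n) c x)\<^sup>2)" for n
    using f ti[of n] integrable_mult_square[OF _ _ f ti[of n]] by (simp add: power2_diff mult.assoc)
  have gi: "integrable LT g" by (rule integrable_LT_sq_imp) (use g in auto)
  have "(\<lambda>n. \<integral>x. trig (fbox n) c x * g x \<partial>LT) \<longlonglongrightarrow> (\<integral>x. f x * g x \<partial>LT)"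
    by (rule tendsto_integral_mult_L2) (use f g ti fti lim in auto)
  moreover have "(\<integral>x. trig (fbox n) c x * g x \<partial>LT) = (2 * pi) ^ 3 * Re (\<Sum>k\<in>fbox n. c k * cnj (fcoef g k))" for n
  proof -
    have gc: "integrable LT (\<lambda>x. complex_of_real (g x) * cis (phase k x))" for k
      by (rule integrable_LT_mult_cis[OF gi])
    have W: "integrable LT (\<lambda>x. Re (c k * (complex_of_real (g x) * cis (phase k x))))" for k
      by (intro integrable_Re integrable_mult_right gc)
    have "trig (fbox n) c x * g x = (\<Sum>k\<in>fbox n. Re (c k * (complex_of_real (g x) * cis (phase k x))))" for x
      unfolding trig_def sum_distrib_right by (intro sum.cong) (simp_all add: algebra_simps)
    then have "(\<integral>x. trig (fbox n) c x * g x \<partial>LT) = (\<Sum>k\<in>fbox n. \<integral>x. Re (c k * (complex_of_real (g x) * cis (phase k x))) \<partial>LT)"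
      by (simp add: Bochner_Integration.integral_sum[OF W] del: times_complex.sel)
    also have "\<dots> = (\<Sum>k\<in>fbox n. Re (c k * (\<integral>x. complex_of_real (g x) * cis (phase k x) \<partial>LT)))"
      by (subst integral_Re[OF integrable_mult_right[OF gc]]) (simp del: times_complex.sel)
    also have "\<dots> = (\<Sum>k\<in>fbox n. Re (c k * ((2 * pi) ^ 3 * cnj (fcoef g k))))"
      unfolding fcoef_uminus[symmetric] by (simp add: fcoef_eq phase_minus del: times_complex.sel)
    also have "\<dots> = (2 * pi) ^ 3 * Re (\<Sum>k\<in>fbox n. c k * cnj (fcoef g k))"
    proof -
      have "Re (a * (complex_of_real r * b)) = r * Re (a * b)" for a b r by (simp add: algebra_simps)
      from this[of _ "(2 * pi) ^ 3"] show ?thesis by (simp add: sum_distrib_left del: times_complex.sel)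
    qed
    finally show ?thesis .
  qed
  moreover have "(\<lambda>n. (2 * pi) ^ 3 * Re (\<Sum>k\<in>fbox n. c k * cnj (fcoef g k))) \<longlonglongrightarrow> pair_s c (fcoef g)"
    unfolding pair_s_def
    by (intro tendsto_intros tendsto_sum_fbox abs_summable_mult_l2[OF cA fcoef_square_bound]) (use g in auto)
  ultimately show ?thesis
    using LIMSEQ_unique by simp
qed

lemma fejer_eq_weighted_sum:
  assumes "\<And>k. k \<notin> fbox m \<Longrightarrow> fcoef g k = 0"
  shows "fejer n g x = (\<Sum>k\<in>fbox m. fejer_weight n k * Re (fcoef g k * cis (phase k x)))"
proof -
  let ?B = "fbox n \<times> fbox n" and ?h = "\<lambda>k. Re (fcoef g k * cis (phase k x))"
  have "(\<Sum>p\<in>?B. ?h (fst p - snd p)) = (\<Sum>p\<in>?B. \<Sum>k\<in>fbox m. if fst p - snd p = k then ?h k else 0)"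
    by (intro sum.cong refl) (auto simp: assms)
  also have "\<dots> = (\<Sum>k\<in>fbox m. \<Sum>p\<in>?B. if fst p - snd p = k then ?h k else 0)"
    by (rule sum.swap)
  also have "\<dots> = (\<Sum>k\<in>fbox m. card {p \<in> ?B. fst p - snd p = k} * ?h k)"
    by (intro sum.cong refl) (subst sum.inter_filter[symmetric], auto)
  finally show ?thesis
    by (simp add: fejer_def case_prod_beta fejer_weight_def sum_divide_distrib)
qed

lemma convex_on_abs_real: "convex_on UNIV (\<lambda>x::real. \<bar>x\<bar>)"
  by (auto intro!: convex_onI order_trans[OF abs_triangle_ineq] simp: abs_mult)

text \<open>f is split into a partial sum and an L_1-small rest. Fejer means contract L_1 (the
  convex bound for the absolute value), which controls the rest, and on the partial sum only
  finitely many weights have to approach 1.\<close>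

lemma fejer_tendsto_L1:
  fixes f :: "real ^ 3 \<Rightarrow> real"
  assumes c: "\<And>k. c (- k) = cnj (c k)"
    and fm [measurable]: "f \<in> borel_measurable LT"
    and f: "integrable LT (\<lambda>x. (f x)\<^sup>2)"
    and lim: "(\<lambda>n. \<integral>x. (f x - trig (fbox n) c x)\<^sup>2 \<partial>LT) \<longlonglongrightarrow> 0"
  shows "(\<lambda>n. \<integral>x. \<bar>fejer n f x - f x\<bar> \<partial>LT) \<longlonglongrightarrow> 0"
proof (rule LIMSEQ_I)
  interpret finite_measure LT by (rule finite_measure_LT)
  fix r :: real assume r: "0 < r"
  define V where "V = ((2 * pi) ^ 3 :: real)"
  have V: "0 < V" by (simp add: V_def)
  \<comment> \<open>Chosen so that e V = r/4, which balances the two halves of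
    \<open>abs_le_sq_param\<close> when the L_1 norm of the rest is bounded by r/4.\<close>
  define e where "e = r / (4 * V)"
  have e: "0 < e" using r V by (simp add: e_def)
  let ?S = "\<lambda>n. trig (fbox n) c"
  have tm [measurable]: "?S n \<in> borel_measurable LT" for n
    by (intro borel_measurable_cperiodic cperiodic_trig)
  have ti: "integrable LT (\<lambda>x. (?S n x)\<^sup>2)" for n
    by (intro integrable_LT_continuous continuous_intros continuous_on_trig_fun)
  have fti: "integrable LT (\<lambda>x. (f x - ?S n x)\<^sup>2)" for n
    using f ti[of n] integrable_mult_square[OF _ _ f ti[of n]] by (simp add: power2_diff mult.assoc)
  have fi: "integrable LT f" by (rule integrable_LT_sq_imp[OF fm f])
  have Si: "integrable LT (?S n)" for n by (rule integrable_LT_cperiodic[OF cperiodic_trig])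
  have "eventually (\<lambda>n. (\<integral>x. (f x - ?S n x)\<^sup>2 \<partial>LT) < e * (r / 4)) sequentially"
    by (rule order_tendstoD[OF lim]) (use r e in simp)
  then obtain m where m: "(\<integral>x. (f x - ?S m x)\<^sup>2 \<partial>LT) < e * (r / 4)"
    by (auto simp: eventually_sequentially)
  let ?g = "\<lambda>x. f x - ?S m x"
  have gi: "integrable LT ?g" using fi Si by simp
  have L1: "(\<integral>x. \<bar>?g x\<bar> \<partial>LT) < r / 4"
  proof -
    have "(\<integral>x. \<bar>?g x\<bar> \<partial>LT) \<le> (\<integral>x. (e + (?g x)\<^sup>2 / e) / 2 \<partial>LT)"
      by (intro integral_mono abs_le_sq_param e) (use gi fti[of m] in auto)
    also have "\<dots> = (e * V + (\<integral>x. (?g x)\<^sup>2 \<partial>LT) / e) / 2"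
      using fti[of m] measure_LT by (simp add: V_def)
    also have "\<dots> < (e * V + (e * (r / 4)) / e) / 2"
      using m e by (intro divide_strict_right_mono add_strict_left_mono) auto
    also have "\<dots> = r / 4" using e V by (simp add: e_def)
    finally show ?thesis .
  qed
  have L1': "(\<integral>x. \<bar>fejer n ?g x\<bar> \<partial>LT) < r / 4" for n
    using integral_convex_fejer_le[OF convex_on_abs_real gi, of n] gi L1 by auto
  define a where "a n = (\<Sum>k\<in>fbox m. (1 - fejer_weight n k) * cmod (c k))" for n
  have "a \<longlonglongrightarrow> (\<Sum>k\<in>fbox m. (1 - 1) * cmod (c k))"
    unfolding a_def by (intro tendsto_intros fejer_weight_tendsto)
  then have "eventually (\<lambda>n. a n < r / (4 * V)) sequentially"
    by (intro order_tendstoD) (use r V in auto)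
  then obtain N where N: "\<And>n. n \<ge> N \<Longrightarrow> a n < r / (4 * V)"
    by (auto simp: eventually_sequentially)
  have "norm ((\<integral>x. \<bar>fejer n f x - f x\<bar> \<partial>LT) - 0) < r" if n: "n \<ge> N" for n
  proof -
    have fS: "fcoef (?S m) k = (if k \<in> fbox m then c k else 0)" for k
      by (rule fcoef_trig) (auto simp: c)
    have S: "\<bar>fejer n (?S m) x - ?S m x\<bar> \<le> a n" for x
    proof -
      have "fejer n (?S m) x - ?S m x = (\<Sum>k\<in>fbox m. (fejer_weight n k - 1) * Re (c k * cis (phase k x)))"
        by (subst fejer_eq_weighted_sum[of m])
          (auto simp: fS trig_def sum_subtractf[symmetric] left_diff_distrib intro!: sum.cong simp del: times_complex.sel)
      also have "\<bar>\<dots>\<bar> \<le> (\<Sum>k\<in>fbox m. \<bar>(fejer_weight n k - 1) * Re (c k * cis (phase k x))\<bar>)"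
        by (rule sum_abs)
      also have "\<dots> \<le> a n"
        unfolding a_def
      proof (intro sum_mono)
        fix k
        have "\<bar>Re (c k * cis (phase k x))\<bar> \<le> cmod (c k)"
          using abs_Re_le_cmod[of "c k * cis (phase k x)"] by (simp add: norm_mult del: times_complex.sel)
        then show "\<bar>(fejer_weight n k - 1) * Re (c k * cis (phase k x))\<bar> \<le> (1 - fejer_weight n k) * cmod (c k)"
          using fejer_weight_le_1[of n k] unfolding abs_mult by (intro mult_mono) auto
      qed
      finally show ?thesis .
    qed
    have ci: "integrable LT (\<lambda>x. \<bar>fejer n h x\<bar>)" for h
      by (intro integrable_abs integrable_LT_cperiodic cperiodic_fejer)
    have "fejer n f x - f x = fejer n ?g x + (fejer n (?S m) x - ?S m x) - ?g x" for x
      by (simp add: fejer_diff[OF fi Si])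
    then have "\<bar>fejer n f x - f x\<bar> \<le> \<bar>fejer n ?g x\<bar> + a n + \<bar>?g x\<bar>" for x
      using S[of x] by (smt (verit))
    then have "(\<integral>x. \<bar>fejer n f x - f x\<bar> \<partial>LT) \<le> (\<integral>x. \<bar>fejer n ?g x\<bar> + a n + \<bar>?g x\<bar> \<partial>LT)"
      using integrable_LT_cperiodic[OF cperiodic_fejer, of n f] fi gi ci[of ?g]
      by (intro integral_mono) auto
    also have "\<dots> = (\<integral>x. \<bar>fejer n ?g x\<bar> \<partial>LT) + a n * V + (\<integral>x. \<bar>?g x\<bar> \<partial>LT)"
      using gi ci[of ?g] measure_LT by (simp add: V_def)
    also have "\<dots> < r / 4 + r / (4 * V) * V + r / 4"
      using L1 L1'[of n] N[OF n] V by (intro add_strict_mono mult_strict_right_mono) auto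
    also have "\<dots> \<le> r" using r V by simp
    finally show ?thesis by simp
  qed
  then show "\<exists>N. \<forall>n\<ge>N. norm ((\<integral>x. \<bar>fejer n f x - f x\<bar> \<partial>LT) - 0) < r" by blast
qed

lemma nn_integral_le_liminf_tendsto:
  fixes u :: "nat \<Rightarrow> 'a \<Rightarrow> real"
  assumes [measurable]: "\<And>n. u n \<in> borel_measurable M"
    and lim: "AE x in M. (\<lambda>n. u n x) \<longlonglongrightarrow> v x"
    and bd: "\<And>n. (\<integral>\<^sup>+x. ennreal (u n x) \<partial>M) \<le> C"
  shows "(\<integral>\<^sup>+x. ennreal (v x) \<partial>M) \<le> C"
proof -
  have "(\<integral>\<^sup>+x. ennreal (v x) \<partial>M) = (\<integral>\<^sup>+x. liminf (\<lambda>n. ennreal (u n x)) \<partial>M)"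
  proof (rule nn_integral_cong_AE, use lim in eventually_elim)
    fix x assume "(\<lambda>n. u n x) \<longlonglongrightarrow> v x"
    then show "ennreal (v x) = liminf (\<lambda>n. ennreal (u n x))"
      by (intro lim_imp_Liminf[symmetric] tendsto_ennrealI) auto
  qed
  also have "\<dots> \<le> liminf (\<lambda>n. \<integral>\<^sup>+x. ennreal (u n x) \<partial>M)"
    by (rule nn_integral_liminf) measurable
  also have "\<dots> \<le> C"
    using Liminf_mono[of "\<lambda>n. \<integral>\<^sup>+x. ennreal (u n x) \<partial>M" "\<lambda>_. C" sequentially] bd
    by (simp add: Liminf_const)
  finally show ?thesis .
qed

text \<open>Lower semicontinuity of a convex integral functional under convergence of all Fourier
  coefficients: Fejer means turn this into pointwise convergence, and Jensen's inequality
  controls them.\<close>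

lemma nn_integral_convex_weak_limit:
  fixes f :: "real ^ 3 \<Rightarrow> real" and g :: "nat \<Rightarrow> real ^ 3 \<Rightarrow> real"
  assumes \<phi>: "convex_on UNIV \<phi>" "\<And>x. 0 \<le> \<phi> x"
    and c: "\<And>k. c (- k) = cnj (c k)"
    and fm [measurable]: "f \<in> borel_measurable LT"
    and f: "integrable LT (\<lambda>x. (f x)\<^sup>2)" "\<And>k. fcoef f k = c k"
    and lim: "(\<lambda>n. \<integral>x. (f x - trig (fbox n) c x)\<^sup>2 \<partial>LT) \<longlonglongrightarrow> 0"
    and g: "\<And>N. integrable LT (g N)" "\<And>N. integrable LT (\<lambda>x. \<phi> (g N x))"
    and glim: "\<And>k. (\<lambda>N. fcoef (g N) k) \<longlonglongrightarrow> c k"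
    and gbd: "\<And>N. (\<integral>x. \<phi> (g N x) \<partial>LT) \<le> C"
  shows "(\<integral>\<^sup>+x. ennreal (\<phi> (f x)) \<partial>LT) \<le> ennreal C"
proof -
  have cont: "continuous_on UNIV \<phi>" by (rule continuous_on_convex[OF \<phi>(1)])
  have fi: "integrable LT f" by (rule integrable_LT_sq_imp[OF fm f(1)])
  have phm: "(\<lambda>x. \<phi> (h x)) \<in> borel_measurable LT" if "h \<in> borel_measurable LT" for h
    using borel_measurable_continuous_onI[OF cont] that by (rule measurable_compose[rotated])
  have pfi: "integrable LT (\<lambda>x. \<phi> (fejer n h x))" for n h
    by (intro integrable_LT_cperiodic cperiodic_compose[OF cperiodic_fejer cont])
  have fejm: "fejer n h \<in> borel_measurable LT" for n h
    by (intro borel_measurable_cperiodic cperiodic_fejer)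
  have A: "(\<integral>\<^sup>+x. ennreal (\<phi> (fejer n f x)) \<partial>LT) \<le> ennreal C" for n
  proof (rule nn_integral_le_liminf_tendsto[of "\<lambda>N x. \<phi> (fejer n (g N) x)"])
    show "AE x in LT. (\<lambda>N. \<phi> (fejer n (g N) x)) \<longlonglongrightarrow> \<phi> (fejer n f x)"
    proof (rule AE_I2)
      fix x
      have "(\<lambda>N. fejer n (g N) x) \<longlonglongrightarrow> fejer n f x"
        unfolding fejer_def case_prod_beta f(2) by (intro tendsto_intros glim) (simp add: card_fbox)
      then show "(\<lambda>N. \<phi> (fejer n (g N) x)) \<longlonglongrightarrow> \<phi> (fejer n f x)"
        using cont by (auto intro: continuous_on_tendsto_compose)
    qed
    show "(\<integral>\<^sup>+x. ennreal (\<phi> (fejer n (g N) x)) \<partial>LT) \<le> ennreal C" for N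
      using order_trans[OF integral_convex_fejer_le[OF \<phi>(1) g(1) g(2), of n N] gbd[of N]] \<phi>(2)
      by (subst nn_integral_eq_integral[OF pfi]) (auto intro: ennreal_leI)
  qed (intro phm fejm)
  have "(\<lambda>n. \<integral>x. norm (fejer n f x - f x) \<partial>LT) \<longlonglongrightarrow> 0"
    using fejer_tendsto_L1[OF c fm f(1) lim] by simp
  moreover have "integrable LT (\<lambda>x. fejer n f x - f x)" for n
    using fi integrable_LT_cperiodic[OF cperiodic_fejer] by (rule Bochner_Integration.integrable_diff[rotated])
  ultimately obtain r where r: "strict_mono r" "AE x in LT. (\<lambda>n. fejer (r n) f x - f x) \<longlonglongrightarrow> 0"
    using tendsto_L1_AE_subseq[of LT "\<lambda>n x. fejer n f x - f x"] by blast
  show ?thesis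
  proof (rule nn_integral_le_liminf_tendsto[of "\<lambda>n x. \<phi> (fejer (r n) f x)"])
    show "AE x in LT. (\<lambda>n. \<phi> (fejer (r n) f x)) \<longlonglongrightarrow> \<phi> (f x)"
      using r(2)
    proof eventually_elim
      fix x assume "(\<lambda>n. fejer (r n) f x - f x) \<longlonglongrightarrow> 0"
      then have "(\<lambda>n. fejer (r n) f x) \<longlonglongrightarrow> f x" by (simp add: LIM_zero_iff)
      then show "(\<lambda>n. \<phi> (fejer (r n) f x)) \<longlonglongrightarrow> \<phi> (f x)"
        using cont by (auto intro: continuous_on_tendsto_compose)
    qed
  qed (intro phm fejm, rule A)
qed

section \<open>Convex functionals and weak continuity in L_q\<close>

lemma convex_on_abs_powr:
  assumes p: "1 \<le> p" shows "convex_on UNIV (\<lambda>x::real. \<bar>x\<bar> powr p)"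
proof (rule convex_onI)
  fix t x y :: real assume t: "0 < t" "t < 1"
  \<comment> \<open>Serves the case of a vanishing endpoint, where convexity reduces to u^p \<le> u
    for u between 0 and 1.\<close>
  have sc: "(u * a) powr p \<le> u * a powr p" if "0 < u" "u < 1" "0 \<le> a" for u a
  proof -
    have "u powr p \<le> u powr 1" using that p by (intro powr_mono') auto
    then show ?thesis using that by (simp add: powr_mult mult_right_mono)
  qed
  have "\<bar>(1 - t) * x + t * y\<bar> \<le> (1 - t) * \<bar>x\<bar> + t * \<bar>y\<bar>"
    using t by (intro order_trans[OF abs_triangle_ineq]) (simp add: abs_mult)
  then have "\<bar>(1 - t) * x + t * y\<bar> powr p \<le> ((1 - t) * \<bar>x\<bar> + t * \<bar>y\<bar>) powr p"
    using p by (intro powr_mono2) auto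
  also have "\<dots> \<le> (1 - t) * \<bar>x\<bar> powr p + t * \<bar>y\<bar> powr p"
  proof (cases "x = 0 \<or> y = 0")
    case True
    then show ?thesis using sc[of t "\<bar>y\<bar>"] sc[of "1 - t" "\<bar>x\<bar>"] t by auto
  next
    case False
    then show ?thesis
      using convex_onD[OF powr_convex[OF p], of t "\<bar>x\<bar>" "\<bar>y\<bar>"] t by simp
  qed
  finally show "\<bar>(1 - t) *\<^sub>R x + t *\<^sub>R y\<bar> powr p \<le> (1 - t) * \<bar>x\<bar> powr p + t * \<bar>y\<bar> powr p" by simp
qed simp

text \<open>This convex function encodes q = infinity: the integral of the excess of |f| over C
  vanishes exactly when |f| \<le> C almost everywhere.\<close>

lemma convex_on_excess: "convex_on UNIV (\<lambda>x::real. max 0 (\<bar>x\<bar> - C))"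
proof (rule convex_onI)
  fix t x y :: real assume t: "0 < t" "t < 1"
  have "\<bar>(1 - t) * x + t * y\<bar> \<le> (1 - t) * \<bar>x\<bar> + t * \<bar>y\<bar>"
    using t by (intro order_trans[OF abs_triangle_ineq]) (simp add: abs_mult)
  moreover have "(1 - t) * (\<bar>x\<bar> - C) \<le> (1 - t) * max 0 (\<bar>x\<bar> - C)" "t * (\<bar>y\<bar> - C) \<le> t * max 0 (\<bar>y\<bar> - C)"
    using t by (auto intro!: mult_left_mono)
  moreover have "0 \<le> (1 - t) * max 0 (\<bar>x\<bar> - C)" "0 \<le> t * max 0 (\<bar>y\<bar> - C)" using t by auto
  moreover have "(1 - t) * (\<bar>x\<bar> - C) + t * (\<bar>y\<bar> - C) = (1 - t) * \<bar>x\<bar> + t * \<bar>y\<bar> - C"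
    by (simp add: algebra_simps)
  ultimately show "max 0 (\<bar>(1 - t) *\<^sub>R x + t *\<^sub>R y\<bar> - C) \<le> (1 - t) * max 0 (\<bar>x\<bar> - C) + t * max 0 (\<bar>y\<bar> - C)"
    unfolding real_scaleR_def by (intro max.boundedI; linarith)
qed simp

lemma nn_integral_count_space_le:
  fixes f :: "'i::countable \<Rightarrow> ennreal"
  assumes "\<And>F. finite F \<Longrightarrow> sum f F \<le> A"
  shows "(\<integral>\<^sup>+i. f i \<partial>count_space UNIV) \<le> A"
  unfolding infsum_ennreal_eq_nn_integral[symmetric]
  by (subst nonneg_infsum_complete) (auto intro!: SUP_least assms)

text \<open>Erasing mode 0 turns an arbitrary L_2 test function into an admissible element of H^0.
  The pairing with a zero-mean field does not see the change.\<close>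

lemma in_H_0_fcoef:
  fixes g :: "real ^ 3 \<Rightarrow> real"
  assumes "g \<in> borel_measurable LT" "integrable LT (\<lambda>x. (g x)\<^sup>2)"
  shows "in_H 0 ((fcoef g)(0 := 0))"
proof -
  let ?c = "(fcoef g)(0 := 0)"
  have "real_s ?c"
    by (auto simp: real_s_def fcoef_uminus)
  moreover have "ssq 0 ?c \<le> ennreal ((\<integral>x. (g x)\<^sup>2 \<partial>LT) / (2 * pi) ^ 3)"
    unfolding ssq_eq
  proof (rule nn_integral_count_space_le)
    fix F :: "wvec set" assume F: "finite F"
    have "(\<Sum>k\<in>F. ennreal ((norm (?c k))\<^sup>2 * knorm k powr (2 * 0))) \<le> (\<Sum>k\<in>F. ennreal ((cmod (fcoef g k))\<^sup>2))"
      by (intro sum_mono ennreal_leI) auto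
    also have "\<dots> = ennreal (\<Sum>k\<in>F. (cmod (fcoef g k))\<^sup>2)" by simp
    also have "\<dots> \<le> ennreal ((\<integral>x. (g x)\<^sup>2 \<partial>LT) / (2 * pi) ^ 3)"
      by (intro ennreal_leI fcoef_square_bound assms F)
    finally show "(\<Sum>k\<in>F. ennreal ((norm (?c k))\<^sup>2 * knorm k powr (2 * 0))) \<le> ennreal ((\<integral>x. (g x)\<^sup>2 \<partial>LT) / (2 * pi) ^ 3)" .
  qed
  ultimately show ?thesis
    unfolding in_H_def by (auto simp: top_unique intro: le_less_trans)
qed

text \<open>Assumption \<open>Y\<close> is the common form of Young's inequality (finite q) and of a
  sup bound (q infinite, with H = 0). It makes the error from truncating g uniform in t, so the
  claim follows from bounded test functions by uniform convergence.\<close>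

lemma continuous_on_integral_mult_truncation:
  fixes Th :: "real \<Rightarrow> real ^ 3 \<Rightarrow> real" and g :: "real ^ 3 \<Rightarrow> real"
  assumes s: "1 \<le> s" and [measurable]: "g \<in> borel_measurable LT" and g: "integrable LT (\<lambda>x. \<bar>g x\<bar> powr s)"
    and Thm: "\<And>t. t \<in> I \<Longrightarrow> Th t \<in> borel_measurable LT"
    and Y: "\<And>e. 0 < e \<Longrightarrow> \<exists>K\<ge>0. \<forall>t\<in>I. \<exists>H. integrable LT H \<and> integral\<^sup>L LT H \<le> e \<and>
        (AE x in LT. \<forall>b. \<bar>Th t x * b\<bar> \<le> H x + K * \<bar>b\<bar> powr s)"
    and cont: "\<And>h. h \<in> borel_measurable LT \<Longrightarrow> integrable LT (\<lambda>x. (h x)\<^sup>2) \<Longrightarrow>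
        continuous_on I (\<lambda>t. \<integral>x. Th t x * h x \<partial>LT)"
  shows "continuous_on I (\<lambda>t. \<integral>x. Th t x * g x \<partial>LT)"
proof -
  interpret finite_measure LT by (rule finite_measure_LT)
  \<comment> \<open>Large values are set to 0 rather than clipped, so that both \<open>gn n\<close>
    and the remainder are dominated by |g|.\<close>
  define gn where "gn n x = (if \<bar>g x\<bar> \<le> real n then g x else 0)" for n x
  have gnm [measurable]: "gn n \<in> borel_measurable LT" for n unfolding gn_def by measurable
  have gnb: "\<bar>gn n x\<bar> \<le> real n" for n x by (simp add: gn_def)
  have gn2: "integrable LT (\<lambda>x. (gn n x)\<^sup>2)" for n
    by (rule integrable_const_bound[of _ "(real n)\<^sup>2"])
      (use gnb[of n] in \<open>auto simp: abs_le_square_iff[symmetric]\<close>)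
  have dle: "\<bar>g x - gn n x\<bar> powr s \<le> \<bar>g x\<bar> powr s" for n x by (simp add: gn_def)
  have gle: "\<bar>gn n x\<bar> powr s \<le> \<bar>g x\<bar> powr s" for n x by (simp add: gn_def)
  have di: "integrable LT (\<lambda>x. \<bar>g x - gn n x\<bar> powr s)" for n
    by (rule Bochner_Integration.integrable_bound[OF g]) (use dle in auto)
  have gni: "integrable LT (\<lambda>x. \<bar>gn n x\<bar> powr s)" for n
    by (rule Bochner_Integration.integrable_bound[OF g]) (use gle in auto)
  define Q where "Q e K t \<longleftrightarrow> (\<exists>H. integrable LT H \<and> integral\<^sup>L LT H \<le> e \<and>
        (AE x in LT. \<forall>b. \<bar>Th t x * b\<bar> \<le> H x + K * \<bar>b\<bar> powr s))" for e K t
  have YQ: "\<exists>K\<ge>0. \<forall>t\<in>I. Q e K t" if "0 < e" for e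
    unfolding Q_def by (rule Y[OF that])
  have lim: "(\<lambda>n. \<integral>x. \<bar>g x - gn n x\<bar> powr s \<partial>LT) \<longlonglongrightarrow> (\<integral>x. 0 \<partial>LT)"
  proof (rule integral_dominated_convergence[OF _ _ g])
    show "AE x in LT. (\<lambda>n. \<bar>g x - gn n x\<bar> powr s) \<longlonglongrightarrow> 0"
    proof (rule AE_I2, rule tendsto_eventually)
      fix x
      obtain N where "\<bar>g x\<bar> \<le> real N" using real_arch_simple by blast
      then show "\<forall>\<^sub>F n in sequentially. \<bar>g x - gn n x\<bar> powr s = 0"
        by (intro eventually_sequentiallyI[of N]) (simp add: gn_def)
    qed
  qed (use dle in auto)
  have Ti: "integrable LT (\<lambda>x. Th t x * h x)"
    if t: "t \<in> I" and [measurable]: "h \<in> borel_measurable LT" and "integrable LT (\<lambda>x. \<bar>h x\<bar> powr s)" for t h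
  proof -
    obtain K where "0 \<le> K" "Q 1 K t"
      using YQ[of 1] t by auto
    then obtain H where K: "0 \<le> K" "integrable LT H" "AE x in LT. \<forall>b. \<bar>Th t x * b\<bar> \<le> H x + K * \<bar>b\<bar> powr s"
      unfolding Q_def by blast
    show ?thesis
    proof (rule Bochner_Integration.integrable_bound)
      show "integrable LT (\<lambda>x. H x + K * \<bar>h x\<bar> powr s)" using K that(3) by simp
      show "AE x in LT. norm (Th t x * h x) \<le> norm (H x + K * \<bar>h x\<bar> powr s)"
        using K(3)
      proof eventually_elim
        fix x assume "\<forall>b. \<bar>Th t x * b\<bar> \<le> H x + K * \<bar>b\<bar> powr s"
        from spec[OF this, of "h x"] show "norm (Th t x * h x) \<le> norm (H x + K * \<bar>h x\<bar> powr s)"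
          unfolding real_norm_def by linarith
      qed
    qed (use Thm[OF t] in measurable)
  qed
  have "uniform_limit I (\<lambda>n t. \<integral>x. Th t x * gn n x \<partial>LT) (\<lambda>t. \<integral>x. Th t x * g x \<partial>LT) sequentially"
  proof (rule uniform_limitI)
    fix e :: real assume e: "0 < e"
    obtain K where K: "0 \<le> K" "\<And>t. t \<in> I \<Longrightarrow> Q (e / 2) K t"
      using YQ[of "e / 2"] e by auto
    have "\<forall>\<^sub>F n in sequentially. (\<integral>x. \<bar>g x - gn n x\<bar> powr s \<partial>LT) < e / (2 * (K + 1))"
      using lim e K(1) by (intro order_tendstoD(2)) auto
    then show "\<forall>\<^sub>F n in sequentially. \<forall>t\<in>I. dist (\<integral>x. Th t x * gn n x \<partial>LT) (\<integral>x. Th t x * g x \<partial>LT) < e"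
    proof (eventually_elim, intro ballI)
      fix n t assume n: "(\<integral>x. \<bar>g x - gn n x\<bar> powr s \<partial>LT) < e / (2 * (K + 1))" and t: "t \<in> I"
      obtain H where H: "integrable LT H" "integral\<^sup>L LT H \<le> e / 2"
          "AE x in LT. \<forall>b. \<bar>Th t x * b\<bar> \<le> H x + K * \<bar>b\<bar> powr s"
        using K(2)[OF t] unfolding Q_def by blast
      have i: "integrable LT (\<lambda>x. Th t x * (g x - gn n x))"
        by (rule Ti[OF t _ di]) measurable
      have "dist (\<integral>x. Th t x * gn n x \<partial>LT) (\<integral>x. Th t x * g x \<partial>LT) = \<bar>\<integral>x. Th t x * (g x - gn n x) \<partial>LT\<bar>"
        using Ti[OF t _ g] Ti[OF t gnm gni, of n] by (simp add: dist_real_def right_diff_distrib abs_minus_commute)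
      also have "\<dots> \<le> (\<integral>x. \<bar>Th t x * (g x - gn n x)\<bar> \<partial>LT)"
        using integral_norm_bound[of LT "\<lambda>x. Th t x * (g x - gn n x)"] by simp
      also have "\<dots> \<le> (\<integral>x. H x + K * \<bar>g x - gn n x\<bar> powr s \<partial>LT)"
        by (intro integral_mono_AE) (use i H di[of n] in auto)
      also have "\<dots> = integral\<^sup>L LT H + K * (\<integral>x. \<bar>g x - gn n x\<bar> powr s \<partial>LT)"
        using H di[of n] by simp
      also have "\<dots> \<le> e / 2 + K * (e / (2 * (K + 1)))"
        using H n K(1) by (intro add_mono mult_left_mono) auto
      also have "\<dots> < e / 2 + (K + 1) * (e / (2 * (K + 1)))"
        using e K(1) by (intro add_strict_left_mono mult_strict_right_mono) auto
      also have "\<dots> = e" using K(1) by (simp add: field_simps)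
      finally show "dist (\<integral>x. Th t x * gn n x \<partial>LT) (\<integral>x. Th t x * g x \<partial>LT) < e" .
    qed
  qed
  then show ?thesis
    by (rule uniform_limit_theorem[rotated]) (auto intro!: always_eventually cont gnm gn2)
qed

text \<open>The scale d is free so that the term in a, later the solution, can be given an
  arbitrarily small integral while the term in b only acquires a constant. The factors 1/r and 1/s
  are simply bounded by 1.\<close>

lemma Young_scaled:
  fixes r s d a b :: real
  assumes r: "1 < r" and s: "s = r / (r - 1)" and d: "0 < d"
  shows "\<bar>a * b\<bar> \<le> d powr r * \<bar>a\<bar> powr r + (1 / d) powr s * \<bar>b\<bar> powr s"
proof -
  have s1: "1 < s" "1 / r + 1 / s = 1" using r by (auto simp: s field_simps)
  have "(d * \<bar>a\<bar>) * ((1 / d) * \<bar>b\<bar>) \<le> (d * \<bar>a\<bar>) powr r / r + ((1 / d) * \<bar>b\<bar>) powr s / s"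
    by (rule Youngs_inequality) (use r s1 d in auto)
  also have "\<dots> \<le> (d * \<bar>a\<bar>) powr r / 1 + ((1 / d) * \<bar>b\<bar>) powr s / 1"
    using r s1 by (intro add_mono divide_left_mono) auto
  also have "\<dots> = d powr r * \<bar>a\<bar> powr r + (1 / d) powr s * \<bar>b\<bar> powr s"
    using d by (subst (1 2) powr_mult) auto
  finally show ?thesis using d by (simp add: abs_mult)
qed

text \<open>All L_q information is carried by convex functionals: \<open>|x| powr r\<close> for
  finite q = r, the excess over a bound for q = infinity. Lower semicontinuity gives the bounds for
  the limit, and these in turn supply the domination needed to extend weak continuity from L_2 to
  L_q.\<close>

theorem Cw_Lq_weak_limit:
  fixes th :: "real \<Rightarrow> sfield" and th0 :: "real ^ 3 \<Rightarrow> real" and g :: "nat \<Rightarrow> real \<Rightarrow> real ^ 3 \<Rightarrow> real"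
  assumes q: "2 \<le> q" and th0: "in_Lq q th0"
    and th: "\<And>t k. t \<in> {0..T} \<Longrightarrow> th t (- k) = cnj (th t k)" "\<And>t. t \<in> {0..T} \<Longrightarrow> th t 0 = 0"
    and thA: "\<And>t F. t \<in> {0..T} \<Longrightarrow> finite F \<Longrightarrow> (\<Sum>k\<in>F. (cmod (th t k))\<^sup>2) \<le> A"
    and cont: "\<And>h. in_H 0 h \<Longrightarrow> continuous_on {0..T} (\<lambda>t. pair_s (th t) h)"
    and g: "\<And>N t. t \<in> {0..T} \<Longrightarrow> cperiodic (g N t)"
    and glim: "\<And>t k. t \<in> {0..T} \<Longrightarrow> (\<lambda>N. fcoef (g N t) k) \<longlonglongrightarrow> th t k"
    and gbd: "\<And>\<phi> N t. t \<in> {0..T} \<Longrightarrow> convex_on UNIV \<phi> \<Longrightarrow> (\<And>x. 0 \<le> \<phi> x) \<Longrightarrow> integrable LT (\<lambda>x. \<phi> (th0 x)) \<Longrightarrow>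
        (\<integral>x. \<phi> (g N t x) \<partial>LT) \<le> (\<integral>x. \<phi> (th0 x) \<partial>LT)"
  shows "Cw_Lq q T th"
proof -
  interpret finite_measure LT by (rule finite_measure_LT)
  have "\<exists>f. f \<in> borel_measurable LT \<and> integrable LT (\<lambda>x. (f x)\<^sup>2) \<and> (\<forall>k. fcoef f k = th t k) \<and>
      (\<lambda>n. \<integral>x. (f x - trig (fbox n) (th t) x)\<^sup>2 \<partial>LT) \<longlonglongrightarrow> 0" if t: "t \<in> {0..T}" for t
    by (rule Riesz_Fischer[of "th t" A, OF th(1)[OF t] thA[OF t]]) blast+
  then have "\<exists>Th. \<forall>t\<in>{0..T}. Th t \<in> borel_measurable LT \<and> integrable LT (\<lambda>x. (Th t x)\<^sup>2) \<and> (\<forall>k. fcoef (Th t) k = th t k) \<and>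
      (\<lambda>n. \<integral>x. (Th t x - trig (fbox n) (th t) x)\<^sup>2 \<partial>LT) \<longlonglongrightarrow> 0"
    by (intro bchoice ballI)
  then obtain Th where Th: "\<And>t. t \<in> {0..T} \<Longrightarrow> Th t \<in> borel_measurable LT"
      "\<And>t. t \<in> {0..T} \<Longrightarrow> integrable LT (\<lambda>x. (Th t x)\<^sup>2)"
      "\<And>t k. t \<in> {0..T} \<Longrightarrow> fcoef (Th t) k = th t k"
      "\<And>t. t \<in> {0..T} \<Longrightarrow> (\<lambda>n. \<integral>x. (Th t x - trig (fbox n) (th t) x)\<^sup>2 \<partial>LT) \<longlonglongrightarrow> 0"
    by blast
  have Ph: "(\<integral>\<^sup>+x. ennreal (\<phi> (Th t x)) \<partial>LT) \<le> ennreal (\<integral>x. \<phi> (th0 x) \<partial>LT)"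
    if t: "t \<in> {0..T}" and \<phi>: "convex_on UNIV \<phi>" "\<And>x. 0 \<le> \<phi> x" "integrable LT (\<lambda>x. \<phi> (th0 x))" for t \<phi>
  proof -
    have i: "integrable LT (g N t)" "integrable LT (\<lambda>x. \<phi> (g N t x))" for N
      using integrable_LT_cperiodic[OF g[OF t]]
        integrable_LT_cperiodic[OF cperiodic_compose[OF g[OF t] continuous_on_convex[OF \<phi>(1)]]] by auto
    show ?thesis
      by (rule nn_integral_convex_weak_limit[OF \<phi>(1,2) th(1)[OF t] Th(1,2,3,4)[OF t] i glim[OF t] gbd[OF t \<phi>]])
  qed
  have contL2: "continuous_on {0..T} (\<lambda>t. \<integral>x. Th t x * h x \<partial>LT)"
    if h: "h \<in> borel_measurable LT" "integrable LT (\<lambda>x. (h x)\<^sup>2)" for h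
  proof -
    have "(\<integral>x. Th t x * h x \<partial>LT) = pair_s (th t) ((fcoef h)(0 := 0))" if t: "t \<in> {0..T}" for t
    proof -
      have "(\<integral>x. Th t x * h x \<partial>LT) = pair_s (th t) (fcoef h)"
        by (rule integral_mult_eq_pair_s[OF th(1)[OF t] thA[OF t] Th(1)[OF t] h(1) Th(2)[OF t] h(2) Th(4)[OF t]])
      also have "\<dots> = pair_s (th t) ((fcoef h)(0 := 0))"
      proof -
        have "(\<lambda>k. th t k * cnj (fcoef h k)) = (\<lambda>k. th t k * cnj (((fcoef h)(0 := 0)) k))"
          using th(2)[OF t] by auto
        then show ?thesis unfolding pair_s_def by simp
      qed
      finally show ?thesis .
    qed
    then show ?thesis
      using continuous_on_eq[OF cont[OF in_H_0_fcoef[OF h]]] by simp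
  qed
  define s where "s = real_of_ereal (conj_exp q)"
  have main: "(\<forall>t\<in>{0..T}. in_Lq q (Th t)) \<and> 1 \<le> s \<and> (\<forall>e>0. \<exists>K\<ge>0. \<forall>t\<in>{0..T}. \<exists>H. integrable LT H \<and>
      integral\<^sup>L LT H \<le> e \<and> (AE x in LT. \<forall>b. \<bar>Th t x * b\<bar> \<le> H x + K * \<bar>b\<bar> powr s))"
  proof (cases "q = \<infinity>")
    case True
    then obtain C where C: "AE x in LT. \<bar>th0 x\<bar> \<le> C" using th0 by (auto simp: in_Lq_def)
    let ?\<phi> = "\<lambda>x. max 0 (\<bar>x\<bar> - \<bar>C\<bar>)"
    have [measurable]: "th0 \<in> borel_measurable LT" using th0 by (auto simp: in_Lq_def)
    have z: "AE x in LT. ?\<phi> (th0 x) = 0" using C by eventually_elim auto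
    have zi: "integrable LT (\<lambda>x. ?\<phi> (th0 x))" "(\<integral>x. ?\<phi> (th0 x) \<partial>LT) = 0"
      using integrable_cong_AE[of "\<lambda>x. ?\<phi> (th0 x)" LT "\<lambda>_. 0"] integral_cong_AE[of "\<lambda>x. ?\<phi> (th0 x)" LT "\<lambda>_. 0"] z by auto
    have B: "AE x in LT. \<bar>Th t x\<bar> \<le> \<bar>C\<bar>" if t: "t \<in> {0..T}" for t
    proof -
      have [measurable]: "Th t \<in> borel_measurable LT" by (rule Th(1)[OF t])
      have "(\<integral>\<^sup>+x. ennreal (?\<phi> (Th t x)) \<partial>LT) = 0"
        using Ph[OF t convex_on_excess, of "\<bar>C\<bar>"] zi by simp
      then have "AE x in LT. ennreal (?\<phi> (Th t x)) = 0"
        by (subst (asm) nn_integral_0_iff_AE) auto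
      then show ?thesis by eventually_elim (auto simp: ennreal_eq_0_iff)
    qed
    have s: "s = 1" using True by (simp add: s_def conj_exp_def)
    have "AE x in LT. \<forall>b. \<bar>Th t x * b\<bar> \<le> 0 + \<bar>C\<bar> * \<bar>b\<bar> powr s" if t: "t \<in> {0..T}" for t
      using B[OF t] by eventually_elim (auto simp: s abs_mult intro!: mult_right_mono)
    then have "\<exists>K\<ge>0. \<forall>t\<in>{0..T}. \<exists>H. integrable LT H \<and>
      integral\<^sup>L LT H \<le> e \<and> (AE x in LT. \<forall>b. \<bar>Th t x * b\<bar> \<le> H x + K * \<bar>b\<bar> powr s)" if "0 < e" for e
      using that by (intro exI[of _ "\<bar>C\<bar>"] conjI ballI exI[of _ "\<lambda>_. 0"]) simp_all
    moreover have "in_Lq q (Th t)" if t: "t \<in> {0..T}" for t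
      using True Th(1)[OF t] B[OF t] by (auto simp: in_Lq_def)
    ultimately show ?thesis
      using s by simp
  next
    case False
    then obtain r where qr: "q = ereal r" and r: "2 \<le> r" using q by (cases q) auto
    have i0: "integrable LT (\<lambda>x. \<bar>th0 x\<bar> powr r)" using th0 False qr by (simp add: in_Lq_def)
    define C where "C = (\<integral>x. \<bar>th0 x\<bar> powr r \<partial>LT)"
    have C0: "0 \<le> C" by (simp add: C_def)
    have B: "integrable LT (\<lambda>x. \<bar>Th t x\<bar> powr r)" "(\<integral>x. \<bar>Th t x\<bar> powr r \<partial>LT) \<le> C" if t: "t \<in> {0..T}" for t
    proof -
      have [measurable]: "Th t \<in> borel_measurable LT" by (rule Th(1)[OF t])
      have le: "(\<integral>\<^sup>+x. ennreal (\<bar>Th t x\<bar> powr r) \<partial>LT) \<le> ennreal C"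
        unfolding C_def by (rule Ph[OF t convex_on_abs_powr]) (use r i0 in auto)
      then show i: "integrable LT (\<lambda>x. \<bar>Th t x\<bar> powr r)"
        by (intro integrableI_bounded) (auto intro: le_less_trans)
      show "(\<integral>x. \<bar>Th t x\<bar> powr r \<partial>LT) \<le> C"
        using le C0 by (subst (asm) nn_integral_eq_integral[OF i]) auto
    qed
    have s: "s = r / (r - 1)" using qr by (simp add: s_def conj_exp_def)
    have s1: "1 \<le> s" using r by (simp add: s field_simps)
    have "\<exists>K\<ge>0. \<forall>t\<in>{0..T}. \<exists>H. integrable LT H \<and>
      integral\<^sup>L LT H \<le> e \<and> (AE x in LT. \<forall>b. \<bar>Th t x * b\<bar> \<le> H x + K * \<bar>b\<bar> powr s)" if e: "0 < e" for e
    proof -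
      \<comment> \<open>Solves d^r (C + 1) = e, so the term in \<open>Th t\<close> has integral at
        most e; C + 1 instead of C avoids dividing by 0.\<close>
      define d where "d = (e / (C + 1)) powr (1 / r)"
      have d: "0 < d" using e C0 by (simp add: d_def)
      have dr: "d powr r = e / (C + 1)" using e C0 r by (simp add: d_def powr_powr)
      show ?thesis
      proof (intro exI[of _ "(1 / d) powr s"] conjI ballI)
        fix t assume t: "t \<in> {0..T}"
        have "e / (C + 1) * (\<integral>x. \<bar>Th t x\<bar> powr r \<partial>LT) \<le> e / (C + 1) * (C + 1)"
          using e C0 B(2)[OF t] by (intro mult_left_mono) auto
        then show "\<exists>H. integrable LT H \<and> integral\<^sup>L LT H \<le> e \<and> (AE x in LT. \<forall>b. \<bar>Th t x * b\<bar> \<le> H x + (1 / d) powr s * \<bar>b\<bar> powr s)"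
          using B(1)[OF t] C0 Young_scaled[OF _ s d, of "Th t _"] r
          by (intro exI[of _ "\<lambda>x. d powr r * \<bar>Th t x\<bar> powr r"]) (auto simp: dr)
      qed simp
    qed
    then show ?thesis using B(1) Th(1) s1 False qr by (auto simp: in_Lq_def)
  qed
  show ?thesis
    unfolding Cw_Lq_def
  proof (intro exI[of _ Th] conjI ballI allI impI)
    fix t assume t: "t \<in> {0..T}"
    show "in_Lq q (Th t)" using main t by blast
    show "fcoef (Th t) = th t" using Th(3)[OF t] by auto
  next
    fix h assume h: "in_Lq (conj_exp q) h"
    \<comment> \<open>The conjugate exponent is finite even for q = infinity, so the test function
      always falls under the integrable branch of \<open>in_Lq\<close>.\<close>
    have "conj_exp q \<noteq> \<infinity>" by (simp add: conj_exp_def)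
    then have "h \<in> borel_measurable LT" "integrable LT (\<lambda>x. \<bar>h x\<bar> powr s)"
      using h by (auto simp: in_Lq_def s_def)
    then show "continuous_on {0..T} (\<lambda>t. \<integral>x. Th t x * h x \<partial>LT)"
      by (rule continuous_on_integral_mult_truncation[OF conjunct1[OF conjunct2[OF main]] _ _ Th(1)
            conjunct2[OF conjunct2[OF main], THEN spec, THEN mp] contL2])
  qed
qed

section \<open>The Leray projection\<close>

lemma kdot_add: "kdot k (a + b) = kdot k a + kdot k b"
  by (simp add: kdot_def sum.distrib algebra_simps)

lemma kdot_smult: "kdot k (c *s a) = c * kdot k a"
  by (simp add: kdot_def sum_distrib_left algebra_simps)

lemma kdot_scaleR: "kdot k (c *\<^sub>R a) = of_real c * kdot k a"
  by (simp add: kdot_def sum_distrib_left scaleR_conv_of_real[where 'a = complex] algebra_simps)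

lemma kdot_minus_left: "kdot (- k) a = - kdot k a"
  by (simp add: kdot_def sum_negf)

lemma kdot_diff_left: "kdot (j - k) a = kdot j a - kdot k a"
  by (simp add: kdot_def sum_subtractf algebra_simps)

lemma kdot_vcnj: "kdot k (vcnj a) = cnj (kdot k a)"
  by (simp add: kdot_def vcnj_def)

lemma kdot_0 [simp]: "kdot k 0 = 0"
  by (simp add: kdot_def)

lemma kdot_diff: "kdot k (a - b) = kdot k a - kdot k b"
  by (simp add: kdot_def sum_subtractf algebra_simps)

lemma vcnj_vcnj [simp]: "vcnj (vcnj a) = a"
  by (simp add: vcnj_def vec_eq_iff)

lemma vcnj_add: "vcnj (a + b) = vcnj a + vcnj b"
  by (simp add: vcnj_def vec_eq_iff)

lemma vcnj_diff: "vcnj (a - b) = vcnj a - vcnj b"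
  by (simp add: vcnj_def vec_eq_iff)

lemma vcnj_smult: "vcnj (c *s a) = cnj c *s vcnj a"
  by (simp add: vcnj_def vec_eq_iff)

lemma vcnj_scaleR: "vcnj (c *\<^sub>R a) = c *\<^sub>R vcnj a"
  by (simp add: vcnj_def vec_eq_iff)

lemma vcnj_0 [simp]: "vcnj 0 = 0"
  by (simp add: vcnj_def vec_eq_iff)

lemma vcnj_sum: "vcnj (sum f A) = (\<Sum>x\<in>A. vcnj (f x))"
  by (induction A rule: infinite_finite_induct) (auto simp: vcnj_add)

lemma norm_vcnj [simp]: "norm (vcnj a) = norm a"
  by (simp add: norm_vec_def vcnj_def)

lemma norm_smult: "norm (c *s (a :: complex ^ 'n)) = cmod c * norm a"
  by (simp add: norm_vec_def norm_mult L2_set_right_distrib)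

lemma inner_eq_cdot: "a \<bullet> b = Re (cdot a (vcnj b))"
  by (simp add: inner_vec_def cdot_def vcnj_def inner_complex_def)

lemma cdot_smult_left: "cdot (c *s a) b = c * cdot a b"
  by (simp add: cdot_def sum_distrib_left algebra_simps)

lemma cdot_scaleR_left: "cdot (c *\<^sub>R a) b = of_real c * cdot a b"
  by (simp add: cdot_def sum_distrib_left scaleR_conv_of_real[where 'a = complex] algebra_simps)

lemma cdot_scaleR_right: "cdot a (c *\<^sub>R b) = of_real c * cdot a b"
  by (simp add: cdot_def sum_distrib_left scaleR_conv_of_real[where 'a = complex] algebra_simps)

lemma cdot_add_left: "cdot (a + b) c = cdot a c + cdot b c"
  by (simp add: cdot_def sum.distrib algebra_simps)

lemma cdot_diff_left: "cdot (a - b) c = cdot a c - cdot b c"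
  by (simp add: cdot_def sum_subtractf algebra_simps)

lemma cdot_0_left [simp]: "cdot 0 c = 0"
  by (simp add: cdot_def)

lemma cdot_sum_left: "cdot (sum f A) c = (\<Sum>x\<in>A. cdot (f x) c)"
  by (induction A rule: infinite_finite_induct) (auto simp: cdot_add_left)

lemma cdot_commute: "cdot a b = cdot b a"
  by (simp add: cdot_def mult.commute)

lemma cdot_vcnj: "cdot (vcnj a) (vcnj b) = cnj (cdot a b)"
  by (simp add: cdot_def vcnj_def)

lemma norm_cdot_le: "cmod (cdot a b) \<le> norm a * norm b"
proof -
  have "cmod (cdot a b) \<le> (\<Sum>i\<in>UNIV. \<bar>norm (a $ i)\<bar> * \<bar>norm (b $ i)\<bar>)"
    unfolding cdot_def by (rule order_trans[OF norm_sum]) (simp add: norm_mult)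
  also have "\<dots> \<le> norm a * norm b"
    unfolding norm_vec_def by (rule L2_set_mult_ineq)
  finally show ?thesis .
qed

lemma norm_kdot_le: "cmod (kdot k a) \<le> knorm k * norm a"
proof -
  have "cmod (kdot k a) \<le> (\<Sum>i\<in>UNIV. \<bar>real_of_int (k $ i)\<bar> * \<bar>norm (a $ i)\<bar>)"
    unfolding kdot_def by (rule order_trans[OF norm_sum]) (simp add: norm_mult)
  also have "\<dots> \<le> L2_set (\<lambda>i. real_of_int (k $ i)) UNIV * norm a"
    unfolding norm_vec_def by (rule L2_set_mult_ineq)
  finally show ?thesis by (simp add: knorm_def L2_set_def)
qed

definition kvec :: "wvec \<Rightarrow> complex ^ 3" where
  "kvec k = (\<chi> i. of_int (k $ i))"

lemma norm_kvec: "norm (kvec k) = knorm k"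
  by (simp add: kvec_def norm_vec_def knorm_def L2_set_def norm_of_int)

lemma kdot_kvec: "kdot k (kvec k) = of_real ((knorm k)\<^sup>2)"
  by (simp add: kdot_def kvec_def knorm_def sum_nonneg power2_eq_square)

text \<open>The Leray projection acts on the \<open>k\<close>-th Fourier coefficient as the orthogonal projection
  onto the complement of \<open>k\<close>.\<close>

definition leray :: "wvec \<Rightarrow> complex ^ 3 \<Rightarrow> complex ^ 3" where
  "leray k w = w - (kdot k w / of_real ((knorm k)\<^sup>2)) *s kvec k"

lemma kdot_leray: "k \<noteq> 0 \<Longrightarrow> kdot k (leray k w) = 0"
  using knorm_pos[of k] by (simp add: leray_def kdot_diff kdot_smult kdot_kvec)

text \<open>The triangle inequality yields the constant 2; only a bound uniform in k matters. At k =
  0 the map is the identity, since \<open>kvec 0\<close> is 0.\<close>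

lemma norm_leray_le: "norm (leray k w) \<le> 2 * norm w"
proof (cases "k = 0")
  case False
  have "norm ((kdot k w / of_real ((knorm k)\<^sup>2)) *s kvec k) = cmod (kdot k w) / knorm k"
    using knorm_pos[OF False]
    by (simp add: norm_smult norm_kvec norm_divide power2_eq_square del: of_real_power of_real_mult)
  also have "\<dots> \<le> norm w"
    using norm_kdot_le[of k w] knorm_pos[OF False] by (simp add: field_simps)
  finally show ?thesis
    unfolding leray_def using norm_triangle_ineq4[of w "(kdot k w / of_real ((knorm k)\<^sup>2)) *s kvec k"] by linarith
next
  case True
  then have "kvec k = 0" by (simp add: kvec_def vec_eq_iff)
  then show ?thesis by (simp add: leray_def)
qed

text \<open>Divergence-free tests do not see the projection; this removes the pressure from both the
  energy balance and the weak formulation.\<close>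

lemma cdot_leray: "kdot k v = 0 \<Longrightarrow> cdot (leray k w) v = cdot w v"
proof -
  assume v: "kdot k v = 0"
  have "cdot (kvec k) v = kdot k v" by (simp add: cdot_def kvec_def kdot_def)
  with v show ?thesis by (simp add: leray_def cdot_diff_left cdot_smult_left)
qed

lemma leray_add: "leray k (a + b) = leray k a + leray k b"
  by (simp add: leray_def kdot_add add_divide_distrib vector_sadd_rdistrib algebra_simps)

lemma leray_scaleR: "leray k (c *\<^sub>R a) = c *\<^sub>R leray k a"
  by (simp add: leray_def kdot_scaleR vec_eq_iff scaleR_conv_of_real[where 'a = complex] algebra_simps)

lemma leray_uminus_vcnj: "leray (- k) (vcnj w) = vcnj (leray k w)"
  by (simp add: leray_def kdot_minus_left kdot_vcnj kvec_def vcnj_diff vcnj_smult vec_eq_iff)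
    (simp add: vcnj_def)

lemma linear_leray: "linear (leray k)"
  by (rule linearI) (auto simp: leray_add leray_scaleR)

lemma bounded_linear_leray: "bounded_linear (leray k)"
  by (rule linear_conv_bounded_linear[THEN iffD1, OF linear_leray])

lemma bounded_linear_kdot: "bounded_linear (kdot k)"
  by (rule linear_conv_bounded_linear[THEN iffD1], rule linearI) (auto simp: kdot_add kdot_scaleR scaleR_conv_of_real[where 'a = complex])

lemma bounded_linear_cdot_left: "bounded_linear (\<lambda>a. cdot a b)"
  by (rule linear_conv_bounded_linear[THEN iffD1], rule linearI) (auto simp: cdot_add_left cdot_scaleR_left scaleR_conv_of_real[where 'a = complex])

lemma norm_lam_v_le:
  assumes "0 \<le> \<alpha>" shows "norm (lam_v (- 2 * \<alpha>) v k) \<le> norm (v k)"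
proof (cases "k = 0")
  case False
  have "knorm k powr (- 2 * \<alpha>) \<le> knorm k powr 0"
    using knorm_ge_1[OF False] assms by (intro powr_mono) auto
  then have "knorm k powr (- 2 * \<alpha>) \<le> 1" using knorm_pos[OF False] by simp
  then show ?thesis by (simp add: lam_v_def mult_left_le_one_le)
qed (simp add: lam_v_def)

lemma real_v_lam_v: "real_v v \<Longrightarrow> real_v (lam_v s v)"
  by (auto simp: real_v_def lam_v_def vcnj_scaleR kdot_scaleR)

section \<open>A convexity-preserving transport step\<close>

text \<open>A doubly stochastic operator modelling transport along the shear flow \<open>w d\<close>, where the
  profile \<open>w\<close> is constant in the direction \<open>d\<close>.\<close>

definition shear_avg :: "real ^ 3 \<Rightarrow> (real ^ 3 \<Rightarrow> real) \<Rightarrow> (real ^ 3 \<Rightarrow> real) \<Rightarrow> real ^ 3 \<Rightarrow> real" where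
  "shear_avg d w f x = ((1 + w x) * f (x - d) + (1 - w x) * f (x + d)) / 2"

lemma cperiodic_shear_avg:
  assumes "cperiodic w" "cperiodic f" shows "cperiodic (shear_avg d w f)"
proof -
  have "cperiodic (\<lambda>x. ((1 + w x) * f (x + - d) + (1 + (- 1) * w x) * f (x + d)) * (1 / 2))"
    by (intro cperiodic_mult cperiodic_add cperiodic_const assms cperiodic_translate)
  then show ?thesis by (simp add: shear_avg_def[abs_def])
qed

text \<open>Pointwise Jensen has the weights (1 + w)/2 and (1 - w)/2. Since w is invariant under the
  shift d, each weight can be moved along with its translate of f. Translation invariance of the
  integral then recombines the weights to 1.\<close>

lemma integral_convex_shear_avg_le:
  assumes f: "cperiodic f" and w: "cperiodic w" "\<And>x. \<bar>w x\<bar> \<le> 1" "\<And>x. w (x + d) = w x"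
    and \<phi>: "convex_on UNIV \<phi>"
  shows "(\<integral>x. \<phi> (shear_avg d w f x) \<partial>LT) \<le> (\<integral>x. \<phi> (f x) \<partial>LT)"
proof -
  have w': "w (x + - d) = w x" for x using w(3)[of "x - d"] by simp
  have pf: "cperiodic (\<lambda>x. \<phi> (f x))"
    by (intro cperiodic_compose[OF f] continuous_on_convex \<phi>)
  define A where "A x = (1 + w x) * \<phi> (f x) * (1 / 2)" for x
  define B where "B x = (1 + (- 1) * w x) * \<phi> (f x) * (1 / 2)" for x
  have AB: "cperiodic A" "cperiodic B"
    unfolding A_def[abs_def] B_def[abs_def] by (intro cperiodic_mult cperiodic_add cperiodic_const w pf)+
  have "(\<integral>x. \<phi> (shear_avg d w f x) \<partial>LT) \<le> (\<integral>x. A (x + - d) + B (x + d) \<partial>LT)"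
  proof (rule integral_mono)
    show "integrable LT (\<lambda>x. \<phi> (shear_avg d w f x))"
      by (intro integrable_LT_cperiodic cperiodic_compose[OF cperiodic_shear_avg] continuous_on_convex \<phi> f w)
    show "integrable LT (\<lambda>x. A (x + - d) + B (x + d))"
      by (intro integrable_LT_cperiodic cperiodic_add cperiodic_translate AB)
    show "\<phi> (shear_avg d w f x) \<le> A (x + - d) + B (x + d)" for x
    proof -
      have "shear_avg d w f x = (1 - (1 - w x) / 2) *\<^sub>R f (x - d) + ((1 - w x) / 2) *\<^sub>R f (x + d)"
        by (simp add: shear_avg_def field_simps)
      also have "\<phi> \<dots> \<le> (1 - (1 - w x) / 2) * \<phi> (f (x - d)) + ((1 - w x) / 2) * \<phi> (f (x + d))"
        by (rule convex_onD[OF \<phi>]) (use w(2)[of x] in \<open>auto simp: abs_le_iff field_simps\<close>)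
      also have "\<dots> = A (x + - d) + B (x + d)"
        unfolding A_def B_def w(3) w' by (simp add: field_simps)
      finally show ?thesis .
    qed
  qed
  also have "\<dots> = integral\<^sup>L LT A + integral\<^sup>L LT B"
    using integral_LT_translate[OF AB(1), of "- d"] integral_LT_translate[OF AB(2), of d]
      integrable_LT_cperiodic[OF cperiodic_translate[OF AB(1), of "- d"]]
      integrable_LT_cperiodic[OF cperiodic_translate[OF AB(2), of d]] by simp
  also have "\<dots> = (\<integral>x. A x + B x \<partial>LT)"
    using integrable_LT_cperiodic[OF AB(1)] integrable_LT_cperiodic[OF AB(2)] by simp
  also have "\<dots> = (\<integral>x. \<phi> (f x) \<partial>LT)"
    by (intro Bochner_Integration.integral_cong) (auto simp: A_def B_def field_simps)
  finally show ?thesis .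
qed

text \<open>To first order in d the cosine is 1 and the sine is linear, so this is an Euler step of
  transport by the field w d. The condition \<open>phase j d = 0\<close> gives the modes k - j and k
  + j the same sine as k.\<close>

lemma fcoef_shear_avg:
  assumes f: "cperiodic f" and d: "phase j d = 0"
  shows "fcoef (shear_avg d (\<lambda>x. Re (c * cis (phase j x))) f) k
    = of_real (cos (phase k d)) * fcoef f k
      - \<i> / 2 * of_real (sin (phase k d)) * (c * fcoef f (k - j) + cnj c * fcoef f (k + j))"
proof -
  let ?w = "\<lambda>x. Re (c * cis (phase j x))"
  have fp: "cperiodic (\<lambda>x. f (x + - d))" "cperiodic (\<lambda>x. f (x + d))"
    by (intro cperiodic_translate f)+
  define h where "h x = f (x + - d) - f (x + d)" for x
  define m where "m x = f (x + - d) + f (x + d)" for x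
  have ih: "integrable LT h" and im: "integrable LT m"
    unfolding h_def[abs_def] m_def[abs_def] using integrable_LT_cperiodic[OF fp(1)] integrable_LT_cperiodic[OF fp(2)] by auto
  have hp: "cperiodic h"
    unfolding h_def[abs_def] using cperiodic_add[OF fp(1) cperiodic_mult[OF cperiodic_const[of "- 1"] fp(2)]] by simp
  have iw: "integrable LT (\<lambda>x. ?w x * h x)"
    by (intro integrable_LT_cperiodic cperiodic_mult cperiodic_wave hp)
  have fh: "fcoef h l = - 2 * \<i> * of_real (sin (phase l d)) * fcoef f l" for l
  proof -
    have "fcoef h l = cis (phase l (- d)) * fcoef f l - cis (phase l d) * fcoef f l"
      unfolding h_def[abs_def] by (simp add: fcoef_diff fp integrable_LT_cperiodic fcoef_translate[OF f] del: add_uminus_conv_diff)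
    also have "\<dots> = (cis (- phase l d) - cis (phase l d)) * fcoef f l"
      by (simp add: phase_minus_right algebra_simps)
    also have "cis (- phase l d) - cis (phase l d) = - 2 * \<i> * of_real (sin (phase l d))"
      by (simp add: complex_eq_iff)
    finally show ?thesis by simp
  qed
  have fm: "fcoef m k = 2 * of_real (cos (phase k d)) * fcoef f k"
  proof -
    have "fcoef m k = cis (phase k (- d)) * fcoef f k + cis (phase k d) * fcoef f k"
      unfolding m_def[abs_def] by (simp add: fcoef_add fp integrable_LT_cperiodic fcoef_translate[OF f] del: add_uminus_conv_diff)
    also have "\<dots> = (cis (- phase k d) + cis (phase k d)) * fcoef f k"
      by (simp add: phase_minus_right algebra_simps)
    also have "cis (- phase k d) + cis (phase k d) = 2 * of_real (cos (phase k d))"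
      by (simp add: complex_eq_iff)
    finally show ?thesis by simp
  qed
  have "shear_avg d ?w f = (\<lambda>x. (1/2) * (m x + ?w x * h x))"
  proof -
    have "((1 + w) * p + (1 - w) * q) / 2 = (1 / 2) * ((p + q) + w * (p - q))" for w p q :: real
      by (simp add: field_simps)
    then show ?thesis unfolding shear_avg_def[abs_def] h_def m_def by (simp only: diff_conv_add_uminus[symmetric])
  qed
  then have "fcoef (shear_avg d ?w f) k = 1/2 * (fcoef m k + (c * fcoef h (k - j) + cnj c * fcoef h (k + j)) / 2)"
    using fcoef_cmult[of "1/2" "\<lambda>x. m x + ?w x * h x" k] fcoef_add[OF im iw, of k] fcoef_mult_wave[OF ih, of c j k]
    by simp
  also have "\<dots> = of_real (cos (phase k d)) * fcoef f k
      - \<i> / 2 * of_real (sin (phase k d)) * (c * fcoef f (k - j) + cnj c * fcoef f (k + j))"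
    unfolding fm fh phase_diff phase_add d by (simp add: field_simps)
  finally show ?thesis .
qed

lemma one_minus_cos_le: "\<bar>cos x - 1\<bar> \<le> x\<^sup>2 / 2" for x :: real
proof -
  have "cos x = 1 - 2 * (sin (x / 2))\<^sup>2" using cos_double_sin[of "x / 2"] by simp
  moreover have "(sin (x / 2))\<^sup>2 \<le> (x / 2)\<^sup>2"
    using abs_sin_x_le_abs_x[of "x / 2"] by (simp only: abs_le_square_iff)
  ultimately show ?thesis by (simp add: power_divide)
qed

lemma sin_minus_le: "\<bar>sin x - x\<bar> \<le> x\<^sup>2 / 2" for x :: real
  using Maclaurin_sin_bound[of x 2] by (simp add: sin_coeff_def numeral_2_eq_2 field_simps)

definition shear_dir :: "vfield \<Rightarrow> wvec \<Rightarrow> complex \<Rightarrow> real ^ 3" where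
  "shear_dir u j c = (\<chi> i. Re (cnj c * u j $ i))"

text \<open>At k = j the right side vanishes for divergence-free u: each wave profile is constant
  along its own direction of motion, as the shear average requires.\<close>

lemma phase_shear_dir: "phase k (shear_dir u j c) = Re (cnj c * kdot k (u j))"
proof -
  have "cnj c * kdot k (u j) = (\<Sum>i\<in>UNIV. of_int (k $ i) * (cnj c * u j $ i))"
    by (simp add: kdot_def sum_distrib_left mult_ac)
  then show ?thesis by (simp add: phase_def shear_dir_def)
qed

text \<open>One time step of the transport equation: the velocity field is split into the plane shear
  waves \<open>Re (u\<^sub>j e\<^sup>i\<^sup>j\<^sup>x) = \<Sum>c\<in>{1,\<i>}. Re (c e\<^sup>i\<^sup>j\<^sup>x) Re (cnj c u\<^sub>j)\<close>.\<close>

definition transport_step :: "wvec set \<Rightarrow> real \<Rightarrow> vfield \<Rightarrow> (real ^ 3 \<Rightarrow> real) \<Rightarrow> real ^ 3 \<Rightarrow> real" where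
  "transport_step J \<tau> u f x = (\<Sum>(j, c)\<in>J \<times> {1, \<i>}.
     (1 / (2 * real (card J))) * shear_avg ((2 * real (card J) * \<tau>) *\<^sub>R shear_dir u j c) (\<lambda>x. Re (c * cis (phase j x))) f x)"

lemma cperiodic_transport_step: "cperiodic f \<Longrightarrow> cperiodic (transport_step J \<tau> u f)"
  unfolding transport_step_def[abs_def] case_prod_beta
  by (intro cperiodic_sum cperiodic_mult cperiodic_const cperiodic_shear_avg cperiodic_wave)

lemma integral_convex_transport_step_le:
  assumes f: "cperiodic f" and J: "finite J" "J \<noteq> {}" and u: "\<And>j. kdot j (u j) = 0" and \<phi>: "convex_on UNIV \<phi>"
  shows "(\<integral>x. \<phi> (transport_step J \<tau> u f x) \<partial>LT) \<le> (\<integral>x. \<phi> (f x) \<partial>LT)"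
proof -
  let ?I = "J \<times> {1, \<i>}"
  define s where "s p = shear_avg ((2 * real (card J) * \<tau>) *\<^sub>R shear_dir u (fst p) (snd p)) (\<lambda>x. Re (snd p * cis (phase (fst p) x))) f" for p
  define a where "a = (1 / (2 * real (card J)))"
  have cI: "card ?I = 2 * card J" by (simp add: card_cartesian_product)
  have c0: "card J > 0" using J by (simp add: card_gt_0_iff)
  have a: "(\<Sum>p\<in>?I. a) = 1" "0 \<le> a" using c0 by (auto simp: cI a_def)
  have sp: "cperiodic (s p)" for p
    unfolding s_def by (intro cperiodic_shear_avg cperiodic_wave f)
  have is': "integrable LT (\<lambda>x. \<phi> (s p x))" for p
    by (intro integrable_LT_cperiodic cperiodic_compose[OF sp] continuous_on_convex \<phi>)
  have ts: "transport_step J \<tau> u f x = (\<Sum>p\<in>?I. a *\<^sub>R s p x)" for x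
    by (simp add: transport_step_def s_def a_def case_prod_beta)
  have le: "(\<integral>x. \<phi> (s p x) \<partial>LT) \<le> (\<integral>x. \<phi> (f x) \<partial>LT)" if "p \<in> ?I" for p
    unfolding s_def
  proof (rule integral_convex_shear_avg_le[OF f cperiodic_wave _ _ \<phi>])
    show "\<bar>Re (snd p * cis (phase (fst p) x))\<bar> \<le> 1" for x
      using that abs_Re_le_cmod[of "snd p * cis (phase (fst p) x)"] by (auto simp: norm_mult simp del: times_complex.sel)
    have "phase (fst p) ((2 * real (card J) * \<tau>) *\<^sub>R shear_dir u (fst p) (snd p)) = 0"
      by (simp add: phase_scaleR phase_shear_dir u)
    then show "Re (snd p * cis (phase (fst p) (x + (2 * real (card J) * \<tau>) *\<^sub>R shear_dir u (fst p) (snd p)))) = Re (snd p * cis (phase (fst p) x))" for x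
      by (simp add: phase_add_right)
  qed
  have "(\<integral>x. \<phi> (transport_step J \<tau> u f x) \<partial>LT) \<le> (\<integral>x. (\<Sum>p\<in>?I. a * \<phi> (s p x)) \<partial>LT)"
  proof (rule integral_mono)
    show "integrable LT (\<lambda>x. \<phi> (transport_step J \<tau> u f x))"
      by (intro integrable_LT_cperiodic cperiodic_compose[OF cperiodic_transport_step] continuous_on_convex \<phi> f)
    show "\<phi> (transport_step J \<tau> u f x) \<le> (\<Sum>p\<in>?I. a * \<phi> (s p x))" for x
      unfolding ts by (rule convex_on_sum[OF _ _ \<phi>]) (use J a in auto)
  qed (auto intro!: is')
  also have "\<dots> = (\<Sum>p\<in>?I. a * (\<integral>x. \<phi> (s p x) \<partial>LT))"
    using is' by (subst Bochner_Integration.integral_sum) auto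
  also have "\<dots> \<le> (\<Sum>p\<in>?I. a * (\<integral>x. \<phi> (f x) \<partial>LT))"
    by (intro sum_mono mult_left_mono le a(2))
  also have "\<dots> = (\<integral>x. \<phi> (f x) \<partial>LT)"
    by (simp only: sum_distrib_right[symmetric] a(1) mult_1)
  finally show ?thesis .
qed

text \<open>Taylor expansion of sine and cosine in the displacement: the linear terms add up to the
  convolution, the quadratic ones form the error. The error grows with the square of
  \<open>card J\<close>, so \<tau> has to be chosen after J.\<close>

lemma fcoef_transport_step:
  assumes f: "cperiodic f" and J: "finite J" "J \<noteq> {}" "\<And>j. - j \<in> J \<longleftrightarrow> j \<in> J"
    and u: "\<And>j. kdot j (u j) = 0" "\<And>j. u (- j) = vcnj (u j)"
    and U: "\<And>j. norm (u j) \<le> U" and B: "\<And>k. cmod (fcoef f k) \<le> B" and \<tau>: "0 \<le> \<tau>"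
  shows "cmod (fcoef (transport_step J \<tau> u f) k - fcoef f k + \<tau> * (\<i> * (\<Sum>j\<in>J. kdot k (u j) * fcoef f (k - j))))
     \<le> B * (2 * real (card J) * \<tau> * knorm k * U)\<^sup>2"
proof -
  let ?I = "J \<times> {1, \<i>}"
  let ?F = "fcoef f"
  \<comment> \<open>Averaging over 2 card J shears divides each displacement by that number, so a
    single shear has to travel \<delta> to produce the net time step \<tau>.\<close>
  define \<delta> where "\<delta> = 2 * real (card J) * \<tau>"
  define a where "a = 1 / (2 * real (card J))"
  have c0: "real (card J) > 0" using J by (simp add: card_gt_0_iff)
  have a0: "0 < a" using c0 by (simp add: a_def)
  have a\<delta>: "a * \<delta> = \<tau>" using c0 by (simp add: a_def \<delta>_def)
  have \<delta>0: "0 \<le> \<delta>" using \<tau> by (simp add: \<delta>_def)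
  have cI: "card ?I = 2 * card J" by (simp add: card_cartesian_product)
  have aI: "(\<Sum>p\<in>?I. a * X) = X" for X using c0 by (simp add: cI a_def)
  define x where "x p = \<delta> * Re (cnj (snd p) * kdot k (u (fst p)))" for p
  define y where "y p = snd p * ?F (k - fst p) + cnj (snd p) * ?F (k + fst p)" for p
  have U0: "0 \<le> U" using U[of 0] norm_ge_zero order_trans by blast
  have B0: "0 \<le> B" using B[of 0] norm_ge_zero order_trans by blast
  have xb: "(x p)\<^sup>2 \<le> (\<delta> * knorm k * U)\<^sup>2" if "p \<in> ?I" for p
  proof -
    have "\<bar>Re (cnj (snd p) * kdot k (u (fst p)))\<bar> \<le> cmod (kdot k (u (fst p)))"
      using abs_Re_le_cmod[of "cnj (snd p) * kdot k (u (fst p))"] that by (auto simp: norm_mult simp del: times_complex.sel)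
    also have "\<dots> \<le> knorm k * U"
      by (rule order_trans[OF norm_kdot_le]) (simp add: mult_left_mono U)
    finally have "\<bar>x p\<bar> \<le> \<bar>\<delta> * knorm k * U\<bar>"
      unfolding x_def abs_mult using \<delta>0 U0 by (simp add: mult_left_mono mult.assoc)
    then show ?thesis by (simp only: abs_le_square_iff)
  qed
  have yb: "cmod (y p) \<le> 2 * B" if "p \<in> ?I" for p
    using that B[of "k - fst p"] B[of "k + fst p"] unfolding y_def
    by (intro order_trans[OF norm_triangle_ineq]) (auto simp: norm_mult)
  have e1: "fcoef (transport_step J \<tau> u f) k = (\<Sum>p\<in>?I. a * (cos (x p) * ?F k - \<i> / 2 * sin (x p) * y p))"
  proof -
    have "fcoef (transport_step J \<tau> u f) k
      = (\<Sum>p\<in>?I. fcoef (\<lambda>x. a * shear_avg (\<delta> *\<^sub>R shear_dir u (fst p) (snd p)) (\<lambda>x. Re (snd p * cis (phase (fst p) x))) f x) k)"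
      unfolding transport_step_def[abs_def] case_prod_beta a_def[symmetric] \<delta>_def[symmetric]
      by (intro fcoef_sum integrable_LT_cperiodic cperiodic_mult cperiodic_const cperiodic_shear_avg cperiodic_wave f)
    also have "\<dots> = (\<Sum>p\<in>?I. a * (cos (x p) * ?F k - \<i> / 2 * sin (x p) * y p))"
      unfolding fcoef_cmult
      by (intro sum.cong refl arg_cong[of _ _ "\<lambda>z. of_real a * z"])
        (subst fcoef_shear_avg[OF f], simp_all add: phase_scaleR phase_shear_dir u x_def y_def del: times_complex.sel)
    finally show ?thesis .
  qed
  have e2: "(\<Sum>p\<in>?I. a * ?F k) = ?F k"
    using c0 cI by (simp add: a_def)
  have e3: "\<tau> * (\<i> * (\<Sum>j\<in>J. kdot k (u j) * ?F (k - j))) = (\<Sum>p\<in>?I. a * (\<i> / 2 * x p * y p))"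
  proof -
    \<comment> \<open>The phases c = 1 and c = \<i> recombine the real and imaginary parts of
      \<open>kdot k (u j)\<close>. Replacing j by -j, which uses the reality of u, then merges the
      two shifts k - j and k + j.\<close>
    have one: "(\<Sum>c\<in>{1, \<i>}. x (j, c) * y (j, c)) = \<delta> * (kdot k (u j) * ?F (k - j) + cnj (kdot k (u j)) * ?F (k + j))" for j
      by (simp add: x_def y_def complex_eq_iff algebra_simps)
    have sw: "(\<Sum>j\<in>J. cnj (kdot k (u j)) * ?F (k + j)) = (\<Sum>j\<in>J. kdot k (u j) * ?F (k - j))"
      by (rule sum.reindex_bij_witness[of _ uminus uminus]) (auto simp: J u kdot_vcnj)
    have "(\<Sum>p\<in>?I. a * (\<i> / 2 * x p * y p)) = a * (\<i> / 2) * (\<Sum>j\<in>J. \<Sum>c\<in>{1, \<i>}. x (j, c) * y (j, c))"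
      unfolding sum.cartesian_product sum_distrib_left by (intro sum.cong) (auto simp: mult_ac)
    also have "\<dots> = a * (\<i> / 2) * (\<delta> * (2 * (\<Sum>j\<in>J. kdot k (u j) * ?F (k - j))))"
      unfolding one sum_distrib_left[symmetric] sum.distrib sw by simp
    also have "\<dots> = of_real (a * \<delta>) * (\<i> * (\<Sum>j\<in>J. kdot k (u j) * ?F (k - j)))" by simp
    finally show ?thesis unfolding a\<delta> by simp
  qed
  have "fcoef (transport_step J \<tau> u f) k - ?F k + \<tau> * (\<i> * (\<Sum>j\<in>J. kdot k (u j) * ?F (k - j)))
      = (\<Sum>p\<in>?I. a * (cos (x p) * ?F k - \<i> / 2 * sin (x p) * y p)) - (\<Sum>p\<in>?I. a * ?F k)
        + (\<Sum>p\<in>?I. a * (\<i> / 2 * x p * y p))"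
    unfolding e1 e2 e3 ..
  also have "\<dots> = (\<Sum>p\<in>?I. a * ((cos (x p) - 1) * ?F k - \<i> / 2 * (sin (x p) - x p) * y p))"
    unfolding sum_subtractf[symmetric] sum.distrib[symmetric]
    by (intro sum.cong refl) (simp add: algebra_simps)
  also have "cmod \<dots> \<le> (\<Sum>p\<in>?I. a * (B * (\<delta> * knorm k * U)\<^sup>2))"
  proof (rule sum_norm_le)
    fix p assume p: "p \<in> ?I"
    have c: "cmod (of_real (cos (x p) - 1) * ?F k) \<le> (x p)\<^sup>2 / 2 * B"
      unfolding norm_mult norm_of_real using one_minus_cos_le B by (intro mult_mono) auto
    have s: "cmod (\<i> / 2 * of_real (sin (x p) - x p) * y p) \<le> 1 / 2 * ((x p)\<^sup>2 / 2) * (2 * B)"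
      unfolding norm_mult norm_of_real using sin_minus_le yb[OF p] by (intro mult_mono) auto
    have "cmod (of_real (cos (x p) - 1) * ?F k - \<i> / 2 * of_real (sin (x p) - x p) * y p) \<le> (x p)\<^sup>2 / 2 * B + 1 / 2 * ((x p)\<^sup>2 / 2) * (2 * B)"
      using norm_triangle_ineq4 c s by (rule order_trans[OF _ add_mono])
    also have "\<dots> = B * (x p)\<^sup>2" by simp
    also have "\<dots> \<le> B * (\<delta> * knorm k * U)\<^sup>2" using xb[OF p] B0 by (rule mult_left_mono)
    finally show "cmod (a * ((cos (x p) - 1) * ?F k - \<i> / 2 * (sin (x p) - x p) * y p)) \<le> a * (B * (\<delta> * knorm k * U)\<^sup>2)"
      using a0 by (simp add: norm_mult mult_left_mono)
  qed
  also have "\<dots> = B * (\<delta> * knorm k * U)\<^sup>2" by (rule aI)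
  finally show ?thesis by (simp add: \<delta>_def)
qed

section \<open>The time-discrete Galerkin scheme\<close>

text \<open>Coefficients of (u . grad) v without the factor \<i>, which \<open>gal_source\<close>
  supplies. The wave vector k stands where differentiating v would give k - j; the two agree because
  j is orthogonal to u j for divergence-free u.\<close>

definition advect :: "wvec set \<Rightarrow> vfield \<Rightarrow> vfield \<Rightarrow> vfield" where
  "advect J u v k = (\<Sum>j\<in>J. kdot k (u j) *s v (k - j))"

definition gal_source :: "wvec set \<Rightarrow> vfield \<Rightarrow> vfield \<Rightarrow> sfield \<Rightarrow> vfield" where
  "gal_source J u v \<theta> k = leray k (\<theta> k *s axis e3 1 - \<i> *s advect J u v k)"

definition gal_rhs :: "wvec set \<Rightarrow> real \<Rightarrow> real \<Rightarrow> vfield \<Rightarrow> vfield \<Rightarrow> sfield \<Rightarrow> vfield" where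
  "gal_rhs J \<nu> \<beta> u v \<theta> k = gal_source J u v \<theta> k - (\<nu> * knorm k powr (2 * \<beta>)) *\<^sub>R v k"

definition gal_step :: "wvec set \<Rightarrow> real \<Rightarrow> real \<Rightarrow> real \<Rightarrow> vfield \<Rightarrow> vfield \<Rightarrow> sfield \<Rightarrow> vfield" where
  "gal_step J \<tau> \<nu> \<beta> u v \<theta> k = (if k \<in> J then v k + \<tau> *\<^sub>R gal_rhs J \<nu> \<beta> u v \<theta> k else 0)"

lemma real_vD:
  assumes "real_v w"
  shows "w 0 = 0" "w (- k) = vcnj (w k)" "kdot k (w k) = 0"
  using assms by (auto simp: real_v_def)

lemma advect_uminus:
  assumes J: "\<And>j. - j \<in> J \<longleftrightarrow> j \<in> J" and u: "real_v u" and v: "real_v v"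
  shows "advect J u v (- k) = - vcnj (advect J u v k)"
proof -
  have "advect J u v (- k) = (\<Sum>j\<in>J. kdot (- k) (u (- j)) *s v (- k - - j))"
    unfolding advect_def by (rule sum.reindex_bij_witness[of _ uminus uminus]) (auto simp: J)
  also have "\<dots> = (\<Sum>j\<in>J. - vcnj (kdot k (u j) *s v (k - j)))"
  proof (intro sum.cong refl)
    fix j
    have "- k - - j = - (k - j)" by simp
    then show "kdot (- k) (u (- j)) *s v (- k - - j) = - vcnj (kdot k (u j) *s v (k - j))"
      by (simp only: real_vD(2)[OF v] real_vD(2)[OF u] kdot_minus_left kdot_vcnj vcnj_smult complex_cnj_minus vector_smult_lneg)
  qed
  finally show ?thesis by (simp add: sum_negf advect_def vcnj_sum)
qed

text \<open>The involution sending (k, j) to (k - j, -j) turns each term into minus its conjugate,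
  so the sum is purely imaginary. Restricting to the pairs with k - j in J, outside which v
  vanishes, makes the index set invariant.\<close>

lemma energy_conservation:
  assumes J: "finite J" "\<And>j. - j \<in> J \<longleftrightarrow> j \<in> J" and u: "real_v u" and v: "\<And>k. k \<notin> J \<Longrightarrow> v k = 0"
  shows "(\<Sum>k\<in>J. Re (cdot (\<i> *s advect J u v k) (vcnj (v k)))) = 0"
proof -
  define t where "t p = \<i> * kdot (fst p) (u (snd p)) * cdot (v (fst p - snd p)) (vcnj (v (fst p)))" for p
  define P where "P = {p \<in> J \<times> J. fst p - snd p \<in> J}"
  have "(\<Sum>k\<in>J. cdot (\<i> *s advect J u v k) (vcnj (v k))) = (\<Sum>p\<in>J \<times> J. t p)"
    by (simp add: sum.cartesian_product' advect_def cdot_smult_left cdot_sum_left sum_distrib_left t_def mult.assoc)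
  also have "\<dots> = (\<Sum>p\<in>P. t p)"
    by (rule sum.mono_neutral_right) (use J v in \<open>auto simp: P_def t_def\<close>)
  finally have S: "(\<Sum>k\<in>J. cdot (\<i> *s advect J u v k) (vcnj (v k))) = (\<Sum>p\<in>P. t p)" .
  have "(\<Sum>p\<in>P. t p) = (\<Sum>p\<in>P. - cnj (t p))"
  proof (rule sum.reindex_bij_witness[of _ "\<lambda>p. (fst p - snd p, - snd p)" "\<lambda>p. (fst p - snd p, - snd p)"])
    fix p assume p: "p \<in> P"
    obtain k j where kj: "p = (k, j)" by (cases p)
    show "(fst p - snd p, - snd p) \<in> P" using p by (simp add: P_def mem_Times_iff J(2))
    have "kdot (k - j) (u (- j)) = cnj (kdot k (u j))"
      using real_vD(3)[OF u, of j] by (simp add: real_vD(2)[OF u] kdot_vcnj kdot_diff_left)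
    moreover have "cdot (v k) (vcnj (v (k - j))) = cnj (cdot (v (k - j)) (vcnj (v k)))"
      using cdot_vcnj[of "v (k - j)" "vcnj (v k)"] by (simp add: cdot_commute)
    ultimately show "- cnj (t (fst p - snd p, - snd p)) = t p"
      by (simp add: t_def kj)
  qed (simp_all add: P_def mem_Times_iff J(2))
  then have "Re (\<Sum>p\<in>P. t p) = Re (- cnj (\<Sum>p\<in>P. t p))"
    by (simp add: sum_negf)
  then have "Re (\<Sum>p\<in>P. t p) = 0" by simp
  then show ?thesis unfolding S[symmetric] Re_sum .
qed

lemma sum_shift_le:
  fixes v :: "wvec \<Rightarrow> 'a::real_normed_vector"
  assumes J: "finite J" and v: "\<And>k. k \<notin> J \<Longrightarrow> v k = 0"
  shows "(\<Sum>j\<in>J. (norm (v (k - j)))\<^sup>2) \<le> (\<Sum>j\<in>J. (norm (v j))\<^sup>2)"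
proof -
  have "(\<Sum>j\<in>J. (norm (v (k - j)))\<^sup>2) = (\<Sum>l\<in>(\<lambda>j. k - j) ` J. (norm (v l))\<^sup>2)"
    by (subst sum.reindex) (auto simp: inj_on_def)
  also have "\<dots> = (\<Sum>l\<in>(\<lambda>j. k - j) ` J \<inter> J. (norm (v l))\<^sup>2)"
    by (rule sum.mono_neutral_right) (use J v in auto)
  also have "\<dots> \<le> (\<Sum>j\<in>J. (norm (v j))\<^sup>2)"
    by (rule sum_mono2) (use J in auto)
  finally show ?thesis .
qed

lemma norm_advect_le_sum:
  "norm (advect J u v k) \<le> knorm k * (\<Sum>j\<in>J. norm (u j) * norm (v (k - j)))"
proof -
  have "norm (advect J u v k) \<le> (\<Sum>j\<in>J. knorm k * (norm (u j) * norm (v (k - j))))"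
    unfolding advect_def
    by (rule sum_norm_le) (simp add: norm_smult mult.assoc[symmetric] mult_right_mono norm_kdot_le)
  then show ?thesis by (simp add: sum_distrib_left)
qed

lemma norm_advect_le:
  assumes J: "finite J" and v: "\<And>k. k \<notin> J \<Longrightarrow> v k = 0" and uv: "\<And>k. norm (u k) \<le> norm (v k)"
  shows "norm (advect J u v k) \<le> knorm k * (\<Sum>j\<in>J. (norm (v j))\<^sup>2)"
proof -
  have "(\<Sum>j\<in>J. norm (u j) * norm (v (k - j))) \<le> (\<Sum>j\<in>J. ((norm (v j))\<^sup>2 + (norm (v (k - j)))\<^sup>2) / 2)"
  proof (rule sum_mono)
    fix j
    have "norm (u j) * norm (v (k - j)) \<le> norm (v j) * norm (v (k - j))"
      by (simp add: mult_right_mono uv)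
    also have "\<dots> \<le> ((norm (v j))\<^sup>2 + (norm (v (k - j)))\<^sup>2) / 2"
      using abs_mult_le_param[of 1 "norm (v j)" "norm (v (k - j))"] by simp
    finally show "norm (u j) * norm (v (k - j)) \<le> ((norm (v j))\<^sup>2 + (norm (v (k - j)))\<^sup>2) / 2" .
  qed
  also have "\<dots> = ((\<Sum>j\<in>J. (norm (v j))\<^sup>2) + (\<Sum>j\<in>J. (norm (v (k - j)))\<^sup>2)) / 2"
    by (simp add: sum.distrib sum_divide_distrib[symmetric])
  also have "\<dots> \<le> (\<Sum>j\<in>J. (norm (v j))\<^sup>2)"
    using sum_shift_le[of J v k, OF J v] by simp
  finally show ?thesis
    by (intro order_trans[OF norm_advect_le_sum] mult_left_mono) auto
qed

text \<open>Avoids square roots in the constants; it is the source of the recurring S + 1 and M +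
  1.\<close>

lemma le_add_1_if_square_le: "x \<le> S + 1" if "x\<^sup>2 \<le> S" for x S :: real
  using zero_le_power2[of "x - 1"] that by (simp add: power2_diff) (smt (verit) zero_le_power2)

lemma norm_axis_one: "norm (axis i (1::complex) :: complex ^ 'n) = 1"
proof -
  have "norm (axis i (1::complex) :: complex ^ 'n) = L2_set (\<lambda>l. if l = i then 1 else 0) UNIV"
    unfolding norm_vec_def by (intro L2_set_cong) (auto simp: axis_def)
  then show ?thesis by (simp add: L2_set_def if_distrib[of "\<lambda>x. x\<^sup>2"] cong: if_cong)
qed

lemma norm_gal_source_le:
  "norm (gal_source J u v \<theta> k) \<le> 2 * (cmod (\<theta> k) + norm (advect J u v k))"
proof -
  have "norm (\<theta> k *s axis e3 1 - \<i> *s advect J u v k) \<le> cmod (\<theta> k) + norm (advect J u v k)"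
    by (rule order_trans[OF norm_triangle_ineq4]) (simp add: norm_smult norm_axis_one)
  then show ?thesis
    unfolding gal_source_def by (intro order_trans[OF norm_leray_le] mult_left_mono) auto
qed

lemma norm_gal_rhs_le:
  assumes J: "finite J" and v: "\<And>k. k \<notin> J \<Longrightarrow> v k = 0" and uv: "\<And>k. norm (u k) \<le> norm (v k)"
    and S: "\<And>k. (cmod (\<theta> k))\<^sup>2 \<le> S" and M: "(\<Sum>j\<in>J. (norm (v j))\<^sup>2) \<le> M" and \<nu>: "0 \<le> \<nu>"
  shows "norm (gal_rhs J \<nu> \<beta> u v \<theta> k) \<le> 2 * (S + 1 + knorm k * M) + \<nu> * knorm k powr (2 * \<beta>) * (M + 1)"
proof -
  have "norm (advect J u v k) \<le> knorm k * M"
    by (rule order_trans[OF norm_advect_le[OF J v uv]]) (use M in \<open>auto intro: mult_left_mono\<close>)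
  then have 1: "norm (gal_source J u v \<theta> k) \<le> 2 * (S + 1 + knorm k * M)"
    using le_add_1_if_square_le[OF S[of k]]
    by (intro order_trans[OF norm_gal_source_le] mult_left_mono add_mono) auto
  have "norm (v k) \<le> M + 1"
  proof (rule le_add_1_if_square_le)
    show "(norm (v k))\<^sup>2 \<le> M"
    proof (cases "k \<in> J")
      case True
      then show ?thesis
        by (intro order_trans[OF member_le_sum[of k J "\<lambda>j. (norm (v j))\<^sup>2"] M]) (use J in auto)
    next
      case False
      then show ?thesis using order_trans[OF sum_nonneg M] v by auto
    qed
  qed
  then have "norm ((\<nu> * knorm k powr (2 * \<beta>)) *\<^sub>R v k) \<le> \<nu> * knorm k powr (2 * \<beta>) * (M + 1)"
    using \<nu> by (simp add: mult_left_mono)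
  with 1 show ?thesis
    unfolding gal_rhs_def by (intro order_trans[OF norm_triangle_ineq4]) linarith
qed

lemma real_v_gal_step:
  assumes J: "\<And>j. - j \<in> J \<longleftrightarrow> j \<in> J" "0 \<notin> J" and u: "real_v u" and v: "real_v v"
    and \<theta>: "\<And>k. \<theta> (- k) = cnj (\<theta> k)"
  shows "real_v (gal_step J \<tau> \<nu> \<beta> u v \<theta>)"
proof -
  have src: "gal_source J u v \<theta> (- k) = vcnj (gal_source J u v \<theta> k)" for k
  proof -
    have ax: "vcnj (axis e3 1) = axis e3 1" by (simp add: vcnj_def axis_def vec_eq_iff)
    have "\<theta> (- k) *s axis e3 1 - \<i> *s advect J u v (- k) = vcnj (\<theta> k *s axis e3 1 - \<i> *s advect J u v k)"
      unfolding \<theta> advect_uminus[OF J(1) u v] vcnj_diff vcnj_smult ax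
      by (simp add: vec_eq_iff)
    then show ?thesis unfolding gal_source_def leray_uminus_vcnj[symmetric] by simp
  qed
  have kd: "kdot k (gal_source J u v \<theta> k) = 0" if "k \<in> J" for k
    unfolding gal_source_def by (rule kdot_leray) (use that J in auto)
  show ?thesis
    unfolding real_v_def gal_step_def gal_rhs_def
    using J by (auto simp: src real_vD[OF v] vcnj_add vcnj_diff vcnj_scaleR kdot_add kdot_diff kdot_scaleR kd)
qed

text \<open>Advection drops out by \<open>energy_conservation\<close>, and the buoyancy is split
  into squares. Explicit Euler adds the error \<tau>^2 times the squared right-hand side; the
  smallness assumption reduces it to \<tau>, which accounts for the 1 in S + 1.\<close>

lemma energy_step:
  assumes J: "finite J" "\<And>j. - j \<in> J \<longleftrightarrow> j \<in> J" and u: "real_v u" and v: "real_v v" "\<And>k. k \<notin> J \<Longrightarrow> v k = 0"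
    and S: "(\<Sum>k\<in>J. (cmod (\<theta> k))\<^sup>2) \<le> S" and \<tau>: "0 \<le> \<tau>"
    and small: "\<tau> * (\<Sum>k\<in>J. (norm (gal_rhs J \<nu> \<beta> u v \<theta> k))\<^sup>2) \<le> 1"
  shows "(\<Sum>k\<in>J. (norm (gal_step J \<tau> \<nu> \<beta> u v \<theta> k))\<^sup>2) + 2 * \<tau> * \<nu> * (\<Sum>k\<in>J. (norm (v k))\<^sup>2 * knorm k powr (2 * \<beta>))
     \<le> (1 + \<tau>) * (\<Sum>k\<in>J. (norm (v k))\<^sup>2) + \<tau> * (S + 1)"
proof -
  let ?R = "gal_rhs J \<nu> \<beta> u v \<theta>"
  define E where "E = (\<Sum>k\<in>J. (norm (v k))\<^sup>2)"
  define D where "D = (\<Sum>k\<in>J. (norm (v k))\<^sup>2 * knorm k powr (2 * \<beta>))"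
  have R: "?R k \<bullet> v k = Re (\<theta> k * cnj (v k $ e3)) - Re (cdot (\<i> *s advect J u v k) (vcnj (v k)))
      - \<nu> * ((norm (v k))\<^sup>2 * knorm k powr (2 * \<beta>))" for k
  proof -
    have kd: "kdot k (vcnj (v k)) = 0" by (simp add: kdot_vcnj real_vD[OF v(1)])
    have "cdot (axis e3 1) (vcnj (v k)) = cnj (v k $ e3)"
      by (simp add: cdot_def vcnj_def axis_def if_distrib[of "\<lambda>x. x * _"] cong: if_cong)
    then show ?thesis
      unfolding gal_rhs_def gal_source_def inner_diff_left inner_eq_cdot[of "leray _ _"] cdot_leray[OF kd]
      by (simp add: cdot_diff_left cdot_smult_left power2_norm_eq_inner)
  qed
  have "(\<Sum>k\<in>J. ?R k \<bullet> v k) = (\<Sum>k\<in>J. Re (\<theta> k * cnj (v k $ e3))) - \<nu> * D"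
    using energy_conservation[of J u v, OF J u v(2)]
    by (simp add: R sum_subtractf D_def sum_distrib_left del: times_complex.sel)
  also have "(\<Sum>k\<in>J. Re (\<theta> k * cnj (v k $ e3))) \<le> (\<Sum>k\<in>J. ((cmod (\<theta> k))\<^sup>2 + (norm (v k))\<^sup>2) / 2)"
  proof (rule sum_mono)
    fix k
    have "Re (\<theta> k * cnj (v k $ e3)) \<le> cmod (\<theta> k) * cmod (v k $ e3)"
      using complex_Re_le_cmod[of "\<theta> k * cnj (v k $ e3)"] by (simp add: norm_mult)
    also have "\<dots> \<le> cmod (\<theta> k) * norm (v k)"
      by (intro mult_left_mono Finite_Cartesian_Product.norm_nth_le) auto
    also have "\<dots> \<le> ((cmod (\<theta> k))\<^sup>2 + (norm (v k))\<^sup>2) / 2"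
      using abs_mult_le_param[of 1 "cmod (\<theta> k)" "norm (v k)"] by simp
    finally show "Re (\<theta> k * cnj (v k $ e3)) \<le> ((cmod (\<theta> k))\<^sup>2 + (norm (v k))\<^sup>2) / 2" .
  qed
  also have "\<dots> \<le> (S + E) / 2"
    using S by (simp add: sum.distrib sum_divide_distrib[symmetric] E_def)
  finally have RV: "(\<Sum>k\<in>J. ?R k \<bullet> v k) \<le> (S + E) / 2 - \<nu> * D" by simp
  have sq: "(norm (a + \<tau> *\<^sub>R b))\<^sup>2 = (norm a)\<^sup>2 + 2 * \<tau> * (b \<bullet> a) + \<tau>\<^sup>2 * (norm b)\<^sup>2" for a b :: "complex ^ 3"
    unfolding power2_norm_eq_inner
    by (simp add: inner_add_left inner_add_right inner_commute[of a b] power2_eq_square algebra_simps)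
  have "(\<Sum>k\<in>J. (norm (gal_step J \<tau> \<nu> \<beta> u v \<theta> k))\<^sup>2) = (\<Sum>k\<in>J. (norm (v k))\<^sup>2 + 2 * \<tau> * (?R k \<bullet> v k) + \<tau>\<^sup>2 * (norm (?R k))\<^sup>2)"
    by (intro sum.cong refl) (simp only: gal_step_def if_True sq)
  also have "\<dots> = E + 2 * \<tau> * (\<Sum>k\<in>J. ?R k \<bullet> v k) + \<tau> * (\<tau> * (\<Sum>k\<in>J. (norm (?R k))\<^sup>2))"
    by (simp add: sum.distrib sum_distrib_left E_def power2_eq_square mult_ac)
  also have "\<dots> \<le> E + 2 * \<tau> * ((S + E) / 2 - \<nu> * D) + \<tau> * 1"
    using RV small \<tau> by (intro add_mono mult_left_mono) auto
  also have "\<dots> = (1 + \<tau>) * E + \<tau> * (S + 1) - 2 * \<tau> * \<nu> * D"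
    by (simp add: field_simps)
  finally show ?thesis
    unfolding E_def[symmetric] D_def[symmetric] by simp
qed

text \<open>The restriction on \<tau> keeps the factor 1 - \<tau> \<nu> |k|^(2 \<beta>) nonnegative,
  so damping acts on the norm itself. Summed over the steps this becomes
  \<open>damping_sum\<close>.\<close>

lemma norm_gal_step_le:
  assumes "k \<in> J" "0 \<le> \<tau>" "\<tau> * (\<nu> * knorm k powr (2 * \<beta>)) \<le> 1"
  shows "norm (gal_step J \<tau> \<nu> \<beta> u v \<theta> k) \<le> norm (v k) - \<tau> * (\<nu> * knorm k powr (2 * \<beta>)) * norm (v k) + \<tau> * norm (gal_source J u v \<theta> k)"
proof -
  let ?l = "\<tau> * (\<nu> * knorm k powr (2 * \<beta>))"
  have "gal_step J \<tau> \<nu> \<beta> u v \<theta> k = (1 - ?l) *\<^sub>R v k + \<tau> *\<^sub>R gal_source J u v \<theta> k"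
    using assms(1) by (simp add: gal_step_def gal_rhs_def algebra_simps)
  then have "norm (gal_step J \<tau> \<nu> \<beta> u v \<theta> k) \<le> (1 - ?l) * norm (v k) + \<tau> * norm (gal_source J u v \<theta> k)"
    using norm_triangle_ineq[of "(1 - ?l) *\<^sub>R v k" "\<tau> *\<^sub>R gal_source J u v \<theta> k"] assms(2,3) by simp
  then show ?thesis by (simp add: algebra_simps)
qed

definition scheme_step :: "wvec set \<Rightarrow> real \<Rightarrow> real \<Rightarrow> real \<Rightarrow> real \<Rightarrow> vfield \<times> (real ^ 3 \<Rightarrow> real) \<Rightarrow> vfield \<times> (real ^ 3 \<Rightarrow> real)" where
  "scheme_step J \<tau> \<alpha> \<beta> \<nu> p =
    (gal_step J \<tau> \<nu> \<beta> (lam_v (- 2 * \<alpha>) (fst p)) (fst p) (fcoef (snd p)), transport_step J \<tau> (lam_v (- 2 * \<alpha>) (fst p)) (snd p))"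

text \<open>M is the Gronwall bound for the energy up to time T. The first smallness condition makes
  the Euler error harmless; it is stated with the worst right-hand side allowed by M, so it does not
  depend on the iterates. The second is the stability condition for the explicit treatment of
  dissipation.\<close>

locale scheme =
  fixes J :: "wvec set" and \<tau> \<alpha> \<beta> \<nu> T :: real and w0 :: vfield and f0 :: "real ^ 3 \<Rightarrow> real" and S E0 M :: real
  assumes J: "finite J" "J \<noteq> {}" "\<And>j. - j \<in> J \<longleftrightarrow> j \<in> J" "0 \<notin> J"
    and par: "0 \<le> \<tau>" "0 \<le> \<alpha>" "0 < \<nu>" "0 \<le> T"
    and w0: "real_v w0" "\<And>k. k \<notin> J \<Longrightarrow> w0 k = 0" "(\<Sum>k\<in>J. (norm (w0 k))\<^sup>2) \<le> E0"
    and f0: "cperiodic f0" "fcoef f0 0 = 0" "(\<integral>x. (f0 x)\<^sup>2 \<partial>LT) / (2 * pi) ^ 3 \<le> S"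
    and M: "M = exp T * (E0 + S + 1)"
    and small: "\<tau> * (\<Sum>k\<in>J. (2 * (S + 1 + knorm k * M) + \<nu> * knorm k powr (2 * \<beta>) * (M + 1))\<^sup>2) \<le> 1"
      "\<And>k. k \<in> J \<Longrightarrow> \<tau> * (\<nu> * knorm k powr (2 * \<beta>)) \<le> 1"
begin

definition V :: "nat \<Rightarrow> vfield" where "V n = fst ((scheme_step J \<tau> \<alpha> \<beta> \<nu> ^^ n) (w0, f0))"
definition G :: "nat \<Rightarrow> real ^ 3 \<Rightarrow> real" where "G n = snd ((scheme_step J \<tau> \<alpha> \<beta> \<nu> ^^ n) (w0, f0))"
abbreviation U :: "nat \<Rightarrow> vfield" where "U n \<equiv> lam_v (- 2 * \<alpha>) (V n)"

lemma V_0: "V 0 = w0" and G_0: "G 0 = f0"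
  by (simp_all add: V_def G_def)

lemma V_Suc: "V (Suc n) = gal_step J \<tau> \<nu> \<beta> (U n) (V n) (fcoef (G n))"
  and G_Suc: "G (Suc n) = transport_step J \<tau> (U n) (G n)"
  by (simp_all add: V_def G_def scheme_step_def)

lemma real_v_V: "real_v (V n)"
  by (induction n) (auto simp: V_0 w0 V_Suc intro!: real_v_gal_step J real_v_lam_v fcoef_uminus)

lemma V_outside: "k \<notin> J \<Longrightarrow> V n k = 0"
  by (cases n) (auto simp: V_0 w0 V_Suc gal_step_def)

lemma real_v_U: "real_v (U n)"
  by (intro real_v_lam_v real_v_V)

lemma norm_U_le: "norm (U n k) \<le> norm (V n k)"
  by (rule norm_lam_v_le) (rule par)

lemma cperiodic_G: "cperiodic (G n)"
  by (induction n) (auto simp: G_0 f0 G_Suc intro!: cperiodic_transport_step)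

lemma integral_convex_G_le:
  assumes "convex_on UNIV \<phi>" shows "(\<integral>x. \<phi> (G n x) \<partial>LT) \<le> (\<integral>x. \<phi> (f0 x) \<partial>LT)"
proof (induction n)
  case (Suc n)
  have "(\<integral>x. \<phi> (G (Suc n) x) \<partial>LT) \<le> (\<integral>x. \<phi> (G n x) \<partial>LT)"
    unfolding G_Suc
    by (rule integral_convex_transport_step_le[OF cperiodic_G J(1,2) real_vD(3)[OF real_v_U] assms])
  with Suc show ?case by linarith
qed (simp add: G_0)

lemma sum_fcoef_G_le: "finite F \<Longrightarrow> (\<Sum>k\<in>F. (cmod (fcoef (G n) k))\<^sup>2) \<le> S"
proof -
  assume F: "finite F"
  have sq: "(\<lambda>x::real. \<bar>x\<bar> powr 2) = (\<lambda>x. x\<^sup>2)" by (auto simp: fun_eq_iff powr_numeral)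
  have i2: "integrable LT (\<lambda>x. (G n x)\<^sup>2)"
    by (intro integrable_LT_cperiodic cperiodic_compose[OF cperiodic_G] continuous_intros)
  have "(\<Sum>k\<in>F. (cmod (fcoef (G n) k))\<^sup>2) \<le> (\<integral>x. (G n x)\<^sup>2 \<partial>LT) / (2 * pi) ^ 3"
    by (rule fcoef_square_bound[OF borel_measurable_cperiodic[OF cperiodic_G] i2 F])
  also have "\<dots> \<le> (\<integral>x. (f0 x)\<^sup>2 \<partial>LT) / (2 * pi) ^ 3"
    using integral_convex_G_le[OF convex_on_abs_powr[of 2], of n] unfolding sq by (intro divide_right_mono) auto
  also have "\<dots> \<le> S" by (rule f0)
  finally show ?thesis .
qed

lemma fcoef_G_le: "(cmod (fcoef (G n) k))\<^sup>2 \<le> S" "cmod (fcoef (G n) k) \<le> S + 1"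
  using sum_fcoef_G_le[of "{k}" n] by (auto intro: le_add_1_if_square_le)

lemma S_nonneg: "0 \<le> S"
  using sum_fcoef_G_le[of "{}" 0] by simp

lemma E0_nonneg: "0 \<le> E0"
  by (rule order_trans[OF sum_nonneg w0(3)]) auto

definition E :: "nat \<Rightarrow> real" where "E n = (\<Sum>k\<in>J. (norm (V n k))\<^sup>2)"
definition D :: "nat \<Rightarrow> real" where "D n = (\<Sum>k\<in>J. (norm (V n k))\<^sup>2 * knorm k powr (2 * \<beta>))"

lemma D_nonneg: "0 \<le> D n"
  by (simp add: D_def sum_nonneg)

lemma energy_Suc:
  assumes "E n \<le> M"
  shows "E (Suc n) + 2 * \<tau> * \<nu> * D n \<le> (1 + \<tau>) * E n + \<tau> * (S + 1)"
proof -
  have "\<tau> * (\<Sum>k\<in>J. (norm (gal_rhs J \<nu> \<beta> (U n) (V n) (fcoef (G n)) k))\<^sup>2)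
     \<le> \<tau> * (\<Sum>k\<in>J. (2 * (S + 1 + knorm k * M) + \<nu> * knorm k powr (2 * \<beta>) * (M + 1))\<^sup>2)"
    using assms par
    by (intro mult_left_mono sum_mono power_mono norm_gal_rhs_le J V_outside norm_U_le fcoef_G_le) (auto simp: E_def)
  then show ?thesis
    unfolding E_def D_def V_Suc
    using small(1) by (intro energy_step J real_v_U real_v_V V_outside sum_fcoef_G_le par) auto
qed

lemma exp_ge_power: "(1 + \<tau>) ^ n \<le> exp T" if "n * \<tau> \<le> T"
proof -
  have "(1 + \<tau>) ^ n \<le> exp \<tau> ^ n" using par by (intro power_mono) (auto simp: exp_ge_add_one_self add.commute)
  also have "\<dots> = exp (n * \<tau>)" by (simp add: exp_of_nat_mult)
  also have "\<dots> \<le> exp T" using that by simp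
  finally show ?thesis .
qed

lemma E_le_M: "E n \<le> M" if "n * \<tau> \<le> T" "E n + (S + 1) \<le> (1 + \<tau>) ^ n * (E0 + S + 1)"
proof -
  have "(1 + \<tau>) ^ n * (E0 + S + 1) \<le> M"
    unfolding M by (rule mult_right_mono[OF exp_ge_power[OF that(1)]]) (use S_nonneg E0_nonneg in simp)
  then show ?thesis using that(2) S_nonneg by linarith
qed

text \<open>Discrete Gronwall. The energy step is available only while E n \<le> M, and that bound
  is itself drawn from the induction hypothesis via n \<tau> \<le> T.\<close>

lemma E_growth: "n * \<tau> \<le> T \<Longrightarrow> E n + (S + 1) \<le> (1 + \<tau>) ^ n * (E0 + S + 1)"
proof (induction n)
  case 0
  then show ?case using w0(3) by (simp add: E_def V_0)
next
  case (Suc n)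
  have n: "n * \<tau> \<le> T" using Suc.prems par by (simp add: algebra_simps)
  note IH = Suc.IH[OF n]
  have "E n \<le> M"
    by (rule E_le_M[OF n IH])
  then have "E (Suc n) + (S + 1) \<le> (1 + \<tau>) * (E n + (S + 1))"
  proof -
    have "0 \<le> 2 * \<tau> * \<nu> * D n" using D_nonneg[of n] par by (intro mult_nonneg_nonneg) auto
    then show ?thesis using energy_Suc[OF \<open>E n \<le> M\<close>] by (simp add: algebra_simps)
  qed
  also have "\<dots> \<le> (1 + \<tau>) * ((1 + \<tau>) ^ n * (E0 + S + 1))"
    using IH par by (intro mult_left_mono) auto
  finally show ?case by simp
qed

lemma E_le: "n * \<tau> \<le> T \<Longrightarrow> E n \<le> M"
  by (rule E_le_M[OF _ E_growth])

lemma M_nonneg: "0 \<le> M"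
  using S_nonneg E0_nonneg by (simp add: M)

lemma norm_V_le: "n * \<tau> \<le> T \<Longrightarrow> norm (V n k) \<le> M + 1"
proof (rule le_add_1_if_square_le)
  assume n: "n * \<tau> \<le> T"
  show "(norm (V n k))\<^sup>2 \<le> M"
  proof (cases "k \<in> J")
    case True
    then have "(norm (V n k))\<^sup>2 \<le> E n"
      unfolding E_def by (intro member_le_sum) (use J in auto)
    then show ?thesis using E_le[OF n] by simp
  qed (use M_nonneg V_outside in simp)
qed

lemma sum_D_le: "n * \<tau> \<le> T \<Longrightarrow> E n + 2 * \<nu> * (\<tau> * (\<Sum>m<n. D m)) \<le> E0 + n * \<tau> * (M + S + 1)"
proof (induction n)
  case 0
  then show ?case using w0(3) by (simp add: E_def V_0)
next
  case (Suc n)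
  have n: "n * \<tau> \<le> T" using Suc.prems par by (simp add: algebra_simps)
  have "\<tau> * E n \<le> \<tau> * M" using E_le[OF n] par by (intro mult_left_mono) auto
  then show ?case
    using Suc.IH[OF n] energy_Suc[OF E_le[OF n]] by (simp add: algebra_simps)
qed

lemma V_eq_sum: "k \<in> J \<Longrightarrow> V n k = w0 k + (\<Sum>m<n. \<tau> *\<^sub>R gal_rhs J \<nu> \<beta> (U m) (V m) (fcoef (G m)) k)"
  by (induction n) (auto simp: V_0 V_Suc gal_step_def)

lemma fcoef_G_step:
  assumes n: "n * \<tau> \<le> T"
  shows "cmod (fcoef (G (Suc n)) k - fcoef (G n) k + \<tau> * (\<i> * (\<Sum>j\<in>J. kdot k (U n j) * fcoef (G n) (k - j))))
     \<le> (S + 1) * (2 * real (card J) * \<tau> * knorm k * (M + 1))\<^sup>2"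
  unfolding G_Suc
  by (rule fcoef_transport_step[OF cperiodic_G J(1-3) real_vD(3)[OF real_v_U] real_vD(2)[OF real_v_U]
        order_trans[OF norm_U_le norm_V_le[OF n]] fcoef_G_le(2) par(1)])

lemma fcoef_G_eq_sum:
  "n * \<tau> \<le> T \<Longrightarrow> cmod (fcoef (G n) k - fcoef f0 k + (\<Sum>m<n. \<tau> * (\<i> * (\<Sum>j\<in>J. kdot k (U m j) * fcoef (G m) (k - j)))))
     \<le> n * ((S + 1) * (2 * real (card J) * \<tau> * knorm k * (M + 1))\<^sup>2)"
proof (induction n)
  case (Suc n)
  have n: "n * \<tau> \<le> T" using Suc.prems par by (simp add: algebra_simps)
  have "fcoef (G (Suc n)) k - fcoef f0 k + (\<Sum>m<Suc n. \<tau> * (\<i> * (\<Sum>j\<in>J. kdot k (U m j) * fcoef (G m) (k - j))))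
      = (fcoef (G n) k - fcoef f0 k + (\<Sum>m<n. \<tau> * (\<i> * (\<Sum>j\<in>J. kdot k (U m j) * fcoef (G m) (k - j)))))
       + (fcoef (G (Suc n)) k - fcoef (G n) k + \<tau> * (\<i> * (\<Sum>j\<in>J. kdot k (U n j) * fcoef (G n) (k - j))))"
    by simp
  then show ?case
    using norm_triangle_mono[OF Suc.IH[OF n] fcoef_G_step[OF n, of k]]
    by (simp only: of_nat_Suc distrib_right mult_1_left add.commute)
qed (simp add: G_0)

text \<open>The accumulated error bound carries the factor \<open>knorm k\<close> and so vanishes at
  k = 0: the mean is conserved exactly.\<close>

lemma fcoef_G_0: "fcoef (G n) 0 = 0" if "n * \<tau> \<le> T"
  using fcoef_G_eq_sum[OF that, of 0] f0(2) by (simp add: kdot_def)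

text \<open>Working with the norm instead of its square gives only an L_1 bound in time but gains
  the full weight |k|^(2 \<beta>) for each mode, twice the order that the energy offers. This is
  what keeps the dissipation term convergent for large \<beta>.\<close>

lemma damping_sum:
  assumes k: "k \<in> J"
  shows "norm (V n k) + \<nu> * knorm k powr (2 * \<beta>) * (\<tau> * (\<Sum>m<n. norm (V m k)))
      \<le> norm (w0 k) + \<tau> * (\<Sum>m<n. norm (gal_source J (U m) (V m) (fcoef (G m)) k))"
proof (induction n)
  case (Suc n)
  have "norm (V (Suc n) k) \<le> norm (V n k) - \<tau> * (\<nu> * knorm k powr (2 * \<beta>)) * norm (V n k)
      + \<tau> * norm (gal_source J (U n) (V n) (fcoef (G n)) k)"
    unfolding V_Suc by (rule norm_gal_step_le[OF k par(1) small(2)[OF k]])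
  with Suc show ?case by (simp add: algebra_simps)
qed (simp add: V_0)

end

section \<open>From time steps to functions of continuous time\<close>

lemma measurable_nat_floor: "(\<lambda>t::real. nat \<lfloor>t / \<tau>\<rfloor>) \<in> measurable borel (count_space UNIV)"
  by measurable

lemma borel_measurable_step: "(\<lambda>t::real. F (nat \<lfloor>t / \<tau>\<rfloor>)) \<in> borel_measurable borel"
  by (rule measurable_compose[OF measurable_nat_floor]) simp

lemma integral_step:
  fixes F :: "nat \<Rightarrow> 'b::{banach, second_countable_topology}"
  assumes \<tau>: "0 < \<tau>" and t: "0 \<le> t" and n: "n = nat \<lfloor>t / \<tau>\<rfloor>"
  shows "set_integrable lborel {0..t} (\<lambda>s. F (nat \<lfloor>s / \<tau>\<rfloor>))"
    and "(LINT s:{0..t}|lborel. F (nat \<lfloor>s / \<tau>\<rfloor>)) = (\<Sum>m<n. \<tau> *\<^sub>R F m) + (t - n * \<tau>) *\<^sub>R F n"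
proof -
  \<comment> \<open>Half-open cells up to n, then a closed last cell cut off at t. If t is a grid
    point, the last cell is a single point and contributes nothing.\<close>
  define A where "A m = (if m < n then {m * \<tau>..<(real m + 1) * \<tau>} else {n * \<tau>..t})" for m :: nat
  have nt: "n * \<tau> \<le> t" "t < (real n + 1) * \<tau>"
  proof -
    have z: "0 \<le> t / \<tau>" using \<tau> t by simp
    then have "real n = real_of_int \<lfloor>t / \<tau>\<rfloor>" by (simp add: n)
    then have "real n \<le> t / \<tau>" "t / \<tau> < real n + 1" by linarith+
    then show "n * \<tau> \<le> t" "t < (real n + 1) * \<tau>" using \<tau> by (simp_all add: field_simps)
  qed
  have fl: "nat \<lfloor>s / \<tau>\<rfloor> = m \<longleftrightarrow> m * \<tau> \<le> s \<and> s < (real m + 1) * \<tau>" if "0 \<le> s" for s and m :: nat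
  proof -
    have z: "0 \<le> s / \<tau>" using \<tau> that by simp
    have "nat \<lfloor>s / \<tau>\<rfloor> = m \<longleftrightarrow> \<lfloor>s / \<tau>\<rfloor> = int m" using z by auto
    also have "\<dots> \<longleftrightarrow> real m \<le> s / \<tau> \<and> s / \<tau> < real m + 1" by (simp add: floor_eq_iff)
    also have "\<dots> \<longleftrightarrow> m * \<tau> \<le> s \<and> s < (real m + 1) * \<tau>" using \<tau> by (simp add: field_simps)
    finally show ?thesis .
  qed
  have mon: "(real m + 1) * \<tau> \<le> real n * \<tau>" if "m < n" for m
    using that \<tau> by (intro mult_right_mono) auto
  have eq: "indicator {0..t} s *\<^sub>R F (nat \<lfloor>s / \<tau>\<rfloor>) = (\<Sum>m\<le>n. indicator (A m) s *\<^sub>R F m)" for s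
  proof (cases "s \<in> {0..t}")
    case True
    then have s: "0 \<le> s" "s \<le> t" by auto
    define l where "l = nat \<lfloor>s / \<tau>\<rfloor>"
    have l: "l * \<tau> \<le> s" "s < (real l + 1) * \<tau>" using fl[OF s(1), of l] by (auto simp: l_def)
    have "l < n + 1"
    proof (rule ccontr)
      assume "\<not> l < n + 1"
      then have "(real n + 1) * \<tau> \<le> real l * \<tau>" using \<tau> by (intro mult_right_mono) auto
      then show False using l s nt by linarith
    qed
    then have ln: "l \<le> n" by simp
    have "indicator (A m) s = (if m = l then 1 else 0 :: real)" if "m \<le> n" for m
    proof -
      have "s \<in> A m \<longleftrightarrow> m * \<tau> \<le> s \<and> s < (real m + 1) * \<tau>"
        using that s nt by (auto simp: A_def not_less)
      also have "\<dots> \<longleftrightarrow> m = l" using fl[OF s(1), of m] by (auto simp: l_def)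
      finally show ?thesis by (simp add: indicator_def)
    qed
    then have "(\<Sum>m\<le>n. indicator (A m) s *\<^sub>R F m) = (\<Sum>m\<le>n. if m = l then F m else 0)"
      by (intro sum.cong) auto
    then show ?thesis using True ln by (simp add: l_def)
  next
    case False
    have "s \<notin> A m" if "m \<le> n" for m
    proof
      assume "s \<in> A m"
      have p: "0 \<le> real m * \<tau>" "0 \<le> real n * \<tau>" using \<tau> by simp_all
      have "0 \<le> s \<and> s \<le> t"
      proof (cases "m < n")
        case True
        then have "real m * \<tau> \<le> s" "s < (real m + 1) * \<tau>" using \<open>s \<in> A m\<close> by (auto simp: A_def)
        then show ?thesis using mon[OF True] nt p by (intro conjI; linarith)
      next
        case False
        then have "real n * \<tau> \<le> s" "s \<le> t" using \<open>s \<in> A m\<close> by (auto simp: A_def)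
        then show ?thesis using p by (intro conjI; linarith)
      qed
      then show False using False by simp
    qed
    then show ?thesis using False by simp
  qed
  have emA: "emeasure lborel (A m) < \<infinity>" and meA: "measure lborel (A m) = (if m < n then \<tau> else t - n * \<tau>)" for m
    using \<tau> nt by (auto simp: A_def measure_def algebra_simps)
  have iA: "integrable lborel (\<lambda>s. indicator (A m) s *\<^sub>R F m)" for m
    using emA[of m] by (intro integrable_scaleR_left integrable_real_indicator) (auto simp: A_def)
  show "set_integrable lborel {0..t} (\<lambda>s. F (nat \<lfloor>s / \<tau>\<rfloor>))"
    unfolding set_integrable_def eq by (intro Bochner_Integration.integrable_sum iA)
  have vA: "(\<integral>s. indicator (A m) s *\<^sub>R F m \<partial>lborel) = measure lborel (A m) *\<^sub>R F m" for m
    using emA[of m] by (subst integral_scaleR_left) (auto simp: A_def)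
  have "(LINT s:{0..t}|lborel. F (nat \<lfloor>s / \<tau>\<rfloor>)) = (\<Sum>m\<le>n. measure lborel (A m) *\<^sub>R F m)"
    unfolding set_lebesgue_integral_def eq by (simp only: Bochner_Integration.integral_sum[OF iA] vA)
  also have "\<dots> = (\<Sum>m<n. \<tau> *\<^sub>R F m) + (t - n * \<tau>) *\<^sub>R F n"
    by (simp add: meA lessThan_Suc_atMost[symmetric])
  finally show "(LINT s:{0..t}|lborel. F (nat \<lfloor>s / \<tau>\<rfloor>)) = (\<Sum>m<n. \<tau> *\<^sub>R F m) + (t - n * \<tau>) *\<^sub>R F n" .
qed

lemma ennreal_sum_bounded:
  fixes f :: "'i::countable \<Rightarrow> real"
  assumes f: "\<And>k. 0 \<le> f k" and fin: "(\<integral>\<^sup>+k. ennreal (f k) \<partial>count_space UNIV) < \<infinity>"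
  obtains A where "0 \<le> A" "\<And>F. finite F \<Longrightarrow> sum f F \<le> A"
proof
  let ?A = "enn2real (\<integral>\<^sup>+k. ennreal (f k) \<partial>count_space UNIV)"
  show "0 \<le> ?A" by simp
  fix F :: "'i set" assume F: "finite F"
  have "ennreal (sum f F) = (\<Sum>k\<in>F. ennreal (f k))" using f by simp
  also have "\<dots> = (\<integral>\<^sup>+k. ennreal (f k) * indicator F k \<partial>count_space UNIV)"
    using F by (subst nn_integral_count_space'[of F]) (auto simp: indicator_def)
  also have "\<dots> \<le> (\<integral>\<^sup>+k. ennreal (f k) \<partial>count_space UNIV)"
    by (intro nn_integral_mono) (auto simp: indicator_def)
  also have "\<dots> = ennreal ?A" using fin by simp
  finally show "sum f F \<le> ?A" by (simp del: ennreal_enn2real_if)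
qed

lemma in_V_0_bounded:
  assumes "in_V 0 w"
  obtains A where "0 \<le> A" "\<And>F. finite F \<Longrightarrow> (\<Sum>k\<in>F. (norm (w k))\<^sup>2) \<le> A"
proof -
  have w: "real_v w" and fin: "(\<integral>\<^sup>+k. ennreal ((norm (w k))\<^sup>2 * knorm k powr (2 * 0)) \<partial>count_space UNIV) < \<infinity>"
    using assms by (auto simp: in_V_def vsq_eq)
  have "(\<lambda>k. ennreal ((norm (w k))\<^sup>2 * knorm k powr (2 * 0))) = (\<lambda>k. ennreal ((norm (w k))\<^sup>2))"
  proof
    \<comment> \<open>At k = 0 the weight \<open>0 powr 0\<close> equals 0 and not 1; the two sides
      agree there only because w 0 = 0.\<close>
    fix k show "ennreal ((norm (w k))\<^sup>2 * knorm k powr (2 * 0)) = ennreal ((norm (w k))\<^sup>2)"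
      using knorm_pos[of k] real_vD(1)[OF w] by (cases "k = 0") auto
  qed
  then have "(\<integral>\<^sup>+k. ennreal ((norm (w k))\<^sup>2) \<partial>count_space UNIV) < \<infinity>" using fin by (simp only:)
  then show thesis using ennreal_sum_bounded[of "\<lambda>k. (norm (w k))\<^sup>2"] that by auto
qed

text \<open>Interface between scheme and limit passage: integral equations in continuous time up to
  an error depending on the mode, so that the compactness argument sees neither \<tau> nor the
  recursion. The last clause is the time-integrated damping bound.\<close>

definition approx_solution ::
  "real \<Rightarrow> real \<Rightarrow> real \<Rightarrow> real \<Rightarrow> vfield \<Rightarrow> (real ^ 3 \<Rightarrow> real) \<Rightarrow> wvec set \<Rightarrow> real \<Rightarrow> real \<Rightarrow> real \<Rightarrow> (wvec \<Rightarrow> real)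
    \<Rightarrow> (real \<Rightarrow> vfield) \<Rightarrow> (real \<Rightarrow> real ^ 3 \<Rightarrow> real) \<Rightarrow> bool" where
  "approx_solution \<alpha> \<beta> \<nu> T v0 th0 J M S C err V G \<longleftrightarrow>
    (\<forall>k. (\<lambda>t. V t k) \<in> borel_measurable borel) \<and>
    (\<forall>k. (\<lambda>t. fcoef (G t) k) \<in> borel_measurable borel) \<and>
    (\<forall>t\<in>{0..T}. real_v (V t) \<and> (\<forall>k. k \<notin> J \<longrightarrow> V t k = 0) \<and> (\<Sum>k\<in>J. (norm (V t k))\<^sup>2) \<le> M) \<and>
    (\<integral>\<^sup>+t\<in>{0..T}. ennreal (\<Sum>k\<in>J. (norm (V t k))\<^sup>2 * knorm k powr (2 * \<beta>)) \<partial>lborel) \<le> ennreal C \<and>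
    (\<forall>t\<in>{0..T}. cperiodic (G t) \<and> fcoef (G t) 0 = 0 \<and> (\<forall>F. finite F \<longrightarrow> (\<Sum>k\<in>F. (cmod (fcoef (G t) k))\<^sup>2) \<le> S)) \<and>
    (\<forall>t\<in>{0..T}. \<forall>\<phi>. convex_on UNIV \<phi> \<longrightarrow> integrable LT (\<lambda>x. \<phi> (th0 x)) \<longrightarrow> (\<integral>x. \<phi> (G t x) \<partial>LT) \<le> (\<integral>x. \<phi> (th0 x) \<partial>LT)) \<and>
    (\<forall>t\<in>{0..T}. \<forall>k\<in>J. norm (V t k - v0 k
        - (LINT s:{0..t}|lborel. gal_rhs J \<nu> \<beta> (lam_v (- 2 * \<alpha>) (V s)) (V s) (fcoef (G s)) k)) \<le> err k) \<and>
    (\<forall>t\<in>{0..T}. \<forall>k. norm (fcoef (G t) k - fcoef th0 k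
        + (LINT s:{0..t}|lborel. \<i> * (\<Sum>j\<in>J. kdot k (lam_v (- 2 * \<alpha>) (V s) j) * fcoef (G s) (k - j)))) \<le> err k) \<and>
    (\<forall>k\<in>J. \<nu> * knorm k powr (2 * \<beta>) * (LINT s:{0..T}|lborel. norm (V s k))
        \<le> norm (v0 k) + (LINT s:{0..T}|lborel. norm (gal_source J (lam_v (- 2 * \<alpha>) (V s)) (V s) (fcoef (G s)) k)))"

lemma norm_transport_sum_le:
  assumes J: "finite J" and uv: "\<And>k. norm (u k) \<le> norm (v k)" and M: "(\<Sum>j\<in>J. (norm (v j))\<^sup>2) \<le> M"
    and S: "\<And>F. finite F \<Longrightarrow> (\<Sum>k\<in>F. (cmod (\<theta> k))\<^sup>2) \<le> S"
  shows "cmod (\<i> * (\<Sum>j\<in>J. kdot k (u j) * \<theta> (k - j))) \<le> knorm k * (M + S)"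
proof -
  have "cmod (\<Sum>j\<in>J. kdot k (u j) * \<theta> (k - j)) \<le> (\<Sum>j\<in>J. knorm k * (((norm (v j))\<^sup>2 + (cmod (\<theta> (k - j)))\<^sup>2) / 2))"
  proof (rule sum_norm_le)
    fix j
    have "cmod (kdot k (u j) * \<theta> (k - j)) \<le> (knorm k * norm (v j)) * cmod (\<theta> (k - j))"
      unfolding norm_mult
      by (intro mult_right_mono order_trans[OF norm_kdot_le] mult_left_mono uv) auto
    also have "\<dots> \<le> knorm k * (((norm (v j))\<^sup>2 + (cmod (\<theta> (k - j)))\<^sup>2) / 2)"
      using abs_mult_le_param[of 1 "norm (v j)" "cmod (\<theta> (k - j))"] by (simp add: mult.assoc mult_left_mono)
    finally show "cmod (kdot k (u j) * \<theta> (k - j)) \<le> knorm k * (((norm (v j))\<^sup>2 + (cmod (\<theta> (k - j)))\<^sup>2) / 2)" .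
  qed
  also have "\<dots> = knorm k * (((\<Sum>j\<in>J. (norm (v j))\<^sup>2) + (\<Sum>j\<in>J. (cmod (\<theta> (k - j)))\<^sup>2)) / 2)"
    by (simp add: sum_distrib_left[symmetric] sum_divide_distrib[symmetric] sum.distrib)
  also have "(\<Sum>j\<in>J. (cmod (\<theta> (k - j)))\<^sup>2) = (\<Sum>l\<in>(\<lambda>j. k - j) ` J. (cmod (\<theta> l))\<^sup>2)"
    by (subst sum.reindex) (auto simp: inj_on_def)
  also have "\<dots> \<le> S"
    by (rule S) (simp add: J)
  finally have "cmod (\<Sum>j\<in>J. kdot k (u j) * \<theta> (k - j)) \<le> knorm k * (((\<Sum>j\<in>J. (norm (v j))\<^sup>2) + S) / 2)"
    by (simp add: mult_left_mono divide_right_mono)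
  also have "\<dots> \<le> knorm k * (M + S)"
    using M S[of "{}"] order_trans[OF sum_nonneg M] by (intro mult_left_mono) auto
  finally show ?thesis by (simp add: norm_mult)
qed

context scheme
begin

lemma norm_rhs_le:
  assumes "n * \<tau> \<le> T"
  shows "norm (gal_rhs J \<nu> \<beta> (U n) (V n) (fcoef (G n)) k) \<le> 2 * (S + 1 + knorm k * M) + \<nu> * knorm k powr (2 * \<beta>) * (M + 1)"
  using E_le[OF assms] par
  by (intro norm_gal_rhs_le J V_outside norm_U_le fcoef_G_le) (auto simp: E_def)

lemma norm_transport_le:
  assumes "n * \<tau> \<le> T"
  shows "cmod (\<i> * (\<Sum>j\<in>J. kdot k (U n j) * fcoef (G n) (k - j))) \<le> knorm k * (M + S)"
  by (rule norm_transport_sum_le[OF J(1) norm_U_le E_le[OF assms, unfolded E_def] sum_fcoef_G_le])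

text \<open>The temperature error has three sources: the replacement of th0 by f0, the second-order
  errors of at most T/\<tau> transport steps, and the incomplete cell containing t. For the velocity
  only the last one occurs, since Euler steps sum up exactly.\<close>

lemma approx_solution_step:
  assumes K: "\<tau> = T / real K" "0 < K" "0 < T"
    and w0v0: "\<And>k. k \<in> J \<Longrightarrow> w0 k = v0 k"
    and f0\<phi>: "\<And>\<phi>. convex_on UNIV \<phi> \<Longrightarrow> integrable LT (\<lambda>x. \<phi> (th0 x)) \<Longrightarrow> (\<integral>x. \<phi> (f0 x) \<partial>LT) \<le> (\<integral>x. \<phi> (th0 x) \<partial>LT)"
    and C: "(E0 + T * (M + S + 1)) / (2 * \<nu>) \<le> C"
    and err1: "\<And>k. \<tau> * (2 * (S + 1 + knorm k * M) + \<nu> * knorm k powr (2 * \<beta>) * (M + 1)) \<le> err k"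
    and err2: "\<And>k. cmod (fcoef f0 k - fcoef th0 k) + T / \<tau> * ((S + 1) * (2 * real (card J) * \<tau> * knorm k * (M + 1))\<^sup>2)
        + \<tau> * (knorm k * (M + S)) \<le> err k"
  shows "approx_solution \<alpha> \<beta> \<nu> T v0 th0 J M S C err (\<lambda>t. V (nat \<lfloor>t / \<tau>\<rfloor>)) (\<lambda>t. G (nat \<lfloor>t / \<tau>\<rfloor>))"
proof -
  have \<tau>: "0 < \<tau>" using K by simp
  let ?n = "\<lambda>t. nat \<lfloor>t / \<tau>\<rfloor>"
  have n: "?n t * \<tau> \<le> t" "t < (?n t + 1) * \<tau>" if "t \<in> {0..T}" for t
  proof -
    have "0 \<le> t / \<tau>" using \<tau> that by simp
    then have "real (?n t) = real_of_int \<lfloor>t / \<tau>\<rfloor>" by simp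
    then have "real (?n t) \<le> t / \<tau>" "t / \<tau> < real (?n t) + 1" by linarith+
    then show "?n t * \<tau> \<le> t" "t < (?n t + 1) * \<tau>" using \<tau> by (simp_all add: field_simps)
  qed
  have nT: "?n t * \<tau> \<le> T" if "t \<in> {0..T}" for t using n(1)[OF that] that by simp
  \<comment> \<open>T is a whole number of steps, so integrals up to T have no incomplete cell and
    equal plain sums over m < K.\<close>
  have "T / \<tau> = real K" using K by simp
  then have nK: "?n T = K" by simp
  have KT: "K * \<tau> = T" using K by simp
  have P4: "(\<integral>\<^sup>+t\<in>{0..T}. ennreal (\<Sum>k\<in>J. (norm (V (?n t) k))\<^sup>2 * knorm k powr (2 * \<beta>)) \<partial>lborel) \<le> ennreal C"
  proof -
    have i: "set_integrable lborel {0..T} (\<lambda>t. D (?n t))"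
      by (rule integral_step[OF \<tau> par(4) refl])
    have "(\<integral>\<^sup>+t\<in>{0..T}. ennreal (D (?n t)) \<partial>lborel) = (\<integral>\<^sup>+t. ennreal (indicator {0..T} t *\<^sub>R D (?n t)) \<partial>lborel)"
      by (intro nn_integral_cong) (auto simp: indicator_def)
    also have "\<dots> = ennreal (LINT t:{0..T}|lborel. D (?n t))"
      unfolding set_lebesgue_integral_def
      by (rule nn_integral_eq_integral) (use i D_nonneg in \<open>auto simp: set_integrable_def\<close>)
    also have "(LINT t:{0..T}|lborel. D (?n t)) = \<tau> * (\<Sum>m<K. D m)"
      using integral_step(2)[OF \<tau> par(4) refl, of D] by (simp add: nK KT sum_distrib_left)
    also have "\<dots> \<le> C"
    proof -
      have "2 * \<nu> * (\<tau> * (\<Sum>m<K. D m)) \<le> E0 + T * (M + S + 1)"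
        using sum_D_le[of K] KT sum_nonneg[of J "\<lambda>k. (norm (V K k))\<^sup>2"] by (simp add: E_def)
      then have "\<tau> * (\<Sum>m<K. D m) \<le> (E0 + T * (M + S + 1)) / (2 * \<nu>)"
        using par by (simp add: field_simps)
      then show ?thesis using C by simp
    qed
    finally show ?thesis by (simp add: D_def ennreal_leI)
  qed
  have P7: "norm (V (?n t) k - v0 k
        - (LINT s:{0..t}|lborel. gal_rhs J \<nu> \<beta> (U (?n s)) (V (?n s)) (fcoef (G (?n s))) k)) \<le> err k"
    if t: "t \<in> {0..T}" and k: "k \<in> J" for t k
  proof -
    let ?R = "\<lambda>m. gal_rhs J \<nu> \<beta> (U m) (V m) (fcoef (G m)) k"
    have "(LINT s:{0..t}|lborel. ?R (?n s)) = (\<Sum>m<?n t. \<tau> *\<^sub>R ?R m) + (t - ?n t * \<tau>) *\<^sub>R ?R (?n t)"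
      by (rule integral_step(2)[OF \<tau> _ refl]) (use t in simp)
    then have "V (?n t) k - v0 k - (LINT s:{0..t}|lborel. ?R (?n s)) = - ((t - ?n t * \<tau>) *\<^sub>R ?R (?n t))"
      unfolding V_eq_sum[OF k, of "?n t"] w0v0[OF k] by simp
    also have "norm \<dots> \<le> \<tau> * (2 * (S + 1 + knorm k * M) + \<nu> * knorm k powr (2 * \<beta>) * (M + 1))"
      unfolding norm_minus_cancel norm_scaleR
      using n[OF t] by (intro mult_mono norm_rhs_le nT t) (auto simp: algebra_simps \<tau> less_imp_le)
    also have "\<dots> \<le> err k" by (rule err1)
    finally show ?thesis .
  qed
  have P8: "norm (fcoef (G (?n t)) k - fcoef th0 k
        + (LINT s:{0..t}|lborel. \<i> * (\<Sum>j\<in>J. kdot k (U (?n s) j) * fcoef (G (?n s)) (k - j)))) \<le> err k"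
    if t: "t \<in> {0..T}" for t k
  proof -
    let ?R = "\<lambda>m. \<i> * (\<Sum>j\<in>J. kdot k (U m j) * fcoef (G m) (k - j))"
    have tri: "norm (a + b + c) \<le> x + y + z" if "norm a \<le> x" "norm b \<le> y" "norm c \<le> z" for a b c :: complex and x y z
      using that by (intro norm_triangle_mono)
    have alg: "a - c + (s + r) = (b - c) + (a - b + s) + r" for a b c s r :: complex
      by simp
    have I: "(LINT s:{0..t}|lborel. ?R (?n s)) = (\<Sum>m<?n t. \<tau> *\<^sub>R ?R m) + (t - ?n t * \<tau>) *\<^sub>R ?R (?n t)"
      by (rule integral_step(2)[OF \<tau> _ refl]) (use t in simp)
    have r: "norm ((t - ?n t * \<tau>) *\<^sub>R ?R (?n t)) \<le> \<tau> * (knorm k * (M + S))"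
      unfolding norm_scaleR
      using n[OF t] by (intro mult_mono norm_transport_le nT t) (auto simp: algebra_simps \<tau> less_imp_le)
    have "?n t * ((S + 1) * (2 * real (card J) * \<tau> * knorm k * (M + 1))\<^sup>2) \<le> T / \<tau> * ((S + 1) * (2 * real (card J) * \<tau> * knorm k * (M + 1))\<^sup>2)"
      using nT[OF t] \<tau> S_nonneg by (intro mult_right_mono) (auto simp: field_simps)
    then have s: "norm (fcoef (G (?n t)) k - fcoef f0 k + (\<Sum>m<?n t. \<tau> *\<^sub>R ?R m)) \<le> T / \<tau> * ((S + 1) * (2 * real (card J) * \<tau> * knorm k * (M + 1))\<^sup>2)"
      using fcoef_G_eq_sum[OF nT[OF t], of k] by (simp add: scaleR_conv_of_real)
    have "norm ((fcoef f0 k - fcoef th0 k) + (fcoef (G (?n t)) k - fcoef f0 k + (\<Sum>m<?n t. \<tau> *\<^sub>R ?R m)) + (t - ?n t * \<tau>) *\<^sub>R ?R (?n t))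
        \<le> cmod (fcoef f0 k - fcoef th0 k) + T / \<tau> * ((S + 1) * (2 * real (card J) * \<tau> * knorm k * (M + 1))\<^sup>2)
        + \<tau> * (knorm k * (M + S))"
      by (rule tri[OF order_refl s r])
    from order_trans[OF this err2] show ?thesis
      by (subst I, subst alg[of _ _ _ _ "fcoef f0 k"])
  qed
  have P9: "\<nu> * knorm k powr (2 * \<beta>) * (LINT s:{0..T}|lborel. norm (V (?n s) k))
        \<le> norm (v0 k) + (LINT s:{0..T}|lborel. norm (gal_source J (U (?n s)) (V (?n s)) (fcoef (G (?n s))) k))" if k: "k \<in> J" for k
  proof -
    have e1: "(LINT s:{0..T}|lborel. norm (V (?n s) k)) = \<tau> * (\<Sum>m<K. norm (V m k))"
      using integral_step(2)[OF \<tau> par(4) refl, of "\<lambda>m. norm (V m k)"] by (simp add: nK KT sum_distrib_left)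
    have e2: "(LINT s:{0..T}|lborel. norm (gal_source J (U (?n s)) (V (?n s)) (fcoef (G (?n s))) k))
       = \<tau> * (\<Sum>m<K. norm (gal_source J (U m) (V m) (fcoef (G m)) k))"
      using integral_step(2)[OF \<tau> par(4) refl, of "\<lambda>m. norm (gal_source J (U m) (V m) (fcoef (G m)) k)"]
      by (simp add: nK KT sum_distrib_left)
    show ?thesis
      unfolding e1 e2 using damping_sum[OF k, of K] norm_ge_zero[of "V K k"] unfolding w0v0[OF k] by linarith
  qed
  have P6: "(\<integral>x. \<phi> (G m x) \<partial>LT) \<le> (\<integral>x. \<phi> (th0 x) \<partial>LT)"
    if "convex_on UNIV \<phi>" "integrable LT (\<lambda>x. \<phi> (th0 x))" for \<phi> m
    by (rule order_trans[OF integral_convex_G_le[OF that(1)] f0\<phi>[OF that]])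
  show ?thesis
    unfolding approx_solution_def
  proof (intro conjI allI ballI impI)
    show "(\<lambda>t. V (?n t) k) \<in> borel_measurable borel" "(\<lambda>t. fcoef (G (?n t)) k) \<in> borel_measurable borel" for k
      by (rule borel_measurable_step)+
    show "real_v (V (?n t))" for t by (rule real_v_V)
    show "V (?n t) k = 0" if "k \<notin> J" for t k by (rule V_outside[OF that])
    show "(\<Sum>k\<in>J. (norm (V (?n t) k))\<^sup>2) \<le> M" if "t \<in> {0..T}" for t
      by (rule E_le[unfolded E_def, OF nT[OF that]])
    show "cperiodic (G (?n t))" for t by (rule cperiodic_G)
    show "fcoef (G (?n t)) 0 = 0" if "t \<in> {0..T}" for t by (rule fcoef_G_0[OF nT[OF that]])
    show "(\<Sum>k\<in>F. (cmod (fcoef (G (?n t)) k))\<^sup>2) \<le> S" if "finite F" for t F by (rule sum_fcoef_G_le[OF that])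
    show "(\<integral>\<^sup>+t\<in>{0..T}. ennreal (\<Sum>k\<in>J. (norm (V (?n t) k))\<^sup>2 * knorm k powr (2 * \<beta>)) \<partial>lborel) \<le> ennreal C"
      by (rule P4)
    show "(\<integral>x. \<phi> (G (?n t) x) \<partial>LT) \<le> (\<integral>x. \<phi> (th0 x) \<partial>LT)"
      if "convex_on UNIV \<phi>" "integrable LT (\<lambda>x. \<phi> (th0 x))" for \<phi> t
      by (rule P6[OF that])
  qed (fact P7 P8 P9)+
qed

end

theorem approximants:
  fixes \<alpha> \<beta> \<nu> T :: real
  assumes pr: "0 \<le> \<alpha>" "0 < \<nu>" "0 < T" and v0: "in_V 0 v0"
    and th0: "th0 \<in> borel_measurable LT" "integrable LT (\<lambda>x. (th0 x)\<^sup>2)" "fcoef th0 0 = 0"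
  shows "\<exists>(J :: nat \<Rightarrow> wvec set) M S C (err :: nat \<Rightarrow> wvec \<Rightarrow> real) V G.
    (\<forall>N. finite (J N)) \<and> (\<forall>k. k \<noteq> 0 \<longrightarrow> (\<forall>\<^sub>F N in sequentially. k \<in> J N)) \<and> (\<forall>k. (\<lambda>N. err N k) \<longlonglongrightarrow> 0) \<and>
    (\<forall>N. approx_solution \<alpha> \<beta> \<nu> T v0 th0 (J N) M S C (err N) (V N) (G N))"
proof -
  obtain E0 where E0: "0 \<le> E0" "\<And>F. finite F \<Longrightarrow> (\<Sum>k\<in>F. (norm (v0 k))\<^sup>2) \<le> E0"
    using in_V_0_bounded[OF v0] by blast
  have rv0: "real_v v0" using v0 by (simp add: in_V_def)
  define S where "S = (\<integral>x. (th0 x)\<^sup>2 \<partial>LT) / (2 * pi) ^ 3"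
  define M where "M = exp T * (E0 + S + 1)"
  define C where "C = (E0 + T * (M + S + 1)) / (2 * \<nu>)"
  \<comment> \<open>The box has radius at least 1 so that J is never empty; 0 is removed because all
    fields have zero mean.\<close>
  define J where "J N = fbox (Suc N) - {0}" for N
  have S0: "0 \<le> S" by (simp add: S_def)
  have M0: "0 \<le> M" using S0 E0 by (simp add: M_def)
  define R where "R k = 2 * (S + 1 + knorm k * M) + \<nu> * knorm k powr (2 * \<beta>) * (M + 1)" for k
  have R0: "0 \<le> R k" for k unfolding R_def using S0 M0 pr by simp
  define err where "err N k = (1 - fejer_weight N k) * cmod (fcoef th0 k)
      + inverse (real (Suc N)) * (R k + T * (knorm k)\<^sup>2 + knorm k * (M + S))" for N k
  have th0i: "integrable LT th0" by (rule integrable_LT_sq_imp[OF th0(1,2)])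
  have sq: "(\<lambda>x::real. \<bar>x\<bar> powr 2) = (\<lambda>x. x\<^sup>2)" by (auto simp: fun_eq_iff powr_numeral)
  have ex: "\<exists>V G. approx_solution \<alpha> \<beta> \<nu> T v0 th0 (J N) M S C (err N) V G" for N
  proof -
    \<comment> \<open>Every requirement on the step has the form \<tau> Y \<le> 1, and X dominates
      all the Y: the Euler error, the stability condition, the Taylor error of the shears enlarged
      by N + 1, and N + 1 itself. The factor N + 1 forces the errors to vanish as N grows.\<close>
    define X where "X = (\<Sum>k\<in>J N. (R k)\<^sup>2) + (\<Sum>k\<in>J N. \<nu> * knorm k powr (2 * \<beta>))
        + (S + 1) * (2 * real (card (J N)) * (M + 1))\<^sup>2 * Suc N + Suc N"
    have X: "(\<Sum>k\<in>J N. (R k)\<^sup>2) \<le> X" "k \<in> J N \<Longrightarrow> \<nu> * knorm k powr (2 * \<beta>) \<le> X"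
      "(S + 1) * (2 * real (card (J N)) * (M + 1))\<^sup>2 * Suc N \<le> X" "real (Suc N) \<le> X" for k
    proof -
      have a: "0 \<le> (\<Sum>k\<in>J N. (R k)\<^sup>2)" "0 \<le> (\<Sum>k\<in>J N. \<nu> * knorm k powr (2 * \<beta>))"
         "0 \<le> (S + 1) * (2 * real (card (J N)) * (M + 1))\<^sup>2 * Suc N"
        using S0 pr by (auto intro!: sum_nonneg)
      then show "(\<Sum>k\<in>J N. (R k)\<^sup>2) \<le> X" "(S + 1) * (2 * real (card (J N)) * (M + 1))\<^sup>2 * Suc N \<le> X" "real (Suc N) \<le> X"
        by (simp_all add: X_def)
      show "\<nu> * knorm k powr (2 * \<beta>) \<le> X" if "k \<in> J N"
      proof -
        have "\<nu> * knorm k powr (2 * \<beta>) \<le> (\<Sum>k\<in>J N. \<nu> * knorm k powr (2 * \<beta>))"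
          by (rule member_le_sum[OF that]) (use pr in \<open>auto simp: J_def\<close>)
        then show ?thesis using a by (simp add: X_def)
      qed
    qed
    \<comment> \<open>A positive integer not below T X, so that \<tau> = T/K gives \<tau> X \<le>
      1.\<close>
    define K where "K = Suc (nat \<lceil>T * X\<rceil>)"
    define \<tau> where "\<tau> = T / K"
    have \<tau>0: "0 < \<tau>" using pr by (simp add: \<tau>_def K_def)
    have TX: "T * X \<le> K" unfolding K_def by linarith
    have \<tau>X: "\<tau> * Y \<le> 1" if "Y \<le> X" for Y
    proof -
      have "\<tau> * Y \<le> \<tau> * X" using that \<tau>0 by simp
      also have "\<dots> \<le> 1" using TX by (simp add: \<tau>_def K_def field_simps)
      finally show ?thesis .
    qed
    have \<tau>N: "\<tau> \<le> inverse (real (Suc N))"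
      using \<tau>X[OF X(4)] by (simp add: field_simps del: of_nat_Suc)
    define w0 where "w0 k = (if k \<in> J N then v0 k else 0)" for k
    have Js: "- k \<in> J N \<longleftrightarrow> k \<in> J N" for k by (simp add: J_def)
    have Jne: "J N \<noteq> {}"
    proof -
      have "axis 1 1 \<in> J N" by (auto simp: J_def fbox_def axis_def vec_eq_iff)
      then show ?thesis by auto
    qed
    have i2: "(\<integral>x. (fejer N th0 x)\<^sup>2 \<partial>LT) \<le> (\<integral>x. (th0 x)\<^sup>2 \<partial>LT)"
      using integral_convex_fejer_le[OF convex_on_abs_powr[of 2] th0i, of N] th0(2) unfolding sq by simp
    \<comment> \<open>Fejer smoothing makes the initial temperature continuous and periodic without
      increasing any convex functional and without changing its mean.\<close>
    interpret scheme "J N" \<tau> \<alpha> \<beta> \<nu> T w0 "fejer N th0" S E0 M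
    proof
      show "real_v w0" using rv0 Js by (auto simp: real_v_def w0_def)
      show "(\<Sum>k\<in>J N. (norm (w0 k))\<^sup>2) \<le> E0"
        using E0(2)[of "J N"] by (simp add: w0_def J_def)
      show "(\<integral>x. (fejer N th0 x)\<^sup>2 \<partial>LT) / (2 * pi) ^ 3 \<le> S"
        unfolding S_def using i2 by (rule divide_right_mono) simp
      show "\<tau> * (\<Sum>k\<in>J N. (2 * (S + 1 + knorm k * M) + \<nu> * knorm k powr (2 * \<beta>) * (M + 1))\<^sup>2) \<le> 1"
        using \<tau>X[OF X(1)] by (simp add: R_def)
    qed (use pr \<tau>0 Js Jne M_def \<tau>X[OF X(2)] in \<open>auto simp: J_def w0_def cperiodic_fejer fcoef_fejer th0\<close>)
    show ?thesis
    proof (intro exI, rule approx_solution_step[of K])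
      show "\<tau> = T / real K" "0 < K" "0 < T" using pr by (auto simp: \<tau>_def K_def)
      show "(\<integral>x. \<phi> (fejer N th0 x) \<partial>LT) \<le> (\<integral>x. \<phi> (th0 x) \<partial>LT)"
        if "convex_on UNIV \<phi>" "integrable LT (\<lambda>x. \<phi> (th0 x))" for \<phi>
        by (rule integral_convex_fejer_le[OF that(1) th0i that(2)])
      have e0: "0 \<le> (1 - fejer_weight N k) * cmod (fcoef th0 k)" for k
        using fejer_weight_le_1[of N k] by simp
      show "\<tau> * (2 * (S + 1 + knorm k * M) + \<nu> * knorm k powr (2 * \<beta>) * (M + 1)) \<le> err N k" for k
      proof -
        have "\<tau> * R k \<le> inverse (real (Suc N)) * (R k + T * (knorm k)\<^sup>2 + knorm k * (M + S))"
          using \<tau>N \<tau>0 R0[of k] pr S0 M0 by (intro mult_mono) auto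
        then show ?thesis using e0[of k] by (simp add: err_def R_def)
      qed
      show "cmod (fcoef (fejer N th0) k - fcoef th0 k) + T / \<tau> * ((S + 1) * (2 * real (card (J N)) * \<tau> * knorm k * (M + 1))\<^sup>2)
        + \<tau> * (knorm k * (M + S)) \<le> err N k" for k
      proof -
        have "fcoef (fejer N th0) k - fcoef th0 k = of_real (fejer_weight N k - 1) * fcoef th0 k"
          by (simp add: fcoef_fejer algebra_simps)
        then have 1: "cmod (fcoef (fejer N th0) k - fcoef th0 k) = (1 - fejer_weight N k) * cmod (fcoef th0 k)"
          unfolding \<open>fcoef (fejer N th0) k - fcoef th0 k = _\<close> norm_mult norm_of_real using fejer_weight_le_1[of N k] by simp
        have "T / \<tau> * ((S + 1) * (2 * real (card (J N)) * \<tau> * knorm k * (M + 1))\<^sup>2)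
           = (\<tau> * ((S + 1) * (2 * real (card (J N)) * (M + 1))\<^sup>2 * Suc N)) * (inverse (real (Suc N)) * (T * (knorm k)\<^sup>2))"
          using \<tau>0 by (simp add: field_simps power2_eq_square)
        also have "\<dots> \<le> 1 * (inverse (real (Suc N)) * (T * (knorm k)\<^sup>2))"
          using \<tau>X[OF X(3)] pr by (intro mult_right_mono) auto
        finally have 2: "T / \<tau> * ((S + 1) * (2 * real (card (J N)) * \<tau> * knorm k * (M + 1))\<^sup>2) \<le> inverse (real (Suc N)) * (T * (knorm k)\<^sup>2)" by simp
        have 3: "\<tau> * (knorm k * (M + S)) \<le> inverse (real (Suc N)) * (knorm k * (M + S))"
          using \<tau>N M0 S0 by (intro mult_right_mono) auto
        have 4: "0 \<le> inverse (real (Suc N)) * R k" using R0[of k] by simp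
        have "r * (a + b + c) = r * a + r * b + r * c" for r a b c :: real by (simp add: distrib_left)
        then show ?thesis
          unfolding err_def 1 using 2 3 4 by simp
      qed
    qed (auto simp: w0_def C_def)
  qed
  then obtain V G where VG: "\<And>N. approx_solution \<alpha> \<beta> \<nu> T v0 th0 (J N) M S C (err N) (V N) (G N)"
    by metis
  show ?thesis
  proof (intro exI conjI allI impI)
    show "finite (J N)" for N by (simp add: J_def)
    show "\<forall>\<^sub>F N in sequentially. k \<in> J N" if "k \<noteq> 0" for k
    proof -
      obtain m where "k \<in> fbox m" using ex_fbox by auto
      then have "k \<in> J N" if "N \<ge> m" for N
        using fbox_mono[of m "Suc N"] that \<open>k \<noteq> 0\<close> by (auto simp: J_def)
      then show ?thesis by (auto simp: eventually_sequentially)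
    qed
    show "(\<lambda>N. err N k) \<longlonglongrightarrow> 0" for k
    proof -
      have "(\<lambda>N. err N k) \<longlonglongrightarrow> (1 - 1) * cmod (fcoef th0 k) + 0 * (R k + T * (knorm k)\<^sup>2 + knorm k * (M + S))"
        unfolding err_def by (intro tendsto_intros fejer_weight_tendsto LIMSEQ_inverse_real_of_nat)
      then show ?thesis by simp
    qed
  qed (rule VG)
qed

section \<open>Compactness\<close>

text \<open>Diagonal extraction on rational times, extended to all times by equicontinuity. The
  slack e N i allows for the time jumps of the approximations, and the bound is asked only
  eventually in N because a mode may enter the Galerkin set late.\<close>

lemma equicontinuous_subsequence:
  fixes f :: "nat \<Rightarrow> real \<Rightarrow> 'i::countable \<Rightarrow> 'b::euclidean_space"
  assumes T: "0 < T" and bd: "\<And>N t i. t \<in> {0..T} \<Longrightarrow> norm (f N t i) \<le> B"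
    and eq: "\<And>i. \<forall>\<^sub>F N in sequentially. \<forall>s\<in>{0..T}. \<forall>t\<in>{0..T}. norm (f N t i - f N s i) \<le> L i * \<bar>t - s\<bar> + e N i"
    and L: "\<And>i. 0 \<le> L i" and e: "\<And>i. (\<lambda>N. e N i) \<longlonglongrightarrow> 0"
  obtains r where "strict_mono r" "\<And>t i. t \<in> {0..T} \<Longrightarrow> convergent (\<lambda>N. f (r N) t i)"
proof -
  let ?S = "(\<rat> \<inter> {0..T}) \<times> (UNIV :: 'i set)"
  define g where "g N x = f N (fst x) (snd x)" for N and x :: "real \<times> 'i"
  have cS: "countable ?S" by (intro countable_SIGMA countable_Int1 countable_rat) auto
  have gB: "norm (g N x) \<le> B" if "x \<in> ?S" for N x
    using that bd by (auto simp: g_def)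
  obtain r where r: "strict_mono r" "\<And>x. x \<in> ?S \<Longrightarrow> \<exists>l. (\<lambda>n. g (r n) x) \<longlonglongrightarrow> l"
    using function_convergent_subsequence[of ?S g B, OF cS gB] by blast
  have "convergent (\<lambda>N. f (r N) t i)" if t: "t \<in> {0..T}" for t i
  proof (rule Cauchy_convergent, rule CauchyI)
    fix \<epsilon> :: real assume \<epsilon>: "0 < \<epsilon>"
    \<comment> \<open>Makes the Lipschitz part at most \<epsilon>/5. Together with slack below
      \<epsilon>/5, each passage from t to q costs less than 2\<epsilon>/5, and the Cauchy property
      at q uses the remaining fifth.\<close>
    define \<delta> where "\<delta> = \<epsilon> / (5 * (L i + 1))"
    have \<delta>: "0 < \<delta>" using \<epsilon> L[of i] by (simp add: \<delta>_def add_nonneg_pos)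
    have "max 0 (t - \<delta>) < min T (t + \<delta>)" using t T \<delta> by auto
    then obtain q where q: "q \<in> \<rat>" "max 0 (t - \<delta>) < q" "q < min T (t + \<delta>)" using Rats_dense_in_real by blast
    have qT: "q \<in> {0..T}" and qt: "\<bar>t - q\<bar> \<le> \<delta>" using q by auto
    have Ld: "L i * \<bar>t - q\<bar> \<le> \<epsilon> / 5"
    proof -
      have "L i * \<bar>t - q\<bar> \<le> (L i + 1) * \<delta>" using qt L[of i] \<delta> by (intro mult_mono) auto
      also have "\<dots> = \<epsilon> / 5" using L[of i] by (simp add: \<delta>_def field_simps add_nonneg_eq_0_iff)
      finally show ?thesis .
    qed
    have "\<forall>\<^sub>F N in sequentially. norm (f N t i - f N q i) \<le> L i * \<bar>t - q\<bar> + e N i"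
      using eq[of i] by (rule eventually_mono) (use qT t in auto)
    moreover have "\<forall>\<^sub>F N in sequentially. e N i < \<epsilon> / 5"
      using \<epsilon> by (intro order_tendstoD(2)[OF e]) auto
    ultimately have "\<forall>\<^sub>F N in sequentially. norm (f N t i - f N q i) < 2 * \<epsilon> / 5"
      by eventually_elim (use Ld in linarith)
    then have "\<forall>\<^sub>F N in sequentially. norm (f (r N) t i - f (r N) q i) < 2 * \<epsilon> / 5"
      by (rule eventually_subseq[OF r(1)])
    then obtain N1 where N1: "\<And>N. N \<ge> N1 \<Longrightarrow> norm (f (r N) t i - f (r N) q i) < 2 * \<epsilon> / 5"
      by (auto simp: eventually_sequentially)
    have "Cauchy (\<lambda>N. f (r N) q i)"
      using r(2)[of "(q, i)"] q(1) qT by (auto simp: g_def intro: LIMSEQ_imp_Cauchy)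
    then obtain N2 where N2: "\<And>m n. m \<ge> N2 \<Longrightarrow> n \<ge> N2 \<Longrightarrow> norm (f (r m) q i - f (r n) q i) < \<epsilon> / 5"
      using CauchyD[of _ "\<epsilon> / 5"] \<epsilon> by (metis divide_pos_pos zero_less_numeral)
    have "norm (f (r m) t i - f (r n) t i) < \<epsilon>" if "m \<ge> max N1 N2" "n \<ge> max N1 N2" for m n
    proof -
      have "norm (f (r m) t i - f (r n) t i) \<le> norm (f (r m) t i - f (r m) q i) + norm (f (r m) q i - f (r n) q i) + norm (f (r n) t i - f (r n) q i)"
        using norm_triangle_ineq[of "f (r m) t i - f (r m) q i" "f (r m) q i - f (r n) q i"]
          norm_triangle_ineq4[of "f (r m) t i - f (r n) q i" "f (r n) t i - f (r n) q i"] by simp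
      also have "\<dots> < 2 * \<epsilon> / 5 + \<epsilon> / 5 + 2 * \<epsilon> / 5"
        using that by (intro add_strict_mono N1 N2) auto
      finally show ?thesis by simp
    qed
    then show "\<exists>M. \<forall>m\<ge>M. \<forall>n\<ge>M. norm (f (r m) t i - f (r n) t i) < \<epsilon>" by blast
  qed
  with r(1) show thesis by (rule that)
qed

text \<open>A Vitali argument for series: uniformly small tails reduce the limit to a finite sum,
  and the same tail bound passes to the limit series by Fatou.\<close>

lemma tendsto_integral_uniform_tail:
  fixes H :: "nat \<Rightarrow> 'i::countable \<Rightarrow> 'b::euclidean_space"
  assumes lim: "\<And>j. (\<lambda>N. H N j) \<longlonglongrightarrow> h j"
    and tail: "\<And>e. 0 < e \<Longrightarrow> \<exists>F. finite F \<and> (\<forall>N. (\<integral>\<^sup>+j. ennreal (norm (H N j)) * indicator (- F) j \<partial>count_space UNIV) \<le> ennreal e)"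
  shows "(\<lambda>N. \<integral>j. H N j \<partial>count_space UNIV) \<longlonglongrightarrow> (\<integral>j. h j \<partial>count_space UNIV)"
proof (rule LIMSEQ_I)
  fix \<epsilon> :: real assume \<epsilon>: "0 < \<epsilon>"
  obtain F where F: "finite F" and tl: "\<And>N. (\<integral>\<^sup>+j. ennreal (norm (H N j)) * indicator (- F) j \<partial>count_space UNIV) \<le> ennreal (\<epsilon> / 4)"
    using tail[of "\<epsilon> / 4"] \<epsilon> by auto
  have tlh: "(\<integral>\<^sup>+j. ennreal (norm (h j)) * indicator (- F) j \<partial>count_space UNIV) \<le> ennreal (\<epsilon> / 4)"
  proof -
    have "(\<integral>\<^sup>+j. ennreal (norm (h j) * indicator (- F) j) \<partial>count_space UNIV) \<le> ennreal (\<epsilon> / 4)"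
      by (rule nn_integral_le_liminf_tendsto[of "\<lambda>N j. norm (H N j) * indicator (- F) j"])
        (auto intro!: tendsto_intros lim AE_I2 simp: ennreal_mult' tl ennreal_indicator)
    then show ?thesis by (simp add: ennreal_mult' ennreal_indicator)
  qed
  have split: "integrable (count_space UNIV) g \<and> norm ((\<integral>j. g j \<partial>count_space UNIV) - sum g F) \<le> \<epsilon> / 4"
    if g: "(\<integral>\<^sup>+j. ennreal (norm (g j)) * indicator (- F) j \<partial>count_space UNIV) \<le> ennreal (\<epsilon> / 4)" for g :: "'i \<Rightarrow> 'b"
  proof -
    have eq: "(\<integral>\<^sup>+j. ennreal (norm (indicator (- F) j *\<^sub>R g j)) \<partial>count_space UNIV) = (\<integral>\<^sup>+j. ennreal (norm (g j)) * indicator (- F) j \<partial>count_space UNIV)"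
      by (intro nn_integral_cong) (auto simp: indicator_def)
    have i1: "integrable (count_space UNIV) (\<lambda>j. indicator (- F) j *\<^sub>R g j)"
      by (rule integrableI_bounded) (use eq g in \<open>auto intro: le_less_trans\<close>)
    have hb: "has_bochner_integral (count_space UNIV) (\<lambda>j. indicator F j *\<^sub>R g j) (sum g F)"
    proof -
      have "integrable (count_space UNIV) (\<lambda>j. indicator F j *\<^sub>R g j)"
      proof (rule integrableI_bounded)
        have "(\<integral>\<^sup>+j. ennreal (norm (indicator F j *\<^sub>R g j)) \<partial>count_space UNIV) = (\<Sum>j\<in>F. ennreal (norm (indicator F j *\<^sub>R g j)))"
          by (rule nn_integral_count_space') (use F in auto)
        then show "(\<integral>\<^sup>+j. ennreal (norm (indicator F j *\<^sub>R g j)) \<partial>count_space UNIV) < \<infinity>" by simp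
      qed simp
      moreover have "(\<integral>j. indicator F j *\<^sub>R g j \<partial>count_space UNIV) = sum g F"
      proof -
        have s: "{a. a \<in> UNIV \<and> indicator F a *\<^sub>R g a \<noteq> 0} \<subseteq> F" by (auto simp: indicator_def)
        have "(\<integral>j. indicator F j *\<^sub>R g j \<partial>count_space UNIV) = (\<Sum>a | a \<in> UNIV \<and> indicator F a *\<^sub>R g a \<noteq> 0. indicator F a *\<^sub>R g a)"
          by (rule lebesgue_integral_count_space_finite_support) (rule finite_subset[OF s F])
        also have "\<dots> = (\<Sum>a\<in>F. indicator F a *\<^sub>R g a)"
          by (rule sum.mono_neutral_left[OF F s]) auto
        finally show ?thesis by simp
      qed
      ultimately show ?thesis by (simp add: has_bochner_integral_iff)
    qed
    have gs: "g = (\<lambda>j. indicator F j *\<^sub>R g j + indicator (- F) j *\<^sub>R g j)"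
      by (auto simp: fun_eq_iff indicator_def)
    have "has_bochner_integral (count_space UNIV) g (sum g F + (\<integral>j. indicator (- F) j *\<^sub>R g j \<partial>count_space UNIV))"
      by (subst gs) (intro has_bochner_integral_add hb has_bochner_integral_integrable i1)
    then have gi: "integrable (count_space UNIV) g" and
      ge: "(\<integral>j. g j \<partial>count_space UNIV) = sum g F + (\<integral>j. indicator (- F) j *\<^sub>R g j \<partial>count_space UNIV)"
      by (auto simp: has_bochner_integral_iff)
    have "ennreal (norm (\<integral>j. indicator (- F) j *\<^sub>R g j \<partial>count_space UNIV)) \<le> ennreal (\<epsilon> / 4)"
      by (rule order_trans[OF integral_norm_bound_ennreal[OF i1]]) (use eq g in simp)
    then show ?thesis using gi ge \<epsilon> by simp
  qed
  have "(\<lambda>N. sum (H N) F) \<longlonglongrightarrow> sum h F" by (intro tendsto_sum lim)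
  then obtain N0 where N0: "\<And>N. N \<ge> N0 \<Longrightarrow> norm (sum (H N) F - sum h F) < \<epsilon> / 4"
    using LIMSEQ_D[of _ _ "\<epsilon> / 4"] \<epsilon> by (metis divide_pos_pos zero_less_numeral)
  have "norm ((\<integral>j. H N j \<partial>count_space UNIV) - (\<integral>j. h j \<partial>count_space UNIV)) < \<epsilon>" if "N \<ge> N0" for N
  proof -
    let ?A = "\<integral>j. H N j \<partial>count_space UNIV" and ?B = "\<integral>j. h j \<partial>count_space UNIV"
    have "norm (?A - ?B) \<le> norm (?A - sum (H N) F) + norm (sum (H N) F - sum h F) + norm (?B - sum h F)"
      using norm_triangle_ineq[of "?A - sum (H N) F" "sum (H N) F - sum h F"]
        norm_triangle_ineq4[of "?A - sum h F" "?B - sum h F"] by simp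
    also have "\<dots> < \<epsilon> / 4 + \<epsilon> / 4 + (\<epsilon> / 4 + \<epsilon> / 4)"
      using conjunct2[OF split[OF tl, of N]] conjunct2[OF split[OF tlh]] N0[OF that] \<epsilon> by linarith
    finally show ?thesis by simp
  qed
  then show "\<exists>N0. \<forall>N\<ge>N0. norm ((\<integral>j. H N j \<partial>count_space UNIV) - (\<integral>j. h j \<partial>count_space UNIV)) < \<epsilon>" by blast
qed

text \<open>The tails are small only after integration over s, so the sum cannot be handled at fixed
  time. Sum and integral are exchanged first: dominated convergence then treats each mode, and the
  integrated tails treat the series.\<close>

lemma double_limit:
  fixes h :: "nat \<Rightarrow> 'a \<Rightarrow> 'i::countable \<Rightarrow> 'b::euclidean_space"
  assumes M: "finite_measure M" and meas: "\<And>N j. (\<lambda>s. h N s j) \<in> borel_measurable M"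
    and lim: "\<And>s j. s \<in> space M \<Longrightarrow> (\<lambda>N. h N s j) \<longlonglongrightarrow> hl s j"
    and bd: "\<And>N s j. s \<in> space M \<Longrightarrow> norm (h N s j) \<le> D"
    and tail: "\<And>e. 0 < e \<Longrightarrow> \<exists>F. finite F \<and> (\<forall>N. (\<integral>\<^sup>+s. (\<integral>\<^sup>+j. ennreal (norm (h N s j)) * indicator (- F) j \<partial>count_space UNIV) \<partial>M) \<le> ennreal e)"
  shows "(\<integral>\<^sup>+s. (\<integral>\<^sup>+j. ennreal (norm (hl s j)) \<partial>count_space UNIV) \<partial>M) < \<infinity>"
    and "(\<lambda>N. \<integral>s. (\<integral>j. h N s j \<partial>count_space UNIV) \<partial>M) \<longlonglongrightarrow> (\<integral>s. (\<integral>j. hl s j \<partial>count_space UNIV) \<partial>M)"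
proof -
  interpret finite_measure M by (rule M)
  have hlm: "(\<lambda>s. hl s j) \<in> borel_measurable M" for j
    by (rule borel_measurable_LIMSEQ_metric[OF meas lim])
  obtain F where F: "finite F" and tl: "\<And>N. (\<integral>\<^sup>+s. (\<integral>\<^sup>+j. ennreal (norm (h N s j)) * indicator (- F) j \<partial>count_space UNIV) \<partial>M) \<le> ennreal 1"
    using tail[of 1] by auto
  define C where "C = ennreal (card F * max D 0 * measure M (space M)) + ennreal 1"
  have bdN: "(\<integral>\<^sup>+s. (\<integral>\<^sup>+j. ennreal (norm (h N s j)) \<partial>count_space UNIV) \<partial>M) \<le> C" for N
  proof -
    have "(\<integral>\<^sup>+s. (\<integral>\<^sup>+j. ennreal (norm (h N s j)) \<partial>count_space UNIV) \<partial>M)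
      \<le> (\<integral>\<^sup>+s. ennreal (card F * max D 0) + (\<integral>\<^sup>+j. ennreal (norm (h N s j)) * indicator (- F) j \<partial>count_space UNIV) \<partial>M)"
    proof (rule nn_integral_mono)
      fix s assume s: "s \<in> space M"
      have "(\<integral>\<^sup>+j. ennreal (norm (h N s j)) \<partial>count_space UNIV)
        = (\<integral>\<^sup>+j. ennreal (norm (h N s j)) * indicator F j + ennreal (norm (h N s j)) * indicator (- F) j \<partial>count_space UNIV)"
        by (intro nn_integral_cong) (auto simp: indicator_def)
      also have "\<dots> = (\<integral>\<^sup>+j. ennreal (norm (h N s j)) * indicator F j \<partial>count_space UNIV)
          + (\<integral>\<^sup>+j. ennreal (norm (h N s j)) * indicator (- F) j \<partial>count_space UNIV)"
        by (rule nn_integral_add) auto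
      also have "(\<integral>\<^sup>+j. ennreal (norm (h N s j)) * indicator F j \<partial>count_space UNIV) = (\<Sum>j\<in>F. ennreal (norm (h N s j)))"
        using F by (subst nn_integral_count_space'[of F]) (auto simp: indicator_def)
      also have "\<dots> \<le> (\<Sum>j\<in>F. ennreal (max D 0))"
        by (intro sum_mono ennreal_leI) (use bd[OF s, of N] in \<open>auto simp: le_max_iff_disj\<close>)
      also have "\<dots> = ennreal (card F * max D 0)"
        by (simp add: ennreal_mult' ennreal_of_nat_eq_real_of_nat)
      finally show "(\<integral>\<^sup>+j. ennreal (norm (h N s j)) \<partial>count_space UNIV) \<le> ennreal (card F * max D 0) + (\<integral>\<^sup>+j. ennreal (norm (h N s j)) * indicator (- F) j \<partial>count_space UNIV)"
        by (simp add: add_right_mono)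
    qed
    also have "\<dots> = (\<integral>\<^sup>+s. ennreal (card F * max D 0) \<partial>M) + (\<integral>\<^sup>+s. (\<integral>\<^sup>+j. ennreal (norm (h N s j)) * indicator (- F) j \<partial>count_space UNIV) \<partial>M)"
      by (intro nn_integral_add borel_measurable_nn_integral_count_space) (use meas in auto)
    also have "\<dots> \<le> C"
      unfolding C_def using tl[of N]
      by (intro add_mono) (auto simp: emeasure_eq_measure ennreal_mult'[symmetric])
    finally show ?thesis .
  qed
  have Cfin: "C < \<infinity>" by (simp add: C_def)
  have nn: "(\<integral>\<^sup>+s. (\<integral>\<^sup>+j. ennreal (norm (hl s j)) \<partial>count_space UNIV) \<partial>M) \<le> C"
  proof -
    have "(\<integral>\<^sup>+s. (\<integral>\<^sup>+j. ennreal (norm (hl s j)) \<partial>count_space UNIV) \<partial>M)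
       \<le> (\<integral>\<^sup>+s. liminf (\<lambda>N. \<integral>\<^sup>+j. ennreal (norm (h N s j)) \<partial>count_space UNIV) \<partial>M)"
    proof (rule nn_integral_mono)
      fix s assume s: "s \<in> space M"
      have "(\<integral>\<^sup>+j. ennreal (norm (hl s j)) \<partial>count_space UNIV) = (\<integral>\<^sup>+j. liminf (\<lambda>N. ennreal (norm (h N s j))) \<partial>count_space UNIV)"
        by (intro nn_integral_cong lim_imp_Liminf[symmetric] tendsto_intros lim s) auto
      also have "\<dots> \<le> liminf (\<lambda>N. \<integral>\<^sup>+j. ennreal (norm (h N s j)) \<partial>count_space UNIV)"
        by (rule nn_integral_liminf) auto
      finally show "(\<integral>\<^sup>+j. ennreal (norm (hl s j)) \<partial>count_space UNIV) \<le> liminf (\<lambda>N. \<integral>\<^sup>+j. ennreal (norm (h N s j)) \<partial>count_space UNIV)" .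
    qed
    also have "\<dots> \<le> liminf (\<lambda>N. \<integral>\<^sup>+s. (\<integral>\<^sup>+j. ennreal (norm (h N s j)) \<partial>count_space UNIV) \<partial>M)"
      by (intro nn_integral_liminf borel_measurable_nn_integral_count_space) (use meas in auto)
    also have "\<dots> \<le> C"
      using Liminf_mono[of "\<lambda>N. \<integral>\<^sup>+s. (\<integral>\<^sup>+j. ennreal (norm (h N s j)) \<partial>count_space UNIV) \<partial>M" "\<lambda>_. C" sequentially] bdN
      by (simp add: Liminf_const)
    finally show ?thesis .
  qed
  then show hfin: "(\<integral>\<^sup>+s. (\<integral>\<^sup>+j. ennreal (norm (hl s j)) \<partial>count_space UNIV) \<partial>M) < \<infinity>"
    using Cfin by (rule le_less_trans)
  have sf: "sigma_finite_measure M" by unfold_locales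
  note sw = integral_count_space_swap(3)[OF sf meas le_less_trans[OF bdN Cfin]]
  note sw' = integral_count_space_swap(3)[OF sf hlm hfin]
  have iN: "integrable M (\<lambda>s. h N s j)" for N j
    by (rule integrable_const_bound[of _ D]) (use bd meas in auto)
  show "(\<lambda>N. \<integral>s. (\<integral>j. h N s j \<partial>count_space UNIV) \<partial>M) \<longlonglongrightarrow> (\<integral>s. (\<integral>j. hl s j \<partial>count_space UNIV) \<partial>M)"
    unfolding sw[symmetric] sw'[symmetric]
  proof (rule tendsto_integral_uniform_tail)
    show "(\<lambda>N. \<integral>s. h N s j \<partial>M) \<longlonglongrightarrow> (\<integral>s. hl s j \<partial>M)" for j
      by (rule integral_dominated_convergence[where w = "\<lambda>_. D"])
        (use hlm meas lim bd in \<open>auto intro!: AE_I2\<close>)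
    fix e :: real assume "0 < e"
    then obtain F where F: "finite F" and tl: "\<And>N. (\<integral>\<^sup>+s. (\<integral>\<^sup>+j. ennreal (norm (h N s j)) * indicator (- F) j \<partial>count_space UNIV) \<partial>M) \<le> ennreal e"
      using tail by blast
    have "(\<integral>\<^sup>+j. ennreal (norm (\<integral>s. h N s j \<partial>M)) * indicator (- F) j \<partial>count_space UNIV) \<le> ennreal e" for N
    proof -
      have "(\<integral>\<^sup>+j. ennreal (norm (\<integral>s. h N s j \<partial>M)) * indicator (- F) j \<partial>count_space UNIV)
        \<le> (\<integral>\<^sup>+j. (\<integral>\<^sup>+s. ennreal (norm (h N s j)) * indicator (- F) j \<partial>M) \<partial>count_space UNIV)"
      proof (rule nn_integral_mono)
        fix j
        have "ennreal (norm (\<integral>s. h N s j \<partial>M)) * indicator (- F) j \<le> (\<integral>\<^sup>+s. ennreal (norm (h N s j)) \<partial>M) * indicator (- F) j"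
          by (intro mult_right_mono integral_norm_bound_ennreal iN) auto
        also have "\<dots> = (\<integral>\<^sup>+s. ennreal (norm (h N s j)) * indicator (- F) j \<partial>M)"
          by (subst nn_integral_multc) (use meas in auto)
        finally show "ennreal (norm (\<integral>s. h N s j \<partial>M)) * indicator (- F) j \<le> (\<integral>\<^sup>+s. ennreal (norm (h N s j)) * indicator (- F) j \<partial>M)" .
      qed
      also have "\<dots> = (\<integral>\<^sup>+s. (\<integral>\<^sup>+j. ennreal (norm (h N s j)) * indicator (- F) j \<partial>count_space UNIV) \<partial>M)"
        by (rule nn_integral_count_space_nn_integral[symmetric]) (use meas in auto)
      also have "\<dots> \<le> ennreal e" by (rule tl)
      finally show ?thesis .
    qed
    then show "\<exists>F. finite F \<and> (\<forall>N. (\<integral>\<^sup>+j. ennreal (norm (\<integral>s. h N s j \<partial>M)) * indicator (- F) j \<partial>count_space UNIV) \<le> ennreal e)"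
      using F by blast
  qed
qed

text \<open>The weight \<open>knorm j powr (2 * \<beta>)\<close> makes the high modes of the first factor uniformly small.\<close>

lemma product_tail:
  fixes h :: "nat \<Rightarrow> 'a \<Rightarrow> wvec \<Rightarrow> 'b::real_normed_vector" and a b :: "nat \<Rightarrow> 'a \<Rightarrow> wvec \<Rightarrow> real"
  assumes M: "finite_measure M" and \<beta>: "0 < \<beta>" and c: "0 \<le> c" and CB: "0 \<le> C" "0 \<le> B"
    and meas: "\<And>N j. (\<lambda>s. a N s j) \<in> borel_measurable M" "\<And>N j. (\<lambda>s. b N s j) \<in> borel_measurable M"
    and h: "\<And>N s j. s \<in> space M \<Longrightarrow> norm (h N s j) \<le> c * (a N s j * b N s (k - j))"
    and A: "\<And>N. (\<integral>\<^sup>+s. (\<integral>\<^sup>+j. ennreal ((a N s j)\<^sup>2 * knorm j powr (2 * \<beta>)) \<partial>count_space UNIV) \<partial>M) \<le> ennreal C"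
    and Bb: "\<And>N s. s \<in> space M \<Longrightarrow> (\<integral>\<^sup>+j. ennreal ((b N s j)\<^sup>2) \<partial>count_space UNIV) \<le> ennreal B"
    and e: "0 < e"
  shows "\<exists>F. finite F \<and> (\<forall>N. (\<integral>\<^sup>+s. (\<integral>\<^sup>+j. ennreal (norm (h N s j)) * indicator (- F) j \<partial>count_space UNIV) \<partial>M) \<le> ennreal e)"
proof -
  interpret finite_measure M by (rule M)
  define m where "m = measure M (space M)"
  have m0: "0 \<le> m" by (simp add: m_def)
  have "((\<lambda>R::real. c * R powr (- \<beta>) * (C + B * m)) \<longlongrightarrow> c * 0 * (C + B * m)) at_top"
    using \<beta> by (intro tendsto_intros tendsto_neg_powr filterlim_ident) auto
  then have "\<forall>\<^sub>F R in at_top. c * R powr (- \<beta>) * (C + B * m) < e"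
    using e by (intro order_tendstoD) auto
  then have "\<exists>R>0. c * R powr (- \<beta>) * (C + B * m) < e"
    using eventually_gt_at_top[of 0] by (metis (mono_tags, lifting) eventually_conj eventually_happens trivial_limit_at_top_linorder)
  then obtain R where R: "0 < R" "c * R powr (- \<beta>) * (C + B * m) < e" by blast
  define F where "F = {j. knorm j \<le> R}"
  have "(\<integral>\<^sup>+s. (\<integral>\<^sup>+j. ennreal (norm (h N s j)) * indicator (- F) j \<partial>count_space UNIV) \<partial>M) \<le> ennreal e" for N
  proof -
    let ?r = "R powr (- \<beta>)"
    have half: "(p + q) / 2 \<le> w + q" if "0 \<le> p" "0 \<le> q" "p \<le> w" for p q w :: real
      using that by simp
    let ?X = "\<lambda>s. \<integral>\<^sup>+j. ennreal ((a N s j)\<^sup>2 * knorm j powr (2 * \<beta>)) \<partial>count_space UNIV"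
    have pt: "ennreal (norm (h N s j)) * indicator (- F) j
      \<le> ennreal (c * ?r) * ennreal ((a N s j)\<^sup>2 * knorm j powr (2 * \<beta>)) + ennreal (c * ?r) * ennreal ((b N s (k - j))\<^sup>2)"
      if s: "s \<in> space M" for s j
    proof (cases "j \<in> F")
      case False
      then have j: "R < knorm j" by (simp add: F_def)
      have "R powr \<beta> * R powr \<beta> \<le> knorm j powr (2 * \<beta>)"
        using j R \<beta> by (simp add: powr_add[symmetric] powr_mono2)
      then have w: "(a N s j)\<^sup>2 / ?r \<le> ?r * ((a N s j)\<^sup>2 * knorm j powr (2 * \<beta>))"
        using mult_right_mono[of "R powr \<beta> * R powr \<beta>" "knorm j powr (2 * \<beta>)" "(a N s j)\<^sup>2"] R
        by (simp add: powr_minus field_simps)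
      have "norm (h N s j) \<le> c * (a N s j * b N s (k - j))" by (rule h[OF s])
      also have "\<dots> \<le> c * (((a N s j)\<^sup>2 / ?r + ?r * (b N s (k - j))\<^sup>2) / 2)"
        using abs_mult_le_param[of ?r "a N s j" "b N s (k - j)"] R c by (intro mult_left_mono) auto
      also have "\<dots> \<le> c * (?r * ((a N s j)\<^sup>2 * knorm j powr (2 * \<beta>)) + ?r * (b N s (k - j))\<^sup>2)"
      proof (rule mult_left_mono[OF _ c])
        have "0 \<le> (a N s j)\<^sup>2 / ?r" "0 \<le> ?r * (b N s (k - j))\<^sup>2" by auto
        then show "((a N s j)\<^sup>2 / ?r + ?r * (b N s (k - j))\<^sup>2) / 2 \<le> ?r * ((a N s j)\<^sup>2 * knorm j powr (2 * \<beta>)) + ?r * (b N s (k - j))\<^sup>2"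
          using w half[of "(a N s j)\<^sup>2 / ?r" "?r * (b N s (k - j))\<^sup>2"] by blast
      qed
      finally have "norm (h N s j) \<le> c * ?r * ((a N s j)\<^sup>2 * knorm j powr (2 * \<beta>)) + c * ?r * (b N s (k - j))\<^sup>2"
        by (simp add: distrib_left mult.assoc)
      then show ?thesis
        using c by (simp add: False ennreal_mult''[symmetric] ennreal_plus[symmetric] ennreal_leI del: ennreal_plus)
    qed simp
    have bij: "(\<integral>\<^sup>+j. ennreal ((b N s (k - j))\<^sup>2) \<partial>count_space UNIV) = (\<integral>\<^sup>+j. ennreal ((b N s j)\<^sup>2) \<partial>count_space UNIV)" for s
      by (rule nn_integral_bij_count_space) (rule bij_betw_byWitness[of _ "\<lambda>j. k - j"], auto)
    have Xm: "?X \<in> borel_measurable M"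
      by (rule borel_measurable_nn_integral_count_space) (use meas in measurable)
    have "(\<integral>\<^sup>+s. (\<integral>\<^sup>+j. ennreal (norm (h N s j)) * indicator (- F) j \<partial>count_space UNIV) \<partial>M)
      \<le> (\<integral>\<^sup>+s. ennreal (c * ?r) * ?X s + ennreal (c * ?r) * ennreal B \<partial>M)"
    proof (rule nn_integral_mono)
      fix s assume s: "s \<in> space M"
      have "(\<integral>\<^sup>+j. ennreal (norm (h N s j)) * indicator (- F) j \<partial>count_space UNIV)
        \<le> (\<integral>\<^sup>+j. ennreal (c * ?r) * ennreal ((a N s j)\<^sup>2 * knorm j powr (2 * \<beta>)) + ennreal (c * ?r) * ennreal ((b N s (k - j))\<^sup>2) \<partial>count_space UNIV)"
        by (intro nn_integral_mono pt s)
      also have "\<dots> = ennreal (c * ?r) * ?X s + ennreal (c * ?r) * (\<integral>\<^sup>+j. ennreal ((b N s j)\<^sup>2) \<partial>count_space UNIV)"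
        by (subst nn_integral_add) (auto simp: nn_integral_cmult bij)
      also have "\<dots> \<le> ennreal (c * ?r) * ?X s + ennreal (c * ?r) * ennreal B"
        by (intro add_left_mono mult_left_mono Bb s) auto
      finally show "(\<integral>\<^sup>+j. ennreal (norm (h N s j)) * indicator (- F) j \<partial>count_space UNIV) \<le> ennreal (c * ?r) * ?X s + ennreal (c * ?r) * ennreal B" .
    qed
    also have "\<dots> = ennreal (c * ?r) * (\<integral>\<^sup>+s. ?X s \<partial>M) + ennreal (c * ?r) * ennreal B * emeasure M (space M)"
      using Xm by (subst nn_integral_add) (auto simp: nn_integral_cmult)
    also have "\<dots> \<le> ennreal (c * ?r) * ennreal C + ennreal (c * ?r) * ennreal B * emeasure M (space M)"
      by (intro add_right_mono mult_left_mono A) auto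
    also have "\<dots> = ennreal (c * ?r * C + c * ?r * B * m)"
      using c CB m0 by (simp add: emeasure_eq_measure m_def ennreal_mult''[symmetric] ennreal_plus[symmetric] del: ennreal_plus)
    also have "\<dots> \<le> ennreal e"
      using R(2) by (intro ennreal_leI) (simp add: algebra_simps)
    finally show ?thesis .
  qed
  then show ?thesis using finite_knorm_le[of R] unfolding F_def by blast
qed

lemma borel_measurable_bounded_linear:
  fixes L :: "'b::euclidean_space \<Rightarrow> 'c::euclidean_space"
  assumes "bounded_linear L" "f \<in> borel_measurable M"
  shows "(\<lambda>x. L (f x)) \<in> borel_measurable M"
  by (rule measurable_compose[OF assms(2) borel_measurable_continuous_onI[OF linear_continuous_on[OF assms(1)]]])

lemma bounded_bilinear_smult: "bounded_bilinear (\<lambda>c (w :: complex ^ 'n). c *s w)"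
proof
  show "\<exists>K. \<forall>a (b :: complex ^ 'n). norm (a *s b) \<le> norm a * norm b * K"
    by (rule exI[of _ 1]) (simp add: norm_smult)
qed (simp_all add: vec_eq_iff algebra_simps scaleR_conv_of_real[where 'a = complex])

lemma borel_measurable_smult:
  fixes f :: "'a \<Rightarrow> complex" and g :: "'a \<Rightarrow> complex ^ 'n"
  assumes "f \<in> borel_measurable M" "g \<in> borel_measurable M"
  shows "(\<lambda>x. f x *s g x) \<in> borel_measurable M"
  by (rule borel_measurable_continuous_Pair[OF assms])
    (intro bounded_bilinear.continuous_on[OF bounded_bilinear_smult] continuous_intros)

lemma integral_count_space_support:
  fixes g :: "'i \<Rightarrow> 'b::{banach, second_countable_topology}"
  assumes F: "finite F" and g: "\<And>j. j \<notin> F \<Longrightarrow> g j = 0"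
  shows "(\<integral>j. g j \<partial>count_space UNIV) = sum g F"
proof -
  have s: "{a. a \<in> UNIV \<and> g a \<noteq> 0} \<subseteq> F" using g by auto
  have "(\<integral>j. g j \<partial>count_space UNIV) = (\<Sum>a | a \<in> UNIV \<and> g a \<noteq> 0. g a)"
    by (rule lebesgue_integral_count_space_finite_support) (rule finite_subset[OF s F])
  also have "\<dots> = sum g F"
    by (rule sum.mono_neutral_left[OF F s]) auto
  finally show ?thesis .
qed

section \<open>Integrals over time intervals and Lipschitz bounds for modes\<close>

abbreviation LI :: "real \<Rightarrow> real measure" where
  "LI t \<equiv> restrict_space lborel {0..t}"

lemma finite_measure_LI: "finite_measure (LI t)"
  by (intro finite_measureI) (simp add: emeasure_restrict_space space_restrict_space emeasure_lborel_Icc_eq)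

lemma space_LI [simp]: "space (LI t) = {0..t}"
  by (simp add: space_restrict_space)

lemma set_integral_eq_LI:
  fixes f :: "real \<Rightarrow> 'b::{banach, second_countable_topology}"
  shows "(LINT s:{0..t}|lborel. f s) = (\<integral>s. f s \<partial>LI t)"
  by (simp add: set_lebesgue_integral_def integral_restrict_space)

lemma set_integrable_eq_LI:
  fixes f :: "real \<Rightarrow> 'b::{banach, second_countable_topology}"
  shows "set_integrable lborel {0..t} f \<longleftrightarrow> integrable (LI t) f"
  by (simp add: set_integrable_def integrable_restrict_space)

lemma set_nn_integral_eq_LI: "(\<integral>\<^sup>+s\<in>{0..t}. f s \<partial>lborel) = (\<integral>\<^sup>+s. f s \<partial>LI t)"
  by (simp add: nn_integral_restrict_space)

lemma borel_measurable_LI: "f \<in> borel_measurable borel \<Longrightarrow> f \<in> borel_measurable (LI t)"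
  by (rule measurable_restrict_space1) simp

lemma integrable_LI_bounded:
  fixes f :: "real \<Rightarrow> 'b::{banach, second_countable_topology}"
  assumes "f \<in> borel_measurable borel" "\<And>s. s \<in> {0..t} \<Longrightarrow> norm (f s) \<le> B"
  shows "integrable (LI t) f"
  by (rule finite_measure.integrable_const_bound[OF finite_measure_LI, where B = B])
    (use assms in \<open>auto intro!: AE_I2 borel_measurable_LI\<close>)

lemma integral_LI_diff_le:
  fixes f :: "real \<Rightarrow> 'b::euclidean_space"
  assumes f: "f \<in> borel_measurable borel" "\<And>s. s \<in> {0..T} \<Longrightarrow> norm (f s) \<le> B" and st: "0 \<le> s" "s \<le> t" "t \<le> T"
  shows "norm ((\<integral>s. f s \<partial>LI t) - (\<integral>s. f s \<partial>LI s)) \<le> B * (t - s)"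
proof -
  have i: "set_integrable lborel {0..t} f"
    unfolding set_integrable_eq_LI by (rule integrable_LI_bounded[OF f(1), of _ B]) (use f(2) st in auto)
  have is1: "set_integrable lborel {0..s} f" and is2: "set_integrable lborel {s<..t} f"
    by (rule set_integrable_subset[OF i]; use st in auto)+
  have "(LINT x:{0..t}|lborel. f x) = (LINT x:{0..s}|lborel. f x) + (LINT x:{s<..t}|lborel. f x)"
    using set_integral_Un[OF _ is1 is2] st by (simp add: ivl_disj_un ivl_disj_int)
  then have e: "(\<integral>s. f s \<partial>LI t) - (\<integral>s. f s \<partial>LI s) = (LINT x:{s<..t}|lborel. f x)"
    by (simp add: set_integral_eq_LI)
  have "norm (LINT x:{s<..t}|lborel. f x) \<le> (\<integral>x. indicator {s<..t} x * B \<partial>lborel)"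
    unfolding set_lebesgue_integral_def
  proof (rule order_trans[OF integral_norm_bound], rule integral_mono)
    show "integrable lborel (\<lambda>x. norm (indicator {s<..t} x *\<^sub>R f x))"
      using is2 unfolding set_integrable_def by (rule integrable_norm)
    show "integrable lborel (\<lambda>x. indicator {s<..t} x * B)"
      by (intro integrable_mult_left integrable_real_indicator) (use st in auto)
    show "norm (indicator {s<..t} x *\<^sub>R f x) \<le> indicator {s<..t} x * B" for x
      using f(2)[of x] st by (auto simp: indicator_def)
  qed
  also have "\<dots> = B * (t - s)" using st by simp
  finally show ?thesis unfolding e .
qed

lemma approx_solutionD:
  assumes "approx_solution \<alpha> \<beta> \<nu> T v0 th0 J M S C err V G"
  shows "(\<lambda>t. V t k) \<in> borel_measurable borel" "(\<lambda>t. fcoef (G t) k) \<in> borel_measurable borel"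
    and "t \<in> {0..T} \<Longrightarrow> real_v (V t)" "t \<in> {0..T} \<Longrightarrow> k \<notin> J \<Longrightarrow> V t k = 0"
    and "t \<in> {0..T} \<Longrightarrow> (\<Sum>k\<in>J. (norm (V t k))\<^sup>2) \<le> M"
    and "(\<integral>\<^sup>+t\<in>{0..T}. ennreal (\<Sum>k\<in>J. (norm (V t k))\<^sup>2 * knorm k powr (2 * \<beta>)) \<partial>lborel) \<le> ennreal C"
    and "t \<in> {0..T} \<Longrightarrow> cperiodic (G t)" "t \<in> {0..T} \<Longrightarrow> fcoef (G t) 0 = 0"
    and "t \<in> {0..T} \<Longrightarrow> finite F \<Longrightarrow> (\<Sum>k\<in>F. (cmod (fcoef (G t) k))\<^sup>2) \<le> S"
    and "t \<in> {0..T} \<Longrightarrow> convex_on UNIV \<phi> \<Longrightarrow> integrable LT (\<lambda>x. \<phi> (th0 x)) \<Longrightarrow> (\<integral>x. \<phi> (G t x) \<partial>LT) \<le> (\<integral>x. \<phi> (th0 x) \<partial>LT)"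
    and "t \<in> {0..T} \<Longrightarrow> k \<in> J \<Longrightarrow> norm (V t k - v0 k
        - (\<integral>s. gal_rhs J \<nu> \<beta> (lam_v (- 2 * \<alpha>) (V s)) (V s) (fcoef (G s)) k \<partial>LI t)) \<le> err k"
    and "t \<in> {0..T} \<Longrightarrow> norm (fcoef (G t) k - fcoef th0 k
        + (\<integral>s. \<i> * (\<Sum>j\<in>J. kdot k (lam_v (- 2 * \<alpha>) (V s) j) * fcoef (G s) (k - j)) \<partial>LI t)) \<le> err k"
    and "k \<in> J \<Longrightarrow> \<nu> * knorm k powr (2 * \<beta>) * (\<integral>s. norm (V s k) \<partial>LI T)
        \<le> norm (v0 k) + (\<integral>s. norm (gal_source J (lam_v (- 2 * \<alpha>) (V s)) (V s) (fcoef (G s)) k) \<partial>LI T)"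
  using assms unfolding approx_solution_def set_integral_eq_LI by blast+

lemma borel_measurable_lam_v:
  assumes "\<And>k. (\<lambda>t. V t k) \<in> borel_measurable M"
  shows "(\<lambda>t. lam_v s (V t) k) \<in> borel_measurable M"
  unfolding lam_v_def using assms by measurable

lemma borel_measurable_advect:
  assumes "\<And>k. (\<lambda>t. u t k) \<in> borel_measurable M" "\<And>k. (\<lambda>t. v t k) \<in> borel_measurable M"
  shows "(\<lambda>t. advect J (u t) (v t) k) \<in> borel_measurable M"
  unfolding advect_def
  by (intro borel_measurable_sum borel_measurable_smult borel_measurable_bounded_linear[OF bounded_linear_kdot] assms)

lemma borel_measurable_gal_source:
  assumes "\<And>k. (\<lambda>t. u t k) \<in> borel_measurable M" "\<And>k. (\<lambda>t. v t k) \<in> borel_measurable M" "\<And>k. (\<lambda>t. \<theta> t k) \<in> borel_measurable M"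
  shows "(\<lambda>t. gal_source J (u t) (v t) (\<theta> t) k) \<in> borel_measurable M"
  unfolding gal_source_def
  by (intro borel_measurable_bounded_linear[OF bounded_linear_leray] borel_measurable_diff borel_measurable_smult
      borel_measurable_advect assms borel_measurable_const)

lemma borel_measurable_gal_rhs:
  assumes "\<And>k. (\<lambda>t. u t k) \<in> borel_measurable M" "\<And>k. (\<lambda>t. v t k) \<in> borel_measurable M" "\<And>k. (\<lambda>t. \<theta> t k) \<in> borel_measurable M"
  shows "(\<lambda>t. gal_rhs J \<nu> \<beta> (u t) (v t) (\<theta> t) k) \<in> borel_measurable M"
  unfolding gal_rhs_def
  by (intro borel_measurable_diff borel_measurable_gal_source borel_measurable_scaleR borel_measurable_const assms)

text \<open>The sum of the bounds for the velocity and temperature right-hand sides, so that one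
  constant serves both fields.\<close>

definition mode_lip :: "real \<Rightarrow> real \<Rightarrow> real \<Rightarrow> real \<Rightarrow> wvec \<Rightarrow> real" where
  "mode_lip \<beta> \<nu> M S k = 2 * (S + 1 + knorm k * M) + \<nu> * knorm k powr (2 * \<beta>) * (M + 1) + knorm k * (M + S)"

lemma approx_solution_nonneg:
  assumes "approx_solution \<alpha> \<beta> \<nu> T v0 th0 J M S C err V G" "0 < T"
  shows "0 \<le> M" "0 \<le> S"
  using order_trans[OF sum_nonneg approx_solutionD(5)[OF assms(1), of 0]] approx_solutionD(9)[OF assms(1), of 0 "{}"] assms(2) by auto

text \<open>The integral equation holds up to \<open>err k\<close> at each of the two times
  compared, hence the slack 2 err k on top of the Lipschitz bound coming from the integrand.\<close>

lemma approx_solution_lipschitz: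
  assumes ap: "approx_solution \<alpha> \<beta> \<nu> T v0 th0 J M S C err V G" and J: "finite J"
    and par: "0 \<le> \<alpha>" "0 \<le> \<nu>" "0 < T" and st: "s \<in> {0..T}" "t \<in> {0..T}"
  shows "k \<in> J \<Longrightarrow> norm (V t k - V s k) \<le> mode_lip \<beta> \<nu> M S k * \<bar>t - s\<bar> + 2 * err k"
    and "norm (fcoef (G t) k - fcoef (G s) k) \<le> mode_lip \<beta> \<nu> M S k * \<bar>t - s\<bar> + 2 * err k"
proof -
  note D = approx_solutionD[OF ap]
  note bounds_nonneg = approx_solution_nonneg[OF ap par(3)]
  let ?U = "\<lambda>s. lam_v (- 2 * \<alpha>) (V s)"
  let ?R = "\<lambda>s. gal_rhs J \<nu> \<beta> (?U s) (V s) (fcoef (G s)) k"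
  let ?Q = "\<lambda>s. \<i> * (\<Sum>j\<in>J. kdot k (?U s j) * fcoef (G s) (k - j))"
  have Rm: "?R \<in> borel_measurable borel"
    by (intro borel_measurable_gal_rhs borel_measurable_lam_v D)
  have Qm: "?Q \<in> borel_measurable borel"
    by (intro borel_measurable_times borel_measurable_const borel_measurable_sum borel_measurable_bounded_linear[OF bounded_linear_kdot] borel_measurable_lam_v D)
  have Rb: "norm (?R s) \<le> mode_lip \<beta> \<nu> M S k" if s: "s \<in> {0..T}" for s
  proof -
    have "norm (?R s) \<le> 2 * (S + 1 + knorm k * M) + \<nu> * knorm k powr (2 * \<beta>) * (M + 1)"
      using D(9)[OF s, of "{_}"] by (intro norm_gal_rhs_le J D(4)[OF s] norm_lam_v_le par D(5)[OF s]) auto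
    moreover have "0 \<le> knorm k * (M + S)" using bounds_nonneg by simp
    ultimately show ?thesis unfolding mode_lip_def by linarith
  qed
  have Qb: "norm (?Q s) \<le> mode_lip \<beta> \<nu> M S k" if s: "s \<in> {0..T}" for s
  proof -
    have "norm (?Q s) \<le> knorm k * (M + S)"
      by (intro norm_transport_sum_le[where v = "V s"] J norm_lam_v_le par D(5)[OF s] D(9)[OF s])
    moreover have "0 \<le> 2 * (S + 1 + knorm k * M) + \<nu> * knorm k powr (2 * \<beta>) * (M + 1)"
      using bounds_nonneg par by simp
    ultimately show ?thesis unfolding mode_lip_def by linarith
  qed
  have dl: "norm ((\<integral>s. f s \<partial>LI t) - (\<integral>s. f s \<partial>LI s)) \<le> mode_lip \<beta> \<nu> M S k * \<bar>t - s\<bar>"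
    if f: "f \<in> borel_measurable borel" "\<And>s. s \<in> {0..T} \<Longrightarrow> norm (f s) \<le> mode_lip \<beta> \<nu> M S k" for f :: "real \<Rightarrow> 'c::euclidean_space"
  proof (cases "s \<le> t")
    case True
    then show ?thesis using integral_LI_diff_le[where T = T, OF f, where s = s and t = t] st by simp
  next
    case False
    then show ?thesis using integral_LI_diff_le[where T = T, OF f, where s = t and t = s] st by (simp add: norm_minus_commute)
  qed
  have tri: "norm (a - b) \<le> X + 2 * e" if "norm (a - c - p) \<le> e" "norm (b - c - q) \<le> e" "norm (p - q) \<le> X"
    for a b c p q :: "'c::real_normed_vector" and X e :: real
  proof -
    have "a - b = (a - c - p) - (b - c - q) + (p - q)" by simp
    then have "norm (a - b) \<le> norm (a - c - p) + norm (b - c - q) + norm (p - q)"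
      using norm_triangle_ineq[of "(a - c - p) - (b - c - q)" "p - q"] norm_triangle_ineq4[of "a - c - p" "b - c - q"] by simp
    then show ?thesis using that by linarith
  qed
  show "norm (V t k - V s k) \<le> mode_lip \<beta> \<nu> M S k * \<bar>t - s\<bar> + 2 * err k" if k: "k \<in> J"
    by (rule tri[OF D(11)[OF st(2) k] D(11)[OF st(1) k] dl[OF Rm Rb]])
  have n: "norm (- p - - q) = norm (p - q)" for p q :: complex by (simp add: norm_minus_commute)
  show "norm (fcoef (G t) k - fcoef (G s) k) \<le> mode_lip \<beta> \<nu> M S k * \<bar>t - s\<bar> + 2 * err k"
  proof -
    have h: "norm (fcoef (G t) k - fcoef th0 k - (- (\<integral>s. ?Q s \<partial>LI t))) \<le> err k"
      "norm (fcoef (G s) k - fcoef th0 k - (- (\<integral>s. ?Q s \<partial>LI s))) \<le> err k"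
      using D(12)[OF st(1), of k] D(12)[OF st(2), of k] by simp_all
    have h3: "norm ((- (\<integral>s. ?Q s \<partial>LI t)) - (- (\<integral>s. ?Q s \<partial>LI s))) \<le> mode_lip \<beta> \<nu> M S k * \<bar>t - s\<bar>"
      unfolding n by (rule dl[OF Qm Qb])
    show ?thesis by (rule tri[OF h h3])
  qed
qed

text \<open>Convergence is required at every time in [0,T] rather than almost everywhere, since the
  equations, weak continuity and the L_q bounds are all read off at single times.\<close>

locale approx_limit =
  fixes \<alpha> \<beta> \<nu> T :: real and v0 :: vfield and th0 :: "real ^ 3 \<Rightarrow> real" and J :: "nat \<Rightarrow> wvec set"
    and M S C :: real and err :: "nat \<Rightarrow> wvec \<Rightarrow> real" and V :: "nat \<Rightarrow> real \<Rightarrow> vfield"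
    and G :: "nat \<Rightarrow> real \<Rightarrow> real ^ 3 \<Rightarrow> real" and v :: "real \<Rightarrow> vfield" and th :: "real \<Rightarrow> sfield"
  assumes par: "0 \<le> \<alpha>" "0 < \<beta>" "0 < \<nu>" "0 < T"
    and J: "\<And>N. finite (J N)" "\<And>k. k \<noteq> 0 \<Longrightarrow> \<forall>\<^sub>F N in sequentially. k \<in> J N"
    and err: "\<And>k. (\<lambda>N. err N k) \<longlonglongrightarrow> 0"
    and ap: "\<And>N. approx_solution \<alpha> \<beta> \<nu> T v0 th0 (J N) M S C (err N) (V N) (G N)"
    and limV: "\<And>t k. t \<in> {0..T} \<Longrightarrow> (\<lambda>N. V N t k) \<longlonglongrightarrow> v t k"
    and limG: "\<And>t k. t \<in> {0..T} \<Longrightarrow> (\<lambda>N. fcoef (G N t) k) \<longlonglongrightarrow> th t k"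
    and vm: "\<And>k. (\<lambda>t. v t k) \<in> borel_measurable borel" and thmeas: "\<And>k. (\<lambda>t. th t k) \<in> borel_measurable borel"

theorem approx_limit_exists:
  fixes \<alpha> \<beta> \<nu> T :: real
  assumes par: "0 \<le> \<alpha>" "0 < \<beta>" "0 < \<nu>" "0 < T" and v0: "in_V 0 v0"
    and th0: "th0 \<in> borel_measurable LT" "integrable LT (\<lambda>x. (th0 x)\<^sup>2)" "fcoef th0 0 = 0"
  shows "\<exists>J M S C err V G v th. approx_limit \<alpha> \<beta> \<nu> T v0 th0 J M S C err V G v th"
proof -
  obtain J :: "nat \<Rightarrow> wvec set" and M S C :: real and err :: "nat \<Rightarrow> wvec \<Rightarrow> real" and V G where
    J: "\<And>N. finite (J N)" "\<And>k. k \<noteq> 0 \<Longrightarrow> \<forall>\<^sub>F N in sequentially. k \<in> J N" and err: "\<And>k. (\<lambda>N. err N k) \<longlonglongrightarrow> 0"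
    and ap: "\<And>N. approx_solution \<alpha> \<beta> \<nu> T v0 th0 (J N) M S C (err N) (V N) (G N)"
    using approximants[where \<beta> = \<beta>, OF par(1,3,4) v0 th0] by blast
  note D = approx_solutionD[OF ap]
  note bounds_nonneg = approx_solution_nonneg[OF ap par(4)]
  \<comment> \<open>Both fields are paired so that a single extraction gives a common
    subsequence.\<close>
  define f where "f N t k = (V N t k, fcoef (G N t) k)" for N t k
  have a1: "norm (f N t k) \<le> (M + 1) + (S + 1)" if t: "t \<in> {0..T}" for N t k
  proof -
    have "norm (V N t k) \<le> M + 1"
    proof (rule le_add_1_if_square_le, cases "k \<in> J N")
      case True
      then show "(norm (V N t k))\<^sup>2 \<le> M"
        by (intro order_trans[OF member_le_sum[of k "J N" "\<lambda>k. (norm (V N t k))\<^sup>2"] D(5)[OF t]]) (use J in auto)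
    qed (use D(4)[OF t] bounds_nonneg in auto)
    moreover have "norm (fcoef (G N t) k) \<le> S + 1"
      by (rule le_add_1_if_square_le) (use D(9)[OF t, of "{k}"] in simp)
    ultimately show ?thesis
      unfolding f_def using norm_Pair_le[of "V N t k" "fcoef (G N t) k"] by linarith
  qed
  have a2: "\<forall>\<^sub>F N in sequentially. \<forall>s\<in>{0..T}. \<forall>t\<in>{0..T}.
      norm (f N t k - f N s k) \<le> 2 * mode_lip \<beta> \<nu> M S k * \<bar>t - s\<bar> + 4 * err N k" for k
  proof (cases "k = 0")
    case False
    show ?thesis using J(2)[OF False]
    proof (eventually_elim, intro ballI)
      fix N s t assume k: "k \<in> J N" and st: "s \<in> {0..T}" "t \<in> {0..T}"
      show "norm (f N t k - f N s k) \<le> 2 * mode_lip \<beta> \<nu> M S k * \<bar>t - s\<bar> + 4 * err N k"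
        using norm_Pair_le[of "V N t k - V N s k" "fcoef (G N t) k - fcoef (G N s) k"]
          approx_solution_lipschitz(1)[OF ap J(1) par(1) less_imp_le[OF par(3)] par(4) st k]
          approx_solution_lipschitz(2)[OF ap J(1) par(1) less_imp_le[OF par(3)] par(4) st, of N k]
        unfolding f_def diff_Pair by linarith
    qed
  next
    case True
    \<comment> \<open>Mode 0 is not covered by the eventual membership in J N, but there both
      components vanish identically.\<close>
    have "0 \<le> err N 0" for N using order_trans[OF norm_ge_zero D(12)[of 0 N 0]] par by simp
    moreover have "0 \<le> mode_lip \<beta> \<nu> M S 0" using bounds_nonneg by (simp add: mode_lip_def)
    moreover have "f N t 0 = 0" if "t \<in> {0..T}" for N t
      using real_vD(1)[OF D(3)[OF that]] D(8)[OF that] by (simp add: f_def zero_prod_def)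
    ultimately show ?thesis using True by simp
  qed
  have a3: "0 \<le> 2 * mode_lip \<beta> \<nu> M S k" for k using bounds_nonneg par by (simp add: mode_lip_def)
  have a4: "(\<lambda>N. 4 * err N k) \<longlonglongrightarrow> 0" for k using tendsto_mult[OF tendsto_const err, of 4] by simp
  obtain r where r: "strict_mono r" "\<And>t k. t \<in> {0..T} \<Longrightarrow> convergent (\<lambda>N. f (r N) t k)"
    using equicontinuous_subsequence[of T f "(M + 1) + (S + 1)" "\<lambda>k. 2 * mode_lip \<beta> \<nu> M S k" "\<lambda>N k. 4 * err N k", OF par(4) a1 a2 a3 a4]
    by blast
  \<comment> \<open>Set to 0 outside [0,T], so that each mode is Borel measurable on the whole line
    as a limit of cut-off approximations.\<close>
  define v where "v t k = (if t \<in> {0..T} then fst (lim (\<lambda>N. f (r N) t k)) else 0)" for t k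
  define th where "th t k = (if t \<in> {0..T} then snd (lim (\<lambda>N. f (r N) t k)) else 0)" for t k
  have l: "(\<lambda>N. f (r N) t k) \<longlonglongrightarrow> lim (\<lambda>N. f (r N) t k)" if "t \<in> {0..T}" for t k
    using r(2)[OF that] by (simp add: convergent_LIMSEQ_iff)
  have lv: "(\<lambda>N. V (r N) t k) \<longlonglongrightarrow> v t k" if "t \<in> {0..T}" for t k
    using tendsto_fst[OF l[OF that, of k]] that by (simp add: f_def v_def)
  have lt: "(\<lambda>N. fcoef (G (r N) t) k) \<longlonglongrightarrow> th t k" if "t \<in> {0..T}" for t k
    using tendsto_snd[OF l[OF that, of k]] that by (simp add: f_def th_def)
  have vm: "(\<lambda>t. v t k) \<in> borel_measurable borel" for k
  proof (rule borel_measurable_LIMSEQ_metric)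
    show "(\<lambda>t. indicator {0..T} t *\<^sub>R V (r N) t k) \<in> borel_measurable borel" for N
      using D(1) by measurable
    show "(\<lambda>N. indicator {0..T} t *\<^sub>R V (r N) t k) \<longlonglongrightarrow> v t k" for t
      using lv[of t k] by (cases "t \<in> {0..T}") (auto simp: v_def)
  qed
  have thmeas: "(\<lambda>t. th t k) \<in> borel_measurable borel" for k
  proof (rule borel_measurable_LIMSEQ_metric)
    show "(\<lambda>t. indicator {0..T} t *\<^sub>R fcoef (G (r N) t) k) \<in> borel_measurable borel" for N
      using D(2) by measurable
    show "(\<lambda>N. indicator {0..T} t *\<^sub>R fcoef (G (r N) t) k) \<longlonglongrightarrow> th t k" for t
      using lt[of t k] by (cases "t \<in> {0..T}") (auto simp: th_def)
  qed
  have "approx_limit \<alpha> \<beta> \<nu> T v0 th0 (\<lambda>N. J (r N)) M S C (\<lambda>N. err (r N)) (\<lambda>N. V (r N)) (\<lambda>N. G (r N)) v th"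
  proof
    show "\<forall>\<^sub>F N in sequentially. k \<in> J (r N)" if "k \<noteq> 0" for k
      by (rule eventually_subseq[OF r(1) J(2)[OF that]])
    show "(\<lambda>N. err (r N) k) \<longlonglongrightarrow> 0" for k
      using LIMSEQ_subseq_LIMSEQ[OF err r(1)] by (simp add: o_def)
  qed (fact par J(1) ap lv lt vm thmeas)+
  then show ?thesis by blast
qed

lemma leray_diff: "leray k (a - b) = leray k a - leray k b"
  using linear_diff[OF linear_leray] .

lemma bounded_linear_smult_left: "bounded_linear (\<lambda>c. c *s (w :: complex ^ 'n))"
  by (rule bounded_bilinear.bounded_linear_left[OF bounded_bilinear_smult])

lemma bounded_linear_smult_right: "bounded_linear (\<lambda>w :: complex ^ 'n. c *s w)"
  by (rule bounded_bilinear.bounded_linear_right[OF bounded_bilinear_smult])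

section \<open>Passage to the limit, mode by mode\<close>

context approx_limit
begin

lemmas D = approx_solutionD[OF ap]

lemma bounds_nonneg: "0 \<le> M" "0 \<le> S"
  using approx_solution_nonneg[OF ap par(4)] by auto

abbreviation "U N t \<equiv> lam_v (- 2 * \<alpha>) (V N t)"
abbreviation "u t \<equiv> lam_v (- 2 * \<alpha>) (v t)"
abbreviation "Th N t \<equiv> fcoef (G N t)"

lemma V_sum_le:
  assumes "t \<in> {0..T}" "finite F" shows "(\<Sum>k\<in>F. (norm (V N t k))\<^sup>2) \<le> M"
proof -
  have "(\<Sum>k\<in>F. (norm (V N t k))\<^sup>2) = (\<Sum>k\<in>F \<inter> J N. (norm (V N t k))\<^sup>2)"
    using assms D(4)[OF assms(1)] by (intro sum.mono_neutral_right) auto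
  also have "\<dots> \<le> (\<Sum>k\<in>J N. (norm (V N t k))\<^sup>2)"
    by (rule sum_mono2) (use J in auto)
  also have "\<dots> \<le> M" by (rule D(5)[OF assms(1)])
  finally show ?thesis .
qed

lemma norm_V_le: "t \<in> {0..T} \<Longrightarrow> norm (V N t k) \<le> M + 1"
  using V_sum_le[of t "{k}" N] by (auto intro: le_add_1_if_square_le)

lemma norm_Th_le: "t \<in> {0..T} \<Longrightarrow> norm (Th N t k) \<le> S + 1"
  using D(9)[of t "{k}" N] by (auto intro: le_add_1_if_square_le)

lemma norm_U_le: "norm (U N t k) \<le> norm (V N t k)"
  by (rule norm_lam_v_le) (rule par)

lemma norm_u_le: "norm (u t k) \<le> norm (v t k)"
  by (rule norm_lam_v_le) (rule par)

lemma nn_sum_le: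
  fixes f :: "wvec \<Rightarrow> 'b::real_normed_vector"
  assumes "\<And>F. finite F \<Longrightarrow> (\<Sum>k\<in>F. (norm (f k))\<^sup>2) \<le> B"
  shows "(\<integral>\<^sup>+j. ennreal ((norm (f j))\<^sup>2) \<partial>count_space UNIV) \<le> ennreal B"
  by (rule nn_integral_count_space_le) (simp add: assms ennreal_leI)

lemma v_sum_le: "t \<in> {0..T} \<Longrightarrow> finite F \<Longrightarrow> (\<Sum>k\<in>F. (norm (v t k))\<^sup>2) \<le> M"
  by (rule LIMSEQ_le_const2[of "\<lambda>N. \<Sum>k\<in>F. (norm (V N t k))\<^sup>2"]) (auto intro!: tendsto_intros limV V_sum_le)

lemma th_sum_le: "t \<in> {0..T} \<Longrightarrow> finite F \<Longrightarrow> (\<Sum>k\<in>F. (cmod (th t k))\<^sup>2) \<le> S"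
  by (rule LIMSEQ_le_const2[of "\<lambda>N. \<Sum>k\<in>F. (cmod (Th N t k))\<^sup>2"]) (auto intro!: tendsto_intros limG D(9))

lemma norm_v_le: "t \<in> {0..T} \<Longrightarrow> norm (v t k) \<le> M + 1"
  using v_sum_le[of t "{k}"] by (auto intro: le_add_1_if_square_le)

lemma real_v_v: "t \<in> {0..T} \<Longrightarrow> real_v (v t)"
proof -
  assume t: "t \<in> {0..T}"
  have "v t 0 = 0"
    using LIMSEQ_unique[OF limV[OF t, of 0]] real_vD(1)[OF D(3)[OF t]] by simp
  moreover have "v t (- k) = vcnj (v t k)" for k
  proof (rule LIMSEQ_unique[OF limV[OF t]])
    have "bounded_linear vcnj"
      by (rule linear_conv_bounded_linear[THEN iffD1], rule linearI) (auto simp: vcnj_add vcnj_scaleR)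
    from bounded_linear.tendsto[OF this limV[OF t, of k]]
    show "(\<lambda>N. V N t (- k)) \<longlonglongrightarrow> vcnj (v t k)"
      by (simp add: real_vD(2)[OF D(3)[OF t]])
  qed
  moreover have "kdot k (v t k) = 0" for k
    using LIMSEQ_unique[OF bounded_linear.tendsto[OF bounded_linear_kdot limV[OF t, of k], of k], of 0]
      real_vD(3)[OF D(3)[OF t]] by simp
  ultimately show ?thesis by (simp add: real_v_def)
qed

lemma real_s_th: "t \<in> {0..T} \<Longrightarrow> real_s (th t)"
proof -
  assume t: "t \<in> {0..T}"
  have "th t 0 = 0"
    using LIMSEQ_unique[OF limG[OF t, of 0]] D(8)[OF t] by simp
  moreover have "th t (- k) = cnj (th t k)" for k
  proof (rule LIMSEQ_unique[OF limG[OF t]])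
    show "(\<lambda>N. Th N t (- k)) \<longlonglongrightarrow> cnj (th t k)"
      using tendsto_cnj[OF limG[OF t, of k]] by (simp add: fcoef_uminus)
  qed
  ultimately show ?thesis by (simp add: real_s_def)
qed

lemma limU: "t \<in> {0..T} \<Longrightarrow> (\<lambda>N. U N t k) \<longlonglongrightarrow> u t k"
  unfolding lam_v_def by (intro tendsto_intros limV)

lemma u_measurable: "(\<lambda>t. u t k) \<in> borel_measurable borel"
  by (rule borel_measurable_lam_v[OF vm])

lemma U_measurable: "(\<lambda>t. U N t k) \<in> borel_measurable borel"
  by (rule borel_measurable_lam_v[OF D(1)])

lemma V_dissipation_eq:
  assumes "t \<in> {0..T}"
  shows "(\<integral>\<^sup>+j. ennreal ((norm (V N t j))\<^sup>2 * knorm j powr (2 * \<beta>)) \<partial>count_space UNIV)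
    = ennreal (\<Sum>k\<in>J N. (norm (V N t k))\<^sup>2 * knorm k powr (2 * \<beta>))"
  using D(4)[OF assms] by (subst nn_integral_count_space'[OF J(1)]) auto

lemma V_dissipation:
  assumes t: "t \<in> {0..T}"
  shows "(\<integral>\<^sup>+s. (\<integral>\<^sup>+j. ennreal ((norm (V N s j))\<^sup>2 * knorm j powr (2 * \<beta>)) \<partial>count_space UNIV) \<partial>LI t) \<le> ennreal (max C 0)"
proof -
  have "(\<integral>\<^sup>+s. (\<integral>\<^sup>+j. ennreal ((norm (V N s j))\<^sup>2 * knorm j powr (2 * \<beta>)) \<partial>count_space UNIV) \<partial>LI t)
    = (\<integral>\<^sup>+s\<in>{0..t}. ennreal (\<Sum>k\<in>J N. (norm (V N s k))\<^sup>2 * knorm k powr (2 * \<beta>)) \<partial>lborel)"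
    unfolding set_nn_integral_eq_LI by (rule nn_integral_cong) (use V_dissipation_eq t in auto)
  also have "\<dots> \<le> (\<integral>\<^sup>+s\<in>{0..T}. ennreal (\<Sum>k\<in>J N. (norm (V N s k))\<^sup>2 * knorm k powr (2 * \<beta>)) \<partial>lborel)"
    by (rule nn_integral_mono) (use t in \<open>auto simp: indicator_def\<close>)
  also have "\<dots> \<le> ennreal C" by (rule D(6))
  also have "\<dots> \<le> ennreal (max C 0)" by (rule ennreal_leI) simp
  finally show ?thesis .
qed

text \<open>Fatou is applied twice, over modes at fixed time and then over time; only convergence of
  each mode is needed.\<close>

lemma v_dissipation: "(\<integral>\<^sup>+s. vsq \<beta> (v s) \<partial>LI T) \<le> ennreal (max C 0)"
proof -
  let ?X = "\<lambda>N s. \<integral>\<^sup>+j. ennreal ((norm (V N s j))\<^sup>2 * knorm j powr (2 * \<beta>)) \<partial>count_space UNIV"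
  have Vm: "(\<lambda>s. V N s j) \<in> borel_measurable (LI T)" for N j
    by (rule borel_measurable_LI[OF D(1)])
  have "(\<integral>\<^sup>+s. vsq \<beta> (v s) \<partial>LI T) \<le> (\<integral>\<^sup>+s. liminf (\<lambda>N. ?X N s) \<partial>LI T)"
  proof (rule nn_integral_mono)
    fix s assume s: "s \<in> space (LI T)"
    have "vsq \<beta> (v s) = (\<integral>\<^sup>+j. liminf (\<lambda>N. ennreal ((norm (V N s j))\<^sup>2 * knorm j powr (2 * \<beta>))) \<partial>count_space UNIV)"
      unfolding vsq_eq by (intro nn_integral_cong lim_imp_Liminf[symmetric] tendsto_intros limV) (use s in auto)
    also have "\<dots> \<le> liminf (\<lambda>N. ?X N s)"
      by (rule nn_integral_liminf) auto
    finally show "vsq \<beta> (v s) \<le> liminf (\<lambda>N. ?X N s)" .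
  qed
  also have "\<dots> \<le> liminf (\<lambda>N. \<integral>\<^sup>+s. ?X N s \<partial>LI T)"
    by (intro nn_integral_liminf borel_measurable_nn_integral_count_space) (use Vm in measurable)
  also have "\<dots> \<le> ennreal (max C 0)"
    using Liminf_mono[of "\<lambda>N. \<integral>\<^sup>+s. ?X N s \<partial>LI T" "\<lambda>_. ennreal (max C 0)" sequentially] V_dissipation[of T] par
    by (simp add: Liminf_const)
  finally show ?thesis .
qed

text \<open>The first factor is always the velocity, because it alone has the V^\<beta> bound that
  makes the tails small. The second, velocity or temperature, needs only a uniform l_2
  bound.\<close>

lemma product_limit:
  fixes h :: "nat \<Rightarrow> real \<Rightarrow> wvec \<Rightarrow> 'b::euclidean_space" and b :: "nat \<Rightarrow> real \<Rightarrow> wvec \<Rightarrow> real"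
  assumes t: "t \<in> {0..T}" and c: "0 \<le> c"
    and meas: "\<And>N j. (\<lambda>s. h N s j) \<in> borel_measurable borel" "\<And>N j. (\<lambda>s. b N s j) \<in> borel_measurable borel"
    and lim: "\<And>s j. s \<in> {0..T} \<Longrightarrow> (\<lambda>N. h N s j) \<longlonglongrightarrow> hl s j"
    and h: "\<And>N s j. s \<in> {0..T} \<Longrightarrow> norm (h N s j) \<le> c * (norm (V N s j) * b N s (k - j))"
    and b: "\<And>N s j. s \<in> {0..T} \<Longrightarrow> b N s j \<le> B + 1" "\<And>N s j. s \<in> {0..T} \<Longrightarrow> 0 \<le> b N s j"
    and bB: "\<And>N s F. s \<in> {0..T} \<Longrightarrow> finite F \<Longrightarrow> (\<Sum>j\<in>F. (b N s j)\<^sup>2) \<le> B"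
  shows "(\<integral>\<^sup>+s. (\<integral>\<^sup>+j. ennreal (norm (hl s j)) \<partial>count_space UNIV) \<partial>LI t) < \<infinity>"
    and "(\<lambda>N. \<integral>s. (\<integral>j. h N s j \<partial>count_space UNIV) \<partial>LI t) \<longlonglongrightarrow> (\<integral>s. (\<integral>j. hl s j \<partial>count_space UNIV) \<partial>LI t)"
proof -
  have sT: "s \<in> {0..T}" if "s \<in> space (LI t)" for s using that t by auto
  have B0: "0 \<le> B" using bB[of 0 "{}"] par by simp
  have bd: "norm (h N s j) \<le> c * ((M + 1) * (B + 1))" if "s \<in> space (LI t)" for N s j
    using norm_V_le[OF sT[OF that]] b[OF sT[OF that]] bounds_nonneg B0 c
    by (intro order_trans[OF h[OF sT[OF that]]] mult_left_mono mult_mono) auto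
  have bb: "(\<integral>\<^sup>+j. ennreal ((b N s j)\<^sup>2) \<partial>count_space UNIV) \<le> ennreal B" if "s \<in> space (LI t)" for N s
    by (rule nn_integral_count_space_le) (simp add: bB[OF sT[OF that]] ennreal_leI)
  have tail: "\<exists>F. finite F \<and> (\<forall>N. (\<integral>\<^sup>+s. (\<integral>\<^sup>+j. ennreal (norm (h N s j)) * indicator (- F) j \<partial>count_space UNIV) \<partial>LI t) \<le> ennreal e)"
    if e: "0 < e" for e
  proof (rule product_tail[where a = "\<lambda>N s j. norm (V N s j)" and b = b and c = c and B = B and C = "max C 0" and k = k,
        OF finite_measure_LI par(2) c _ B0 _ _ _ V_dissipation[OF t] bb e])
    show "(\<lambda>s. norm (V N s j)) \<in> borel_measurable (LI t)" for N j
      using borel_measurable_LI[OF D(1)] by measurable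
    show "(\<lambda>s. b N s j) \<in> borel_measurable (LI t)" for N j
      by (rule borel_measurable_LI[OF meas(2)])
    show "norm (h N s j) \<le> c * (norm (V N s j) * b N s (k - j))" if "s \<in> space (LI t)" for N s j
      by (rule h[OF sT[OF that]])
  qed simp
  note dl = double_limit[OF finite_measure_LI borel_measurable_LI[OF meas(1)] lim[OF sT] bd tail]
  show "(\<integral>\<^sup>+s. (\<integral>\<^sup>+j. ennreal (norm (hl s j)) \<partial>count_space UNIV) \<partial>LI t) < \<infinity>"
    by (rule dl(1))
  show "(\<lambda>N. \<integral>s. (\<integral>j. h N s j \<partial>count_space UNIV) \<partial>LI t) \<longlonglongrightarrow> (\<integral>s. (\<integral>j. hl s j \<partial>count_space UNIV) \<partial>LI t)"
    by (rule dl(2))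
qed

lemma limit_integral:
  fixes f :: "nat \<Rightarrow> real \<Rightarrow> 'b::euclidean_space"
  assumes t: "t \<in> {0..T}" and f: "\<And>N. f N \<in> borel_measurable borel" "g \<in> borel_measurable borel"
    and lim: "\<And>s. s \<in> {0..T} \<Longrightarrow> (\<lambda>N. f N s) \<longlonglongrightarrow> g s" and bd: "\<And>N s. s \<in> {0..T} \<Longrightarrow> norm (f N s) \<le> B"
  shows "(\<lambda>N. \<integral>s. f N s \<partial>LI t) \<longlonglongrightarrow> (\<integral>s. g s \<partial>LI t)"
proof (rule integral_dominated_convergence[where w = "\<lambda>_. B"])
  interpret finite_measure "LI t" by (rule finite_measure_LI)
  show "integrable (LI t) (\<lambda>_. B)" by simp
  show "AE s in LI t. (\<lambda>N. f N s) \<longlonglongrightarrow> g s" "\<And>N. AE s in LI t. norm (f N s) \<le> B"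
    using lim bd t by (auto intro!: AE_I2)
qed (intro borel_measurable_LI f)+

text \<open>The convolution in the same convention as \<open>advect\<close>. By
  \<open>NL_limit\<close> the series converges absolutely for almost every time; elsewhere the
  default value 0 of the integral is harmless.\<close>

definition NL :: "real \<Rightarrow> vfield" where
  "NL s k = (\<integral>j. kdot k (u s j) *s v s (k - j) \<partial>count_space UNIV)"

definition NT :: "real \<Rightarrow> sfield" where
  "NT s k = (\<integral>j. kdot k (u s j) * th s (k - j) \<partial>count_space UNIV)"

text \<open>A majorant with norms inside the sum. The damping estimate needs it, because its time
  integral can be passed to the limit.\<close>

definition NA :: "real \<Rightarrow> wvec \<Rightarrow> real" where
  "NA s k = (\<integral>j. norm (u s j) * norm (v s (k - j)) \<partial>count_space UNIV)"

lemma NL_limit: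
  assumes t: "t \<in> {0..T}"
  shows "(\<integral>\<^sup>+s. (\<integral>\<^sup>+j. ennreal (norm (kdot k (u s j) *s v s (k - j))) \<partial>count_space UNIV) \<partial>LI t) < \<infinity>"
    and "(\<lambda>N. \<integral>s. (\<integral>j. kdot k (U N s j) *s V N s (k - j) \<partial>count_space UNIV) \<partial>LI t) \<longlonglongrightarrow> (\<integral>s. NL s k \<partial>LI t)"
proof -
  have b: "norm (kdot k (U N s j) *s V N s (k - j)) \<le> knorm k * (norm (V N s j) * norm (V N s (k - j)))" for N s j
    unfolding norm_smult mult.assoc[symmetric]
    by (intro mult_right_mono order_trans[OF norm_kdot_le] mult_left_mono norm_U_le) auto
  note pl = product_limit[where h = "\<lambda>N s j. kdot k (U N s j) *s V N s (k - j)" and b = "\<lambda>N s j. norm (V N s j)" and B = M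
      and hl = "\<lambda>s j. kdot k (u s j) *s v s (k - j)" and k = k, OF t knorm_nonneg[of k] _ _ _ b norm_V_le norm_ge_zero V_sum_le]
  have m: "(\<lambda>s. kdot k (U N s j) *s V N s (k - j)) \<in> borel_measurable borel" for N j
    by (intro borel_measurable_smult borel_measurable_bounded_linear[OF bounded_linear_kdot] U_measurable D)
  have m2: "(\<lambda>s. norm (V N s j)) \<in> borel_measurable borel" for N j
    using D(1) by measurable
  have l: "(\<lambda>N. kdot k (U N s j) *s V N s (k - j)) \<longlonglongrightarrow> kdot k (u s j) *s v s (k - j)" if "s \<in> {0..T}" for s j
    by (intro bounded_bilinear.tendsto[OF bounded_bilinear_smult] bounded_linear.tendsto[OF bounded_linear_kdot] limU limV that)
  show "(\<integral>\<^sup>+s. (\<integral>\<^sup>+j. ennreal (norm (kdot k (u s j) *s v s (k - j))) \<partial>count_space UNIV) \<partial>LI t) < \<infinity>"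
    by (rule pl(1)[OF m m2 l])
  show "(\<lambda>N. \<integral>s. (\<integral>j. kdot k (U N s j) *s V N s (k - j) \<partial>count_space UNIV) \<partial>LI t) \<longlonglongrightarrow> (\<integral>s. NL s k \<partial>LI t)"
    unfolding NL_def by (rule pl(2)[OF m m2 l])
qed

lemma NT_limit:
  assumes t: "t \<in> {0..T}"
  shows "(\<integral>\<^sup>+s. (\<integral>\<^sup>+j. ennreal (norm (kdot k (u s j) * th s (k - j))) \<partial>count_space UNIV) \<partial>LI t) < \<infinity>"
    and "(\<lambda>N. \<integral>s. (\<integral>j. kdot k (U N s j) * Th N s (k - j) \<partial>count_space UNIV) \<partial>LI t) \<longlonglongrightarrow> (\<integral>s. NT s k \<partial>LI t)"
proof -
  have b: "norm (kdot k (U N s j) * Th N s (k - j)) \<le> knorm k * (norm (V N s j) * norm (Th N s (k - j)))" for N s j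
    unfolding norm_mult mult.assoc[symmetric]
    by (intro mult_right_mono order_trans[OF norm_kdot_le] mult_left_mono norm_U_le) auto
  note pl = product_limit[where h = "\<lambda>N s j. kdot k (U N s j) * Th N s (k - j)" and b = "\<lambda>N s j. norm (Th N s j)" and B = S
      and hl = "\<lambda>s j. kdot k (u s j) * th s (k - j)" and k = k, OF t knorm_nonneg[of k] _ _ _ b norm_Th_le norm_ge_zero D(9)]
  have m: "(\<lambda>s. kdot k (U N s j) * Th N s (k - j)) \<in> borel_measurable borel" for N j
    by (intro borel_measurable_times borel_measurable_bounded_linear[OF bounded_linear_kdot] U_measurable D)
  have m2: "(\<lambda>s. norm (Th N s j)) \<in> borel_measurable borel" for N j
    using D(2) by measurable
  have l: "(\<lambda>N. kdot k (U N s j) * Th N s (k - j)) \<longlonglongrightarrow> kdot k (u s j) * th s (k - j)" if "s \<in> {0..T}" for s j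
    by (intro tendsto_mult bounded_linear.tendsto[OF bounded_linear_kdot] limU limG that)
  show "(\<integral>\<^sup>+s. (\<integral>\<^sup>+j. ennreal (norm (kdot k (u s j) * th s (k - j))) \<partial>count_space UNIV) \<partial>LI t) < \<infinity>"
    by (rule pl(1)[OF m m2 l])
  show "(\<lambda>N. \<integral>s. (\<integral>j. kdot k (U N s j) * Th N s (k - j) \<partial>count_space UNIV) \<partial>LI t) \<longlonglongrightarrow> (\<integral>s. NT s k \<partial>LI t)"
    unfolding NT_def by (rule pl(2)[OF m m2 l])
qed

lemma NA_limit:
  assumes t: "t \<in> {0..T}"
  shows "(\<integral>\<^sup>+s. (\<integral>\<^sup>+j. ennreal (norm (norm (u s j) * norm (v s (k - j)))) \<partial>count_space UNIV) \<partial>LI t) < \<infinity>"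
    and "(\<lambda>N. \<integral>s. (\<integral>j. norm (U N s j) * norm (V N s (k - j)) \<partial>count_space UNIV) \<partial>LI t) \<longlonglongrightarrow> (\<integral>s. NA s k \<partial>LI t)"
proof -
  have b: "norm (norm (U N s j) * norm (V N s (k - j))) \<le> 1 * (norm (V N s j) * norm (V N s (k - j)))" for N s j
    unfolding real_norm_def abs_mult mult_1 abs_norm_cancel by (intro mult_right_mono norm_U_le) auto
  note pl = product_limit[where h = "\<lambda>N s j. norm (U N s j) * norm (V N s (k - j))" and b = "\<lambda>N s j. norm (V N s j)" and B = M
      and hl = "\<lambda>s j. norm (u s j) * norm (v s (k - j))" and k = k, OF t zero_le_one _ _ _ b norm_V_le norm_ge_zero V_sum_le]
  have m: "(\<lambda>s. norm (U N s j) * norm (V N s (k - j))) \<in> borel_measurable borel" for N j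
    by (intro borel_measurable_times measurable_compose[OF _ borel_measurable_norm] U_measurable D)
  have m2: "(\<lambda>s. norm (V N s j)) \<in> borel_measurable borel" for N j
    using D(1) by measurable
  have l: "(\<lambda>N. norm (U N s j) * norm (V N s (k - j))) \<longlonglongrightarrow> norm (u s j) * norm (v s (k - j))" if "s \<in> {0..T}" for s j
    by (intro tendsto_mult tendsto_norm limU limV that)
  show "(\<integral>\<^sup>+s. (\<integral>\<^sup>+j. ennreal (norm (norm (u s j) * norm (v s (k - j)))) \<partial>count_space UNIV) \<partial>LI t) < \<infinity>"
    by (rule pl(1)[OF m m2 l])
  show "(\<lambda>N. \<integral>s. (\<integral>j. norm (U N s j) * norm (V N s (k - j)) \<partial>count_space UNIV) \<partial>LI t) \<longlonglongrightarrow> (\<integral>s. NA s k \<partial>LI t)"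
    unfolding NA_def by (rule pl(2)[OF m m2 l])
qed

lemma U_outside: "t \<in> {0..T} \<Longrightarrow> j \<notin> J N \<Longrightarrow> U N t j = 0"
  by (simp add: lam_v_def D(4))

text \<open>Bounded linear maps are pulled out of the time integral, which leaves three integrals
  whose limits are known separately.\<close>

lemma integral_gal_rhs:
  assumes t: "t \<in> {0..T}"
  shows "(\<integral>s. gal_rhs (J N) \<nu> \<beta> (U N s) (V N s) (Th N s) k \<partial>LI t)
    = leray k ((\<integral>s. Th N s k \<partial>LI t) *s axis e3 1)
      - leray k (\<i> *s (\<integral>s. (\<integral>j. kdot k (U N s j) *s V N s (k - j) \<partial>count_space UNIV) \<partial>LI t))
      - (\<nu> * knorm k powr (2 * \<beta>)) *\<^sub>R (\<integral>s. V N s k \<partial>LI t)"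
proof -
  have sT: "s \<in> {0..T}" if "s \<in> {0..t}" for s using that t by auto
  have adv: "(\<integral>s. (\<integral>j. kdot k (U N s j) *s V N s (k - j) \<partial>count_space UNIV) \<partial>LI t) = (\<integral>s. advect (J N) (U N s) (V N s) k \<partial>LI t)"
    unfolding advect_def
    by (intro Bochner_Integration.integral_cong refl integral_count_space_support J) (use U_outside[OF sT] in auto)
  have i1: "integrable (LI t) (\<lambda>s. Th N s k)"
    by (rule integrable_LI_bounded[OF D(2)]) (rule norm_Th_le[OF sT])
  have i3: "integrable (LI t) (\<lambda>s. V N s k)"
    by (rule integrable_LI_bounded[OF D(1)]) (rule norm_V_le[OF sT])
  have i2: "integrable (LI t) (\<lambda>s. advect (J N) (U N s) (V N s) k)"
  proof (rule integrable_LI_bounded)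
    show "(\<lambda>s. advect (J N) (U N s) (V N s) k) \<in> borel_measurable borel"
      by (intro borel_measurable_advect U_measurable D)
    show "norm (advect (J N) (U N s) (V N s) k) \<le> knorm k * M" if "s \<in> {0..t}" for s
      by (rule order_trans[OF norm_advect_le[OF J(1) D(4)[OF sT[OF that]] norm_U_le] mult_left_mono[OF D(5)[OF sT[OF that]]]]) simp_all
  qed
  note b1 = bounded_linear_compose[OF bounded_linear_leray[of k] bounded_linear_smult_left[of "axis e3 1"]]
  note b2 = bounded_linear_compose[OF bounded_linear_leray[of k] bounded_linear_smult_right[of \<i>]]
  show ?thesis
    unfolding gal_rhs_def gal_source_def leray_diff adv
    using integrable_bounded_linear[OF b1 i1] integrable_bounded_linear[OF b2 i2]
      integral_bounded_linear[OF b1 i1] integral_bounded_linear[OF b2 i2] i3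
    by simp
qed

theorem v_eq:
  assumes t: "t \<in> {0..T}" and k: "k \<noteq> 0"
  shows "v t k = v0 k + (leray k ((\<integral>s. th s k \<partial>LI t) *s axis e3 1) - leray k (\<i> *s (\<integral>s. NL s k \<partial>LI t))
      - (\<nu> * knorm k powr (2 * \<beta>)) *\<^sub>R (\<integral>s. v s k \<partial>LI t))" (is "_ = _ + ?R")
proof -
  note b1 = bounded_linear_compose[OF bounded_linear_leray[of k] bounded_linear_smult_left[of "axis e3 1"]]
  note b2 = bounded_linear_compose[OF bounded_linear_leray[of k] bounded_linear_smult_right[of \<i>]]
  let ?RN = "\<lambda>N. \<integral>s. gal_rhs (J N) \<nu> \<beta> (U N s) (V N s) (Th N s) k \<partial>LI t"
  have "?RN \<longlonglongrightarrow> ?R"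
    unfolding integral_gal_rhs[OF t]
    by (intro tendsto_intros bounded_linear.tendsto[OF b1] bounded_linear.tendsto[OF b2] NL_limit(2)[OF t]
        limit_integral[OF t D(2) thmeas limG norm_Th_le] limit_integral[OF t D(1) vm limV norm_V_le])
  then have l: "(\<lambda>N. norm (V N t k - v0 k - ?RN N)) \<longlonglongrightarrow> norm (v t k - v0 k - ?R)"
    by (intro tendsto_intros limV[OF t])
  have "norm (v t k - v0 k - ?R) \<le> 0"
  proof (rule tendsto_le[OF _ err l])
    show "\<forall>\<^sub>F N in sequentially. norm (V N t k - v0 k - ?RN N) \<le> err N k"
      using J(2)[OF k] by eventually_elim (rule D(11)[OF t])
  qed simp
  then have "v t k - v0 k = ?R" by simp
  then show ?thesis by (simp add: algebra_simps)
qed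

theorem th_eq:
  assumes t: "t \<in> {0..T}"
  shows "th t k = fcoef th0 k - \<i> * (\<integral>s. NT s k \<partial>LI t)"
proof -
  have sT: "s \<in> {0..T}" if "s \<in> {0..t}" for s using that t by auto
  let ?QN = "\<lambda>N. \<integral>s. \<i> * (\<Sum>j\<in>J N. kdot k (U N s j) * Th N s (k - j)) \<partial>LI t"
  have e: "?QN N = \<i> * (\<integral>s. (\<integral>j. kdot k (U N s j) * Th N s (k - j) \<partial>count_space UNIV) \<partial>LI t)" for N
  proof -
    have "(\<integral>s. (\<integral>j. kdot k (U N s j) * Th N s (k - j) \<partial>count_space UNIV) \<partial>LI t) = (\<integral>s. (\<Sum>j\<in>J N. kdot k (U N s j) * Th N s (k - j)) \<partial>LI t)"
      by (intro Bochner_Integration.integral_cong refl integral_count_space_support J) (use U_outside[OF sT] in auto)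
    then show ?thesis by simp
  qed
  have "(\<lambda>N. norm (Th N t k - fcoef th0 k + ?QN N)) \<longlonglongrightarrow> norm (th t k - fcoef th0 k + \<i> * (\<integral>s. NT s k \<partial>LI t))"
    unfolding e by (intro tendsto_intros limG[OF t] NT_limit(2)[OF t])
  then have "norm (th t k - fcoef th0 k + \<i> * (\<integral>s. NT s k \<partial>LI t)) \<le> 0"
    by (rule LIMSEQ_le[OF _ err]) (use D(12)[OF t] in auto)
  then have "th t k - fcoef th0 k + \<i> * (\<integral>s. NT s k \<partial>LI t) = 0" by simp
  then show ?thesis by (simp add: algebra_simps eq_neg_iff_add_eq_0)
qed

text \<open>The norm of the advection term is majorised by a sum of products of norms before N tends
  to infinity. The time integral of that sum converges by \<open>NA_limit\<close>, and the
  inequality survives.\<close>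

theorem damping:
  assumes k: "k \<noteq> 0"
  shows "\<nu> * knorm k powr (2 * \<beta>) * (\<integral>s. norm (v s k) \<partial>LI T)
    \<le> norm (v0 k) + 2 * ((\<integral>s. norm (th s k) \<partial>LI T) + knorm k * (\<integral>s. NA s k \<partial>LI T))"
proof (rule tendsto_le[of sequentially])
  have T: "T \<in> {0..T}" using par by simp
  have nV: "(\<lambda>s. norm (V N s k)) \<in> borel_measurable borel" "(\<lambda>s. norm (v s k)) \<in> borel_measurable borel"
    "(\<lambda>s. norm (Th N s k)) \<in> borel_measurable borel" "(\<lambda>s. norm (th s k)) \<in> borel_measurable borel" for N
    using D(1,2) vm thmeas by measurable
  show "(\<lambda>N. \<nu> * knorm k powr (2 * \<beta>) * (\<integral>s. norm (V N s k) \<partial>LI T)) \<longlonglongrightarrow> \<nu> * knorm k powr (2 * \<beta>) * (\<integral>s. norm (v s k) \<partial>LI T)"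
    by (intro tendsto_mult tendsto_const limit_integral[OF T nV(1,2), where B = "M + 1"] tendsto_norm limV) (simp_all add: norm_V_le)
  show "(\<lambda>N. norm (v0 k) + 2 * ((\<integral>s. norm (Th N s k) \<partial>LI T) + knorm k * (\<integral>s. (\<integral>j. norm (U N s j) * norm (V N s (k - j)) \<partial>count_space UNIV) \<partial>LI T)))
    \<longlonglongrightarrow> norm (v0 k) + 2 * ((\<integral>s. norm (th s k) \<partial>LI T) + knorm k * (\<integral>s. NA s k \<partial>LI T))"
    by (intro tendsto_mult tendsto_add tendsto_const limit_integral[OF T nV(3,4), where B = "S + 1"] tendsto_norm limG NA_limit(2)[OF T]) (simp_all add: norm_Th_le)
  show "\<forall>\<^sub>F N in sequentially. \<nu> * knorm k powr (2 * \<beta>) * (\<integral>s. norm (V N s k) \<partial>LI T)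
    \<le> norm (v0 k) + 2 * ((\<integral>s. norm (Th N s k) \<partial>LI T) + knorm k * (\<integral>s. (\<integral>j. norm (U N s j) * norm (V N s (k - j)) \<partial>count_space UNIV) \<partial>LI T))"
    using J(2)[OF k]
  proof eventually_elim
    fix N assume kN: "k \<in> J N"
    let ?A = "\<lambda>s. \<Sum>j\<in>J N. norm (U N s j) * norm (V N s (k - j))"
    have A: "(\<integral>s. (\<integral>j. norm (U N s j) * norm (V N s (k - j)) \<partial>count_space UNIV) \<partial>LI T) = (\<integral>s. ?A s \<partial>LI T)"
      by (intro Bochner_Integration.integral_cong refl integral_count_space_support J) (use U_outside in auto)
    have i1: "integrable (LI T) (\<lambda>s. norm (Th N s k))"
      by (rule integrable_LI_bounded[OF nV(3), where B = "S + 1"]) (simp add: norm_Th_le)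
    have i2: "integrable (LI T) ?A"
    proof (rule integrable_LI_bounded)
      show "?A \<in> borel_measurable borel"
        by (intro borel_measurable_sum borel_measurable_times measurable_compose[OF _ borel_measurable_norm] U_measurable D)
      show "norm (?A s) \<le> (\<Sum>j\<in>J N. (M + 1) * (M + 1))" if s: "s \<in> {0..T}" for s
        by (rule sum_norm_le)
          (use bounds_nonneg norm_V_le[OF s] order_trans[OF norm_U_le norm_V_le[OF s]] in \<open>auto simp: abs_mult intro!: mult_mono\<close>)
    qed
    have b: "norm (gal_source (J N) (U N s) (V N s) (Th N s) k) \<le> 2 * (norm (Th N s k) + knorm k * ?A s)" for s
      by (rule order_trans[OF norm_gal_source_le]) (use norm_advect_le_sum[of "J N" "U N s" "V N s" k] in simp)
    have "(\<integral>s. norm (gal_source (J N) (U N s) (V N s) (Th N s) k) \<partial>LI T) \<le> (\<integral>s. 2 * (norm (Th N s k) + knorm k * ?A s) \<partial>LI T)"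
    proof (rule integral_mono)
      show i3: "integrable (LI T) (\<lambda>s. 2 * (norm (Th N s k) + knorm k * ?A s))"
        by (intro integrable_mult_right Bochner_Integration.integrable_add i1 i2)
      show "integrable (LI T) (\<lambda>s. norm (gal_source (J N) (U N s) (V N s) (Th N s) k))"
      proof (rule Bochner_Integration.integrable_bound[OF i3])
        show "(\<lambda>s. norm (gal_source (J N) (U N s) (V N s) (Th N s) k)) \<in> borel_measurable (LI T)"
          by (intro borel_measurable_LI measurable_compose[OF _ borel_measurable_norm] borel_measurable_gal_source U_measurable D)
        show "AE s in LI T. norm (norm (gal_source (J N) (U N s) (V N s) (Th N s) k)) \<le> norm (2 * (norm (Th N s k) + knorm k * ?A s))"
          by (intro AE_I2) (simp only: real_norm_def abs_norm_cancel, rule order_trans[OF b abs_ge_self])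
      qed
    qed (rule b)
    also have "\<dots> = 2 * ((\<integral>s. norm (Th N s k) \<partial>LI T) + knorm k * (\<integral>s. ?A s \<partial>LI T))"
      by (simp only: integral_mult_right_zero Bochner_Integration.integral_add[OF i1 integrable_mult_right[OF i2]])
    finally show "\<nu> * knorm k powr (2 * \<beta>) * (\<integral>s. norm (V N s k) \<partial>LI T)
      \<le> norm (v0 k) + 2 * ((\<integral>s. norm (Th N s k) \<partial>LI T) + knorm k * (\<integral>s. (\<integral>j. norm (U N s j) * norm (V N s (k - j)) \<partial>count_space UNIV) \<partial>LI T))"
      unfolding A using D(13)[OF kN] by linarith
  qed
qed simp

lemma lipschitz:
  assumes st: "s \<in> {0..T}" "t \<in> {0..T}"
  shows "norm (v t k - v s k) \<le> mode_lip \<beta> \<nu> M S k * \<bar>t - s\<bar>"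
    and "norm (th t k - th s k) \<le> mode_lip \<beta> \<nu> M S k * \<bar>t - s\<bar>"
proof -
  have e: "(\<lambda>N. mode_lip \<beta> \<nu> M S k * \<bar>t - s\<bar> + 2 * err N k) \<longlonglongrightarrow> mode_lip \<beta> \<nu> M S k * \<bar>t - s\<bar>"
    using tendsto_add[OF tendsto_const tendsto_mult[OF tendsto_const err, of 2]] by simp
  show "norm (th t k - th s k) \<le> mode_lip \<beta> \<nu> M S k * \<bar>t - s\<bar>"
    by (rule tendsto_le[OF _ e tendsto_norm[OF tendsto_diff[OF limG[OF st(2)] limG[OF st(1)]]]])
      (use approx_solution_lipschitz(2)[OF ap J(1) par(1) less_imp_le[OF par(3)] par(4) st] in auto)
  show "norm (v t k - v s k) \<le> mode_lip \<beta> \<nu> M S k * \<bar>t - s\<bar>"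
  proof (cases "k = 0")
    case True
    have "0 \<le> mode_lip \<beta> \<nu> M S k" using bounds_nonneg par by (simp add: mode_lip_def)
    then show ?thesis using True real_vD(1)[OF real_v_v[OF st(1)]] real_vD(1)[OF real_v_v[OF st(2)]] by simp
  next
    case False
    show ?thesis
    proof (rule tendsto_le[OF _ e tendsto_norm[OF tendsto_diff[OF limV[OF st(2)] limV[OF st(1)]]]])
      show "\<forall>\<^sub>F N in sequentially. norm (V N t k - V N s k) \<le> mode_lip \<beta> \<nu> M S k * \<bar>t - s\<bar> + 2 * err N k"
        using J(2)[OF False]
        by eventually_elim (rule approx_solution_lipschitz(1)[OF ap J(1) par(1) less_imp_le[OF par(3)] par(4) st])
    qed simp
  qed
qed

lemma continuous_on_modes:
  "continuous_on {0..T} (\<lambda>t. v t k)" "continuous_on {0..T} (\<lambda>t. th t k)"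
proof -
  have L: "0 \<le> mode_lip \<beta> \<nu> M S k" using bounds_nonneg par by (simp add: mode_lip_def)
  have "(mode_lip \<beta> \<nu> M S k)-lipschitz_on {0..T} (\<lambda>t. v t k)"
    by (rule lipschitz_onI) (use lipschitz(1) L in \<open>auto simp: dist_norm\<close>)
  then show "continuous_on {0..T} (\<lambda>t. v t k)" by (rule lipschitz_on_continuous_on)
  have "(mode_lip \<beta> \<nu> M S k)-lipschitz_on {0..T} (\<lambda>t. th t k)"
    by (rule lipschitz_onI) (use lipschitz(2) L in \<open>auto simp: dist_norm\<close>)
  then show "continuous_on {0..T} (\<lambda>t. th t k)" by (rule lipschitz_on_continuous_on)
qed

end

section \<open>The weak formulation\<close>

text \<open>The product is split into X = |m|^(5/2) a_m |j|^\<beta> b_j and Y = |m|^(-3/2)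
  |j|^(-\<beta>) c. The squares of X factor into the two weighted norms. The squared weight in Y is
  at most |m|^(-3-2\<beta>) + |j|^(-3-2\<beta>), a summable weight in one variable, and summing over
  the other variable runs through c exactly once because \<sigma> is bijective in each
  argument.\<close>

lemma trilinear_bound:
  fixes a b c :: "wvec \<Rightarrow> real" and \<sigma> :: "wvec \<Rightarrow> wvec \<Rightarrow> wvec"
  assumes \<beta>: "0 < \<beta>" and b0: "b 0 = 0" and nn: "\<And>k. 0 \<le> a k" "\<And>k. 0 \<le> b k" "\<And>k. 0 \<le> c k"
    and \<sigma>: "\<And>m. bij (\<sigma> m)" "\<And>j. bij (\<lambda>m. \<sigma> m j)"
  shows "(\<integral>\<^sup>+m. (\<integral>\<^sup>+j. ennreal (knorm m * a m * b j * c (\<sigma> m j)) \<partial>count_space UNIV) \<partial>count_space UNIV)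
    \<le> (\<integral>\<^sup>+m. ennreal ((a m)\<^sup>2 * knorm m powr (2 * (5/2))) \<partial>count_space UNIV) * (\<integral>\<^sup>+j. ennreal ((b j)\<^sup>2 * knorm j powr (2 * \<beta>)) \<partial>count_space UNIV)
      + 2 * (\<integral>\<^sup>+k. ennreal (knorm k powr (- 3 - 2 * \<beta>)) \<partial>count_space UNIV) * (\<integral>\<^sup>+k. ennreal ((c k)\<^sup>2) \<partial>count_space UNIV)"
proof -
  let ?A = "\<lambda>m. ennreal ((a m)\<^sup>2 * knorm m powr (2 * (5/2)))" and ?B = "\<lambda>j. ennreal ((b j)\<^sup>2 * knorm j powr (2 * \<beta>))"
  let ?K = "\<lambda>k. ennreal (knorm k powr (- 3 - 2 * \<beta>))" and ?C = "\<lambda>k. ennreal ((c k)\<^sup>2)"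
  let ?I = "\<lambda>f. integral\<^sup>N (count_space (UNIV :: wvec set)) f"
  have pt: "ennreal (knorm m * a m * b j * c (\<sigma> m j)) \<le> ?A m * ?B j + (?K m * ?C (\<sigma> m j) + ?K j * ?C (\<sigma> m j))" for m j
  proof (cases "m = 0 \<or> j = 0")
    case True
    then show ?thesis by (auto simp: b0)
  next
    case False
    define p q where "p = knorm m" and "q = knorm j"
    have pq: "1 \<le> p" "1 \<le> q" using False knorm_ge_1 by (auto simp: p_def q_def)
    define X where "X = (p powr (5/2) * a m) * (q powr \<beta> * b j)"
    define Y where "Y = (p powr (-3/2) * q powr (- \<beta>)) * c (\<sigma> m j)"
    have "p * a m * b j * c (\<sigma> m j) = (p powr (5/2) * p powr (-3/2)) * (q powr \<beta> * q powr (- \<beta>)) * (a m * b j * c (\<sigma> m j))"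
      using pq by (simp add: powr_add[symmetric])
    also have "\<dots> = X * Y" by (simp add: X_def Y_def mult_ac)
    also have "\<dots> \<le> (X\<^sup>2 + Y\<^sup>2) / 2" using abs_mult_le_param[of 1 X Y] by simp
    also have "\<dots> \<le> X\<^sup>2 + Y\<^sup>2" by simp
    also have "X\<^sup>2 = ((a m)\<^sup>2 * p powr (2 * (5/2))) * ((b j)\<^sup>2 * q powr (2 * \<beta>))"
    proof -
      have "(p powr (5/2))\<^sup>2 = p powr (2 * (5/2))" "(q powr \<beta>)\<^sup>2 = q powr (2 * \<beta>)"
        by (simp_all add: power2_eq_square powr_add[symmetric])
      then show ?thesis unfolding X_def power_mult_distrib by (simp add: mult_ac)
    qed
    also have "Y\<^sup>2 \<le> p powr (- 3 - 2 * \<beta>) * (c (\<sigma> m j))\<^sup>2 + q powr (- 3 - 2 * \<beta>) * (c (\<sigma> m j))\<^sup>2"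
    proof -
      have e: "(p powr (-3/2) * q powr (- \<beta>))\<^sup>2 = p powr (-3) * q powr (- 2 * \<beta>)"
        unfolding power_mult_distrib by (simp add: power2_eq_square powr_add[symmetric])
      \<comment> \<open>Both exponents are negative, so replacing the larger of p and q by the
        smaller one only increases the product.\<close>
      have "p powr (-3) * q powr (- 2 * \<beta>) \<le> p powr (- 3 - 2 * \<beta>) + q powr (- 3 - 2 * \<beta>)"
      proof (cases "p \<le> q")
        case True
        have "p powr (-3) * q powr (- 2 * \<beta>) \<le> p powr (-3) * p powr (- 2 * \<beta>)"
          using True pq \<beta> by (intro mult_left_mono powr_mono2') auto
        also have "\<dots> = p powr (- 3 - 2 * \<beta>)" by (simp add: powr_add[symmetric])
        finally show ?thesis by (simp add: add_increasing2)
      next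
        case False
        have "p powr (-3) * q powr (- 2 * \<beta>) \<le> q powr (-3) * q powr (- 2 * \<beta>)"
          using False pq by (intro mult_right_mono powr_mono2') auto
        also have "\<dots> = q powr (- 3 - 2 * \<beta>)" by (simp add: powr_add[symmetric])
        finally show ?thesis by (simp add: add_increasing)
      qed
      then show ?thesis
        unfolding Y_def power_mult_distrib[of "_ * _" "c _"] e distrib_right[symmetric] by (rule mult_right_mono) simp
    qed
    finally have "ennreal (p * a m * b j * c (\<sigma> m j)) \<le> ennreal (((a m)\<^sup>2 * p powr (2 * (5/2))) * ((b j)\<^sup>2 * q powr (2 * \<beta>))
        + (p powr (- 3 - 2 * \<beta>) * (c (\<sigma> m j))\<^sup>2 + q powr (- 3 - 2 * \<beta>) * (c (\<sigma> m j))\<^sup>2))"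
      by (intro ennreal_leI) simp
    also have "\<dots> = ?A m * ?B j + (?K m * ?C (\<sigma> m j) + ?K j * ?C (\<sigma> m j))"
      unfolding p_def q_def by (simp add: ennreal_mult)
    finally show ?thesis by (simp add: p_def)
  qed
  have "(\<integral>\<^sup>+m. (\<integral>\<^sup>+j. ennreal (knorm m * a m * b j * c (\<sigma> m j)) \<partial>count_space UNIV) \<partial>count_space UNIV)
     \<le> (\<integral>\<^sup>+m. (\<integral>\<^sup>+j. ?A m * ?B j + (?K m * ?C (\<sigma> m j) + ?K j * ?C (\<sigma> m j)) \<partial>count_space UNIV) \<partial>count_space UNIV)"
    by (intro nn_integral_mono pt)
  also have "\<dots> = (\<integral>\<^sup>+m. (\<integral>\<^sup>+j. ?A m * ?B j \<partial>count_space UNIV) \<partial>count_space UNIV)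
      + ((\<integral>\<^sup>+m. (\<integral>\<^sup>+j. ?K m * ?C (\<sigma> m j) \<partial>count_space UNIV) \<partial>count_space UNIV)
      + (\<integral>\<^sup>+m. (\<integral>\<^sup>+j. ?K j * ?C (\<sigma> m j) \<partial>count_space UNIV) \<partial>count_space UNIV))"
    by (simp add: nn_integral_add)
  also have "(\<integral>\<^sup>+m. (\<integral>\<^sup>+j. ?A m * ?B j \<partial>count_space UNIV) \<partial>count_space UNIV) = ?I ?A * ?I ?B"
    by (simp add: nn_integral_cmult nn_integral_multc)
  also have "(\<integral>\<^sup>+m. (\<integral>\<^sup>+j. ?K m * ?C (\<sigma> m j) \<partial>count_space UNIV) \<partial>count_space UNIV) = ?I ?K * ?I ?C"
    by (simp add: nn_integral_cmult nn_integral_multc nn_integral_bij_count_space[OF \<sigma>(1), of ?C])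
  also have "(\<integral>\<^sup>+m. (\<integral>\<^sup>+j. ?K j * ?C (\<sigma> m j) \<partial>count_space UNIV) \<partial>count_space UNIV)
      = (\<integral>\<^sup>+j. (\<integral>\<^sup>+m. ?K j * ?C (\<sigma> m j) \<partial>count_space UNIV) \<partial>count_space UNIV)"
    by (rule nn_integral_count_space_nn_integral) auto
  also have "\<dots> = ?I ?K * ?I ?C"
    using nn_integral_bij_count_space[OF \<sigma>(2), of ?C] by (simp add: nn_integral_cmult nn_integral_multc)
  finally show ?thesis unfolding mult_2 distrib_right .
qed

lemma infsum_pair_eq_integral:
  fixes g :: "'i::countable \<Rightarrow> 'j::countable \<Rightarrow> complex"
  assumes fin: "(\<integral>\<^sup>+m. (\<integral>\<^sup>+j. ennreal (norm (g j m)) \<partial>count_space UNIV) \<partial>count_space UNIV) < \<infinity>"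
  shows "(\<Sum>\<^sub>\<infinity>(j, m)\<in>UNIV. g j m) = (\<integral>m. (\<integral>j. g j m \<partial>count_space UNIV) \<partial>count_space UNIV)"
proof -
  interpret A: sigma_finite_measure "count_space (UNIV :: 'i set)" by (rule sigma_finite_measure_count_space)
  interpret B: sigma_finite_measure "count_space (UNIV :: 'j set)" by (rule sigma_finite_measure_count_space)
  interpret pair_sigma_finite "count_space (UNIV :: 'i set)" "count_space (UNIV :: 'j set)" ..
  have P: "count_space (UNIV :: 'i set) \<Otimes>\<^sub>M count_space (UNIV :: 'j set) = count_space UNIV"
    using pair_measure_countable[of "UNIV :: 'i set" "UNIV :: 'j set"] by simp
  have "(\<integral>\<^sup>+p. ennreal (norm (case p of (j, m) \<Rightarrow> g j m)) \<partial>count_space UNIV) = (\<integral>\<^sup>+m. (\<integral>\<^sup>+j. ennreal (norm (g j m)) \<partial>count_space UNIV) \<partial>count_space UNIV)"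
    using nn_integral_snd[of "\<lambda>p. ennreal (norm (case p of (j, m) \<Rightarrow> g j m))"] unfolding P by simp
  then have i: "integrable (count_space UNIV) (\<lambda>(j, m). g j m)"
    using fin by (intro integrableI_bounded) auto
  have "(\<integral>m. (\<integral>j. g j m \<partial>count_space UNIV) \<partial>count_space UNIV) = (\<integral>p. (case p of (j, m) \<Rightarrow> g j m) \<partial>count_space UNIV)"
    using integral_snd[of g] i unfolding P by simp
  then show ?thesis by (simp add: infsum_complex_eq_integral)
qed

text \<open>The weak formulation sums jointly over (j, m). With m outermost and time in between, the
  inner double integral is the convolution appearing in the mode equations. The joint sum agrees
  with the iterated one at almost every time, which suffices after integration.\<close>

lemma pair_fubini:
  fixes g :: "'a \<Rightarrow> 'i::countable \<Rightarrow> 'j::countable \<Rightarrow> complex"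
  assumes M: "sigma_finite_measure M" and m: "\<And>j m. (\<lambda>s. g s j m) \<in> borel_measurable M"
    and fin: "(\<integral>\<^sup>+s. (\<integral>\<^sup>+m. (\<integral>\<^sup>+j. ennreal (norm (g s j m)) \<partial>count_space UNIV) \<partial>count_space UNIV) \<partial>M) < \<infinity>"
  shows "integrable M (\<lambda>s. \<Sum>\<^sub>\<infinity>(j, m)\<in>UNIV. g s j m)"
    and "(\<integral>s. (\<Sum>\<^sub>\<infinity>(j, m)\<in>UNIV. g s j m) \<partial>M) = (\<integral>m. (\<integral>s. (\<integral>j. g s j m \<partial>count_space UNIV) \<partial>M) \<partial>count_space UNIV)"
    and "integrable (count_space UNIV) (\<lambda>m. \<integral>s. (\<integral>j. g s j m \<partial>count_space UNIV) \<partial>M)"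
proof -
  let ?F = "\<lambda>s m. \<integral>j. g s j m \<partial>count_space UNIV"
  let ?N = "\<lambda>s. \<integral>\<^sup>+m. (\<integral>\<^sup>+j. ennreal (norm (g s j m)) \<partial>count_space UNIV) \<partial>count_space UNIV"
  have Fm: "(\<lambda>s. ?F s m) \<in> borel_measurable M" for m
    by (rule borel_measurable_integral_count_space) (rule m)
  have Nm: "?N \<in> borel_measurable M"
    by (intro borel_measurable_nn_integral_count_space measurable_compose[OF measurable_compose[OF m borel_measurable_norm]]) simp
  have le: "ennreal (norm (?F s m)) \<le> (\<integral>\<^sup>+j. ennreal (norm (g s j m)) \<partial>count_space UNIV)" for s m
  proof (cases "integrable (count_space UNIV) (\<lambda>j. g s j m)")
    case True
    then show ?thesis by (rule integral_norm_bound_ennreal)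
  qed (simp add: not_integrable_integral_eq)
  have Ffin: "(\<integral>\<^sup>+s. (\<integral>\<^sup>+m. ennreal (norm (?F s m)) \<partial>count_space UNIV) \<partial>M) < \<infinity>"
    by (rule le_less_trans[OF _ fin]) (intro nn_integral_mono le)
  note sw = integral_count_space_swap[OF M Fm Ffin]
  have "AE s in M. ?N s \<noteq> \<infinity>"
    by (rule nn_integral_PInf_AE[OF Nm]) (use fin in auto)
  then have ae: "AE s in M. (\<Sum>\<^sub>\<infinity>(j, m)\<in>UNIV. g s j m) = (\<integral>m. ?F s m \<partial>count_space UNIV)"
  proof eventually_elim
    fix s assume "?N s \<noteq> \<infinity>"
    then show "(\<Sum>\<^sub>\<infinity>(j, m)\<in>UNIV. g s j m) = (\<integral>m. ?F s m \<partial>count_space UNIV)"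
      by (intro infsum_pair_eq_integral) (simp add: less_top)
  qed
  have Gm: "(\<lambda>s. \<Sum>\<^sub>\<infinity>(j, m)\<in>UNIV. g s j m) \<in> borel_measurable M"
    by (rule borel_measurable_infsum_complex) (simp add: case_prod_beta m)
  have Hm: "(\<lambda>s. \<integral>m. ?F s m \<partial>count_space UNIV) \<in> borel_measurable M"
    by (rule borel_measurable_integral_count_space) (rule Fm)
  show "integrable M (\<lambda>s. \<Sum>\<^sub>\<infinity>(j, m)\<in>UNIV. g s j m)"
    using integrable_cong_AE[OF Gm Hm ae] sw(1) by simp
  show "(\<integral>s. (\<Sum>\<^sub>\<infinity>(j, m)\<in>UNIV. g s j m) \<partial>M) = (\<integral>m. (\<integral>s. ?F s m \<partial>M) \<partial>count_space UNIV)"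
    using integral_cong_AE[OF Gm Hm ae] sw(3) by simp
  show "integrable (count_space UNIV) (\<lambda>m. \<integral>s. ?F s m \<partial>M)" by (rule sw(2))
qed

lemma nn_integral_tail_small:
  fixes y :: "'i::countable \<Rightarrow> real"
  assumes fin: "(\<integral>\<^sup>+k. ennreal (y k) \<partial>count_space UNIV) < \<infinity>" and e: "0 < (e::real)"
  shows "\<exists>F. finite F \<and> (\<integral>\<^sup>+k. ennreal (y k) * indicator (- F) k \<partial>count_space UNIV) \<le> ennreal e"
proof -
  define A where "A n = {k :: 'i. to_nat k < n}" for n
  have fA: "finite (A n)" for n
  proof -
    have "A n = to_nat -` {..<n}" by (auto simp: A_def)
    then show ?thesis by (simp add: finite_vimageI)
  qed
  have "(\<lambda>n. \<integral>\<^sup>+k. ennreal (y k) * indicator (- A n) k \<partial>count_space UNIV) \<longlonglongrightarrow> (\<integral>\<^sup>+k. 0 \<partial>count_space (UNIV :: 'i set))"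
  proof (rule nn_integral_dominated_convergence[where w = "\<lambda>k. ennreal (y k)"])
    show "AE k in count_space UNIV. (\<lambda>n. ennreal (y k) * indicator (- A n) k) \<longlonglongrightarrow> 0"
    proof (rule AE_I2)
      fix k :: 'i
      show "(\<lambda>n. ennreal (y k) * indicator (- A n) k) \<longlonglongrightarrow> 0"
        by (intro tendsto_eventually eventually_sequentiallyI[of "Suc (to_nat k)"]) (auto simp: A_def indicator_def)
    qed
  qed (use fin in \<open>auto simp: indicator_def\<close>)
  then have "\<forall>\<^sub>F n in sequentially. (\<integral>\<^sup>+k. ennreal (y k) * indicator (- A n) k \<partial>count_space UNIV) < ennreal e"
    by (rule order_tendstoD(2)) (use e in simp)
  then obtain n where "(\<integral>\<^sup>+k. ennreal (y k) * indicator (- A n) k \<partial>count_space UNIV) < ennreal e"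
    unfolding eventually_sequentially by blast
  then show ?thesis
    using fA[of n] by (intro exI[of _ "A n"] conjI less_imp_le) auto
qed

text \<open>A bounded family in l_2 with continuous coordinates is weakly continuous: the tail is
  controlled by the fixed sequence y alone and hence uniformly in t.\<close>

lemma continuous_on_pairing:
  fixes f :: "real \<Rightarrow> 'i::countable \<Rightarrow> complex"
  assumes cont: "\<And>k. continuous_on I (\<lambda>t. f t k)"
    and le: "\<And>t k. t \<in> I \<Longrightarrow> norm (f t k) \<le> x t k * y k"
    and x: "\<And>t F. t \<in> I \<Longrightarrow> finite F \<Longrightarrow> (\<Sum>k\<in>F. (x t k)\<^sup>2) \<le> A"
    and y: "(\<integral>\<^sup>+k. ennreal ((y k)\<^sup>2) \<partial>count_space UNIV) < \<infinity>"
  shows "continuous_on I (\<lambda>t. \<Sum>\<^sub>\<infinity>k. f t k)"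
  unfolding continuous_on_sequentially infsum_complex_eq_integral
proof (intro ballI allI impI, unfold o_def)
  fix t0 and \<tau> :: "nat \<Rightarrow> real" assume t0: "t0 \<in> I" and \<tau>: "(\<forall>n. \<tau> n \<in> I) \<and> \<tau> \<longlonglongrightarrow> t0"
  have A0: "0 \<le> A" using x[OF t0, of "{}"] by simp
  show "(\<lambda>n. \<integral>k. f (\<tau> n) k \<partial>count_space UNIV) \<longlonglongrightarrow> (\<integral>k. f t0 k \<partial>count_space UNIV)"
  proof (rule tendsto_integral_uniform_tail)
    show "(\<lambda>n. f (\<tau> n) k) \<longlonglongrightarrow> f t0 k" for k
      using cont[of k] \<tau> t0 unfolding continuous_on_sequentially by (simp add: o_def)
    fix e :: real assume e: "0 < e"
    \<comment> \<open>With this weight the bounded factor x contributes at most e/2; the tail of y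
      is then required to be below e d so that it contributes at most e/2 as well.\<close>
    define d where "d = e / (A + 1)"
    have d: "0 < d" using e A0 by (simp add: d_def)
    obtain F where F: "finite F" "(\<integral>\<^sup>+k. ennreal ((y k)\<^sup>2) * indicator (- F) k \<partial>count_space UNIV) \<le> ennreal (e * d)"
      using nn_integral_tail_small[OF y, of "e * d"] e d by auto
    have "(\<integral>\<^sup>+k. ennreal (norm (f (\<tau> n) k)) * indicator (- F) k \<partial>count_space UNIV) \<le> ennreal e" for n
    proof -
      have t: "\<tau> n \<in> I" using \<tau> by simp
      have xx: "(\<integral>\<^sup>+k. ennreal ((x (\<tau> n) k)\<^sup>2) \<partial>count_space UNIV) \<le> ennreal A"
        by (rule nn_integral_count_space_le) (simp add: x[OF t] ennreal_leI)
      have pt: "ennreal (norm (f (\<tau> n) k)) * indicator (- F) k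
         \<le> ennreal (d / 2) * ennreal ((x (\<tau> n) k)\<^sup>2) + ennreal (1 / (2 * d)) * (ennreal ((y k)\<^sup>2) * indicator (- F) k)" for k
      proof (cases "k \<in> F")
        case False
        have "norm (f (\<tau> n) k) \<le> \<bar>y k * x (\<tau> n) k\<bar>"
          using le[OF t, of k] by (simp add: mult.commute)
        also have "\<dots> \<le> ((y k)\<^sup>2 / d + d * (x (\<tau> n) k)\<^sup>2) / 2" by (rule abs_mult_le_param[OF d])
        also have "\<dots> = d / 2 * (x (\<tau> n) k)\<^sup>2 + 1 / (2 * d) * (y k)\<^sup>2" using d by (simp add: field_simps)
        finally show ?thesis
          using False d by (simp add: ennreal_mult''[symmetric] ennreal_plus[symmetric] ennreal_leI del: ennreal_plus)
      qed simp
      have "(\<integral>\<^sup>+k. ennreal (norm (f (\<tau> n) k)) * indicator (- F) k \<partial>count_space UNIV)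
        \<le> ennreal (d / 2) * (\<integral>\<^sup>+k. ennreal ((x (\<tau> n) k)\<^sup>2) \<partial>count_space UNIV)
          + ennreal (1 / (2 * d)) * (\<integral>\<^sup>+k. ennreal ((y k)\<^sup>2) * indicator (- F) k \<partial>count_space UNIV)"
        by (rule order_trans[OF nn_integral_mono[OF pt]]) (simp add: nn_integral_add nn_integral_cmult)
      also have "\<dots> \<le> ennreal (d / 2) * ennreal A + ennreal (1 / (2 * d)) * ennreal (e * d)"
        by (intro add_mono mult_left_mono xx F) auto
      also have "\<dots> = ennreal (d / 2 * A + 1 / (2 * d) * (e * d))"
        using d A0 e by (simp add: ennreal_mult''[symmetric] ennreal_plus[symmetric] del: ennreal_plus)
      also have "\<dots> \<le> ennreal e"
      proof (rule ennreal_leI)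
        have "d * A \<le> d * (A + 1)" using d by simp
        also have "\<dots> = e" using A0 by (simp add: d_def)
        finally show "d / 2 * A + 1 / (2 * d) * (e * d) \<le> e" using d by simp
      qed
      finally show ?thesis .
    qed
    then show "\<exists>F. finite F \<and> (\<forall>n. (\<integral>\<^sup>+k. ennreal (norm (f (\<tau> n) k)) * indicator (- F) k \<partial>count_space UNIV) \<le> ennreal e)"
      using F(1) by blast
  qed
qed

lemma nn_integral_mult_l2:
  fixes x y :: "'i::countable \<Rightarrow> real"
  assumes "\<And>k. 0 \<le> x k" "\<And>k. 0 \<le> y k"
  shows "(\<integral>\<^sup>+k. ennreal (x k * y k) \<partial>count_space UNIV)
    \<le> (\<integral>\<^sup>+k. ennreal ((x k)\<^sup>2) \<partial>count_space UNIV) + (\<integral>\<^sup>+k. ennreal ((y k)\<^sup>2) \<partial>count_space UNIV)"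
proof -
  have "ennreal (x k * y k) \<le> ennreal ((x k)\<^sup>2) + ennreal ((y k)\<^sup>2)" for k
  proof -
    have "x k * y k \<le> ((x k)\<^sup>2 + (y k)\<^sup>2) / 2" using abs_mult_le_param[of 1 "x k" "y k"] by simp
    also have "\<dots> \<le> (x k)\<^sup>2 + (y k)\<^sup>2" by simp
    finally show ?thesis by (simp add: ennreal_plus[symmetric] ennreal_leI del: ennreal_plus)
  qed
  then show ?thesis by (simp add: nn_integral_add[symmetric] nn_integral_mono)
qed

lemma nn_sq_le_weighted:
  fixes w :: "wvec \<Rightarrow> 'b::real_normed_vector"
  assumes "w 0 = 0" "0 \<le> s"
  shows "(\<integral>\<^sup>+k. ennreal ((norm (w k))\<^sup>2) \<partial>count_space UNIV) \<le> (\<integral>\<^sup>+k. ennreal ((norm (w k))\<^sup>2 * knorm k powr (2 * s)) \<partial>count_space UNIV)"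
proof (intro nn_integral_mono ennreal_leI)
  fix k
  show "(norm (w k))\<^sup>2 \<le> (norm (w k))\<^sup>2 * knorm k powr (2 * s)"
  proof (cases "k = 0")
    case False
    have "1 \<le> knorm k powr (2 * s)" using knorm_ge_1[OF False] assms(2) by (simp add: ge_one_powr_ge_zero)
    then show ?thesis using mult_left_mono[of 1 "knorm k powr (2 * s)" "(norm (w k))\<^sup>2"] by simp
  qed (use assms in simp)
qed

text \<open>Stated as an inequality because \<open>0 powr 0\<close> is 0: the left side omits the
  mode 0.\<close>

lemma nn_weighted_0_le:
  fixes w :: "wvec \<Rightarrow> 'b::real_normed_vector"
  shows "(\<integral>\<^sup>+k. ennreal ((norm (w k))\<^sup>2 * knorm k powr (2 * 0)) \<partial>count_space UNIV) \<le> (\<integral>\<^sup>+k. ennreal ((norm (w k))\<^sup>2) \<partial>count_space UNIV)"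
proof (intro nn_integral_mono ennreal_leI)
  fix k
  show "(norm (w k))\<^sup>2 * knorm k powr (2 * 0) \<le> (norm (w k))\<^sup>2"
    using knorm_nonneg[of k] by (cases "knorm k = 0") auto
qed

lemma integral_reindex_uminus:
  fixes f :: "wvec \<Rightarrow> 'b::{banach, second_countable_topology}"
  shows "(\<integral>k. f (- k) \<partial>count_space UNIV) = (\<integral>k. f k \<partial>count_space UNIV)"
    "integrable (count_space UNIV) (\<lambda>k. f (- k)) \<longleftrightarrow> integrable (count_space UNIV) f"
proof -
  have b: "bij (uminus :: wvec \<Rightarrow> wvec)" by (rule bij_betw_byWitness[of _ uminus]) auto
  show "(\<integral>k. f (- k) \<partial>count_space UNIV) = (\<integral>k. f k \<partial>count_space UNIV)"
    by (rule integral_bij_count_space[OF b])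
  show "integrable (count_space UNIV) (\<lambda>k. f (- k)) \<longleftrightarrow> integrable (count_space UNIV) f"
    by (rule integrable_bij_count_space[OF b])
qed

lemma ennreal_norm_integral_le:
  fixes f :: "'a \<Rightarrow> 'b::{banach, second_countable_topology}"
  shows "ennreal (norm (\<integral>x. f x \<partial>M)) \<le> (\<integral>\<^sup>+x. ennreal (norm (f x)) \<partial>M)"
  by (cases "integrable M f") (simp_all add: integral_norm_bound_ennreal not_integrable_integral_eq)

lemma Re_integral_scaled:
  fixes f :: "'a \<Rightarrow> complex"
  assumes "integrable M f"
  shows "integrable M (\<lambda>x. c * Re (f x))" "(\<integral>x. c * Re (f x) \<partial>M) = c * Re (\<integral>x. f x \<partial>M)"
  using assms by simp_all

text \<open>The inner series converges only for almost every x, so L is moved through it almost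
  everywhere; measurability of both sides then allows comparison of the outer integrals.\<close>

lemma integral_bounded_linear_double:
  fixes f :: "'a \<Rightarrow> 'i::countable \<Rightarrow> 'b::euclidean_space" and L :: "'b \<Rightarrow> 'c::euclidean_space"
  assumes M: "sigma_finite_measure M" and f: "\<And>i. (\<lambda>x. f x i) \<in> borel_measurable M"
    and fin: "(\<integral>\<^sup>+x. (\<integral>\<^sup>+i. norm (f x i) \<partial>count_space UNIV) \<partial>M) < \<infinity>" and L: "bounded_linear L"
  shows "(\<integral>x. (\<integral>i. L (f x i) \<partial>count_space UNIV) \<partial>M) = L (\<integral>x. (\<integral>i. f x i \<partial>count_space UNIV) \<partial>M)"
proof -
  note sw = integral_count_space_swap[OF M f fin]
  have "(\<integral>x. (\<integral>i. L (f x i) \<partial>count_space UNIV) \<partial>M) = (\<integral>x. L (\<integral>i. f x i \<partial>count_space UNIV) \<partial>M)"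
  proof (rule integral_cong_AE)
    show "(\<lambda>x. \<integral>i. L (f x i) \<partial>count_space UNIV) \<in> borel_measurable M"
      by (rule borel_measurable_integral_count_space) (rule borel_measurable_bounded_linear[OF L f])
    show "(\<lambda>x. L (\<integral>i. f x i \<partial>count_space UNIV)) \<in> borel_measurable M"
      by (rule borel_measurable_bounded_linear[OF L]) (rule borel_measurable_integral_count_space[OF f])
    show "AE x in M. (\<integral>i. L (f x i) \<partial>count_space UNIV) = L (\<integral>i. f x i \<partial>count_space UNIV)"
      using sw(5) by eventually_elim (rule integral_bounded_linear[OF L])
  qed
  also have "\<dots> = L (\<integral>x. (\<integral>i. f x i \<partial>count_space UNIV) \<partial>M)"
    by (rule integral_bounded_linear[OF L sw(1)])
  finally show ?thesis .
qed

lemma sigma_finite_LI: "sigma_finite_measure (LI t)"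
  using finite_measure_LI[of t] by (rule finite_measure.axioms(1))

lemma nn_integral_LI_mono: "t \<le> T \<Longrightarrow> (\<integral>\<^sup>+s. f s \<partial>LI t) \<le> (\<integral>\<^sup>+s. f s \<partial>LI T)"
  unfolding set_nn_integral_eq_LI[symmetric] by (intro nn_integral_mono) (auto simp: indicator_def)

lemma nn_integral_LI_const_less_top: "(\<integral>\<^sup>+s. ennreal B \<partial>LI t) < \<infinity>"
proof -
  interpret finite_measure "LI t" by (rule finite_measure_LI)
  have "emeasure (LI t) {0..t} < \<infinity>" using emeasure_finite[of "space (LI t)"] by (simp add: less_top[symmetric])
  then show ?thesis by (simp add: ennreal_mult_less_top)
qed

lemma bij_minus_wvec:
  fixes a :: wvec
  shows "bij (\<lambda>m. a - m)" "bij (\<lambda>m. m - a)" "bij (\<lambda>m. - m - a)" "bij (\<lambda>m. - a - m)"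
proof -
  show "bij (\<lambda>m. a - m)" by (rule bij_betw_byWitness[of _ "\<lambda>m. a - m"]) auto
  show "bij (\<lambda>m. m - a)" by (rule bij_betw_byWitness[of _ "\<lambda>m. m + a"]) auto
  show "bij (\<lambda>m. - m - a)" by (rule bij_betw_byWitness[of _ "\<lambda>m. - m - a"]) auto
  show "bij (\<lambda>m. - a - m)" by (rule bij_betw_byWitness[of _ "\<lambda>m. - a - m"]) auto
qed

lemma nn_integral_count_space_affine:
  fixes a b d :: "'i \<Rightarrow> ennreal"
  shows "(\<integral>\<^sup>+k. c * (a k + 2 * (b k + d k)) \<partial>count_space UNIV)
    = c * ((\<integral>\<^sup>+k. a k \<partial>count_space UNIV) + 2 * ((\<integral>\<^sup>+k. b k \<partial>count_space UNIV) + (\<integral>\<^sup>+k. d k \<partial>count_space UNIV)))"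
  by (simp add: nn_integral_cmult nn_integral_add)

lemma ennreal_affine:
  assumes "0 \<le> c" "0 \<le> x" "0 \<le> y" "0 \<le> z"
  shows "ennreal (c * (x + 2 * (y + z))) = ennreal c * (ennreal x + 2 * (ennreal y + ennreal z))"
proof -
  have "2 * (ennreal y + ennreal z) = ennreal (2 * (y + z))" using assms by (simp add: ennreal_mult)
  then show ?thesis using assms by (simp add: ennreal_mult)
qed

lemma cdot_axis_vcnj: "cdot (axis e3 1) (vcnj w) = cnj (w $ e3)"
  by (simp add: cdot_def vcnj_def axis_def if_distrib[of "\<lambda>x. x * _"] cong: if_cong)

section \<open>The limit satisfies the weak formulation\<close>

context approx_limit
begin

lemma nn_v_le: "t \<in> {0..T} \<Longrightarrow> (\<integral>\<^sup>+k. ennreal ((norm (v t k))\<^sup>2) \<partial>count_space UNIV) \<le> ennreal M"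
  by (rule nn_sum_le) (rule v_sum_le)

lemma nn_th_le: "t \<in> {0..T} \<Longrightarrow> (\<integral>\<^sup>+k. ennreal ((norm (th t k))\<^sup>2) \<partial>count_space UNIV) \<le> ennreal S"
  by (rule nn_sum_le) (rule th_sum_le)

lemma vsq_v_le: "t \<in> {0..T} \<Longrightarrow> vsq 0 (v t) \<le> ennreal M"
  unfolding vsq_eq by (rule order_trans[OF nn_weighted_0_le nn_v_le])

lemma ssq_th_le: "t \<in> {0..T} \<Longrightarrow> ssq 0 (th t) \<le> ennreal S"
  unfolding ssq_eq by (rule order_trans[OF nn_weighted_0_le nn_th_le])

lemma in_V_v: "t \<in> {0..T} \<Longrightarrow> in_V 0 (v t)"
  using real_v_v[of t] vsq_v_le[of t] by (auto simp: in_V_def intro: le_less_trans)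

lemma in_H_th: "t \<in> {0..T} \<Longrightarrow> in_H 0 (th t)"
  using real_s_th[of t] ssq_th_le[of t] by (auto simp: in_H_def intro: le_less_trans)

lemma continuous_on_pair_v:
  assumes "in_V 0 w" shows "continuous_on {0..T} (\<lambda>t. pair_v (v t) w)"
  unfolding pair_v_def
proof (rule continuous_on_mult[OF continuous_on_const continuous_on_Re], rule continuous_on_pairing[where x = "\<lambda>t k. norm (v t k)" and y = "\<lambda>k. norm (w k)" and A = M])
  show "continuous_on {0..T} (\<lambda>t. cdot (v t k) (vcnj (w k)))" for k
    by (rule bounded_linear.continuous_on[OF bounded_linear_cdot_left continuous_on_modes(1)])
  show "cmod (cdot (v t k) (vcnj (w k))) \<le> norm (v t k) * norm (w k)" for t k
    using norm_cdot_le[of "v t k" "vcnj (w k)"] by simp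
  show "(\<integral>\<^sup>+k. ennreal ((norm (w k))\<^sup>2) \<partial>count_space UNIV) < \<infinity>"
    using assms nn_sq_le_weighted[of w 0] by (auto simp: in_V_def real_v_def vsq_eq intro: le_less_trans)
qed (rule v_sum_le)

lemma continuous_on_pair_s:
  assumes "in_H 0 g" shows "continuous_on {0..T} (\<lambda>t. pair_s (th t) g)"
  unfolding pair_s_def
proof (rule continuous_on_mult[OF continuous_on_const continuous_on_Re], rule continuous_on_pairing[where x = "\<lambda>t k. norm (th t k)" and y = "\<lambda>k. norm (g k)" and A = S])
  show "continuous_on {0..T} (\<lambda>t. th t k * cnj (g k))" for k
    by (intro continuous_intros continuous_on_modes(2))
  show "cmod (th t k * cnj (g k)) \<le> norm (th t k) * norm (g k)" for t k
    by (simp add: norm_mult)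
  show "(\<integral>\<^sup>+k. ennreal ((norm (g k))\<^sup>2) \<partial>count_space UNIV) < \<infinity>"
    using assms nn_sq_le_weighted[of g 0] by (auto simp: in_H_def real_s_def ssq_eq intro: le_less_trans)
qed (rule th_sum_le)

text \<open>The test weight a is fixed in time and c is bounded in l_2, so
  \<open>trilinear_bound\<close> leaves only the time integral of the V^\<beta> norm squared of v,
  which the dissipation bound controls.\<close>

lemma trilinear_finite:
  fixes a :: "wvec \<Rightarrow> real" and c :: "real \<Rightarrow> wvec \<Rightarrow> real"
  assumes t: "t \<in> {0..T}" and a: "\<And>k. 0 \<le> a k" "(\<integral>\<^sup>+m. ennreal ((a m)\<^sup>2 * knorm m powr (2 * (5/2))) \<partial>count_space UNIV) < \<infinity>"
    and c: "\<And>s k. 0 \<le> c s k" "\<And>s. s \<in> {0..T} \<Longrightarrow> (\<integral>\<^sup>+k. ennreal ((c s k)\<^sup>2) \<partial>count_space UNIV) \<le> ennreal B"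
    and \<sigma>: "\<And>m. bij (\<sigma> m)" "\<And>j. bij (\<lambda>m. \<sigma> m j)"
  shows "(\<integral>\<^sup>+s. (\<integral>\<^sup>+m. (\<integral>\<^sup>+j. ennreal (knorm m * a m * norm (v s j) * c s (\<sigma> m j)) \<partial>count_space UNIV) \<partial>count_space UNIV) \<partial>LI t) < \<infinity>"
proof -
  define A where "A = (\<integral>\<^sup>+m. ennreal ((a m)\<^sup>2 * knorm m powr (2 * (5/2))) \<partial>count_space UNIV)"
  define K where "K = (\<integral>\<^sup>+k. ennreal (knorm k powr (- 3 - 2 * \<beta>)) \<partial>count_space UNIV)"
  have K: "K < \<infinity>" using nn_integral_lattice_powr[of "2 * \<beta>"] par by (simp add: K_def)
  have A: "A < \<infinity>" using a(2) by (simp add: A_def)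
  have vm': "(\<lambda>s. vsq \<beta> (v s)) \<in> borel_measurable (LI t)"
    unfolding vsq_eq by (intro borel_measurable_nn_integral_count_space borel_measurable_LI) (use vm in measurable)
  have "(\<integral>\<^sup>+s. (\<integral>\<^sup>+m. (\<integral>\<^sup>+j. ennreal (knorm m * a m * norm (v s j) * c s (\<sigma> m j)) \<partial>count_space UNIV) \<partial>count_space UNIV) \<partial>LI t)
      \<le> (\<integral>\<^sup>+s. A * vsq \<beta> (v s) + 2 * K * ennreal B \<partial>LI t)"
  proof (rule nn_integral_mono)
    fix s assume "s \<in> space (LI t)"
    then have s: "s \<in> {0..T}" using t by auto
    have "(\<integral>\<^sup>+m. (\<integral>\<^sup>+j. ennreal (knorm m * a m * norm (v s j) * c s (\<sigma> m j)) \<partial>count_space UNIV) \<partial>count_space UNIV)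
      \<le> A * vsq \<beta> (v s) + 2 * K * (\<integral>\<^sup>+k. ennreal ((c s k)\<^sup>2) \<partial>count_space UNIV)"
      unfolding vsq_eq A_def K_def
      by (rule trilinear_bound[OF par(2) _ a(1) norm_ge_zero c(1) \<sigma>]) (simp add: real_vD(1)[OF real_v_v[OF s]])
    also have "\<dots> \<le> A * vsq \<beta> (v s) + 2 * K * ennreal B"
      by (intro add_left_mono mult_left_mono c(2) s) simp
    finally show "(\<integral>\<^sup>+m. (\<integral>\<^sup>+j. ennreal (knorm m * a m * norm (v s j) * c s (\<sigma> m j)) \<partial>count_space UNIV) \<partial>count_space UNIV)
      \<le> A * vsq \<beta> (v s) + 2 * K * ennreal B" .
  qed
  also have "\<dots> = A * (\<integral>\<^sup>+s. vsq \<beta> (v s) \<partial>LI t) + 2 * K * (\<integral>\<^sup>+s. ennreal B \<partial>LI t)"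
    using vm' by (simp add: nn_integral_add nn_integral_cmult nn_integral_multc mult_ac)
  also have "\<dots> < \<infinity>"
  proof -
    have "(\<integral>\<^sup>+s. vsq \<beta> (v s) \<partial>LI t) \<le> ennreal (max C 0)"
      using nn_integral_LI_mono[of t T "\<lambda>s. vsq \<beta> (v s)"] v_dissipation t by (auto intro: order_trans)
    then have "(\<integral>\<^sup>+s. vsq \<beta> (v s) \<partial>LI t) < \<infinity>" by (auto intro: le_less_trans)
    then show ?thesis
      using A K nn_integral_LI_const_less_top[of t B] by (simp add: ennreal_mult_less_top del: nn_integral_const)
  qed
  finally show ?thesis .
qed

text \<open>The mode equations \<open>th_eq\<close> are multiplied by the conjugate test
  coefficients and summed; absolute convergence of the trilinear sum justifies exchanging the sum
  with the time integral.\<close>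

lemma transport_equation:
  assumes \<phi>: "in_H (5/2) \<phi>" and t: "t \<in> {0..T}"
  shows "integrable (LI t) (\<lambda>s. tform (u s) \<phi> (th s))"
    and "pair_s (th t) \<phi> - (\<integral>s. tform (u s) \<phi> (th s) \<partial>LI t) = pair_s (fcoef th0) \<phi>"
proof -
  have \<phi>0: "\<phi> 0 = 0" and \<phi>m: "\<phi> (- k) = cnj (\<phi> k)" for k using \<phi> by (auto simp: in_H_def real_s_def)
  have \<phi>5: "(\<integral>\<^sup>+m. ennreal ((norm (\<phi> m))\<^sup>2 * knorm m powr (2 * (5/2))) \<partial>count_space UNIV) < \<infinity>"
    using \<phi> by (simp add: in_H_def ssq_eq)
  have \<phi>2: "(\<integral>\<^sup>+m. ennreal ((norm (\<phi> m))\<^sup>2) \<partial>count_space UNIV) < \<infinity>"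
    by (rule le_less_trans[OF nn_sq_le_weighted \<phi>5]) (simp_all add: \<phi>0)
  define g where "g s j m = \<i> * kdot m (u s j) * \<phi> m * th s (- j - m)" for s j m
  have gm: "(\<lambda>s. g s j m) \<in> borel_measurable (LI t)" for j m
    unfolding g_def
    by (intro borel_measurable_LI borel_measurable_times borel_measurable_const borel_measurable_bounded_linear[OF bounded_linear_kdot u_measurable] thmeas)
  have "(\<integral>\<^sup>+s. (\<integral>\<^sup>+m. (\<integral>\<^sup>+j. ennreal (norm (g s j m)) \<partial>count_space UNIV) \<partial>count_space UNIV) \<partial>LI t)
      \<le> (\<integral>\<^sup>+s. (\<integral>\<^sup>+m. (\<integral>\<^sup>+j. ennreal (knorm m * norm (\<phi> m) * norm (v s j) * norm (th s (- j - m))) \<partial>count_space UNIV) \<partial>count_space UNIV) \<partial>LI t)"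
  proof (intro nn_integral_mono ennreal_leI)
    fix s m j
    have "norm (kdot m (u s j)) \<le> knorm m * norm (v s j)"
      by (rule order_trans[OF norm_kdot_le]) (intro mult_left_mono norm_u_le knorm_nonneg)
    then have "norm (kdot m (u s j)) * (norm (\<phi> m) * norm (th s (- j - m))) \<le> (knorm m * norm (v s j)) * (norm (\<phi> m) * norm (th s (- j - m)))"
      by (rule mult_right_mono) simp
    then show "norm (g s j m) \<le> knorm m * norm (\<phi> m) * norm (v s j) * norm (th s (- j - m))"
      by (simp add: g_def norm_mult mult_ac)
  qed
  also have "\<dots> < \<infinity>"
    by (rule trilinear_finite[OF t _ \<phi>5, where \<sigma> = "\<lambda>m j. - j - m" and c = "\<lambda>s k. norm (th s k)" and B = S])
      (simp_all add: nn_th_le bij_minus_wvec)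
  finally have gfin: "(\<integral>\<^sup>+s. (\<integral>\<^sup>+m. (\<integral>\<^sup>+j. ennreal (norm (g s j m)) \<partial>count_space UNIV) \<partial>count_space UNIV) \<partial>LI t) < \<infinity>" .
  note pf = pair_fubini[OF sigma_finite_LI gm gfin]
  have tf: "tform (u s) \<phi> (th s) = (2 * pi) ^ 3 * Re (\<Sum>\<^sub>\<infinity>(j, m)\<in>UNIV. g s j m)" for s
    by (simp add: tform_def g_def)
  show "integrable (LI t) (\<lambda>s. tform (u s) \<phi> (th s))"
    unfolding tf by (rule Re_integral_scaled(1)[OF pf(1)])
  \<comment> \<open>In \<open>tform\<close> the temperature carries the index -j - m, so for fixed m
    the j-sum is the convolution NT at -m, with a sign from kdot m = - kdot (-m). Reality of \<phi>
    and a reflection of the lattice later turn this into a pairing with conjugates.\<close>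
  have inner: "(\<integral>s. (\<integral>j. g s j m \<partial>count_space UNIV) \<partial>LI t) = \<phi> m * (th t (- m) - fcoef th0 (- m))" for m
  proof -
    have "(\<integral>j. g s j m \<partial>count_space UNIV) = - \<i> * \<phi> m * NT s (- m)" for s
    proof -
      have "(\<integral>j. g s j m \<partial>count_space UNIV) = (\<integral>j. (- \<i> * \<phi> m) * (kdot (- m) (u s j) * th s (- m - j)) \<partial>count_space UNIV)"
      proof (intro Bochner_Integration.integral_cong refl)
        fix j
        show "g s j m = (- \<i> * \<phi> m) * (kdot (- m) (u s j) * th s (- m - j))"
          unfolding g_def minus_diff_commute[of j m] by (simp add: kdot_minus_left mult_ac)
      qed
      then show ?thesis unfolding NT_def by simp
    qed
    then show ?thesis using th_eq[OF t, of "- m"] by simp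
  qed
  have lim: "(\<integral>s. (\<Sum>\<^sub>\<infinity>(j, m)\<in>UNIV. g s j m) \<partial>LI t) = (\<integral>k. (th t k - fcoef th0 k) * cnj (\<phi> k) \<partial>count_space UNIV)"
    and int: "integrable (count_space UNIV) (\<lambda>k. (th t k - fcoef th0 k) * cnj (\<phi> k))"
    using pf(2,3) integral_reindex_uminus[of "\<lambda>m. \<phi> m * (th t (- m) - fcoef th0 (- m))"]
    unfolding inner by (simp_all add: \<phi>m mult.commute)
  have intt: "integrable (count_space UNIV) (\<lambda>k. th t k * cnj (\<phi> k))"
  proof (rule integrableI_bounded)
    have "(\<integral>\<^sup>+k. ennreal (norm (th t k * cnj (\<phi> k))) \<partial>count_space UNIV) \<le> ennreal S + (\<integral>\<^sup>+m. ennreal ((norm (\<phi> m))\<^sup>2) \<partial>count_space UNIV)"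
      using nn_integral_mult_l2[of "\<lambda>k. norm (th t k)" "\<lambda>k. norm (\<phi> k)"] nn_th_le[OF t]
      by (auto simp: norm_mult intro: order_trans add_right_mono)
    then show "(\<integral>\<^sup>+k. ennreal (norm (th t k * cnj (\<phi> k))) \<partial>count_space UNIV) < \<infinity>"
      using \<phi>2 by (auto intro: le_less_trans)
  qed simp
  have "(\<integral>k. fcoef th0 k * cnj (\<phi> k) \<partial>count_space UNIV)
      = (\<integral>k. th t k * cnj (\<phi> k) - (th t k - fcoef th0 k) * cnj (\<phi> k) \<partial>count_space UNIV)"
    by (intro Bochner_Integration.integral_cong refl) (simp add: algebra_simps)
  also have "\<dots> = (\<integral>k. th t k * cnj (\<phi> k) \<partial>count_space UNIV) - (\<integral>s. (\<Sum>\<^sub>\<infinity>(j, m)\<in>UNIV. g s j m) \<partial>LI t)"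
    unfolding lim by (rule Bochner_Integration.integral_diff[OF intt int])
  finally have e: "(\<integral>k. fcoef th0 k * cnj (\<phi> k) \<partial>count_space UNIV)
     = (\<integral>k. th t k * cnj (\<phi> k) \<partial>count_space UNIV) - (\<integral>s. (\<Sum>\<^sub>\<infinity>(j, m)\<in>UNIV. g s j m) \<partial>LI t)" .
  show "pair_s (th t) \<phi> - (\<integral>s. tform (u s) \<phi> (th s) \<partial>LI t) = pair_s (fcoef th0) \<phi>"
    unfolding tf Re_integral_scaled(2)[OF pf(1)] pair_s_def infsum_complex_eq_integral[of "\<lambda>k. _ k * cnj (\<phi> k)"] e
    by (simp add: right_diff_distrib)
qed

lemma force_fubini:
  assumes \<psi>: "(\<integral>\<^sup>+m. ennreal ((norm (\<psi> m :: complex ^ 3))\<^sup>2) \<partial>count_space UNIV) < \<infinity>" and t: "t \<in> {0..T}"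
  shows "(\<integral>\<^sup>+s. (\<integral>\<^sup>+k. ennreal (norm (th s k) * norm (\<psi> k)) \<partial>count_space UNIV) \<partial>LI t) < \<infinity>"
proof -
  have "(\<integral>\<^sup>+s. (\<integral>\<^sup>+k. ennreal (norm (th s k) * norm (\<psi> k)) \<partial>count_space UNIV) \<partial>LI t)
     \<le> (\<integral>\<^sup>+s. ennreal S + (\<integral>\<^sup>+m. ennreal ((norm (\<psi> m))\<^sup>2) \<partial>count_space UNIV) \<partial>LI t)"
  proof (rule nn_integral_mono)
    fix s assume "s \<in> space (LI t)"
    then have s: "s \<in> {0..T}" using t by auto
    show "(\<integral>\<^sup>+k. ennreal (norm (th s k) * norm (\<psi> k)) \<partial>count_space UNIV) \<le> ennreal S + (\<integral>\<^sup>+m. ennreal ((norm (\<psi> m))\<^sup>2) \<partial>count_space UNIV)"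
      by (rule order_trans[OF nn_integral_mult_l2]) (auto intro!: add_right_mono nn_th_le s)
  qed
  also have "\<dots> < \<infinity>"
  proof -
    obtain B where B: "0 \<le> B" "(\<integral>\<^sup>+m. ennreal ((norm (\<psi> m))\<^sup>2) \<partial>count_space UNIV) = ennreal B"
      using \<psi> by (cases "\<integral>\<^sup>+m. ennreal ((norm (\<psi> m))\<^sup>2) \<partial>count_space UNIV") auto
    have "ennreal S + (\<integral>\<^sup>+m. ennreal ((norm (\<psi> m))\<^sup>2) \<partial>count_space UNIV) = ennreal (S + B)"
      using bounds_nonneg B by simp
    then show ?thesis using nn_integral_LI_const_less_top[of t "S + B"] by (simp only:)
  qed
  finally show ?thesis .
qed

text \<open>For \<open>\<beta> > 5/2\<close> the test field is too rough for \<open>v \<in> L\<^sup>2(0,T;V\<^sup>\<beta>)\<close> alone to control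
  the dissipation term. The mode-wise damping bound recovers its absolute convergence for every \<open>\<beta>\<close>.\<close>

lemma dissipation_finite:
  assumes v0: "in_V 0 v0" and \<psi>: "in_V (5/2) \<psi>" and t: "t \<in> {0..T}"
  shows "(\<integral>\<^sup>+s. (\<integral>\<^sup>+k. ennreal (knorm k powr (2 * \<beta>) * norm (v s k) * norm (\<psi> k)) \<partial>count_space UNIV) \<partial>LI t) < \<infinity>"
proof -
  have \<psi>0: "\<psi> 0 = 0" using \<psi> by (auto simp: in_V_def real_v_def)
  have \<psi>5: "(\<integral>\<^sup>+m. ennreal ((norm (\<psi> m))\<^sup>2 * knorm m powr (2 * (5/2))) \<partial>count_space UNIV) < \<infinity>"
    using \<psi> by (simp add: in_V_def vsq_eq)
  have \<psi>2: "(\<integral>\<^sup>+m. ennreal ((norm (\<psi> m))\<^sup>2) \<partial>count_space UNIV) < \<infinity>"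
    by (rule le_less_trans[OF nn_sq_le_weighted \<psi>5]) (simp_all add: \<psi>0)
  have T: "T \<in> {0..T}" using par by simp
  have NAm: "(\<lambda>s. NA s k) \<in> borel_measurable (LI T)" for k
    unfolding NA_def
    by (intro borel_measurable_integral_count_space borel_measurable_LI borel_measurable_times
        measurable_compose[OF u_measurable borel_measurable_norm] measurable_compose[OF vm borel_measurable_norm])
  let ?f = "\<lambda>s k. ennreal (knorm k powr (2 * \<beta>) * norm (v s k) * norm (\<psi> k))"
  let ?a = "\<lambda>k. ennreal (norm (v0 k) * norm (\<psi> k))"
  let ?b = "\<lambda>s k. ennreal (norm (th s k) * norm (\<psi> k))"
  let ?c = "\<lambda>s k. \<integral>\<^sup>+j. ennreal (knorm k * norm (\<psi> k) * norm (v s j) * norm (v s (k - j))) \<partial>count_space UNIV"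
  have mode: "(\<integral>\<^sup>+s. ?f s k \<partial>LI T) \<le> ennreal (1 / \<nu>) * (?a k + 2 * ((\<integral>\<^sup>+s. ?b s k \<partial>LI T) + (\<integral>\<^sup>+s. ?c s k \<partial>LI T)))" for k
  proof (cases "k = 0")
    case False
    have iv: "integrable (LI T) (\<lambda>s. norm (v s k))"
      by (rule integrable_LI_bounded[of _ _ "M + 1"]) (use vm norm_v_le in \<open>auto intro: measurable_compose\<close>)
    define X where "X = (\<integral>s. norm (v s k) \<partial>LI T)"
    define Y where "Y = (\<integral>s. norm (th s k) \<partial>LI T)"
    define Z where "Z = (\<integral>s. NA s k \<partial>LI T)"
    have nn: "0 \<le> X" "0 \<le> Y" "0 \<le> Z" by (auto simp: X_def Y_def Z_def NA_def)
    have d: "\<nu> * knorm k powr (2 * \<beta>) * X \<le> norm (v0 k) + 2 * (Y + knorm k * Z)"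
      using damping[OF False] by (simp add: X_def Y_def Z_def)
    have "(\<integral>\<^sup>+s. ?f s k \<partial>LI T) = (\<integral>\<^sup>+s. ennreal (knorm k powr (2 * \<beta>) * norm (\<psi> k)) * ennreal (norm (v s k)) \<partial>LI T)"
      by (intro nn_integral_cong) (simp add: ennreal_mult''[symmetric] mult_ac)
    also have "\<dots> = ennreal (knorm k powr (2 * \<beta>) * norm (\<psi> k)) * (\<integral>\<^sup>+s. ennreal (norm (v s k)) \<partial>LI T)"
      by (rule nn_integral_cmult) (intro measurable_compose[OF borel_measurable_LI[OF vm]] measurable_compose[OF borel_measurable_norm]; simp)
    also have "(\<integral>\<^sup>+s. ennreal (norm (v s k)) \<partial>LI T) = ennreal X"
      unfolding X_def by (rule nn_integral_eq_integral[OF iv]) simp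
    also have "ennreal (knorm k powr (2 * \<beta>) * norm (\<psi> k)) * ennreal X = ennreal (1 / \<nu> * ((\<nu> * knorm k powr (2 * \<beta>) * X) * norm (\<psi> k)))"
      using nn par by (simp add: ennreal_mult''[symmetric] mult_ac)
    also have "\<dots> \<le> ennreal (1 / \<nu> * ((norm (v0 k) + 2 * (Y + knorm k * Z)) * norm (\<psi> k)))"
      by (intro ennreal_leI mult_left_mono mult_right_mono d) (use par in auto)
    also have "\<dots> = ennreal (1 / \<nu>) * (?a k + 2 * (ennreal (norm (\<psi> k)) * ennreal Y + ennreal (knorm k * norm (\<psi> k)) * ennreal Z))"
    proof -
      have eq: "(norm (v0 k) + 2 * (Y + knorm k * Z)) * norm (\<psi> k) = norm (v0 k) * norm (\<psi> k) + 2 * (norm (\<psi> k) * Y + (knorm k * norm (\<psi> k)) * Z)"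
        by (simp add: algebra_simps)
      show ?thesis
        unfolding eq using nn par by (subst ennreal_affine) (simp_all add: ennreal_mult''[symmetric])
    qed
    also have "\<dots> \<le> ennreal (1 / \<nu>) * (?a k + 2 * ((\<integral>\<^sup>+s. ?b s k \<partial>LI T) + (\<integral>\<^sup>+s. ?c s k \<partial>LI T)))"
    proof (intro mult_left_mono add_left_mono add_mono)
      have "ennreal (norm (\<psi> k)) * ennreal Y \<le> ennreal (norm (\<psi> k)) * (\<integral>\<^sup>+s. ennreal (norm (th s k)) \<partial>LI T)"
        using ennreal_norm_integral_le[of "LI T" "\<lambda>s. norm (th s k)"] nn by (intro mult_left_mono) (simp_all add: Y_def)
      also have "\<dots> = (\<integral>\<^sup>+s. ?b s k \<partial>LI T)"
        by (subst nn_integral_cmult[symmetric])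
          (auto simp: ennreal_mult''[symmetric] mult.commute intro!: nn_integral_cong measurable_compose[OF borel_measurable_LI[OF thmeas]])
      finally show "ennreal (norm (\<psi> k)) * ennreal Y \<le> (\<integral>\<^sup>+s. ?b s k \<partial>LI T)" .
      have "ennreal (knorm k * norm (\<psi> k)) * ennreal Z \<le> ennreal (knorm k * norm (\<psi> k)) * (\<integral>\<^sup>+s. ennreal (norm (NA s k)) \<partial>LI T)"
        using ennreal_norm_integral_le[of "LI T" "\<lambda>s. NA s k"] nn by (intro mult_left_mono) (simp_all add: Z_def)
      also have "\<dots> = (\<integral>\<^sup>+s. ennreal (knorm k * norm (\<psi> k)) * ennreal (norm (NA s k)) \<partial>LI T)"
        by (rule nn_integral_cmult[symmetric]) (intro measurable_compose[OF NAm] measurable_compose[OF borel_measurable_norm]; simp)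
      also have "\<dots> \<le> (\<integral>\<^sup>+s. ?c s k \<partial>LI T)"
      proof (rule nn_integral_mono)
        fix s
        have "ennreal (norm (NA s k)) \<le> (\<integral>\<^sup>+j. ennreal (norm (v s j) * norm (v s (k - j))) \<partial>count_space UNIV)"
          unfolding NA_def
          by (rule order_trans[OF ennreal_norm_integral_le]) (intro nn_integral_mono ennreal_leI,
              simp only: real_norm_def abs_mult abs_norm_cancel, rule mult_right_mono[OF norm_u_le norm_ge_zero])
        then have "ennreal (knorm k * norm (\<psi> k)) * ennreal (norm (NA s k))
            \<le> ennreal (knorm k * norm (\<psi> k)) * (\<integral>\<^sup>+j. ennreal (norm (v s j) * norm (v s (k - j))) \<partial>count_space UNIV)"
          by (rule mult_left_mono) simp
        also have "\<dots> = ?c s k"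
          by (subst nn_integral_cmult[symmetric]) (auto simp: ennreal_mult''[symmetric] mult_ac)
        finally show "ennreal (knorm k * norm (\<psi> k)) * ennreal (norm (NA s k)) \<le> ?c s k" .
      qed
      finally show "ennreal (knorm k * norm (\<psi> k)) * ennreal Z \<le> (\<integral>\<^sup>+s. ?c s k \<partial>LI T)" .
    qed auto
    finally show ?thesis .
  qed (simp add: \<psi>0)
  have bm: "(\<lambda>s. ?b s k) \<in> borel_measurable (LI T)" for k
    by (intro borel_measurable_LI) (use thmeas in measurable)
  have cm: "(\<lambda>s. ?c s k) \<in> borel_measurable (LI T)" for k
    by (intro borel_measurable_nn_integral_count_space borel_measurable_LI) (use vm in measurable)
  have fm: "(\<lambda>s. ?f s k) \<in> borel_measurable (LI T)" for k
    by (intro borel_measurable_LI) (use vm in measurable)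
  have "(\<integral>\<^sup>+s. (\<integral>\<^sup>+k. ?f s k \<partial>count_space UNIV) \<partial>LI t) \<le> (\<integral>\<^sup>+s. (\<integral>\<^sup>+k. ?f s k \<partial>count_space UNIV) \<partial>LI T)"
    using t by (intro nn_integral_LI_mono) auto
  also have "\<dots> = (\<integral>\<^sup>+k. (\<integral>\<^sup>+s. ?f s k \<partial>LI T) \<partial>count_space UNIV)"
    by (rule nn_integral_count_space_nn_integral[OF _ fm]) simp
  also have "\<dots> \<le> (\<integral>\<^sup>+k. ennreal (1 / \<nu>) * (?a k + 2 * ((\<integral>\<^sup>+s. ?b s k \<partial>LI T) + (\<integral>\<^sup>+s. ?c s k \<partial>LI T))) \<partial>count_space UNIV)"
    by (rule nn_integral_mono) (rule mode)
  also have "\<dots> = ennreal (1 / \<nu>) * ((\<integral>\<^sup>+k. ?a k \<partial>count_space UNIV) + 2 * ((\<integral>\<^sup>+k. (\<integral>\<^sup>+s. ?b s k \<partial>LI T) \<partial>count_space UNIV) + (\<integral>\<^sup>+k. (\<integral>\<^sup>+s. ?c s k \<partial>LI T) \<partial>count_space UNIV)))"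
    by (rule nn_integral_count_space_affine)
  also have "(\<integral>\<^sup>+k. (\<integral>\<^sup>+s. ?b s k \<partial>LI T) \<partial>count_space UNIV) = (\<integral>\<^sup>+s. (\<integral>\<^sup>+k. ?b s k \<partial>count_space UNIV) \<partial>LI T)"
    by (rule nn_integral_count_space_nn_integral[symmetric, OF _ bm]) simp
  also have "(\<integral>\<^sup>+k. (\<integral>\<^sup>+s. ?c s k \<partial>LI T) \<partial>count_space UNIV) = (\<integral>\<^sup>+s. (\<integral>\<^sup>+k. ?c s k \<partial>count_space UNIV) \<partial>LI T)"
    by (rule nn_integral_count_space_nn_integral[symmetric, OF _ cm]) simp
  also have "ennreal (1 / \<nu>) * ((\<integral>\<^sup>+k. ?a k \<partial>count_space UNIV) + 2 * ((\<integral>\<^sup>+s. (\<integral>\<^sup>+k. ?b s k \<partial>count_space UNIV) \<partial>LI T) + (\<integral>\<^sup>+s. (\<integral>\<^sup>+k. ?c s k \<partial>count_space UNIV) \<partial>LI T))) < \<infinity>"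
  proof -
    have "(\<integral>\<^sup>+k. ennreal ((norm (v0 k))\<^sup>2) \<partial>count_space UNIV) < \<infinity>"
      using v0 nn_sq_le_weighted[of v0 0] by (auto simp: in_V_def real_v_def vsq_eq intro: le_less_trans)
    then have "(\<integral>\<^sup>+k. ?a k \<partial>count_space UNIV) < \<infinity>"
      by (intro le_less_trans[OF nn_integral_mult_l2]) (use \<psi>2 in auto)
    moreover have "(\<integral>\<^sup>+s. (\<integral>\<^sup>+k. ?b s k \<partial>count_space UNIV) \<partial>LI T) < \<infinity>"
      by (rule force_fubini[OF \<psi>2 T])
    moreover have "(\<integral>\<^sup>+s. (\<integral>\<^sup>+k. ?c s k \<partial>count_space UNIV) \<partial>LI T) < \<infinity>"
      by (rule trilinear_finite[OF T _ \<psi>5, where \<sigma> = "\<lambda>k j. k - j" and c = "\<lambda>s k. norm (v s k)" and B = M])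
        (simp_all add: nn_v_le bij_minus_wvec)
    ultimately show ?thesis by (auto simp: ennreal_mult_less_top)
  qed
  finally show ?thesis .
qed

text \<open>The mode equations are summed against \<psi>. The three time-dependent terms each need
  their own absolute convergence: the trilinear bound for advection, square summability for
  buoyancy, and \<open>dissipation_finite\<close> for dissipation.\<close>

lemma momentum_equation:
  assumes v0: "in_V 0 v0" and \<psi>: "in_V (5/2) \<psi>" and t: "t \<in> {0..T}"
  shows "integrable (LI t) (\<lambda>s. bform (u s) \<psi> (v s))"
    and "integrable (LI t) (\<lambda>s. pair_v (lam_v \<beta> (v s)) (lam_v \<beta> \<psi>))"
    and "integrable (LI t) (\<lambda>s. force (th s) \<psi>)"
    and "pair_v (v t) \<psi> - (\<integral>s. bform (u s) \<psi> (v s) \<partial>LI t) + \<nu> * (\<integral>s. pair_v (lam_v \<beta> (v s)) (lam_v \<beta> \<psi>) \<partial>LI t)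
      = pair_v v0 \<psi> + (\<integral>s. force (th s) \<psi> \<partial>LI t)"
proof -
  have \<psi>r: "real_v \<psi>" using \<psi> by (simp add: in_V_def)
  note \<psi>D = real_vD[OF \<psi>r]
  have \<psi>5: "(\<integral>\<^sup>+m. ennreal ((norm (\<psi> m))\<^sup>2 * knorm m powr (2 * (5/2))) \<partial>count_space UNIV) < \<infinity>"
    using \<psi> by (simp add: in_V_def vsq_eq)
  have \<psi>2: "(\<integral>\<^sup>+m. ennreal ((norm (\<psi> m))\<^sup>2) \<partial>count_space UNIV) < \<infinity>"
    by (rule le_less_trans[OF nn_sq_le_weighted \<psi>5]) (simp_all add: \<psi>D)
  define f where "f s k = th s k * cnj (\<psi> k $ e3)" for s k
  define d where "d s k = of_real (knorm k powr (2 * \<beta>)) * cdot (v s k) (vcnj (\<psi> k))" for s k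
  define g where "g s j m = \<i> * kdot m (u s j) * cdot (\<psi> m) (v s (- j - m))" for s j m
  have fm: "(\<lambda>s. f s k) \<in> borel_measurable (LI t)" for k
    unfolding f_def by (intro borel_measurable_LI borel_measurable_times borel_measurable_const thmeas)
  have dm: "(\<lambda>s. d s k) \<in> borel_measurable (LI t)" for k
    unfolding d_def
    by (intro borel_measurable_LI borel_measurable_times borel_measurable_const borel_measurable_bounded_linear[OF bounded_linear_cdot_left vm])
  have gm: "(\<lambda>s. g s j m) \<in> borel_measurable (LI t)" for j m
    unfolding g_def cdot_commute[of "\<psi> m"]
    by (intro borel_measurable_LI borel_measurable_times borel_measurable_const
        borel_measurable_bounded_linear[OF bounded_linear_kdot u_measurable] borel_measurable_bounded_linear[OF bounded_linear_cdot_left vm])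
  have ffin: "(\<integral>\<^sup>+s. (\<integral>\<^sup>+k. ennreal (norm (f s k)) \<partial>count_space UNIV) \<partial>LI t) < \<infinity>"
    by (rule le_less_trans[OF _ force_fubini[OF \<psi>2 t]])
      (auto simp: f_def norm_mult intro!: nn_integral_mono ennreal_leI mult_left_mono Finite_Cartesian_Product.norm_nth_le)
  have dfin: "(\<integral>\<^sup>+s. (\<integral>\<^sup>+k. ennreal (norm (d s k)) \<partial>count_space UNIV) \<partial>LI t) < \<infinity>"
  proof (rule le_less_trans[OF _ dissipation_finite[OF v0 \<psi> t]], intro nn_integral_mono ennreal_leI)
    fix s k
    show "norm (d s k) \<le> knorm k powr (2 * \<beta>) * norm (v s k) * norm (\<psi> k)"
      using mult_left_mono[OF norm_cdot_le[of "v s k" "vcnj (\<psi> k)"], of "knorm k powr (2 * \<beta>)"]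
      by (simp add: d_def norm_mult mult_ac)
  qed
  have "(\<integral>\<^sup>+s. (\<integral>\<^sup>+m. (\<integral>\<^sup>+j. ennreal (norm (g s j m)) \<partial>count_space UNIV) \<partial>count_space UNIV) \<partial>LI t)
      \<le> (\<integral>\<^sup>+s. (\<integral>\<^sup>+m. (\<integral>\<^sup>+j. ennreal (knorm m * norm (\<psi> m) * norm (v s j) * norm (v s (- j - m))) \<partial>count_space UNIV) \<partial>count_space UNIV) \<partial>LI t)"
  proof (intro nn_integral_mono ennreal_leI)
    fix s m j
    have "norm (kdot m (u s j)) \<le> knorm m * norm (v s j)"
      by (rule order_trans[OF norm_kdot_le]) (intro mult_left_mono norm_u_le knorm_nonneg)
    then have "norm (kdot m (u s j)) * norm (cdot (\<psi> m) (v s (- j - m))) \<le> (knorm m * norm (v s j)) * (norm (\<psi> m) * norm (v s (- j - m)))"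
      by (intro mult_mono norm_cdot_le) auto
    then show "norm (g s j m) \<le> knorm m * norm (\<psi> m) * norm (v s j) * norm (v s (- j - m))"
      by (simp add: g_def norm_mult mult_ac)
  qed
  also have "\<dots> < \<infinity>"
    by (rule trilinear_finite[OF t _ \<psi>5, where \<sigma> = "\<lambda>m j. - j - m" and c = "\<lambda>s k. norm (v s k)" and B = M])
      (simp_all add: nn_v_le bij_minus_wvec)
  finally have gfin: "(\<integral>\<^sup>+s. (\<integral>\<^sup>+m. (\<integral>\<^sup>+j. ennreal (norm (g s j m)) \<partial>count_space UNIV) \<partial>count_space UNIV) \<partial>LI t) < \<infinity>" .
  note pg = pair_fubini[OF sigma_finite_LI gm gfin]
  note pf = integral_count_space_swap[OF sigma_finite_LI fm ffin]
  note pd = integral_count_space_swap[OF sigma_finite_LI dm dfin]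
  have bf: "bform (u s) \<psi> (v s) = (2 * pi) ^ 3 * Re (\<Sum>\<^sub>\<infinity>(j, m)\<in>UNIV. g s j m)" for s
    by (simp add: bform_def g_def)
  have ff: "force (th s) \<psi> = (2 * pi) ^ 3 * Re (\<integral>k. f s k \<partial>count_space UNIV)" for s
    by (simp add: force_def f_def infsum_complex_eq_integral)
  have df: "pair_v (lam_v \<beta> (v s)) (lam_v \<beta> \<psi>) = (2 * pi) ^ 3 * Re (\<integral>k. d s k \<partial>count_space UNIV)" for s
  proof -
    have "cdot (lam_v \<beta> (v s) k) (vcnj (lam_v \<beta> \<psi> k)) = d s k" for k
    proof -
      have "complex_of_real (knorm k powr \<beta>) * complex_of_real (knorm k powr \<beta>) = of_real (knorm k powr (2 * \<beta>))"
        by (simp only: of_real_mult[symmetric] powr_add[symmetric] mult_2)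
      then show ?thesis
        by (simp add: lam_v_def d_def vcnj_scaleR cdot_scaleR_left cdot_scaleR_right mult.assoc[symmetric])
    qed
    then show ?thesis by (simp add: pair_v_def infsum_complex_eq_integral)
  qed
  show "integrable (LI t) (\<lambda>s. bform (u s) \<psi> (v s))"
    unfolding bf by (rule Re_integral_scaled(1)[OF pg(1)])
  show "integrable (LI t) (\<lambda>s. pair_v (lam_v \<beta> (v s)) (lam_v \<beta> \<psi>))"
    unfolding df by (rule Re_integral_scaled(1)[OF pd(1)])
  show "integrable (LI t) (\<lambda>s. force (th s) \<psi>)"
    unfolding ff by (rule Re_integral_scaled(1)[OF pf(1)])
  define N where "N k = (\<integral>s. NL s k \<partial>LI t)" for k
  have inner: "(\<integral>s. (\<integral>j. g s j m \<partial>count_space UNIV) \<partial>LI t) = - \<i> * cdot (N (- m)) (\<psi> m)" for m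
  proof -
    let ?h = "\<lambda>s j. kdot (- m) (u s j) *s v s (- m - j)"
    let ?L = "\<lambda>w. - \<i> * cdot w (\<psi> m)"
    have L: "bounded_linear ?L"
      by (rule bounded_linear_compose[OF bounded_linear_mult_right bounded_linear_cdot_left])
    have hm: "(\<lambda>s. ?h s j) \<in> borel_measurable (LI t)" for j
      by (intro borel_measurable_LI borel_measurable_smult borel_measurable_bounded_linear[OF bounded_linear_kdot u_measurable] vm)
    have "g s j m = ?L (?h s j)" for s j
      unfolding g_def minus_diff_commute[of j m] cdot_smult_left kdot_minus_left cdot_commute[of "\<psi> m"] by simp
    then have "(\<integral>s. (\<integral>j. g s j m \<partial>count_space UNIV) \<partial>LI t) = (\<integral>s. (\<integral>j. ?L (?h s j) \<partial>count_space UNIV) \<partial>LI t)"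
      by simp
    also have "\<dots> = ?L (\<integral>s. (\<integral>j. ?h s j \<partial>count_space UNIV) \<partial>LI t)"
      by (rule integral_bounded_linear_double[OF sigma_finite_LI hm NL_limit(1)[OF t, of "- m"] L])
    finally show ?thesis by (simp only: N_def NL_def)
  qed
  have g_sum: "(\<integral>s. (\<Sum>\<^sub>\<infinity>(j, m)\<in>UNIV. g s j m) \<partial>LI t) = (\<integral>k. - \<i> * cdot (N k) (vcnj (\<psi> k)) \<partial>count_space UNIV)"
    and g_int: "integrable (count_space UNIV) (\<lambda>k. - \<i> * cdot (N k) (vcnj (\<psi> k)))"
    using pg(2,3) integral_reindex_uminus[of "\<lambda>m. - \<i> * cdot (N (- m)) (\<psi> m)"]
    unfolding inner by (simp_all only: \<psi>D(2) minus_minus)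
  have v_int: "integrable (count_space UNIV) (\<lambda>k. cdot (v t k) (vcnj (\<psi> k)))"
  proof (rule integrableI_bounded)
    have "(\<integral>\<^sup>+k. ennreal (norm (cdot (v t k) (vcnj (\<psi> k)))) \<partial>count_space UNIV) \<le> (\<integral>\<^sup>+k. ennreal (norm (v t k) * norm (\<psi> k)) \<partial>count_space UNIV)"
      using norm_cdot_le[of "v t _" "vcnj (\<psi> _)"] by (intro nn_integral_mono ennreal_leI) simp
    also have "\<dots> \<le> ennreal M + (\<integral>\<^sup>+m. ennreal ((norm (\<psi> m))\<^sup>2) \<partial>count_space UNIV)"
      by (rule order_trans[OF nn_integral_mult_l2]) (auto intro!: add_right_mono nn_v_le t)
    also have "\<dots> < \<infinity>" using \<psi>2 by simp
    finally show "(\<integral>\<^sup>+k. ennreal (norm (cdot (v t k) (vcnj (\<psi> k)))) \<partial>count_space UNIV) < \<infinity>" .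
  qed simp
  define F where "F k = (\<integral>s. f s k \<partial>LI t)" for k
  define D where "D k = (\<integral>s. d s k \<partial>LI t)" for k
  \<comment> \<open>The mode equation tested with \<psi> k, where the Leray projection disappears by
    incompressibility of \<psi>. At k = 0, which \<open>v_eq\<close> does not cover, every term
    vanishes since \<psi> 0 = 0.\<close>
  have mode: "cdot (v0 k) (vcnj (\<psi> k)) = cdot (v t k) (vcnj (\<psi> k)) - F k - - \<i> * cdot (N k) (vcnj (\<psi> k)) + of_real \<nu> * D k" for k
  proof (cases "k = 0")
    case True
    then show ?thesis by (simp add: F_def D_def f_def d_def \<psi>D cdot_def)
  next
    case False
    have kd: "kdot k (vcnj (\<psi> k)) = 0" by (simp add: kdot_vcnj \<psi>D)
    have iv: "integrable (LI t) (\<lambda>s. v s k)"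
      by (rule integrable_LI_bounded[OF vm, of _ _ "M + 1"]) (use t norm_v_le in auto)
    have D: "D k = of_real (knorm k powr (2 * \<beta>)) * cdot (\<integral>s. v s k \<partial>LI t) (vcnj (\<psi> k))"
      unfolding D_def d_def by (simp add: integral_bounded_linear[OF bounded_linear_cdot_left iv])
    have F: "F k = (\<integral>s. th s k \<partial>LI t) * cnj (\<psi> k $ e3)"
      unfolding F_def f_def by simp
    show ?thesis
      unfolding v_eq[OF t False] N_def[symmetric] D F
      by (simp add: cdot_add_left cdot_diff_left cdot_leray[OF kd] cdot_smult_left cdot_scaleR_left cdot_axis_vcnj)
  qed
  have "(\<integral>k. cdot (v0 k) (vcnj (\<psi> k)) \<partial>count_space UNIV)
     = (\<integral>k. cdot (v t k) (vcnj (\<psi> k)) \<partial>count_space UNIV) - (\<integral>k. F k \<partial>count_space UNIV)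
      - (\<integral>k. - \<i> * cdot (N k) (vcnj (\<psi> k)) \<partial>count_space UNIV) + of_real \<nu> * (\<integral>k. D k \<partial>count_space UNIV)"
  proof -
    have i: "integrable (count_space UNIV) F" "integrable (count_space UNIV) D"
      using pf(2) pd(2) unfolding F_def D_def .
    show ?thesis
      unfolding mode
      by (subst Bochner_Integration.integral_add Bochner_Integration.integral_diff
          | (intro Bochner_Integration.integrable_diff integrable_mult_right v_int i g_int; fail))+ simp
  qed
  also have "(\<integral>k. F k \<partial>count_space UNIV) = (\<integral>s. (\<integral>k. f s k \<partial>count_space UNIV) \<partial>LI t)"
    unfolding F_def by (rule pf(3))
  also have "(\<integral>k. D k \<partial>count_space UNIV) = (\<integral>s. (\<integral>k. d s k \<partial>count_space UNIV) \<partial>LI t)"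
    unfolding D_def by (rule pd(3))
  also note g_sum[symmetric]
  finally have e: "(\<integral>k. cdot (v0 k) (vcnj (\<psi> k)) \<partial>count_space UNIV)
     = (\<integral>k. cdot (v t k) (vcnj (\<psi> k)) \<partial>count_space UNIV) - (\<integral>s. (\<integral>k. f s k \<partial>count_space UNIV) \<partial>LI t)
      - (\<integral>s. (\<Sum>\<^sub>\<infinity>(j, m)\<in>UNIV. g s j m) \<partial>LI t) + of_real \<nu> * (\<integral>s. (\<integral>k. d s k \<partial>count_space UNIV) \<partial>LI t)" .
  have pv: "pair_v w \<psi> = (2 * pi) ^ 3 * Re (\<integral>k. cdot (w k) (vcnj (\<psi> k)) \<partial>count_space UNIV)" for w
    by (simp add: pair_v_def infsum_complex_eq_integral)
  show "pair_v (v t) \<psi> - (\<integral>s. bform (u s) \<psi> (v s) \<partial>LI t) + \<nu> * (\<integral>s. pair_v (lam_v \<beta> (v s)) (lam_v \<beta> \<psi>) \<partial>LI t)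
      = pair_v v0 \<psi> + (\<integral>s. force (th s) \<psi> \<partial>LI t)"
    unfolding bf df ff pv Re_integral_scaled(2)[OF pg(1)] Re_integral_scaled(2)[OF pf(1)] Re_integral_scaled(2)[OF pd(1)] e
    by (simp add: algebra_simps)
qed

lemma weak_solution:
  assumes v0: "in_V 0 v0"
  shows "weak_solution \<alpha> \<beta> \<nu> T v0 (fcoef th0) v th"
proof -
  have "(\<integral>\<^sup>+t\<in>{0..T}. vsq \<beta> (v t) \<partial>lborel) < \<infinity>"
    unfolding set_nn_integral_eq_LI by (rule le_less_trans[OF v_dissipation]) simp
  then show ?thesis
    unfolding weak_solution_def set_integrable_eq_LI set_integral_eq_LI
    using in_V_v vsq_v_le in_H_th ssq_th_le continuous_on_pair_v continuous_on_pair_s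
      momentum_equation[OF v0] transport_equation
    by blast
qed

end

section \<open>Conclusion\<close>

lemma in_Lq_square_integrable:
  assumes "in_Lq q f" "2 \<le> q"
  shows "f \<in> borel_measurable LT" "integrable LT (\<lambda>x. (f x)\<^sup>2)"
proof -
  interpret finite_measure LT by (rule finite_measure_LT)
  show m: "f \<in> borel_measurable LT" using assms by (simp add: in_Lq_def)
  show "integrable LT (\<lambda>x. (f x)\<^sup>2)"
  proof (cases "q = \<infinity>")
    case True
    then obtain C where C: "AE x in LT. \<bar>f x\<bar> \<le> C" using assms by (auto simp: in_Lq_def)
    show ?thesis
    proof (rule integrable_const_bound[where B = "C\<^sup>2"])
      show "AE x in LT. norm ((f x)\<^sup>2) \<le> C\<^sup>2"
        using C by eventually_elim (simp add: abs_le_square_iff[symmetric])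
    qed (use m in measurable)
  next
    case False
    then obtain r where r: "q = ereal r" "2 \<le> r" using assms(2) by (cases q) auto
    show ?thesis
    proof (rule Bochner_Integration.integrable_bound)
      show "integrable LT (\<lambda>x. 1 + \<bar>f x\<bar> powr r)" using assms(1) r by (simp add: in_Lq_def)
      show "AE x in LT. norm ((f x)\<^sup>2) \<le> norm (1 + \<bar>f x\<bar> powr r)"
      proof (rule AE_I2)
        fix x
        have "(f x)\<^sup>2 \<le> 1 + \<bar>f x\<bar> powr r"
        proof (cases "1 \<le> \<bar>f x\<bar>")
          case True
          then have "\<bar>f x\<bar> powr 2 \<le> \<bar>f x\<bar> powr r" using r(2) by (intro powr_mono) auto
          then show ?thesis using True by (simp add: powr_numeral)
        next
          case False
          then have "(f x)\<^sup>2 \<le> 1" by (simp add: abs_square_le_1)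
          then show ?thesis by (simp add: add_increasing2)
        qed
        then show "norm ((f x)\<^sup>2) \<le> norm (1 + \<bar>f x\<bar> powr r)" by simp
      qed
    qed (use m in measurable)
  qed
qed

theorem theorem8:
  fixes \<alpha> \<beta> \<nu> T :: real and q :: ereal and v0 :: vfield and th0 :: "real ^ 3 \<Rightarrow> real"
  assumes "\<alpha> \<ge> 0" and "\<beta> > 0" and "\<nu> > 0" and "T > 0" and "2 \<le> q"
    and "in_V 0 v0"
    and "in_Lq q th0" and "fcoef th0 0 = 0"
  shows "\<exists>v th. weak_solution \<alpha> \<beta> \<nu> T v0 (fcoef th0) v th \<and> Cw_Lq q T th"
proof -
  obtain J M S C err V G v th where lim: "approx_limit \<alpha> \<beta> \<nu> T v0 th0 J M S C err V G v th"
    using approx_limit_exists[OF assms(1-4,6) in_Lq_square_integrable[OF assms(7,5)] assms(8)] by blast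
  interpret approx_limit \<alpha> \<beta> \<nu> T v0 th0 J M S C err V G v th by (rule lim)
  have "Cw_Lq q T th"
  proof (rule Cw_Lq_weak_limit[OF assms(5,7), where A = S and g = G])
    fix t assume t: "t \<in> {0..T}"
    show "th t 0 = 0" "th t (- k) = cnj (th t k)" for k
      using real_s_th[OF t] by (auto simp: real_s_def)
  qed (use th_sum_le continuous_on_pair_s D(7,10) limG in auto)
  then show ?thesis using weak_solution[OF assms(6)] by blast
qed

end
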